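(* Let $r\ge 3$ and $\ell\ge 1$ be integers. There exist a constant $c>0$ and functions $\varepsilon_1(n),\varepsilon_2(n),\varepsilon_3(n)$ tending to $0$ as $n\to\infty$ (all depending only on $r,\ell$) such that, for $p=p(n)\in[0,1]$, asymptotically almost surely $$\mathrm{ex}(G^r_{n,p},C^r_{2\ell+1})\le\begin{cases} c\,pn^{r-1}, & \text{if } p\ge n^{-r+2+\frac{2\ell+r-3}{2\ell(r-2)}+\varepsilon_1(n)};\\[2pt] p^{\frac{2\ell-1}{2\ell(r-1)-1}}n^{2+\varepsilon_3(n)}, & \text{if } n^{-r+1+\frac{1}{2\ell}+\varepsilon_2(n)}\le p\le n^{-r+2+\frac{2\ell+r-3}{2\ell(r-2)}+\varepsilon_1(n)}.\end{cases}$$ Moreover, when $\ell=1$ this upper bound is tight: these functions can be chosen so that, in addition, for some constant $c'>0$ depending only on $r$, asymptotically almost surely $\mathrm{ex}(G^r_{n,p},C^r_{3})\ge c'pn^{r-1}$ in the first range of $p$ and $\mathrm{ex}(G^r_{n,p},C^r_3)\ge p^{\frac{1}{2r-3}}n^{2-\varepsilon_3(n)}$ in the second range of $p$.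
   Context: An $r$-graph is a hypergraph all of whose edges have size $r$. $C^r_m$ is the $r$-uniform linear cycle of length $m$, i.e. the $r$-expansion of the graph cycle $C_m$: the $r$-graph obtained from the cycle of length $m$ by enlarging each of its edges by a set of $r-2$ new vertices of degree one (the sets added to different edges being disjoint). $G^r_{n,p}$ is the random $r$-graph on $n$ vertices in which each $r$-set is an edge independently with probability $p$. $\mathrm{ex}(G^r_{n,p},H)$ is the maximum number of edges in an $H$-free subgraph of $G^r_{n,p}$. A statement depending on $n$ holds asymptotically almost surely if its probability tends to $1$ as $n\to\infty$. *)

theory Defs
  imports "HOL-Probability.Probability"
begin

text \<open>A hypergraph is a pair of a vertex set and an edge set.\<close>

type_synonym 'a hypergraph = "'a set \<times> 'a set set"

definition contains_copy :: "'a hypergraph \<Rightarrow> 'b hypergraph \<Rightarrow> bool" where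
  "contains_copy G H \<longleftrightarrow>
     (\<exists>\<phi>. inj_on \<phi> (fst H) \<and> \<phi> ` fst H \<subseteq> fst G \<and> (\<forall>e\<in>snd H. \<phi> ` e \<in> snd G))"

definition subhypergraph :: "'a hypergraph \<Rightarrow> 'a hypergraph \<Rightarrow> bool" where
  "subhypergraph F G \<longleftrightarrow> fst F \<subseteq> fst G \<and> snd F \<subseteq> snd G \<and> \<Union> (snd F) \<subseteq> fst F"

text \<open>For finite \<open>G\<close> and \<open>H\<close> with at least one edge, this is a maximum over a finite nonempty set.\<close>

definition ex :: "'a hypergraph \<Rightarrow> 'b hypergraph \<Rightarrow> nat" where
  "ex G H = Max {card (snd F) | F. subhypergraph F G \<and> \<not> contains_copy F H}"

definition cycle_graph :: "nat \<Rightarrow> nat hypergraph" where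
  "cycle_graph m = ({..<m}, {{i, (i + 1) mod m} | i. i < m})"

text \<open>In the \<open>r\<close>-expansion of a graph, the new vertices added to the edge \<open>e\<close> are
  \<open>Inr (e, 0), \<dots>, Inr (e, r - 3)\<close>.\<close>

definition expand_edge :: "nat \<Rightarrow> 'a set \<Rightarrow> ('a + 'a set \<times> nat) set" where
  "expand_edge r e = Inl ` e \<union> Inr ` ({e} \<times> {..<r - 2})"

definition expansion :: "nat \<Rightarrow> 'a hypergraph \<Rightarrow> ('a + 'a set \<times> nat) hypergraph" where
  "expansion r G = (Inl ` fst G \<union> Inr ` (snd G \<times> {..<r - 2}), expand_edge r ` snd G)"

definition linear_cycle :: "nat \<Rightarrow> nat \<Rightarrow> (nat + nat set \<times> nat) hypergraph" where
  "linear_cycle r m = expansion r (cycle_graph m)"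

text \<open>The vertex set is \<open>{..<n}\<close>; one independent Bernoulli trial per \<open>r\<close>-subset decides whether
  it is an edge.\<close>

definition random_rgraph :: "nat \<Rightarrow> nat \<Rightarrow> real \<Rightarrow> nat hypergraph pmf" where
  "random_rgraph r n p =
     (let K = {e. e \<subseteq> {..<n} \<and> card e = r} in
      map_pmf (\<lambda>f. ({..<n}, {e \<in> K. f e})) (Pi_pmf K False (\<lambda>_. bernoulli_pmf p)))"

definition aas :: "(nat \<Rightarrow> 'a pmf) \<Rightarrow> (nat \<Rightarrow> 'a \<Rightarrow> bool) \<Rightarrow> bool" where
  "aas M P \<longleftrightarrow> (\<lambda>n. measure_pmf.prob (M n) {x. P n x}) \<longlonglongrightarrow> 1"

text \<open>The exponents of \<open>n\<close> (without error terms) that delimit the ranges of \<open>p\<close>.\<close>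

definition upper_exponent :: "nat \<Rightarrow> nat \<Rightarrow> real" where
  "upper_exponent r l =
     - real r + 2 + (2 * real l + real r - 3) / (2 * real l * (real r - 2))"

definition lower_exponent :: "nat \<Rightarrow> nat \<Rightarrow> real" where
  "lower_exponent r l = - real r + 1 + 1 / (2 * real l)"

end

theory Submission
  imports Defs "HOL-Real_Asymp.Real_Asymp"
begin

text \<open>
  Upper bound. Give a set \<open>R\<close> the weight \<open>q ^ card R\<close>. Starting with the family of all independent sets
  of a hypergraph, pass repeatedly to the link of a small set whose share of the weight is too small.
  This ends after few steps with a down-closed family in which every small set has almost the largest
  possible share, and a second moment computation shows that the union of such a family carries no
  spread system of hyperedges. So every independent set lies in a container given by a small
  fingerprint. The hyperedges here are the edge sets of linear cycles. To find a spread system of them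
  in a large \<open>r\<close>-graph, order its edges, regularise all degrees up to a factor \<open>n powr o(1)\<close>, choose the
  pair of positions with the smallest degree, and build a cycle by choosing its core as a fan of triples
  with a common apex and then completing every core pair to an edge. The first moment method over the
  containers yields both ranges.

  Lower bound for triangles. The dense range is attained by a star. In the sparse range take the
  \<open>r\<close>-partite \<open>r\<close>-graph of progressions \<open>y, y + a, \<dots>\<close> with \<open>a\<close> in a Behrend set, in which the three edges
  of a triangle coincide, blow up each vertex, intersect with the random \<open>r\<close>-graph, and delete one edge
  from each of the few triangles.

  All estimates hold for each fixed \<open>\<epsilon>\<close> uniformly in \<open>p\<close>, and a diagonal sequence \<open>\<epsilon> n\<close> gives the error
  terms.
\<close>

section \<open>Containers for down-closed families\<close>

text \<open>The exponents rest on one comparison. In the spread system a prescribed set of edges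
  fixes the core vertices at their ends. A proper nonempty set of \<open>m\<close> cycle edges has
  at least \<open>m + 1\<close> ends, so each edge after the first saves at least one vertex factor
  \<open>D\<close>; all \<open>2 * l + 1\<close> edges have only \<open>2 * l + 1\<close> ends, so
  \<open>2 * l\<close> further edges save only \<open>2 * l - 1\<close> factors. This worst case is
  the ratio \<open>(2 * l - 1) / (2 * l)\<close>. In a regular family of size about \<open>M\<close>
  a pair degree is at least about \<open>M / n^2\<close>, and the smallest one is at most about a
  product of \<open>r - 2\<close> extension counts, so \<open>D\<close> is at least about
  \<open>(M / n^2) powr (1 / (r - 2))\<close>; hence the fingerprint size
  \<open>n^2 * (M / n^2) powr (- scale_exponent r l)\<close>. The first moment works once
  \<open>p * M\<close> exceeds this size, and equality gives the sparse range. However, edges must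
  be movable off vertices already used, which is guaranteed only above a multiple of
  \<open>n ^ (r - 1)\<close>; this floor on \<open>M\<close> gives the dense range.\<close>

definition weight :: "real \<Rightarrow> 'a set set \<Rightarrow> real" where
  "weight q X = (\<Sum>R\<in>X. q ^ card R)"

definition down_closed :: "'a set set \<Rightarrow> bool" where
  "down_closed D \<longleftrightarrow> (\<forall>R\<in>D. \<forall>S. S \<subseteq> R \<longrightarrow> S \<in> D)"

text \<open>In a down-closed family, \<open>(q / (1 + q)) ^ card T\<close> is the largest share of the weight that the supersets
  of \<open>T\<close> can have; \<open>Pow V\<close> attains it.\<close>

definition near_maximal :: "real \<Rightarrow> real \<Rightarrow> nat \<Rightarrow> 'a set set \<Rightarrow> bool" where
  "near_maximal q \<beta> k D \<longleftrightarrow> (\<forall>T\<in>D. T \<noteq> {} \<and> card T \<le> k \<longrightarrow>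
     (1 - \<beta>) * (q / (1 + q)) ^ card T * weight q D \<le> weight q {R \<in> D. T \<subseteq> R})"

lemma weight_nonneg: "q \<ge> 0 \<Longrightarrow> weight q X \<ge> 0"
  by (simp add: weight_def sum_nonneg)

lemma weight_mono: "q \<ge> 0 \<Longrightarrow> finite Y \<Longrightarrow> X \<subseteq> Y \<Longrightarrow> weight q X \<le> weight q Y"
  by (auto simp: weight_def intro!: sum_mono2)

lemma weight_shift:
  assumes "finite T" "\<And>R. R \<in> X \<Longrightarrow> finite R \<and> T \<subseteq> R"
  shows "weight q X = q ^ card T * weight q ((\<lambda>R. R - T) ` X)"
proof -
  have inj: "inj_on (\<lambda>R. R - T) X"
  proof (rule inj_onI)
    fix x y assume "x \<in> X" "y \<in> X" "x - T = y - T"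
    with assms(2) have "T \<subseteq> x" "T \<subseteq> y" by auto
    with \<open>x - T = y - T\<close> show "x = y" by blast
  qed
  have "q ^ card R = q ^ card T * q ^ card (R - T)" if "R \<in> X" for R
  proof -
    from assms(2)[OF that] have "card R = card T + card (R - T)"
      by (metis assms(1) card_Diff_subset card_mono le_add_diff_inverse)
    then show ?thesis by (simp add: power_add)
  qed
  then show ?thesis
    by (simp add: weight_def sum.reindex[OF inj] sum_distrib_left)
qed

lemma weight_Pow: "finite V \<Longrightarrow> weight q (Pow V) = (1 + q) ^ card V"
  using prod_add[of V "\<lambda>_. q" "\<lambda>_. 1"]
  by (simp add: weight_def add.commute)

text \<open>Removing \<open>T\<close> is injective on supersets of \<open>T\<close>. The target
  \<open>Y\<close> is kept free: \<open>Y = D\<close> gives the trivial bound on a share, and a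
  smaller \<open>Y\<close> is used when the remainders are known to avoid a configuration.\<close>

lemma weight_supersets_le:
  assumes "q \<ge> 0" "finite D" "\<And>R. R \<in> D \<Longrightarrow> finite R" "finite T"
    and "\<And>R. R \<in> D \<Longrightarrow> T \<subseteq> R \<Longrightarrow> R - T \<in> Y" "finite Y"
  shows "weight q {R \<in> D. T \<subseteq> R} \<le> q ^ card T * weight q Y"
proof -
  have "weight q {R \<in> D. T \<subseteq> R} = q ^ card T * weight q ((\<lambda>R. R - T) ` {R \<in> D. T \<subseteq> R})"
    using assms by (intro weight_shift) auto
  also have "\<dots> \<le> q ^ card T * weight q Y"
    using assms by (intro mult_left_mono weight_mono) auto
  finally show ?thesis .
qed

text \<open>The map sending \<open>R\<close> to the pair of \<open>R \<inter> T\<close> and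
  \<open>R \<union> T\<close> is injective and respects weights, because
  \<open>card R + card T = card (R \<union> T) + card (R \<inter> T)\<close>. The traces on
  \<open>T\<close> sum to \<open>(1 + q) ^ card T\<close>. Read backwards: if the supersets of
  \<open>T\<close> are light, so is the link of \<open>T\<close>.\<close>

lemma weight_link_le:
  assumes q: "q \<ge> 0" and D: "finite D" "\<And>R. R \<in> D \<Longrightarrow> finite R" and T: "finite T"
  shows "q ^ card T * weight q {R \<in> D. R \<union> T \<in> D} \<le> (1 + q) ^ card T * weight q {R \<in> D. T \<subseteq> R}"
proof -
  let ?X = "{R \<in> D. R \<union> T \<in> D}" and ?Y = "{R \<in> D. T \<subseteq> R}"
  let ?g = "\<lambda>R. (R \<inter> T, R \<union> T)"
  have inj: "inj_on ?g ?X"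
  proof (rule inj_onI)
    fix x y assume "?g x = ?g y"
    then have "x \<inter> T = y \<inter> T" "x \<union> T = y \<union> T" by auto
    then show "x = y" by blast
  qed
  have eq: "q ^ card T * q ^ card R = q ^ card (R \<inter> T) * q ^ card (R \<union> T)" if "R \<in> ?X" for R
  proof -
    have "card R + card T = card (R \<union> T) + card (R \<inter> T)"
      using that D T by (intro card_Un_Int) auto
    then show ?thesis by (metis add.commute power_add)
  qed
  have "q ^ card T * weight q ?X = (\<Sum>R\<in>?X. q ^ card (R \<inter> T) * q ^ card (R \<union> T))"
    by (simp add: weight_def sum_distrib_left eq)
  also have "\<dots> = (\<Sum>(S, R)\<in>?g ` ?X. q ^ card S * q ^ card R)"
    by (simp add: sum.reindex[OF inj])
  also have "\<dots> \<le> (\<Sum>(S, R)\<in>Pow T \<times> ?Y. q ^ card S * q ^ card R)"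
    using assms by (intro sum_mono2) auto
  also have "\<dots> = weight q (Pow T) * weight q ?Y"
    by (simp add: weight_def sum_product sum.cartesian_product)
  finally show ?thesis by (simp add: weight_Pow T)
qed

text \<open>Given a violating set \<open>T\<close>, either \<open>I\<close> omits \<open>T\<close>, which costs nothing, or \<open>T\<close> is put into the
  fingerprint and \<open>D\<close> is replaced by the link of \<open>T\<close>, whose weight is smaller by a factor \<open>1 - \<beta>\<close>. The
  second case therefore occurs at most \<open>ln (weight q D) / \<beta>\<close> times.\<close>

lemma near_maximal_fingerprint:
  fixes V :: "'a set"
  assumes V: "finite V" and q: "q > 0" and \<beta>: "0 < \<beta>" "\<beta> < 1"
    and D: "D \<subseteq> Pow V" "down_closed D"
  shows "\<exists>\<phi>. \<forall>I\<in>D. A \<subseteq> I \<longrightarrow> (\<exists>F. A \<subseteq> F \<and> F \<subseteq> I \<and>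
           real (card (F - A)) \<le> k * ln (weight q D) / \<beta> \<and>
           \<phi> F \<subseteq> D \<and> down_closed (\<phi> F) \<and> near_maximal q \<beta> k (\<phi> F) \<and> I \<in> \<phi> F)"
  using D
\<comment> \<open>\<open>A\<close> is the part of the fingerprint collected so far; it varies
  because the link branch continues with \<open>A \<union> T\<close>.\<close>
proof (induction "card D" arbitrary: D A rule: less_induct)
  case less
  have finD: "finite D" using less.prems V finite_subset by blast
  have finR: "finite R" if "R \<in> D" for R using less.prems V finite_subset that by blast
  show ?case
  proof (cases "D = {} \<or> near_maximal q \<beta> k D")
    case True
    have "0 \<le> ln (weight q D)" if "I \<in> D" for I
    proof -
      have "{} \<in> D" using that less.prems(2) by (auto simp: down_closed_def)
      then have "weight q ({{}} :: 'a set set) \<le> weight q D" using q finD by (intro weight_mono) auto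
      then show ?thesis by (simp add: weight_def)
    qed
    then show ?thesis using True less.prems \<beta>
      by (intro exI[of _ "\<lambda>_. D"] ballI impI exI[of _ A]) auto
  next
    case False
    \<comment> \<open>\<open>T\<close> depends on \<open>D\<close> only and is fixed before any
      independent set is considered, so it can be recomputed from the fingerprint.\<close>
    then obtain T where T: "T \<in> D" "T \<noteq> {}" "card T \<le> k"
      and low: "weight q {R \<in> D. T \<subseteq> R} < (1 - \<beta>) * (q / (1 + q)) ^ card T * weight q D"
      by (auto simp: near_maximal_def not_le)
    have finT: "finite T" using finR T by auto
    define D1 where "D1 = {R \<in> D. \<not> T \<subseteq> R}"
    define D2 where "D2 = {R \<in> D. R \<union> T \<in> D}"
    have "{} \<in> D" using T less.prems(2) by (auto simp: down_closed_def)
    then have "{} \<in> D1" "{} \<in> D2" using T by (auto simp: D1_def D2_def)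
    have ge1: "1 \<le> weight q X" if "{} \<in> X" "X \<subseteq> D" for X
    proof -
      have "weight q ({{}} :: 'a set set) \<le> weight q X" using q that finite_subset[OF that(2) finD] by (intro weight_mono) auto
      then show ?thesis by (simp add: weight_def)
    qed
    have Z1: "1 \<le> weight q D1" "1 \<le> weight q D2" "1 \<le> weight q D"
      using ge1 \<open>{} \<in> D\<close> \<open>{} \<in> D1\<close> \<open>{} \<in> D2\<close> by (auto simp: D1_def D2_def)
    have D1: "D1 \<subseteq> Pow V" "down_closed D1" "D1 \<subset> D"
      using less.prems T by (auto simp: D1_def down_closed_def)
    have D2: "D2 \<subseteq> Pow V" "down_closed D2" "D2 \<subseteq> D"
    proof -
      show "D2 \<subseteq> Pow V" "D2 \<subseteq> D" using less.prems by (auto simp: D2_def)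
      show "down_closed D2" unfolding down_closed_def
      proof (intro ballI allI impI)
        fix R S assume "R \<in> D2" "S \<subseteq> R"
        then have "S \<union> T \<subseteq> R \<union> T" "R \<union> T \<in> D" "R \<in> D" by (auto simp: D2_def)
        with \<open>S \<subseteq> R\<close> less.prems(2) show "S \<in> D2" by (auto simp: D2_def down_closed_def)
      qed
    qed
    have "q ^ card T * weight q D2 \<le> (1 + q) ^ card T * weight q {R \<in> D. T \<subseteq> R}"
      unfolding D2_def using q finD finR finT by (intro weight_link_le) auto
    also have "\<dots> < (1 + q) ^ card T * ((1 - \<beta>) * (q / (1 + q)) ^ card T * weight q D)"
      using low q by (intro mult_strict_left_mono) auto
    also have "\<dots> = q ^ card T * ((1 - \<beta>) * weight q D)"
      using q by (simp add: power_divide)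
    finally have drop: "weight q D2 < (1 - \<beta>) * weight q D" using q by simp
    have "(1 - \<beta>) * weight q D \<le> weight q D" using \<beta> Z1 by (simp add: mult_le_cancel_right2)
    \<comment> \<open>As a set, \<open>D2\<close> is only known to lie in \<open>D\<close>; the
      strict loss of weight is what makes the recursion on the link terminate.\<close>
    then have "D2 \<noteq> D" using drop by auto
    then have card2: "card D2 < card D" and card1: "card D1 < card D"
      using D1 D2 finD by (auto intro!: psubset_card_mono)
    have ln1: "ln (weight q D1) \<le> ln (weight q D)"
      using D1 q finD Z1 by (intro ln_mono weight_mono) auto
    have "ln (weight q D2) \<le> ln ((1 - \<beta>) * weight q D)"
      using drop Z1 \<beta> by (intro ln_mono) auto
    also have "\<dots> = ln (1 - \<beta>) + ln (weight q D)" using \<beta> Z1 by (intro ln_mult_pos) auto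
    also have "\<dots> \<le> - \<beta> + ln (weight q D)"
      using ln_add_one_self_le_self2[of "- \<beta>"] \<beta> by simp
    finally have ln2: "ln (weight q D2) \<le> ln (weight q D) - \<beta>" by simp
    from less.hyps[OF card1 D1(1,2), of "A"] obtain \<phi>1 where \<phi>1: "\<forall>I\<in>D1. A \<subseteq> I \<longrightarrow> (\<exists>F. A \<subseteq> F \<and> F \<subseteq> I \<and>
           real (card (F - A)) \<le> k * ln (weight q D1) / \<beta> \<and>
           \<phi>1 F \<subseteq> D1 \<and> down_closed (\<phi>1 F) \<and> near_maximal q \<beta> k (\<phi>1 F) \<and> I \<in> \<phi>1 F)"
      by (elim exE) (rule that)
    from less.hyps[OF card2 D2(1,2), of "A \<union> T"] obtain \<phi>2 where \<phi>2: "\<forall>I\<in>D2. A \<union> T \<subseteq> I \<longrightarrow> (\<exists>F. A \<union> T \<subseteq> F \<and> F \<subseteq> I \<and>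
           real (card (F - (A \<union> T))) \<le> k * ln (weight q D2) / \<beta> \<and>
           \<phi>2 F \<subseteq> D2 \<and> down_closed (\<phi>2 F) \<and> near_maximal q \<beta> k (\<phi>2 F) \<and> I \<in> \<phi>2 F)"
      by (elim exE) (rule that)
    \<comment> \<open>The branch taken can be read off \<open>F\<close>: the link branch puts
      \<open>T\<close> into \<open>F\<close>, and in the other branch \<open>T\<close> is not
      contained in \<open>I\<close>, hence not in \<open>F \<subseteq> I\<close>.\<close>
    define \<phi> where "\<phi> F = (if T \<subseteq> F then \<phi>2 F else \<phi>1 F)" for F
    show ?thesis
    proof (intro exI[of _ \<phi>] ballI impI)
      fix I assume I: "I \<in> D" "A \<subseteq> I"
      show "\<exists>F. A \<subseteq> F \<and> F \<subseteq> I \<and> real (card (F - A)) \<le> k * ln (weight q D) / \<beta> \<and>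
           \<phi> F \<subseteq> D \<and> down_closed (\<phi> F) \<and> near_maximal q \<beta> k (\<phi> F) \<and> I \<in> \<phi> F"
      proof (cases "T \<subseteq> I")
        case True
        then have "I \<in> D2" using I by (auto simp: D2_def Un_absorb2)
        have "A \<union> T \<subseteq> I" using I True by auto
        from \<phi>2[rule_format, OF \<open>I \<in> D2\<close> this] obtain F where F: "A \<union> T \<subseteq> F" "F \<subseteq> I"
          "real (card (F - (A \<union> T))) \<le> k * ln (weight q D2) / \<beta>"
          "\<phi>2 F \<subseteq> D2" "down_closed (\<phi>2 F)" "near_maximal q \<beta> k (\<phi>2 F)" "I \<in> \<phi>2 F" by (elim exE conjE) (rule that)
        have "card (F - A) \<le> card (T \<union> (F - (A \<union> T)))"
          using finite_subset[OF F(2) finR[OF I(1)]] finT by (intro card_mono) auto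
        also have "\<dots> \<le> k + card (F - (A \<union> T))" using card_Un_le[of T "F - (A \<union> T)"] T by linarith
        finally have "real (card (F - A)) \<le> k + k * ln (weight q D2) / \<beta>"
          using F(3) by linarith
        also have "\<dots> \<le> k + k * (ln (weight q D) - \<beta>) / \<beta>"
          using ln2 \<beta> by (intro add_left_mono divide_right_mono mult_left_mono) auto
        also have "\<dots> = k * ln (weight q D) / \<beta>" using \<beta> by (simp add: field_simps)
        finally show ?thesis using F D2 by (intro exI[of _ F]) (auto simp: \<phi>_def)
      next
        case False
        then have "I \<in> D1" using I by (auto simp: D1_def)
        from \<phi>1[rule_format, OF this I(2)] obtain F where F: "A \<subseteq> F" "F \<subseteq> I"
          "real (card (F - A)) \<le> k * ln (weight q D1) / \<beta>"
          "\<phi>1 F \<subseteq> D1" "down_closed (\<phi>1 F)" "near_maximal q \<beta> k (\<phi>1 F)" "I \<in> \<phi>1 F" by (elim exE conjE) (rule that)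
        have "k * ln (weight q D1) / \<beta> \<le> k * ln (weight q D) / \<beta>"
          using ln1 \<beta> by (intro divide_right_mono mult_left_mono) auto
        moreover have "\<not> T \<subseteq> F" using F(2) False by auto
        ultimately show ?thesis using F D1 by (intro exI[of _ F]) (auto simp: \<phi>_def)
      qed
    qed
  qed
qed

section \<open>Minimal nonmembers of a near-maximal family\<close>

lemma weight_filter:
  "finite D \<Longrightarrow> weight q {R \<in> D. P R} = (\<Sum>R\<in>D. q ^ card R * of_bool (P R))"
  unfolding weight_def by (rule sum.mono_neutral_cong_left) auto

text \<open>The minimal non-faces of size at most \<open>k\<close> of \<open>D\<close>, seen as a
  simplicial complex. They form an antichain.\<close>

definition min_nonmembers :: "'a set \<Rightarrow> nat \<Rightarrow> 'a set set \<Rightarrow> 'a set set" where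
  "min_nonmembers V k D = {E. E \<subseteq> V \<and> card E \<le> k \<and> E \<notin> D \<and> (\<forall>S. S \<subset> E \<longrightarrow> S \<in> D)}"

text \<open>Bernoulli's inequality for \<open>1 / (1 + q)\<close>: while
  \<open>k * q \<le> \<beta>\<close>, replacing \<open>q / (1 + q)\<close> by \<open>q\<close> in
  the near-maximality bound costs just one more factor \<open>1 - \<beta>\<close>.\<close>

lemma q_ratio_power_ge:
  fixes q \<beta> :: real
  assumes "q > 0" "real k * q \<le> \<beta>" "j \<le> k"
  shows "(1 - \<beta>) * q ^ j \<le> (q / (1 + q)) ^ j"
proof -
  have "1 - \<beta> \<le> 1 - real k * q" using assms by simp
  also have "\<dots> \<le> 1 - real j * q" using assms by simp
  also have "\<dots> \<le> 1 + real j * (- (q / (1 + q)))"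
  proof -
    have "real j * (q / (1 + q)) \<le> real j * q"
      using assms by (intro mult_left_mono) (auto simp: field_simps)
    then show ?thesis by simp
  qed
  also have "\<dots> \<le> (1 + - (q / (1 + q))) ^ j"
    using assms by (intro Bernoulli_inequality) (auto simp: field_simps)
  also have "1 + - (q / (1 + q)) = 1 / (1 + q)" using assms by (simp add: field_simps)
  finally have "(1 - \<beta>) * q ^ j \<le> (1 / (1 + q)) ^ j * q ^ j"
    using assms by (intro mult_right_mono) auto
  then show ?thesis by (simp add: power_divide)
qed

text \<open>Second moment method, by induction from large \<open>T\<close> down to small
  \<open>T\<close>. Let \<open>X R\<close> count the minimal nonmembers \<open>E\<close> above
  \<open>T\<close> with \<open>E - T \<subseteq> R\<close>. If the sum exceeded \<open>1\<close>,
  then by Cauchy-Schwarz \<open>X\<close> would be positive on a fixed proportion of the weight. But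
  near-maximality at \<open>T\<close> puts almost all weight on sets with \<open>X R = 0\<close>.
  The value of \<open>\<beta>\<close> is tuned to the contradiction:
  \<open>2 * \<beta> * 2 ^ (k + 1) = 1 / 2\<close>.\<close>

lemma cover_degree_le:
  fixes V :: "'a set"
  assumes V: "finite V" and D: "D \<subseteq> Pow V" "down_closed D" and k: "k \<ge> 1"
    and q: "q > 0" "real k * q \<le> \<beta>" and \<beta>: "\<beta> = 1 / 2 ^ (k + 3)"
    and st: "near_maximal q \<beta> k D" and T: "T \<in> D" "T \<noteq> {}"
  shows "(\<Sum>E\<in>{E \<in> min_nonmembers V k D. T \<subseteq> E}. q ^ (card E - card T)) \<le> 1"
  using T
proof (induction "k - card T" arbitrary: T rule: less_induct)
  case less
  let ?G = "min_nonmembers V k D"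
  define GT where "GT = {E \<in> ?G. T \<subseteq> E}"
  define w where "w = (\<Sum>E\<in>GT. q ^ (card E - card T))"
  define Z where "Z = weight q D"
  have finD: "finite D" using D V finite_subset by blast
  have finR: "finite R" if "R \<in> D" for R using D V finite_subset that by blast
  have finG: "finite ?G" using V by (auto simp: min_nonmembers_def intro: finite_subset[of _ "Pow V"])
  have finGT: "finite GT" using finG by (simp add: GT_def)
  have finE: "finite E" if "E \<in> GT" for E
    using that V finite_subset by (auto simp: GT_def min_nonmembers_def)
  have finT: "finite T" using finR less.prems by auto
  have "{} \<in> D" using less.prems(1) D by (auto simp: down_closed_def)
  then have "weight q ({{}} :: 'a set set) \<le> Z"
    unfolding Z_def using q finD by (intro weight_mono) auto
  then have Z: "Z \<ge> 1" by (simp add: weight_def)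
  have \<beta>16: "0 < \<beta>" "\<beta> \<le> 1/16"
  proof -
    have "(2::real) ^ 4 \<le> 2 ^ (k + 3)" using k by (intro power_increasing) auto
    then show "\<beta> \<le> 1/16" "0 < \<beta>" by (auto simp: \<beta> field_simps)
  qed
  have up: "weight q {R \<in> D. S \<subseteq> R} \<le> q ^ card S * Z" if "finite S" for S
    unfolding Z_def using q finD finR that D(2)
    by (intro weight_supersets_le) (auto simp: down_closed_def)
  show ?case
  proof (rule ccontr)
    assume "\<not> ?thesis"
    then have w1: "w > 1" by (simp add: w_def GT_def)
    have inD: "S \<in> D" if "E \<in> GT" "S \<subset> E" for S E
      using that by (auto simp: GT_def min_nonmembers_def)
    have notD: "E \<notin> D" "card E \<le> k" "T \<subset> E" if "E \<in> GT" for E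
      using that less.prems by (auto simp: GT_def min_nonmembers_def)
    have cardTE: "card T < card E" "card (E - T) = card E - card T" if "E \<in> GT" for E
      using notD[OF that] finE[OF that] finT by (auto intro: psubset_card_mono simp: card_Diff_subset)
    \<comment> \<open>Sort \<open>E'\<close> by its intersection \<open>S\<close> with
      \<open>E\<close>. The case \<open>S = T\<close> contributes at most \<open>w\<close>;
      \<open>S = E\<close> leaves only \<open>E\<close> itself by minimality; every \<open>S\<close>
      strictly between contributes at most \<open>1\<close> by the induction hypothesis. There are
      at most \<open>2 ^ k\<close> sets \<open>S\<close>.\<close>
    have pair: "(\<Sum>E'\<in>GT. q ^ card ((E' - T) \<union> (E - T))) \<le> q ^ (card E - card T) * (w + 2 ^ k)"
      if E: "E \<in> GT" for E
    proof -
      define \<S> where "\<S> = {S. T \<subseteq> S \<and> S \<subseteq> E}"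
      have fin\<S>: "finite \<S>" using finE[OF E] by (simp add: \<S>_def)
      have "card \<S> \<le> card (Pow E)" using finE[OF E] by (intro card_mono) (auto simp: \<S>_def)
      also have "\<dots> \<le> 2 ^ k" using notD[OF E] by (simp add: card_Pow finE[OF E])
      finally have card\<S>: "card \<S> \<le> 2 ^ k" .
      have one: "(\<Sum>E'\<in>{E'\<in>GT. E' \<inter> E = S}. q ^ card (E' - E)) \<le> (if S = T then w else 1)"
        if S: "S \<in> \<S>" for S
      proof -
        have c: "card (E' - E) = card E' - card S" if "E' \<in> GT" "E' \<inter> E = S" for E'
          using that finE[OF E] by (metis card_Diff_subset_Int finite_Int)
        have ST: "T \<subseteq> S" "S \<subseteq> E" using S by (auto simp: \<S>_def)
        consider "S = T" | "S = E" "S \<noteq> T" | "T \<subset> S" "S \<subset> E" using ST by blast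
        then show ?thesis
        proof cases
          case 1
          have "(\<Sum>E'\<in>{E'\<in>GT. E' \<inter> E = S}. q ^ card (E' - E)) = (\<Sum>E'\<in>{E'\<in>GT. E' \<inter> E = S}. q ^ (card E' - card T))"
            using c 1 by (intro sum.cong) auto
          also have "\<dots> \<le> w" unfolding w_def using finGT q by (intro sum_mono2) auto
          finally show ?thesis using 1 by simp
        next
          case 2
          have "{E'\<in>GT. E' \<inter> E = S} \<subseteq> {E}"
          proof
            fix E' assume "E' \<in> {E'\<in>GT. E' \<inter> E = S}"
            then have "E' \<in> GT" "E \<subseteq> E'" using 2 by auto
            then show "E' \<in> {E}" using inD[of E' E] notD(1)[OF E] by blast
          qed
          then have "(\<Sum>E'\<in>{E'\<in>GT. E' \<inter> E = S}. q ^ card (E' - E)) \<le> (\<Sum>E'\<in>{E}. q ^ card (E' - E))"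
            using q by (intro sum_mono2) auto
          then show ?thesis using 2 by simp
        next
          case 3
          then have "S \<in> D" "S \<noteq> {}" using inD[OF E] less.prems by auto
          have "card T < card S" "card S < card E"
            using 3 finE[OF E] finite_subset[OF ST(2) finE[OF E]] by (auto intro: psubset_card_mono)
          then have "k - card S < k - card T" using notD(2)[OF E] by linarith
          from less.hyps[OF this \<open>S \<in> D\<close> \<open>S \<noteq> {}\<close>]
          have IH: "(\<Sum>E\<in>{E \<in> ?G. S \<subseteq> E}. q ^ (card E - card S)) \<le> 1" .
          have "(\<Sum>E'\<in>{E'\<in>GT. E' \<inter> E = S}. q ^ card (E' - E)) = (\<Sum>E'\<in>{E'\<in>GT. E' \<inter> E = S}. q ^ (card E' - card S))"
            using c by (intro sum.cong) auto
          also have "\<dots> \<le> (\<Sum>E\<in>{E \<in> ?G. S \<subseteq> E}. q ^ (card E - card S))"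
            using finG q by (intro sum_mono2) (auto simp: GT_def)
          finally show ?thesis using IH 3 by auto
        qed
      qed
      have "(\<Sum>E'\<in>GT. q ^ card (E' - E)) = (\<Sum>S\<in>\<S>. \<Sum>E'\<in>{E'\<in>GT. E' \<inter> E = S}. q ^ card (E' - E))"
        using finGT fin\<S> by (intro sum.group[symmetric]) (auto simp: \<S>_def GT_def intro: subsetD[OF less_imp_le[OF notD(3)[OF E]]])
      also have "\<dots> \<le> (\<Sum>S\<in>\<S>. if S = T then w else 1)" by (intro sum_mono one)
      also have "\<dots> \<le> (\<Sum>S\<in>\<S>. (if S = T then w else 0) + 1)" using w1 by (intro sum_mono) auto
      also have "\<dots> = (if T \<in> \<S> then w else 0) + real (card \<S>)"
        using fin\<S> by (simp add: sum.distrib sum.delta)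
      also have "\<dots> \<le> w + 2 ^ k"
      proof -
        have "real (card \<S>) \<le> 2 ^ k" by (metis card\<S> of_nat_le_iff of_nat_numeral of_nat_power)
        moreover have "(if T \<in> \<S> then w else 0) \<le> w" using w1 by simp
        ultimately show ?thesis by linarith
      qed
      finally have *: "(\<Sum>E'\<in>GT. q ^ card (E' - E)) \<le> w + 2 ^ k" .
      have "card ((E' - T) \<union> (E - T)) = (card E - card T) + card (E' - E)" if "E' \<in> GT" for E'
      proof -
        have eq: "(E' - T) \<union> (E - T) = (E - T) \<union> (E' - E)" using notD(3)[OF E] by auto
        have "card ((E' - T) \<union> (E - T)) = card (E - T) + card (E' - E)" unfolding eq
          using finE[OF E] finE[OF that] notD(3)[OF E] by (intro card_Un_disjoint) auto
        then show ?thesis using cardTE[OF E] by simp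
      qed
      then have "(\<Sum>E'\<in>GT. q ^ card ((E' - T) \<union> (E - T))) = q ^ (card E - card T) * (\<Sum>E'\<in>GT. q ^ card (E' - E))"
        by (simp add: power_add sum_distrib_left)
      then show ?thesis using * q by (simp add: mult_left_mono)
    qed
    define X where "X R = (\<Sum>E\<in>GT. of_bool (E - T \<subseteq> R) :: real)" for R
    have S1eq: "(\<Sum>R\<in>D. q ^ card R * X R) = (\<Sum>E\<in>GT. weight q {R \<in> D. E - T \<subseteq> R})"
    proof -
      have "(\<Sum>R\<in>D. q ^ card R * X R) = (\<Sum>E\<in>GT. \<Sum>R\<in>D. q ^ card R * of_bool (E - T \<subseteq> R))"
        unfolding X_def sum_distrib_left by (rule sum.swap)
      also have "\<dots> = (\<Sum>E\<in>GT. weight q {R \<in> D. E - T \<subseteq> R})"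
        by (simp only: weight_filter[OF finD])
      finally show ?thesis .
    qed
    have S1: "(1 - \<beta>)\<^sup>2 * w * Z \<le> (\<Sum>R\<in>D. q ^ card R * X R)"
    proof -
      have "(1 - \<beta>)\<^sup>2 * w * Z = (\<Sum>E\<in>GT. (1 - \<beta>) * ((1 - \<beta>) * q ^ (card E - card T)) * Z)"
        by (simp add: w_def sum_distrib_left sum_distrib_right power2_eq_square mult.assoc)
      also have "\<dots> \<le> (\<Sum>E\<in>GT. weight q {R \<in> D. E - T \<subseteq> R})"
      proof (intro sum_mono)
        fix E assume E: "E \<in> GT"
        have "E - T \<subset> E" using notD(3)[OF E] less.prems by auto
        then have "E - T \<in> D" using inD[OF E] by auto
        moreover have "E - T \<noteq> {}" using notD(3)[OF E] by auto
        moreover have c: "card (E - T) \<le> k" using cardTE[OF E] notD(2)[OF E] by simp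
        ultimately have "(1 - \<beta>) * (q / (1 + q)) ^ card (E - T) * Z \<le> weight q {R \<in> D. E - T \<subseteq> R}"
          using st by (auto simp: near_maximal_def Z_def)
        moreover have "(1 - \<beta>) * ((1 - \<beta>) * q ^ card (E - T)) * Z \<le> (1 - \<beta>) * (q / (1 + q)) ^ card (E - T) * Z"
          using q_ratio_power_ge[OF q c] \<beta>16 Z by (intro mult_right_mono mult_left_mono) auto
        ultimately show "(1 - \<beta>) * ((1 - \<beta>) * q ^ (card E - card T)) * Z \<le> weight q {R \<in> D. E - T \<subseteq> R}"
          using cardTE[OF E] by simp
      qed
      finally show ?thesis by (simp add: S1eq)
    qed
    have S2: "(\<Sum>R\<in>D. q ^ card R * (X R)\<^sup>2) \<le> Z * w * (w + 2 ^ k)"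
    proof -
      have "(\<Sum>R\<in>D. q ^ card R * (X R)\<^sup>2) =
          (\<Sum>R\<in>D. \<Sum>E\<in>GT. \<Sum>E'\<in>GT. q ^ card R * of_bool ((E' - T) \<union> (E - T) \<subseteq> R))"
      proof (intro sum.cong refl)
        fix R
        have "(X R)\<^sup>2 = (\<Sum>E\<in>GT. \<Sum>E'\<in>GT. of_bool ((E' - T) \<union> (E - T) \<subseteq> R))"
          unfolding X_def power2_eq_square sum_product by (intro sum.cong refl) auto
        then show "q ^ card R * (X R)\<^sup>2 = (\<Sum>E\<in>GT. \<Sum>E'\<in>GT. q ^ card R * of_bool ((E' - T) \<union> (E - T) \<subseteq> R))"
          by (simp only: sum_distrib_left)
      qed
      also have "\<dots> = (\<Sum>E\<in>GT. \<Sum>R\<in>D. \<Sum>E'\<in>GT. q ^ card R * of_bool ((E' - T) \<union> (E - T) \<subseteq> R))"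
        by (rule sum.swap)
      also have "\<dots> = (\<Sum>E\<in>GT. \<Sum>E'\<in>GT. \<Sum>R\<in>D. q ^ card R * of_bool ((E' - T) \<union> (E - T) \<subseteq> R))"
        by (intro sum.cong refl sum.swap)
      also have "\<dots> = (\<Sum>E\<in>GT. \<Sum>E'\<in>GT. weight q {R \<in> D. (E' - T) \<union> (E - T) \<subseteq> R})"
        by (simp only: weight_filter[OF finD])
      also have "\<dots> \<le> (\<Sum>E\<in>GT. \<Sum>E'\<in>GT. q ^ card ((E' - T) \<union> (E - T)) * Z)"
        using finE by (intro sum_mono up) auto
      also have "\<dots> = (\<Sum>E\<in>GT. (\<Sum>E'\<in>GT. q ^ card ((E' - T) \<union> (E - T))) * Z)"
        by (simp add: sum_distrib_right)
      also have "\<dots> \<le> (\<Sum>E\<in>GT. (q ^ (card E - card T) * (w + 2 ^ k)) * Z)"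
        using Z by (intro sum_mono mult_right_mono pair) auto
      also have "\<dots> = Z * w * (w + 2 ^ k)"
        unfolding w_def sum_distrib_right sum_distrib_left by (intro sum.cong refl) simp
      finally show ?thesis .
    qed
    define P where "P = weight q {R \<in> D. \<exists>E\<in>GT. E - T \<subseteq> R}"
    define N where "N = weight q {R \<in> D. \<not> (\<exists>E\<in>GT. E - T \<subseteq> R)}"
    have "D = {R \<in> D. \<exists>E\<in>GT. E - T \<subseteq> R} \<union> {R \<in> D. \<not> (\<exists>E\<in>GT. E - T \<subseteq> R)}" by auto
    then have PN: "Z = P + N" unfolding Z_def P_def N_def weight_def
      using finD by (subst sum.union_disjoint[symmetric]) (auto intro!: sum.cong)
    \<comment> \<open>A member containing \<open>T\<close> cannot contain some \<open>E - T\<close>,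
      since it would contain \<open>E\<close>; so deleting \<open>T\<close> from it lands among the
      sets with \<open>X\<close> equal to zero.\<close>
    have "weight q {R \<in> D. T \<subseteq> R} \<le> q ^ card T * N" unfolding N_def
    proof (intro weight_supersets_le)
      fix R assume R: "R \<in> D" "T \<subseteq> R"
      have "\<not> E - T \<subseteq> R - T" if "E \<in> GT" for E
      proof
        assume "E - T \<subseteq> R - T"
        then have "E \<subseteq> R" using R by auto
        then show False using R D(2) notD(1)[OF that] by (auto simp: down_closed_def)
      qed
      moreover have "R - T \<in> D" using R D(2) by (auto simp: down_closed_def)
      ultimately show "R - T \<in> {R \<in> D. \<not> (\<exists>E\<in>GT. E - T \<subseteq> R)}" by auto
    qed (use q finD finR finT in auto)
    obtain E0 where E0: "E0 \<in> GT"
    proof (cases "GT = {}")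
      case True then show ?thesis using w1 by (simp add: w_def)
    qed auto
    have cTk: "card T \<le> k" using cardTE(1)[OF E0] notD(2)[OF E0] by simp
    have "q ^ card T * ((1 - \<beta>)\<^sup>2 * Z) = (1 - \<beta>) * ((1 - \<beta>) * q ^ card T) * Z"
      by (simp add: power2_eq_square)
    also have "\<dots> \<le> (1 - \<beta>) * (q / (1 + q)) ^ card T * Z"
      using q_ratio_power_ge[OF q cTk] \<beta>16 Z by (intro mult_right_mono mult_left_mono) auto
    also have "\<dots> \<le> weight q {R \<in> D. T \<subseteq> R}"
      using st less.prems cTk by (auto simp: near_maximal_def Z_def)
    also have "\<dots> \<le> q ^ card T * N" by fact
    finally have "(1 - \<beta>)\<^sup>2 * Z \<le> N" using q by simp
    moreover have "(1 - 2 * \<beta>) * Z \<le> (1 - \<beta>)\<^sup>2 * Z"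
      using Z by (intro mult_right_mono) (auto simp: power2_eq_square algebra_simps)
    ultimately have P: "P \<le> 2 * \<beta> * Z" using PN by (simp add: algebra_simps)
    \<comment> \<open>Cauchy-Schwarz with the indicator of \<open>X R > 0\<close> as the second
      factor.\<close>
    have CS: "(\<Sum>R\<in>D. q ^ card R * X R)\<^sup>2 \<le> (\<Sum>R\<in>D. q ^ card R * (X R)\<^sup>2) * P"
    proof -
      have "(\<Sum>R\<in>D. q ^ card R * X R) =
          (\<Sum>R\<in>D. (sqrt (q ^ card R) * X R) * (sqrt (q ^ card R) * of_bool (\<exists>E\<in>GT. E - T \<subseteq> R)))"
      proof (intro sum.cong refl)
        fix R
        have "X R = 0" if "\<not> (\<exists>E\<in>GT. E - T \<subseteq> R)" using that by (auto simp: X_def intro!: sum.neutral)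
        moreover have "sqrt (q ^ card R) * sqrt (q ^ card R) = q ^ card R" using q by simp
        ultimately show "q ^ card R * X R = (sqrt (q ^ card R) * X R) * (sqrt (q ^ card R) * of_bool (\<exists>E\<in>GT. E - T \<subseteq> R))"
          by (cases "\<exists>E\<in>GT. E - T \<subseteq> R") (auto simp: algebra_simps)
      qed
      also have "(\<dots>)\<^sup>2 \<le> (\<Sum>R\<in>D. (sqrt (q ^ card R) * X R)\<^sup>2) * (\<Sum>R\<in>D. (sqrt (q ^ card R) * of_bool (\<exists>E\<in>GT. E - T \<subseteq> R))\<^sup>2)"
        by (rule Cauchy_Schwarz_ineq_sum)
      also have "(\<Sum>R\<in>D. (sqrt (q ^ card R) * X R)\<^sup>2) = (\<Sum>R\<in>D. q ^ card R * (X R)\<^sup>2)"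
        using q by (simp add: power_mult_distrib)
      also have "(\<Sum>R\<in>D. (sqrt (q ^ card R) * of_bool (\<exists>E\<in>GT. E - T \<subseteq> R))\<^sup>2) = P"
        unfolding P_def weight_filter[OF finD] using q by (intro sum.cong refl) (auto simp: power_mult_distrib)
      finally show ?thesis .
    qed
    have "((1 - \<beta>)\<^sup>2 * w * Z)\<^sup>2 \<le> (\<Sum>R\<in>D. q ^ card R * X R)\<^sup>2"
      using S1 w1 Z by (intro power_mono) auto
    also note CS
    also have "(\<Sum>R\<in>D. q ^ card R * (X R)\<^sup>2) * P \<le> (Z * w * (w + 2 ^ k)) * (2 * \<beta> * Z)"
      using S2 P w1 Z \<beta>16 q by (intro mult_mono) (auto simp: P_def weight_nonneg)
    finally have "(w * Z\<^sup>2) * ((1 - \<beta>) ^ 4 * w) \<le> (w * Z\<^sup>2) * (2 * \<beta> * (w + 2 ^ k))"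
      by (simp add: power2_eq_square power4_eq_xxxx algebra_simps)
    then have "(1 - \<beta>) ^ 4 * w \<le> 2 * \<beta> * (w + 2 ^ k)"
      using w1 Z by (subst (asm) mult_le_cancel_left_pos) auto
    also have "\<dots> \<le> 2 * \<beta> * (w * 2 ^ (k + 1))"
    proof -
      have "w + 2 ^ k \<le> w * 2 ^ k + w * 2 ^ k" using w1 by (intro add_mono) (auto simp: mult_le_cancel_left1 mult_le_cancel_right1)
      then show ?thesis using \<beta>16 by (intro mult_left_mono) auto
    qed
    also have "\<dots> = w / 2" by (simp add: \<beta> power_add)
    finally have "(1 - \<beta>) ^ 4 \<le> 1 / 2" using w1 by (simp add: field_simps)
    moreover have "1 + real 4 * (- \<beta>) \<le> (1 + (- \<beta>)) ^ 4" using \<beta>16 by (intro Bernoulli_inequality) auto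
    ultimately show False using \<beta>16 by simp
  qed
qed

text \<open>The strict inequality makes a spread family incompatible with a cheap cover of \<open>H\<close> inside \<open>C\<close>
  by sets with at least two elements.\<close>

definition spread :: "real \<Rightarrow> nat \<Rightarrow> 'a set set \<Rightarrow> 'a set \<Rightarrow> bool" where
  "spread q k H C \<longleftrightarrow> (\<exists>\<S> (w :: 'a set \<Rightarrow> real). finite \<S> \<and> \<S> \<subseteq> H \<and>
     (\<forall>E\<in>\<S>. E \<subseteq> C \<and> card E \<le> k \<and> 0 \<le> w E) \<and> 0 < sum w \<S> \<and>
     (\<forall>S. S \<subseteq> C \<and> 2 \<le> card S \<and> card S \<le> k \<longrightarrow>
        real (card C) * sum w {E \<in> \<S>. S \<subseteq> E} < q ^ (card S - 1) * sum w \<S>))"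

section \<open>From spread systems to one container step\<close>

lemma spread_mono: "spread q k H C \<Longrightarrow> 0 \<le> q \<Longrightarrow> q \<le> q' \<Longrightarrow> spread q' k H C"
  unfolding spread_def by (smt (verit) mult_right_mono power_mono)

text \<open>A hyperedge of the system is not in \<open>D\<close>, while \<open>{}\<close> and all
  singletons of the union are; so it contains a minimal nonmember with at least two elements. These
  nonmembers cost at most \<open>card C\<close> in total by \<open>cover_degree_le\<close> at
  singletons, and the degree condition makes the weight they can cover strictly less than all of
  it.\<close>

lemma near_maximal_not_spread:
  fixes V :: "'a set"
  assumes V: "finite V" and D: "D \<subseteq> Pow V" "down_closed D" "{} \<in> D" and k: "k \<ge> 1"
    and q: "q > 0" "real k * q \<le> \<beta>" and \<beta>: "\<beta> = 1 / 2 ^ (k + 3)"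
    and st: "near_maximal q \<beta> k D" and H: "H \<inter> D = {}"
  shows "\<not> spread q k H {v. {v} \<in> D}"
proof
  define C where "C = {v. {v} \<in> D}"
  assume "spread q k H {v. {v} \<in> D}"
  then obtain \<S> and w :: "'a set \<Rightarrow> real" where fin\<S>: "finite \<S>" and \<S>: "\<S> \<subseteq> H"
    and \<S>C: "\<forall>E\<in>\<S>. E \<subseteq> C \<and> card E \<le> k \<and> 0 \<le> w E" and pos: "0 < sum w \<S>"
    and deg: "\<forall>S. S \<subseteq> C \<and> 2 \<le> card S \<and> card S \<le> k \<longrightarrow>
        real (card C) * sum w {E \<in> \<S>. S \<subseteq> E} < q ^ (card S - 1) * sum w \<S>"
    unfolding spread_def C_def[symmetric] by (elim exE conjE) (rule that)
  let ?G = "min_nonmembers V k D"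
  define G where "G = {S \<in> ?G. S \<subseteq> C \<and> 2 \<le> card S}"
  have CV: "C \<subseteq> V" using D by (auto simp: C_def)
  have finC: "finite C" using CV V finite_subset by blast
  have finG: "finite G" using finC by (auto simp: G_def intro: finite_subset[of _ "Pow C"])
  have cover: "\<exists>S\<in>G. S \<subseteq> E" if E: "E \<in> \<S>" for E
  proof -
    have E': "E \<subseteq> C" "card E \<le> k" "E \<notin> D" using \<S>C \<S> H E by auto
    then have finE: "finite E" using finC finite_subset by blast
    have "\<exists>S. S \<subseteq> E \<and> S \<notin> D" using E' by auto
    then obtain S where S: "S \<subseteq> E \<and> S \<notin> D" and min: "\<And>S'. S' \<subseteq> E \<and> S' \<notin> D \<Longrightarrow> card S \<le> card S'"
      using ex_has_least_nat[of "\<lambda>S. S \<subseteq> E \<and> S \<notin> D" E card] E' by blast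
    have finS: "finite S" using S finE finite_subset by blast
    have "S' \<in> D" if "S' \<subset> S" for S'
      using min[of S'] psubset_card_mono[OF finS that] that S by auto
    moreover have "card S \<le> k" using card_mono[OF finE] S E'(2) by (meson le_trans)
    moreover have "card S \<noteq> 0" using S finS D(3) by auto
    moreover have "card S \<noteq> 1"
    proof
      assume "card S = 1"
      then obtain v where "S = {v}" by (auto simp: card_1_singleton_iff)
      then show False using S E' by (auto simp: C_def)
    qed
    ultimately have "S \<in> G" using S E' CV by (auto simp: G_def min_nonmembers_def)
    then show ?thesis using S by blast
  qed
  have "G \<noteq> {}"
  proof
    assume "G = {}"
    then have "\<S> = {}" using cover by auto
    then show False using pos by simp
  qed
  have "sum w \<S> \<le> (\<Sum>S\<in>G. sum w {E \<in> \<S>. S \<subseteq> E})"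
  proof -
    have "sum w \<S> \<le> sum w (\<Union>S\<in>G. {E \<in> \<S>. S \<subseteq> E})"
      using fin\<S> finG cover \<S>C by (intro sum_mono2) auto
    also have "\<dots> \<le> (\<Sum>S\<in>G. sum w {E \<in> \<S>. S \<subseteq> E})"
      using finG
    proof (induction G rule: finite_induct)
      case (insert S G)
      have "sum w (\<Union>S\<in>insert S G. {E \<in> \<S>. S \<subseteq> E}) \<le> sum w {E \<in> \<S>. S \<subseteq> E} + sum w (\<Union>S\<in>G. {E \<in> \<S>. S \<subseteq> E})"
      proof -
        have "finite (\<Union>S\<in>G. {E \<in> \<S>. S \<subseteq> E})" using fin\<S> insert.hyps by auto
        moreover have "sum w ({E \<in> \<S>. S \<subseteq> E} \<inter> (\<Union>S\<in>G. {E \<in> \<S>. S \<subseteq> E})) \<ge> 0"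
          using \<S>C by (intro sum_nonneg) auto
        ultimately show ?thesis using fin\<S> by (simp add: sum_Un)
      qed
      then show ?case using insert by simp
    qed simp
    finally show ?thesis .
  qed
  then have "real (card C) * sum w \<S> \<le> (\<Sum>S\<in>G. real (card C) * sum w {E \<in> \<S>. S \<subseteq> E})"
    by (simp add: sum_distrib_left[symmetric] mult_left_mono)
  also have "\<dots> < (\<Sum>S\<in>G. q ^ (card S - 1) * sum w \<S>)"
    using finG \<open>G \<noteq> {}\<close> deg by (intro sum_strict_mono) (auto simp: G_def min_nonmembers_def)
  also have "\<dots> = (\<Sum>S\<in>G. q ^ (card S - 1)) * sum w \<S>" by (simp add: sum_distrib_right)
  also have "\<dots> \<le> real (card C) * sum w \<S>"
  proof (intro mult_right_mono)
    \<comment> \<open>Crude double counting: each \<open>S\<close> is charged to all of its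
      elements, where one would do.\<close>
    have "(\<Sum>S\<in>G. q ^ (card S - 1)) \<le> (\<Sum>S\<in>G. \<Sum>v\<in>S. q ^ (card S - 1))"
      using q by (intro sum_mono) (auto simp: G_def mult_le_cancel_right1)
    also have "\<dots> = (\<Sum>S\<in>G. \<Sum>v\<in>C. if v \<in> S then q ^ (card S - 1) else 0)"
      using finC by (intro sum.cong refl sum.mono_neutral_cong_left) (auto simp: G_def)
    also have "\<dots> = (\<Sum>v\<in>C. \<Sum>S\<in>G. if v \<in> S then q ^ (card S - 1) else 0)" by (rule sum.swap)
    also have "\<dots> \<le> (\<Sum>v\<in>C. 1)"
    proof (intro sum_mono)
      fix v assume "v \<in> C"
      have fin: "finite ?G" using V by (auto simp: min_nonmembers_def intro: finite_subset[of _ "Pow V"])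
      have "(\<Sum>S\<in>G. if v \<in> S then q ^ (card S - 1) else 0) = (\<Sum>S\<in>{S\<in>G. v \<in> S}. q ^ (card S - 1))"
        using finG by (intro sum.mono_neutral_cong_right) auto
      also have "\<dots> \<le> (\<Sum>S\<in>{S \<in> ?G. {v} \<subseteq> S}. q ^ (card S - card {v}))"
        using fin q unfolding card_1_singleton_iff by (simp, intro sum_mono2) (auto simp: G_def)
      also have "\<dots> \<le> 1"
        using \<open>v \<in> C\<close> by (intro cover_degree_le[OF V D(1,2) k q \<beta> st]) (auto simp: C_def)
      finally show "(\<Sum>S\<in>G. if v \<in> S then q ^ (card S - 1) else 0) \<le> 1" .
    qed
    finally show "(\<Sum>S\<in>G. q ^ (card S - 1)) \<le> real (card C)" by simp
  qed (use pos in simp)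
  finally show False by simp
qed

text \<open>Start from the family of all independent sets. Its weight is at most
  \<open>(1 + q) ^ card V\<close>, so the logarithm in the fingerprint bound is at most
  \<open>q * card V\<close>. The container is the union of the final family, read off from its
  singletons.\<close>

theorem container_step:
  fixes V :: "'a set"
  assumes V: "finite V" and k: "k \<ge> 1" and q: "q > 0" "real k * q \<le> 1 / 2 ^ (k + 3)"
  shows "\<exists>\<psi>. \<forall>I\<subseteq>V. (\<forall>E\<in>H. \<not> E \<subseteq> I) \<longrightarrow> (\<exists>F\<subseteq>I. real (card F) \<le> real k * 2 ^ (k + 3) * q * real (card V) \<and>
           I \<subseteq> \<psi> F \<and> \<psi> F \<subseteq> V \<and> \<not> spread q k H (\<psi> F))"
proof -
  define \<beta> :: real where "\<beta> = 1 / 2 ^ (k + 3)"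
  have \<beta>01: "0 < \<beta>" "\<beta> < 1" by (auto simp: \<beta>_def field_simps)
  define D0 where "D0 = {I. I \<subseteq> V \<and> (\<forall>E\<in>H. \<not> E \<subseteq> I)}"
  have D0: "D0 \<subseteq> Pow V" "down_closed D0" by (auto simp: D0_def down_closed_def)
  from near_maximal_fingerprint[OF V q(1) \<beta>01 D0, of "{}" k] obtain \<phi> where \<phi>: "\<forall>I\<in>D0. {} \<subseteq> I \<longrightarrow>
      (\<exists>F. {} \<subseteq> F \<and> F \<subseteq> I \<and> real (card (F - {})) \<le> k * ln (weight q D0) / \<beta> \<and>
           \<phi> F \<subseteq> D0 \<and> down_closed (\<phi> F) \<and> near_maximal q \<beta> k (\<phi> F) \<and> I \<in> \<phi> F)"
    by (elim exE) (rule that)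
  show ?thesis
  proof (intro exI[of _ "\<lambda>F. {v. {v} \<in> \<phi> F}"] allI impI)
    fix I assume I: "I \<subseteq> V" "\<forall>E\<in>H. \<not> E \<subseteq> I"
    then have ID: "I \<in> D0" by (simp add: D0_def)
    from \<phi>[rule_format, OF ID empty_subsetI] obtain F where F: "F \<subseteq> I"
      "real (card (F - {})) \<le> k * ln (weight q D0) / \<beta>"
      "\<phi> F \<subseteq> D0" "down_closed (\<phi> F)" "near_maximal q \<beta> k (\<phi> F)" "I \<in> \<phi> F"
      by (elim exE conjE) (rule that)
    have emp: "{} \<in> \<phi> F" using F by (auto simp: down_closed_def)
    have "weight q ({{}} :: 'a set set) \<le> weight q D0"
      using q V D0 emp F by (intro weight_mono) (auto intro: finite_subset[of _ "Pow V"])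
    then have "0 < weight q D0" by (simp add: weight_def)
    moreover have "weight q D0 \<le> weight q (Pow V)" using q V D0 by (intro weight_mono) auto
    ultimately have "ln (weight q D0) \<le> ln ((1 + q) ^ card V)" by (simp add: weight_Pow V)
    also have "\<dots> = real (card V) * ln (1 + q)" using q by (simp add: ln_realpow)
    also have "\<dots> \<le> real (card V) * q" using q by (intro mult_left_mono ln_add_one_self_le_self) auto
    finally have "k * ln (weight q D0) / \<beta> \<le> k * (real (card V) * q) / \<beta>"
      using \<beta>01 by (intro divide_right_mono mult_left_mono) auto
    then have "real (card F) \<le> real k * 2 ^ (k + 3) * q * real (card V)"
      using F(2) by (simp add: \<beta>_def mult_ac)
    moreover have "I \<subseteq> {v. {v} \<in> \<phi> F}" using F by (auto simp: down_closed_def)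
    moreover have "{v. {v} \<in> \<phi> F} \<subseteq> V" using F D0 by auto
    moreover have "\<not> spread q k H {v. {v} \<in> \<phi> F}"
    proof (rule near_maximal_not_spread[OF V _ F(4) emp k q(1) _ \<beta>_def F(5)])
      show "\<phi> F \<subseteq> Pow V" using F D0 by auto
      show "real k * q \<le> \<beta>" using q by (simp add: \<beta>_def)
      show "H \<inter> \<phi> F = {}" using F by (auto simp: D0_def)
    qed
    ultimately show "\<exists>F\<subseteq>I. real (card F) \<le> real k * 2 ^ (k + 3) * q * real (card V) \<and>
           I \<subseteq> {v. {v} \<in> \<phi> F} \<and> {v. {v} \<in> \<phi> F} \<subseteq> V \<and> \<not> spread q k H {v. {v} \<in> \<phi> F}"
      using F(1) by blast
  qed
qed

section \<open>Regularisation of families of functions\<close>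

text \<open>Edges are stored as functions from positions to vertices, so a degree refers to a set
  \<open>I\<close> of positions and not just to a set of vertices.\<close>

definition matching :: "('i \<Rightarrow> 'b) set \<Rightarrow> 'i set \<Rightarrow> ('i \<Rightarrow> 'b) \<Rightarrow> ('i \<Rightarrow> 'b) set" where
  "matching G I f = {g \<in> G. \<forall>i\<in>I. g i = f i}"

definition degree_on :: "('i \<Rightarrow> 'b) set \<Rightarrow> 'i set \<Rightarrow> ('i \<Rightarrow> 'b) \<Rightarrow> nat" where
  "degree_on G I f = card (matching G I f)"

definition shadow :: "('i \<Rightarrow> 'b) set \<Rightarrow> 'i set \<Rightarrow> ('i \<Rightarrow> 'b) set" where
  "shadow G I = (\<lambda>f. restrict f I) ` G"

definition max_degree :: "('i \<Rightarrow> 'b) set \<Rightarrow> 'i set \<Rightarrow> nat" where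
  "max_degree G I = Max (degree_on G I ` G)"

lemma restrict_eq_iff: "restrict f I = restrict g I \<longleftrightarrow> (\<forall>i\<in>I. f i = g i)"
  by (auto simp: fun_eq_iff restrict_def)

lemma matching_subset: "matching G I f \<subseteq> G"
  by (auto simp: matching_def)

lemma finite_matching: "finite G \<Longrightarrow> finite (matching G I f)"
  by (auto simp: matching_def)

lemma degree_on_pos: "finite G \<Longrightarrow> f \<in> G \<Longrightarrow> degree_on G I f > 0"
  by (auto simp: degree_on_def card_gt_0_iff finite_matching matching_def)

lemma degree_on_mono: "finite G \<Longrightarrow> G' \<subseteq> G \<Longrightarrow> degree_on G' I f \<le> degree_on G I f"
  unfolding degree_on_def by (intro card_mono finite_matching) (auto simp: matching_def)

lemma degree_on_le_max: "finite G \<Longrightarrow> f \<in> G \<Longrightarrow> degree_on G I f \<le> max_degree G I"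
  by (simp add: max_degree_def)

lemma max_degree_pos: "finite G \<Longrightarrow> G \<noteq> {} \<Longrightarrow> max_degree G I > 0"
  by (metis all_not_in_conv degree_on_le_max degree_on_pos gr0I leD)

lemma max_degree_le:
  "finite G \<Longrightarrow> G \<noteq> {} \<Longrightarrow> (\<And>f. f \<in> G \<Longrightarrow> degree_on G I f \<le> c) \<Longrightarrow> max_degree G I \<le> c"
  by (simp add: max_degree_def)

lemma finite_shadow: "finite G \<Longrightarrow> finite (shadow G I)"
  by (simp add: shadow_def)

lemma shadow_mono: "G' \<subseteq> G \<Longrightarrow> shadow G' I \<subseteq> shadow G I"
  by (auto simp: shadow_def)

lemma card_eq_sum_shadow:
  assumes "finite G"
  shows "card G = (\<Sum>s\<in>shadow G I. degree_on G I s)"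
proof -
  have "card G = (\<Sum>s\<in>shadow G I. card {f \<in> G. restrict f I = s})"
    unfolding card_eq_sum shadow_def
    using sum.group[of G "(\<lambda>f. restrict f I) ` G" "\<lambda>f. restrict f I" "\<lambda>_. 1::nat"] assms by simp
  also have "\<dots> = (\<Sum>s\<in>shadow G I. degree_on G I s)"
  proof (intro sum.cong refl)
    fix s assume "s \<in> shadow G I"
    then obtain f where "f \<in> G" "s = restrict f I" by (auto simp: shadow_def)
    then have "{g \<in> G. restrict g I = s} = matching G I s"
      by (auto simp: matching_def restrict_eq_iff)
    then show "card {g \<in> G. restrict g I = s} = degree_on G I s" by (simp add: degree_on_def)
  qed
  finally show ?thesis .
qed

lemma degree_on_restrict [simp]: "degree_on G I (restrict f I) = degree_on G I f"
  by (simp add: degree_on_def matching_def)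

text \<open>A subfamily maximising the size minus the weighted shadow sizes has no small class, since
  deleting a class shrinks its shadow by one.\<close>

lemma min_degree_subfamily:
  fixes G :: "('i \<Rightarrow> 'b) set" and c :: "'i set \<Rightarrow> real"
  assumes G: "finite G" and \<I>: "finite \<I>" and c: "\<And>I. I \<in> \<I> \<Longrightarrow> c I \<ge> 0"
  obtains G' where "G' \<subseteq> G" "\<And>I f. I \<in> \<I> \<Longrightarrow> f \<in> G' \<Longrightarrow> c I \<le> degree_on G' I f"
    "real (card G) - (\<Sum>I\<in>\<I>. c I * card (shadow G I)) \<le> card G'"
proof -
  define \<Phi> where "\<Phi> G' = real (card G') - (\<Sum>I\<in>\<I>. c I * card (shadow G' I))" for G' :: "('i \<Rightarrow> 'b) set"
  have "\<exists>G'\<in>Pow G. \<forall>G''\<in>Pow G. \<Phi> G'' \<le> \<Phi> G'"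
  proof -
    have "finite (\<Phi> ` Pow G)" "\<Phi> ` Pow G \<noteq> {}" using G by auto
    then have "Max (\<Phi> ` Pow G) \<in> \<Phi> ` Pow G" by (rule Max_in)
    then obtain G' where "G' \<in> Pow G" "\<Phi> G' = Max (\<Phi> ` Pow G)" by auto
    then show ?thesis using \<open>finite (\<Phi> ` Pow G)\<close> by (intro bexI[of _ G']) auto
  qed
  then obtain G' where G': "G' \<subseteq> G" and max: "\<And>G''. G'' \<subseteq> G \<Longrightarrow> \<Phi> G'' \<le> \<Phi> G'" by auto
  have finG': "finite G'" using G G' finite_subset by blast
  show ?thesis
  proof
    show "G' \<subseteq> G" by fact
  next
    fix I f assume I: "I \<in> \<I>" and f: "f \<in> G'"
    show "c I \<le> degree_on G' I f"
    proof (rule ccontr)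
      assume less: "\<not> ?thesis"
      define G'' where "G'' = G' - matching G' I f"
      have "card G'' = card G' - degree_on G' I f" unfolding G''_def degree_on_def
        by (intro card_Diff_subset finite_matching finG' matching_subset)
      moreover have "degree_on G' I f \<le> card G'" unfolding degree_on_def
        by (intro card_mono finG' matching_subset)
      ultimately have cG: "real (card G'') = card G' - real (degree_on G' I f)" by linarith
      have sub: "shadow G'' J \<subseteq> shadow G' J" for J by (intro shadow_mono) (auto simp: G''_def)
      have "restrict f I \<in> shadow G' I - shadow G'' I"
        using f by (auto simp: shadow_def G''_def matching_def restrict_eq_iff)
      then have "shadow G'' I \<subset> shadow G' I" using sub by blast
      then have "card (shadow G'' I) < card (shadow G' I)"
        using finG' by (intro psubset_card_mono finite_shadow)
      then have "real (card (shadow G'' I)) + 1 \<le> card (shadow G' I)" by linarith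
      then have "c I * (real (card (shadow G'' I)) + 1) \<le> c I * card (shadow G' I)"
        using c[OF I] by (intro mult_left_mono)
      then have 1: "c I * card (shadow G'' I) + c I \<le> c I * card (shadow G' I)" by (simp add: algebra_simps)
      have 2: "(\<Sum>J\<in>\<I> - {I}. c J * card (shadow G'' J)) \<le> (\<Sum>J\<in>\<I> - {I}. c J * card (shadow G' J))"
        using c sub finG' by (intro sum_mono mult_left_mono of_nat_mono card_mono finite_shadow) auto
      have "(\<Sum>J\<in>\<I>. c J * card (shadow G'' J)) + c I \<le> (\<Sum>J\<in>\<I>. c J * card (shadow G' J))"
        unfolding sum.remove[OF \<I> I] using 1 2 by linarith
      then have "\<Phi> G' < \<Phi> G''" unfolding \<Phi>_def cG using less by linarith
      moreover have "G'' \<subseteq> G" using G' by (auto simp: G''_def)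
      ultimately show False using max[of G''] by linarith
    qed
  next
    have "0 \<le> (\<Sum>I\<in>\<I>. c I * card (shadow G' I))" using c by (intro sum_nonneg) auto
    then show "real (card G) - (\<Sum>I\<in>\<I>. c I * card (shadow G I)) \<le> card G'"
      using max[OF order_refl] by (simp add: \<Phi>_def)
  qed
qed

text \<open>Maximise the size times the product of all maximal degrees to the power
  \<open>- \<eta>\<close>. Restricting to the functions whose degree at \<open>I\<close> is below
  \<open>\<theta>\<close> times the maximum divides that maximum by at least
  \<open>1 / \<theta>\<close>, so by optimality they make up at most the fraction
  \<open>\<theta> powr \<eta>\<close>. Comparing the optimum with \<open>G\<close> bounds the loss
  of size.\<close>

lemma few_low_degrees:
  fixes G :: "('i \<Rightarrow> 'b) set" and U \<eta> \<theta> :: real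
  assumes G: "finite G" "G \<noteq> {}" and \<I>: "finite \<I>" and \<eta>: "\<eta> > 0" and \<theta>: "0 < \<theta>" "\<theta> < 1"
    and U: "\<And>I. I \<in> \<I> \<Longrightarrow> real (max_degree G I) \<le> U" "U \<ge> 1"
  obtains G' where "G' \<subseteq> G" "G' \<noteq> {}" "card G * U powr (- \<eta> * card \<I>) \<le> card G'"
    "\<And>I. I \<in> \<I> \<Longrightarrow> card {f \<in> G'. degree_on G' I f < \<theta> * max_degree G' I} \<le> \<theta> powr \<eta> * card G'"
proof -
  define \<Phi> where "\<Phi> G' = real (card G') * (\<Prod>I\<in>\<I>. real (max_degree G' I) powr (- \<eta>))" for G' :: "('i \<Rightarrow> 'b) set"
  define P where "P = {G'. G' \<subseteq> G \<and> G' \<noteq> {}}"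
  have finP: "finite P" using G by (auto simp: P_def)
  have "\<exists>G'\<in>P. \<forall>G''\<in>P. \<Phi> G'' \<le> \<Phi> G'"
  proof -
    have "finite (\<Phi> ` P)" "\<Phi> ` P \<noteq> {}" using G finP by (auto simp: P_def)
    then have "Max (\<Phi> ` P) \<in> \<Phi> ` P" by (rule Max_in)
    then obtain G' where "G' \<in> P" "\<Phi> G' = Max (\<Phi> ` P)" by auto
    then show ?thesis using \<open>finite (\<Phi> ` P)\<close> by (intro bexI[of _ G']) auto
  qed
  then obtain G' where G': "G' \<in> P" and max: "\<And>G''. G'' \<in> P \<Longrightarrow> \<Phi> G'' \<le> \<Phi> G'" by auto
  have G'G: "G' \<subseteq> G" "G' \<noteq> {}" using G' by (auto simp: P_def)
  have finG': "finite G'" using G G'G finite_subset by blast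
  define Q where "Q = (\<Prod>I\<in>\<I>. real (max_degree G' I) powr (- \<eta>))"
  have md: "real (max_degree G' I) \<ge> 1" for I
    using max_degree_pos[OF finG' G'G(2), of I] by linarith
  have Qpos: "Q > 0" unfolding Q_def
  proof (intro prod_pos ballI)
    fix I show "real (max_degree G' I) powr (- \<eta>) > 0" using md[of I] by simp
  qed
  have Q1: "Q \<le> 1" unfolding Q_def
  proof (intro prod_le_1 conjI)
    fix I
    have "real (max_degree G' I) powr (- \<eta>) \<le> real (max_degree G' I) powr 0"
      using md[of I] \<eta> by (intro powr_mono) auto
    then show "real (max_degree G' I) powr (- \<eta>) \<le> 1" using md[of I] by simp
  qed simp
  show ?thesis
  proof
    show "G' \<subseteq> G" "G' \<noteq> {}" by fact+
    have "(\<Prod>I\<in>\<I>. U powr (- \<eta>)) \<le> (\<Prod>I\<in>\<I>. real (max_degree G I) powr (- \<eta>))"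
    proof (intro prod_mono conjI)
      fix I assume "I \<in> \<I>"
      show "U powr (- \<eta>) \<le> real (max_degree G I) powr (- \<eta>)"
        using U(1)[OF \<open>I \<in> \<I>\<close>] max_degree_pos[OF G, of I] \<eta> by (intro powr_mono2') auto
    qed simp
    then have "card G * (\<Prod>I\<in>\<I>. U powr (- \<eta>)) \<le> \<Phi> G" unfolding \<Phi>_def by (intro mult_left_mono) auto
    also have "\<dots> \<le> \<Phi> G'" using G by (intro max) (auto simp: P_def)
    also have "\<dots> \<le> real (card G') * 1" unfolding \<Phi>_def Q_def[symmetric] using Q1 by (intro mult_left_mono) auto
    finally have "card G * (\<Prod>I\<in>\<I>. U powr (- \<eta>)) \<le> card G' * 1" by simp
    then show "card G * U powr (- \<eta> * card \<I>) \<le> card G'"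
    proof -
      have "(U powr (- \<eta>)) ^ card \<I> = U powr (- \<eta> * card \<I>)"
        using U(2) by (simp add: powr_realpow[symmetric] powr_powr)
      then show ?thesis using \<open>card G * (\<Prod>I\<in>\<I>. U powr (- \<eta>)) \<le> card G' * 1\<close> by simp
    qed
  next
    fix I assume I: "I \<in> \<I>"
    define B where "B = {f \<in> G'. degree_on G' I f < \<theta> * max_degree G' I}"
    show "card B \<le> \<theta> powr \<eta> * card G'"
    proof (cases "B = {}")
      case False
      have BG: "B \<subseteq> G'" by (auto simp: B_def)
      have finB: "finite B" using BG finG' finite_subset by blast
      have mdB: "real (max_degree B J) \<ge> 1" for J
        using max_degree_pos[OF finB False, of J] by linarith
      have le: "max_degree B J \<le> max_degree G' J" for J
      proof (intro max_degree_le finB False)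
        fix f assume "f \<in> B"
        then show "degree_on B J f \<le> max_degree G' J"
          using degree_on_mono[OF finG' BG, of J f] degree_on_le_max[OF finG', of f J] BG by fastforce
      qed
      have leI: "real (max_degree B I) \<le> \<theta> * max_degree G' I"
      proof -
        have "max_degree B I \<in> degree_on B I ` B" unfolding max_degree_def using finB False by (intro Max_in) auto
        then obtain f where f: "f \<in> B" "max_degree B I = degree_on B I f" by auto
        have "real (degree_on B I f) \<le> degree_on G' I f" using degree_on_mono[OF finG' BG] by simp
        also have "\<dots> \<le> \<theta> * max_degree G' I" using f by (auto simp: B_def)
        finally show ?thesis using f by simp
      qed
      have "\<theta> powr (- \<eta>) * Q \<le> (\<Prod>J\<in>\<I>. real (max_degree B J) powr (- \<eta>))"
      proof -
        have "\<theta> powr (- \<eta>) * Q = (\<theta> * max_degree G' I) powr (- \<eta>) * (\<Prod>J\<in>\<I> - {I}. real (max_degree G' J) powr (- \<eta>))"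
          unfolding Q_def prod.remove[OF \<I> I] using \<theta> by (simp add: powr_mult)
        also have "\<dots> \<le> real (max_degree B I) powr (- \<eta>) * (\<Prod>J\<in>\<I> - {I}. real (max_degree B J) powr (- \<eta>))"
        proof (intro mult_mono prod_mono conjI prod_nonneg)
          show "(\<theta> * max_degree G' I) powr (- \<eta>) \<le> real (max_degree B I) powr (- \<eta>)"
            using leI mdB[of I] \<eta> by (intro powr_mono2') auto
          fix J show "real (max_degree G' J) powr (- \<eta>) \<le> real (max_degree B J) powr (- \<eta>)"
            using le[of J] mdB[of J] \<eta> by (intro powr_mono2') auto
        qed auto
        finally show ?thesis unfolding prod.remove[OF \<I> I] .
      qed
      then have "card B * (\<theta> powr (- \<eta>) * Q) \<le> \<Phi> B" unfolding \<Phi>_def by (intro mult_left_mono) auto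
      also have "\<dots> \<le> \<Phi> G'" using BG G'G False by (intro max) (auto simp: P_def)
      also have "\<dots> = card G' * Q" by (simp add: \<Phi>_def Q_def)
      finally have "card B * \<theta> powr (- \<eta>) \<le> card G'" using Qpos by simp
      then have "\<theta> powr \<eta> * (card B * \<theta> powr (- \<eta>)) \<le> \<theta> powr \<eta> * card G'" by (intro mult_left_mono) auto
      moreover have "\<theta> powr \<eta> * (card B * \<theta> powr (- \<eta>)) = card B"
        using \<theta> by (simp add: powr_minus field_simps)
      ultimately show ?thesis by simp
    qed simp
  qed
qed

text \<open>Deleting functions of low degree can lower other degrees, so two extremal choices are
  combined. \<open>few_low_degrees\<close> makes the average degree comparable to the maximum for
  every \<open>I\<close>, even after the bad functions are removed;
  \<open>min_degree_subfamily\<close> then turns averages into minima. Upper bounds survive passing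
  to subfamilies.\<close>

lemma regular_subfamily:
  fixes G :: "('i \<Rightarrow> 'b) set" and U \<eta> \<theta> :: real
  assumes G: "finite G" "G \<noteq> {}" and \<I>: "finite \<I>" "\<I> \<noteq> {}" and \<eta>: "\<eta> > 0" and \<theta>: "0 < \<theta>" "\<theta> < 1"
    and \<theta>\<eta>: "card \<I> * \<theta> powr \<eta> \<le> 1 / 2"
    and U: "\<And>I. I \<in> \<I> \<Longrightarrow> real (max_degree G I) \<le> U" "U \<ge> 1"
  obtains G' and \<Delta> :: "'i set \<Rightarrow> real" where "G' \<subseteq> G" "G' \<noteq> {}" "card G * U powr (- \<eta> * card \<I>) / 4 \<le> card G'"
    "\<And>I f. I \<in> \<I> \<Longrightarrow> f \<in> G' \<Longrightarrow> \<theta> / (4 * card \<I>) * \<Delta> I \<le> degree_on G' I f \<and> degree_on G' I f \<le> \<Delta> I"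
    "\<And>I. 0 < \<Delta> I"
proof -
  obtain G0 where G0: "G0 \<subseteq> G" "G0 \<noteq> {}" "card G * U powr (- \<eta> * card \<I>) \<le> card G0"
    "\<And>I. I \<in> \<I> \<Longrightarrow> card {f \<in> G0. degree_on G0 I f < \<theta> * max_degree G0 I} \<le> \<theta> powr \<eta> * card G0"
    by (rule few_low_degrees[OF G \<I>(1) \<eta> \<theta> U]) (assumption | rule that)+
  have finG0: "finite G0" using G G0 finite_subset by blast
  define N where "N = real (card \<I>)"
  have N: "N \<ge> 1" using \<I> by (simp add: N_def card_gt_0_iff Suc_leI)
  define \<Delta> where "\<Delta> I = real (max_degree G0 I)" for I
  have \<Delta>: "\<Delta> I \<ge> 1" for I using max_degree_pos[OF finG0 G0(2), of I] unfolding \<Delta>_def by linarith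
  define B where "B = (\<Union>I\<in>\<I>. {f \<in> G0. degree_on G0 I f < \<theta> * max_degree G0 I})"
  define G1 where "G1 = G0 - B"
  have "real (card B) \<le> (\<Sum>I\<in>\<I>. real (card {f \<in> G0. degree_on G0 I f < \<theta> * max_degree G0 I}))"
    unfolding B_def of_nat_sum[symmetric] using \<I> by (intro of_nat_mono card_UN_le)
  also have "\<dots> \<le> (\<Sum>I\<in>\<I>. \<theta> powr \<eta> * card G0)" by (intro sum_mono G0(4))
  also have "\<dots> \<le> 1 / 2 * card G0"
    using mult_right_mono[OF \<theta>\<eta>, of "real (card G0)"] by simp
  finally have cardB: "real (card B) \<le> card G0 / 2" by simp
  have finB: "finite B" "B \<subseteq> G0" using finG0 \<I> by (auto simp: B_def)
  have "card G1 = card G0 - card B" unfolding G1_def by (rule card_Diff_subset[OF finB])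
  then have cardG1: "real (card G0) \<le> 2 * card G1" using cardB card_mono[OF finG0 finB(2)] by linarith
  have finG1: "finite G1" using finG0 by (simp add: G1_def)
  have "card G0 > 0" using finG0 G0 by (simp add: card_gt_0_iff)
  then have G1pos: "card G1 > 0" using cardG1 by linarith
  \<comment> \<open>The average degree divided by \<open>2 * N\<close>; the weighted shadows then
    sum to half of \<open>card G1\<close>, so at least half of \<open>G1\<close> survives.\<close>
  define c where "c I = card G1 / (2 * N * card (shadow G1 I))" for I
  have shpos: "card (shadow G1 I) > 0" for I
    using G1pos finite_shadow[OF finG1, of I] by (auto simp: card_gt_0_iff shadow_def)
  obtain G2 where G2: "G2 \<subseteq> G1" "\<And>I f. I \<in> \<I> \<Longrightarrow> f \<in> G2 \<Longrightarrow> c I \<le> degree_on G2 I f"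
    "real (card G1) - (\<Sum>I\<in>\<I>. c I * card (shadow G1 I)) \<le> card G2"
  proof (rule min_degree_subfamily[OF finG1 \<I>(1), of c])
    show "0 \<le> c I" for I using N by (simp add: c_def)
  qed (rule that)
  have "c I * card (shadow G1 I) = card G1 / (2 * N)" for I
    using shpos[of I] N by (simp add: c_def field_simps)
  then have "(\<Sum>I\<in>\<I>. c I * card (shadow G1 I)) = card G1 / 2" using N by (simp add: N_def)
  then have cardG2: "real (card G1) \<le> 2 * card G2" using G2(3) by linarith
  \<comment> \<open>Each class of \<open>G1\<close> comes from a class of \<open>G0\<close> of size
    at least \<open>\<theta> * \<Delta> I\<close>, and these are disjoint. Hence the shadow of
    \<open>G1\<close> has at most \<open>card G0 / (\<theta> * \<Delta> I)\<close> elements and the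
    average degree is large.\<close>
  have clow: "\<theta> / (4 * N) * \<Delta> I \<le> c I" if I: "I \<in> \<I>" for I
  proof -
    have "card (shadow G1 I) * (\<theta> * \<Delta> I) = (\<Sum>s\<in>shadow G1 I. \<theta> * \<Delta> I)" by simp
    also have "\<dots> \<le> (\<Sum>s\<in>shadow G1 I. real (degree_on G0 I s))"
    proof (intro sum_mono)
      fix s assume "s \<in> shadow G1 I"
      then obtain f where f: "f \<in> G0" "f \<notin> B" "s = restrict f I" by (auto simp: shadow_def G1_def)
      then show "\<theta> * \<Delta> I \<le> real (degree_on G0 I s)" using I by (auto simp: B_def \<Delta>_def)
    qed
    also have "\<dots> \<le> (\<Sum>s\<in>shadow G0 I. real (degree_on G0 I s))"
      using finG0 by (intro sum_mono2 finite_shadow shadow_mono) (auto simp: G1_def)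
    also have "\<dots> = card G0" unfolding of_nat_sum[symmetric] using card_eq_sum_shadow[OF finG0] by simp
    also have "\<dots> \<le> 2 * card G1" by fact
    finally have "card (shadow G1 I) * (\<theta> * \<Delta> I) \<le> 2 * card G1" .
    then have "\<theta> * \<Delta> I \<le> 2 * card G1 / card (shadow G1 I)" using shpos[of I] by (simp add: field_simps)
    then have "\<theta> * \<Delta> I / (4 * N) \<le> 2 * card G1 / card (shadow G1 I) / (4 * N)"
      using N by (intro divide_right_mono) auto
    also have "\<dots> = c I" using N shpos[of I] by (simp add: c_def field_simps)
    finally show ?thesis by simp
  qed
  show ?thesis
  proof
    show "G2 \<subseteq> G" using G2 G0 by (auto simp: G1_def)
    show "G2 \<noteq> {}" using cardG2 G1pos by auto
    show "card G * U powr (- \<eta> * card \<I>) / 4 \<le> card G2" using G0(3) cardG1 cardG2 by linarith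
    show "0 < \<Delta> I" for I using \<Delta>[of I] by simp
    fix I f assume I: "I \<in> \<I>" and f: "f \<in> G2"
    have "degree_on G2 I f \<le> degree_on G0 I f"
      using G2 by (intro degree_on_mono finG0) (auto simp: G1_def)
    also have "\<dots> \<le> max_degree G0 I" using f G2 finG0 by (intro degree_on_le_max) (auto simp: G1_def)
    finally have "real (degree_on G2 I f) \<le> \<Delta> I" by (simp add: \<Delta>_def)
    then show "\<theta> / (4 * card \<I>) * \<Delta> I \<le> degree_on G2 I f \<and> degree_on G2 I f \<le> \<Delta> I"
      using G2(2)[OF I f] clow[OF I] by (simp add: N_def)
  qed
qed

text \<open>With \<open>\<theta>\<close> a small negative power of \<open>n\<close> and \<open>\<eta>\<close> a small constant, all the losses of the
  regularisation are absorbed in \<open>n powr \<delta>\<close>.\<close>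

lemma eventually_regular_subfamily:
  fixes \<delta> :: real and r :: nat
  assumes "\<delta> > 0"
  shows "\<forall>\<^sub>F n in sequentially. \<forall>G. G \<subseteq> ({..<r} \<rightarrow>\<^sub>E {..<n}) \<and> G \<noteq> {} \<longrightarrow>
    (\<exists>G' (\<Delta> :: nat set \<Rightarrow> real). G' \<subseteq> G \<and> G' \<noteq> {} \<and> real (card G) \<le> real n powr \<delta> * card G' \<and>
       (\<forall>I. 0 < \<Delta> I) \<and>
       (\<forall>I\<subseteq>{..<r}. \<forall>f\<in>G'. \<Delta> I \<le> real n powr \<delta> * degree_on G' I f \<and> degree_on G' I f \<le> \<Delta> I))"
proof -
  define N where "N = (2::real) ^ r"
  \<comment> \<open>With maximal degrees at most \<open>n ^ r\<close>, this keeps the loss of size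
    within \<open>n powr (\<delta> / 2)\<close>; the other half of \<open>\<delta>\<close> pays for
    the constants.\<close>
  define \<eta> where "\<eta> = \<delta> / (2 * (real r + 1) * N)"
  have N: "N \<ge> 1" by (simp add: N_def)
  have \<eta>: "\<eta> > 0" using assms N by (simp add: \<eta>_def)
  have "\<forall>\<^sub>F n in sequentially. N * (real n powr (- \<delta> / 2)) powr \<eta> \<le> 1 / 2"
    using assms \<eta> N by real_asymp
  moreover have "\<forall>\<^sub>F n in sequentially. 4 * N * real n powr (\<delta> / 2) \<le> real n powr \<delta>"
    using assms N by real_asymp
  moreover have "\<forall>\<^sub>F n in sequentially. 4 * real n powr (\<delta> / 2) \<le> real n powr \<delta>"
    using assms by real_asymp
  ultimately show ?thesis using eventually_gt_at_top[of 1]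
  proof eventually_elim
    case (elim n)
    show ?case
    proof (intro allI impI, elim conjE)
      fix G assume G: "G \<subseteq> ({..<r} \<rightarrow>\<^sub>E {..<n})" "G \<noteq> {}"
      have finP: "finite ({..<r} \<rightarrow>\<^sub>E {..<n})" by (intro finite_PiE) auto
      have finG: "finite G" using G(1) finP by (rule finite_subset)
      have cN: "real (card (Pow {..<r})) = N" by (simp add: N_def card_Pow)
      have "card G \<le> n ^ r" using card_mono[OF finP G(1)] by (simp add: card_PiE)
      have md: "real (max_degree G I) \<le> real n ^ r" for I
      proof -
        have "max_degree G I \<le> n ^ r"
        proof (rule max_degree_le[OF finG G(2)])
          fix f assume "f \<in> G"
          have "degree_on G I f \<le> card G" unfolding degree_on_def by (intro card_mono finG matching_subset)
          then show "degree_on G I f \<le> n ^ r" using \<open>card G \<le> n ^ r\<close> by simp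
        qed
        then show ?thesis by (metis of_nat_le_iff of_nat_power)
      qed
      have \<theta>: "0 < real n powr (- \<delta> / 2)" "real n powr (- \<delta> / 2) < 1"
      proof -
        have "real n powr (- \<delta> / 2) < real n powr 0" using elim assms by (intro powr_less_mono) auto
        then show "real n powr (- \<delta> / 2) < 1" "0 < real n powr (- \<delta> / 2)" using elim by auto
      qed
      obtain G' and \<Delta> :: "nat set \<Rightarrow> real" where G': "G' \<subseteq> G" "G' \<noteq> {}" "card G * (real n ^ r) powr (- \<eta> * N) / 4 \<le> card G'"
        "\<And>I f. I \<in> Pow {..<r} \<Longrightarrow> f \<in> G' \<Longrightarrow> real n powr (- \<delta> / 2) / (4 * N) * \<Delta> I \<le> degree_on G' I f \<and> degree_on G' I f \<le> \<Delta> I"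
        "\<And>I. 0 < \<Delta> I"
      proof (rule regular_subfamily[OF finG G(2), of "Pow {..<r}" \<eta> "real n powr (- \<delta> / 2)" "real n ^ r"])
        show "card (Pow {..<r}) * (real n powr (- \<delta> / 2)) powr \<eta> \<le> 1 / 2" using elim(1) cN by simp
        show "1 \<le> real n ^ r" using elim by simp
      qed (use \<eta> md \<theta> cN in \<open>auto intro: that\<close>)
      have "real n powr (- \<delta> / 2) \<le> (real n ^ r) powr (- \<eta> * N)"
      proof -
        have "(real n ^ r) powr (- \<eta> * N) = real n powr (- (real r * \<eta> * N))"
          using elim by (simp add: powr_powr powr_realpow[symmetric] mult.assoc)
        moreover have "real r * \<eta> * N \<le> \<delta> / 2"
        proof -
          have "real r * \<eta> * N = \<delta> / 2 * (real r / (real r + 1))" using N by (simp add: \<eta>_def divide_simps)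
          also have "\<dots> \<le> \<delta> / 2 * 1" using assms by (intro mult_left_mono) auto
          finally show ?thesis by simp
        qed
        ultimately show ?thesis using elim by (simp add: powr_mono)
      qed
      then have "card G * real n powr (- \<delta> / 2) \<le> card G * (real n ^ r) powr (- \<eta> * N)"
        by (intro mult_left_mono) auto
      also have "\<dots> \<le> 4 * card G'" using G'(3) by simp
      finally have "card G * real n powr (- \<delta> / 2) \<le> 4 * card G'" .
      then have "real n powr (\<delta> / 2) * (card G * real n powr (- \<delta> / 2)) \<le> real n powr (\<delta> / 2) * (4 * card G')"
        by (intro mult_left_mono) auto
      then have "real (card G) \<le> 4 * real n powr (\<delta> / 2) * card G'"
        using elim by (simp add: powr_minus field_simps)
      also have "\<dots> \<le> real n powr \<delta> * card G'" using elim(3) by (intro mult_right_mono) auto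
      finally have c1: "real (card G) \<le> real n powr \<delta> * card G'" .
      have "\<Delta> I \<le> real n powr \<delta> * degree_on G' I f" if "I \<subseteq> {..<r}" "f \<in> G'" for I f
      proof -
        have "real n powr (- \<delta> / 2) / (4 * N) * \<Delta> I \<le> degree_on G' I f" using G'(4)[of I f] that by simp
        then have "(4 * N * real n powr (\<delta> / 2)) * (real n powr (- \<delta> / 2) / (4 * N) * \<Delta> I) \<le> (4 * N * real n powr (\<delta> / 2)) * degree_on G' I f"
          using N by (intro mult_left_mono) auto
        then have "\<Delta> I \<le> (4 * N * real n powr (\<delta> / 2)) * degree_on G' I f"
          using elim N by (simp add: powr_minus field_simps)
        also have "\<dots> \<le> real n powr \<delta> * degree_on G' I f" using elim(2) by (intro mult_right_mono) auto
        finally show ?thesis .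
      qed
      then show "\<exists>G' (\<Delta> :: nat set \<Rightarrow> real). G' \<subseteq> G \<and> G' \<noteq> {} \<and> real (card G) \<le> real n powr \<delta> * card G' \<and>
       (\<forall>I. 0 < \<Delta> I) \<and>
       (\<forall>I\<subseteq>{..<r}. \<forall>f\<in>G'. \<Delta> I \<le> real n powr \<delta> * degree_on G' I f \<and> degree_on G' I f \<le> \<Delta> I)"
        using G' c1 by (intro exI[of _ G'] exI[of _ \<Delta>]) auto
    qed
  qed
qed

section \<open>Linear cycles in regular families\<close>

definition seqs :: "(nat \<Rightarrow> 'a list \<Rightarrow> 'a set) \<Rightarrow> nat \<Rightarrow> 'a list set" where
  "seqs X m = {es. length es = m \<and> (\<forall>a<m. es ! a \<in> X a (take a es))}"

lemma seqs_0: "seqs X 0 = {[]}"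
  by (auto simp: seqs_def)

lemma seqs_Suc: "seqs X (Suc m) = (\<Union>es\<in>seqs X m. (\<lambda>x. es @ [x]) ` X m es)"
proof (intro equalityI subsetI)
  fix fs assume "fs \<in> seqs X (Suc m)"
  then have fs: "length fs = Suc m" "\<And>a. a < Suc m \<Longrightarrow> fs ! a \<in> X a (take a fs)" by (auto simp: seqs_def)
  have "take m fs \<in> seqs X m" using fs by (auto simp: seqs_def min_def)
  moreover have "fs = take m fs @ [fs ! m]" using fs(1) by (metis lessI take_Suc_conv_app_nth take_all_iff order_refl)
  moreover have "fs ! m \<in> X m (take m fs)" using fs by auto
  ultimately show "fs \<in> (\<Union>es\<in>seqs X m. (\<lambda>x. es @ [x]) ` X m es)" by blast
next
  fix fs assume "fs \<in> (\<Union>es\<in>seqs X m. (\<lambda>x. es @ [x]) ` X m es)"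
  then obtain es x where "es \<in> seqs X m" "fs = es @ [x]" "x \<in> X m es" by auto
  then show "fs \<in> seqs X (Suc m)" by (auto simp: seqs_def nth_append less_Suc_eq)
qed

lemma finite_seqs: "(\<And>a es. a < m \<Longrightarrow> es \<in> seqs X a \<Longrightarrow> finite (X a es)) \<Longrightarrow> finite (seqs X m)"
  by (induction m) (auto simp: seqs_0 seqs_Suc)

lemma card_seqs_ge:
  fixes b :: "nat \<Rightarrow> real"
  assumes "\<And>a es. a < m \<Longrightarrow> es \<in> seqs X a \<Longrightarrow> finite (X a es) \<and> b a \<le> card (X a es)" "\<And>a. b a \<ge> 0"
  shows "(\<Prod>a<m. b a) \<le> card (seqs X m)"
  using assms(1)
proof (induction m)
  case (Suc m)
  have fin: "finite (seqs X m)" using Suc.prems by (intro finite_seqs) auto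
  have "card (seqs X (Suc m)) = (\<Sum>es\<in>seqs X m. card ((\<lambda>x. es @ [x]) ` X m es))"
    unfolding seqs_Suc using fin Suc.prems by (intro card_UN_disjoint) auto
  also have "\<dots> = (\<Sum>es\<in>seqs X m. card (X m es))"
    by (intro sum.cong refl card_image) (auto simp: inj_on_def)
  finally have "real (card (seqs X (Suc m))) = (\<Sum>es\<in>seqs X m. real (card (X m es)))" by simp
  also have "\<dots> \<ge> (\<Sum>es\<in>seqs X m. b m)" using Suc.prems by (intro sum_mono) auto
  also have "(\<Sum>es\<in>seqs X m. b m) = card (seqs X m) * b m" by simp
  also have "(\<Prod>a<m. b a) * b m \<le> card (seqs X m) * b m"
    using Suc assms(2) by (intro mult_right_mono) auto
  finally show ?case by simp
qed (simp add: seqs_0)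

lemma card_seqs_le:
  fixes B :: "nat \<Rightarrow> real"
  assumes "\<And>a es. a < m \<Longrightarrow> es \<in> seqs X a \<Longrightarrow> finite (X a es) \<and> card (X a es) \<le> B a" "\<And>a. B a \<ge> 0"
  shows "card {es \<in> seqs X m. \<forall>a\<in>A. a < m \<longrightarrow> es ! a = w a} \<le> (\<Prod>a\<in>{..<m} - A. B a)"
  using assms(1)
proof (induction m)
  case 0
  then show ?case by (simp add: seqs_0 card_gt_0_iff Collect_conv_if)
next
  case (Suc m)
  define S where "S m = {es \<in> seqs X m. \<forall>a\<in>A. a < m \<longrightarrow> es ! a = w a}" for m
  have fin: "finite (S m)" using Suc.prems finite_seqs[of m X] by (auto simp: S_def)
  define Y where "Y es = (if m \<in> A then X m es \<inter> {w m} else X m es)" for es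
  have len: "length es = m" if "es \<in> seqs X m" for es using that by (simp add: seqs_def)
  have "S (Suc m) \<subseteq> (\<Union>es\<in>S m. (\<lambda>x. es @ [x]) ` Y es)"
  proof
    fix fs assume fs: "fs \<in> S (Suc m)"
    then obtain es x where e: "es \<in> seqs X m" "fs = es @ [x]" "x \<in> X m es" by (auto simp: S_def seqs_Suc)
    have "es ! a = w a" if "a \<in> A" "a < m" for a
      using fs that e len[OF e(1)] by (auto simp: S_def nth_append dest!: bspec[of _ _ a])
    moreover have "x = w m" if "m \<in> A"
      using fs that e len[OF e(1)] by (auto simp: S_def nth_append dest!: bspec[of _ _ m])
    ultimately show "fs \<in> (\<Union>es\<in>S m. (\<lambda>x. es @ [x]) ` Y es)" using e by (auto simp: S_def Y_def)
  qed
  moreover have finY: "finite (Y es)" if "es \<in> S m" for es using Suc.prems that by (auto simp: Y_def S_def)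
  ultimately have "card (S (Suc m)) \<le> card (\<Union>es\<in>S m. (\<lambda>x. es @ [x]) ` Y es)"
    using fin by (intro card_mono) auto
  also have "\<dots> \<le> (\<Sum>es\<in>S m. card ((\<lambda>x. es @ [x]) ` Y es))" using fin by (rule card_UN_le)
  also have "\<dots> \<le> (\<Sum>es\<in>S m. card (Y es))" using finY by (intro sum_mono card_image_le)
  finally have "real (card (S (Suc m))) \<le> (\<Sum>es\<in>S m. real (card (Y es)))" by (metis of_nat_le_iff of_nat_sum)
  also have "\<dots> \<le> (\<Sum>es\<in>S m. if m \<in> A then 1 else B m)"
  proof (intro sum_mono)
    fix es assume es: "es \<in> S m"
    have "card (X m es \<inter> {w m}) \<le> 1" by (metis Int_lower2 card_mono finite.emptyI finite.insertI is_singletonI is_singleton_altdef)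
    then show "real (card (Y es)) \<le> (if m \<in> A then 1 else B m)" using Suc.prems es by (auto simp: Y_def S_def)
  qed
  also have "\<dots> = card (S m) * (if m \<in> A then 1 else B m)" by simp
  also have "\<dots> \<le> (\<Prod>a\<in>{..<m} - A. B a) * (if m \<in> A then 1 else B m)"
    using Suc assms(2) by (intro mult_right_mono) (auto simp: S_def)
  also have "\<dots> = (\<Prod>a\<in>{..<Suc m} - A. B a)"
  proof (cases "m \<in> A")
    case True
    then have "{..<Suc m} - A = {..<m} - A" by (auto simp: less_Suc_eq)
    then show ?thesis using True by simp
  next
    case False
    then have "{..<Suc m} - A = insert m ({..<m} - A)" by (auto simp: less_Suc_eq)
    then show ?thesis using False by simp
  qed
  finally show ?case by (simp add: S_def)
qed

text \<open>Two families are carried along: \<open>G\<close> has large codegrees, so that single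
  coordinates can be changed inside it, while \<open>G'\<close> is regular and drives the counting;
  regularising may destroy the codegrees. The bound \<open>(2 * l + 1) * (r + 1)\<close> counts
  \<open>2 * l + 1\<close> core vertices and \<open>r\<close> vertices for each of
  \<open>2 * l + 1\<close> edges.\<close>

locale regular_family =
  fixes r n l :: nat and G G' :: "(nat \<Rightarrow> nat) set" and \<Delta> :: "nat set \<Rightarrow> real" and \<mu> :: real
  assumes r: "r \<ge> 3" and l: "l \<ge> 1" and \<mu>: "\<mu> \<ge> 1"
    and G: "G \<subseteq> {..<r} \<rightarrow>\<^sub>E {..<n}" and inj: "\<And>f. f \<in> G \<Longrightarrow> inj_on f {..<r}"
    and G': "G' \<subseteq> G" "G' \<noteq> {}"
    and mindeg: "\<And>t f. t < r \<Longrightarrow> f \<in> G \<Longrightarrow> (2 * l + 1) * (r + 1) < degree_on G ({..<r} - {t}) f"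
    and \<Delta>pos: "\<And>I. 0 < \<Delta> I"
    and reg: "\<And>I f. I \<subseteq> {..<r} \<Longrightarrow> f \<in> G' \<Longrightarrow> \<Delta> I \<le> \<mu> * degree_on G' I f \<and> degree_on G' I f \<le> \<Delta> I"
begin

lemma finite_G: "finite G"
  using G by (rule finite_subset) (auto intro: finite_PiE)

lemma finite_G': "finite G'"
  using G'(1) finite_G by (rule finite_subset)

section \<open>Extension counts as ratios of degrees\<close>

definition extensions :: "nat set \<Rightarrow> nat \<Rightarrow> (nat \<Rightarrow> nat) \<Rightarrow> nat set" where
  "extensions I c f = (\<lambda>h. h c) ` matching G' I f"

lemma finite_extensions: "finite (extensions I c f)"
  by (simp add: extensions_def finite_matching finite_G')

lemma degree_eq_sum_extensions:
  "degree_on G' I f = (\<Sum>z\<in>extensions I c f. card {h \<in> matching G' I f. h c = z})"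
  unfolding degree_on_def card_eq_sum extensions_def
  using sum.group[of "matching G' I f" "(\<lambda>h. h c) ` matching G' I f" "\<lambda>h. h c" "\<lambda>_. 1::nat"]
  by (simp add: finite_matching finite_G')

lemma extension_class:
  assumes "I \<subseteq> {..<r}" "c < r" "z \<in> extensions I c f"
  shows "\<Delta> (insert c I) \<le> \<mu> * card {h \<in> matching G' I f. h c = z}"
    "card {h \<in> matching G' I f. h c = z} \<le> \<Delta> (insert c I)"
proof -
  from assms(3) obtain h where h: "h \<in> G'" "\<forall>i\<in>I. h i = f i" "h c = z"
    by (auto simp: extensions_def matching_def)
  then have "{h \<in> matching G' I f. h c = z} = matching G' (insert c I) h"
    by (auto simp: matching_def)
  then show "\<Delta> (insert c I) \<le> \<mu> * card {h \<in> matching G' I f. h c = z}"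
    "card {h \<in> matching G' I f. h c = z} \<le> \<Delta> (insert c I)"
    using reg[of "insert c I" h] h(1) assms by (auto simp: degree_on_def)
qed

text \<open>The functions over \<open>I\<close> split by their value at \<open>c\<close> into
  classes of size between \<open>\<Delta> (insert c I) / \<mu>\<close> and
  \<open>\<Delta> (insert c I)\<close>, so the number of extensions is a ratio of degrees up to
  powers of \<open>\<mu>\<close>.\<close>

lemma card_extensions_le:
  assumes "I \<subseteq> {..<r}" "c < r" "f \<in> G'"
  shows "card (extensions I c f) \<le> \<mu> * (\<Delta> I / \<Delta> (insert c I))"
proof -
  have "card (extensions I c f) * \<Delta> (insert c I) = (\<Sum>z\<in>extensions I c f. \<Delta> (insert c I))" by simp
  also have "\<dots> \<le> (\<Sum>z\<in>extensions I c f. \<mu> * card {h \<in> matching G' I f. h c = z})"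
    using extension_class assms by (intro sum_mono) auto
  also have "\<dots> = \<mu> * degree_on G' I f"
    unfolding degree_eq_sum_extensions[of I f c] by (simp add: sum_distrib_left)
  also have "\<dots> \<le> \<mu> * \<Delta> I" using reg[of I f] assms \<mu> by (intro mult_left_mono) auto
  finally show ?thesis using \<Delta>pos[of "insert c I"] by (simp add: field_simps)
qed

lemma card_extensions_ge:
  assumes "I \<subseteq> {..<r}" "c < r" "f \<in> G'"
  shows "\<Delta> I / \<Delta> (insert c I) \<le> \<mu> * card (extensions I c f)"
proof -
  have "\<Delta> I \<le> \<mu> * degree_on G' I f" using reg[of I f] assms by auto
  also have "\<dots> = \<mu> * (\<Sum>z\<in>extensions I c f. real (card {h \<in> matching G' I f. h c = z}))"
    unfolding degree_eq_sum_extensions[of I f c] by simp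
  also have "\<dots> \<le> \<mu> * (\<Sum>z\<in>extensions I c f. \<Delta> (insert c I))"
    using extension_class assms \<mu> by (intro mult_left_mono sum_mono) auto
  also have "\<dots> = \<mu> * card (extensions I c f) * \<Delta> (insert c I)" by simp
  finally show ?thesis using \<Delta>pos[of "insert c I"] by (simp add: field_simps)
qed

lemma card_le_shadow:
  assumes "I \<subseteq> {..<r}"
  shows "card G' \<le> real n ^ card I * \<Delta> I"
proof -
  have "card (shadow G' I) \<le> card (I \<rightarrow>\<^sub>E {..<n})"
  proof (intro card_mono finite_PiE)
    show "finite I" using assms finite_subset by blast
    show "shadow G' I \<subseteq> I \<rightarrow>\<^sub>E {..<n}" using G G'(1) assms by (fastforce simp: shadow_def)
  qed auto
  also have "\<dots> = n ^ card I" using assms finite_subset by (subst card_PiE) auto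
  finally have c: "real (card (shadow G' I)) \<le> real n ^ card I" by (metis of_nat_le_iff of_nat_power)
  have "card G' = (\<Sum>s\<in>shadow G' I. real (degree_on G' I s))"
    using card_eq_sum_shadow[OF finite_G'] by (metis of_nat_sum)
  also have "\<dots> \<le> (\<Sum>s\<in>shadow G' I. \<Delta> I)"
  proof (intro sum_mono)
    fix s assume "s \<in> shadow G' I"
    then obtain f where "f \<in> G'" "s = restrict f I" by (auto simp: shadow_def)
    then show "real (degree_on G' I s) \<le> \<Delta> I" using reg[OF assms, of f] by simp
  qed
  also have "\<dots> = card (shadow G' I) * \<Delta> I" by simp
  also have "\<dots> \<le> real n ^ card I * \<Delta> I" using c \<Delta>pos[of I] by (intro mult_right_mono) auto
  finally show ?thesis .
qed

text \<open>A function agreeing with \<open>f\<close> on \<open>I\<close> is determined by its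
  values outside \<open>I\<close>, and each of these is an extension.\<close>

lemma degree_le_prod_extensions:
  assumes "I \<subseteq> {..<r}" "f \<in> G'"
  shows "real (degree_on G' I f) \<le> (\<Prod>c\<in>{..<r} - I. real (card (extensions I c f)))"
proof -
  have "inj_on (\<lambda>h. restrict h ({..<r} - I)) (matching G' I f)"
  proof (rule inj_onI)
    fix g h assume g: "g \<in> matching G' I f" and h: "h \<in> matching G' I f"
      and eq: "restrict g ({..<r} - I) = restrict h ({..<r} - I)"
    show "g = h"
    proof (rule PiE_ext)
      show "g \<in> {..<r} \<rightarrow>\<^sub>E {..<n}" "h \<in> {..<r} \<rightarrow>\<^sub>E {..<n}" using g h G G' by (auto simp: matching_def)
      fix x assume "x \<in> {..<r}"
      then show "g x = h x" using g h eq unfolding restrict_eq_iff by (cases "x \<in> I") (auto simp: matching_def)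
    qed
  qed
  then have "degree_on G' I f = card ((\<lambda>h. restrict h ({..<r} - I)) ` matching G' I f)"
    by (simp add: degree_on_def card_image)
  also have "\<dots> \<le> card (\<Pi>\<^sub>E c\<in>{..<r} - I. extensions I c f)"
  proof (intro card_mono finite_PiE image_subsetI)
    fix h assume "h \<in> matching G' I f"
    then show "restrict h ({..<r} - I) \<in> (\<Pi>\<^sub>E c\<in>{..<r} - I. extensions I c f)"
      unfolding restrict_PiE_iff by (auto simp: extensions_def)
  qed (use finite_extensions in auto)
  also have "\<dots> = (\<Prod>c\<in>{..<r} - I. card (extensions I c f))" by (simp add: card_PiE)
  finally show ?thesis by (metis of_nat_le_iff of_nat_prod)
qed

text \<open>The pair of positions is chosen with the smallest maximal degree, so that the third position
  \<open>k\<close> is the one with the fewest extensions among \<open>i\<close>, \<open>j\<close>, \<open>k\<close>; all three extension counts are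
  then at least that of \<open>k\<close>.\<close>

lemma choose_positions:
  obtains i j k where "i < r" "j < r" "k < r" "i \<noteq> j" "k \<noteq> i" "k \<noteq> j"
    "\<And>a b. a < r \<Longrightarrow> b < r \<Longrightarrow> a \<noteq> b \<Longrightarrow> \<Delta> {i, j} \<le> \<Delta> {a, b}"
    "\<Delta> {i, j} / \<mu> \<le> (\<mu> * (\<Delta> {i, j} / \<Delta> {i, j, k})) ^ (r - 2)"
proof -
  define P where "P = {(a, b). a < r \<and> b < r \<and> a \<noteq> b}"
  have "P \<subseteq> {..<r} \<times> {..<r}" by (auto simp: P_def)
  then have finP: "finite P" by (rule finite_subset) auto
  have "(0, 1) \<in> P" using r by (auto simp: P_def)
  then have "Min ((\<lambda>(a, b). \<Delta> {a, b}) ` P) \<in> (\<lambda>(a, b). \<Delta> {a, b}) ` P" using finP by (intro Min_in) auto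
  then obtain i j where ij: "(i, j) \<in> P" "\<Delta> {i, j} = Min ((\<lambda>(a, b). \<Delta> {a, b}) ` P)" by auto
  have min: "\<Delta> {i, j} \<le> \<Delta> {a, b}" if "(a, b) \<in> P" for a b
    unfolding ij(2) using finP that by (intro Min_le) (auto intro!: rev_image_eqI)
  obtain f where f: "f \<in> G'" using G' by auto
  define S where "S = {..<r} - {i, j}"
  have cardS: "card S = r - 2" using ij by (auto simp: S_def P_def card_Diff_subset)
  have "S \<noteq> {}"
  proof
    assume "S = {}"
    then show False using cardS r by simp
  qed
  \<comment> \<open>\<open>k\<close> maximises the ratio over the pair \<open>{i, j}\<close>. All
    \<open>r - 2\<close> extension counts are at most \<open>M\<close>, so \<open>M\<close> is at
    least the root of order \<open>r - 2\<close> of the pair degree, up to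
    \<open>\<mu>\<close>.\<close>
  define M where "M = Max ((\<lambda>c. \<mu> * (\<Delta> {i, j} / \<Delta> (insert c {i, j}))) ` S)"
  have "M \<in> (\<lambda>c. \<mu> * (\<Delta> {i, j} / \<Delta> (insert c {i, j}))) ` S"
    unfolding M_def using \<open>S \<noteq> {}\<close> by (intro Max_in) (auto simp: S_def)
  then obtain k where k: "k \<in> S" "M = \<mu> * (\<Delta> {i, j} / \<Delta> (insert k {i, j}))" by auto
  have ijr: "{i, j} \<subseteq> {..<r}" using ij by (auto simp: P_def)
  have "\<Delta> {i, j} / \<mu> \<le> degree_on G' {i, j} f" using reg[OF ijr f] \<mu> by (simp add: field_simps)
  also have "\<dots> \<le> (\<Prod>c\<in>S. real (card (extensions {i, j} c f)))"
    unfolding S_def by (rule degree_le_prod_extensions[OF ijr f])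
  also have "\<dots> \<le> (\<Prod>c\<in>S. M)"
  proof (intro prod_mono conjI)
    fix c assume "c \<in> S"
    then have "card (extensions {i, j} c f) \<le> \<mu> * (\<Delta> {i, j} / \<Delta> (insert c {i, j}))"
      using ijr f by (intro card_extensions_le) (auto simp: S_def)
    also have "\<dots> \<le> M" unfolding M_def using \<open>c \<in> S\<close> by (intro Max_ge) (auto simp: S_def)
    finally show "card (extensions {i, j} c f) \<le> M" .
  qed auto
  also have "\<dots> = (\<mu> * (\<Delta> {i, j} / \<Delta> {i, j, k})) ^ (r - 2)"
    by (simp add: cardS k(2) insert_commute)
  finally show ?thesis
  proof (intro that[of i j k])
    fix a b assume "a < r" "b < r" "a \<noteq> b"
    then show "\<Delta> {i, j} \<le> \<Delta> {a, b}" by (intro min) (auto simp: P_def)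
  qed (use ij k in \<open>auto simp: P_def S_def\<close>)
qed

text \<open>Coordinates are repaired one at a time: by \<open>mindeg\<close> the coordinate
  \<open>t\<close> has more possible values than \<open>W\<close> has elements. Good coordinates are
  left alone, which keeps the map bounded-to-one.\<close>

lemma avoid_exists:
  assumes e: "e \<in> G" and W: "finite W" "card W \<le> (2 * l + 1) * (r + 1)" and Q: "Q \<subseteq> {..<r}"
  shows "\<exists>e'\<in>G. (\<forall>t\<in>{..<r} - Q. e' t = e t) \<and> (\<forall>t\<in>Q. e' t \<notin> W \<and> (e t \<notin> W \<longrightarrow> e' t = e t))"
proof -
  have "finite Q" using Q finite_subset by blast
  then show ?thesis using Q
  proof (induction Q rule: finite_induct)
    case empty
    then show ?case using e by auto
  next
    case (insert t Q)
    then obtain e' where e': "e' \<in> G" "\<forall>s\<in>{..<r} - Q. e' s = e s" "\<forall>s\<in>Q. e' s \<notin> W \<and> (e s \<notin> W \<longrightarrow> e' s = e s)"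
      by auto
    show ?case
    proof (cases "e t \<in> W")
      case False
      then show ?thesis using e' insert by (intro bexI[of _ e']) auto
    next
      case True
      let ?M = "matching G ({..<r} - {t}) e'"
      have "inj_on (\<lambda>h. h t) ?M"
      proof (rule inj_onI)
        fix g h assume gh: "g \<in> ?M" "h \<in> ?M" "g t = h t"
        show "g = h"
        proof (rule PiE_ext)
          show "g \<in> {..<r} \<rightarrow>\<^sub>E {..<n}" "h \<in> {..<r} \<rightarrow>\<^sub>E {..<n}" using gh G by (auto simp: matching_def)
          fix x assume "x \<in> {..<r}"
          then show "g x = h x" using gh by (cases "x = t") (auto simp: matching_def)
        qed
      qed
      then have "card ((\<lambda>h. h t) ` ?M) = degree_on G ({..<r} - {t}) e'" by (simp add: card_image degree_on_def)
      also have "\<dots> > (2 * l + 1) * (r + 1)" using mindeg[of t e'] e' insert.prems by auto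
      finally have "card W < card ((\<lambda>h. h t) ` ?M)" using W by simp
      then have "\<not> (\<lambda>h. h t) ` ?M \<subseteq> W" using W(1) card_mono by (metis leD)
      then obtain h where h: "h \<in> ?M" "h t \<notin> W" by auto
      have hs: "h s = e' s" if "s < r" "s \<noteq> t" for s using h that by (auto simp: matching_def)
      have "h s \<notin> W \<and> (e s \<notin> W \<longrightarrow> h s = e s)" if s: "s \<in> insert t Q" for s
      proof (cases "s = t")
        case False
        then have "h s = e' s" "s \<in> Q" using s insert.prems hs by auto
        then show ?thesis using e'(3) by auto
      qed (use h True in auto)
      moreover have "h s = e s" if "s \<in> {..<r} - insert t Q" for s using that hs[of s] e'(2) by auto
      moreover have "h \<in> G" using h by (auto simp: matching_def)
      ultimately show ?thesis by (intro bexI[of _ h]) blast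
    qed
  qed
qed

definition avoid :: "nat set \<Rightarrow> nat set \<Rightarrow> (nat \<Rightarrow> nat) \<Rightarrow> (nat \<Rightarrow> nat)" where
  "avoid W Q e = (SOME e'. e' \<in> G \<and> (\<forall>t\<in>{..<r} - Q. e' t = e t) \<and> (\<forall>t\<in>Q. e' t \<notin> W \<and> (e t \<notin> W \<longrightarrow> e' t = e t)))"

lemma avoid:
  assumes "e \<in> G" "finite W" "card W \<le> (2 * l + 1) * (r + 1)" "Q \<subseteq> {..<r}"
  shows "avoid W Q e \<in> G" "\<And>t. t < r \<Longrightarrow> t \<notin> Q \<Longrightarrow> avoid W Q e t = e t" "\<And>t. t \<in> Q \<Longrightarrow> avoid W Q e t \<notin> W"
    "\<And>t. t \<in> Q \<Longrightarrow> e t \<notin> W \<Longrightarrow> avoid W Q e t = e t"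
  using someI_ex[of "\<lambda>e'. e' \<in> G \<and> (\<forall>t\<in>{..<r} - Q. e' t = e t) \<and> (\<forall>t\<in>Q. e' t \<notin> W \<and> (e t \<notin> W \<longrightarrow> e' t = e t))"]
    avoid_exists[OF assms] unfolding avoid_def[symmetric] by blast+

text \<open>An unmoved coordinate is visible in the image and a moved one came from
  \<open>W\<close>, so each coordinate of a preimage has at most \<open>card W + 1\<close> possible
  values.\<close>

lemma card_avoid_image:
  assumes C: "C \<subseteq> G" and W: "finite W" "card W \<le> (2 * l + 1) * (r + 1)" and Q: "Q \<subseteq> {..<r}"
  shows "card C \<le> ((2 * l + 1) * (r + 1) + 1) ^ r * card (avoid W Q ` C)"
proof -
  have finC: "finite C" using C finite_G finite_subset by blast
  have "card {e \<in> C. avoid W Q e = e'} \<le> ((2 * l + 1) * (r + 1) + 1) ^ r" for e'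
  proof -
    have "{e \<in> C. avoid W Q e = e'} \<subseteq> (\<Pi>\<^sub>E t\<in>{..<r}. insert (e' t) W)"
    proof
      fix e assume "e \<in> {e \<in> C. avoid W Q e = e'}"
      then have e: "e \<in> G" "e' = avoid W Q e" using C by auto
      have "e t \<in> insert (e' t) W" if "t < r" for t
        using avoid(2,4)[OF e(1) W Q, of t] that e(2) by (cases "t \<in> Q") auto
      moreover have "e \<in> extensional {..<r}" using e(1) G by (auto simp: PiE_def)
      ultimately show "e \<in> (\<Pi>\<^sub>E t\<in>{..<r}. insert (e' t) W)" by (auto simp: PiE_def)
    qed
    then have "card {e \<in> C. avoid W Q e = e'} \<le> card (\<Pi>\<^sub>E t\<in>{..<r}. insert (e' t) W)"
      using W(1) by (intro card_mono finite_PiE) auto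
    also have "\<dots> = (\<Prod>t<r. card (insert (e' t) W))" by (simp add: card_PiE)
    also have "\<dots> \<le> (\<Prod>t<r. (2 * l + 1) * (r + 1) + 1)"
      using W by (intro prod_mono conjI) (auto simp: card_insert_if)
    finally show ?thesis by simp
  qed
  moreover have "card C = (\<Sum>e'\<in>avoid W Q ` C. card {e \<in> C. avoid W Q e = e'})"
    unfolding card_eq_sum using sum.group[of C "avoid W Q ` C" "avoid W Q" "\<lambda>_. 1::nat"] finC by simp
  ultimately have "card C \<le> (\<Sum>e'\<in>avoid W Q ` C. ((2 * l + 1) * (r + 1) + 1) ^ r)" by (simp only: sum_mono)
  then show ?thesis by (simp add: mult.commute)
qed

end

section \<open>Recognising linear cycles\<close>

lemma inj_on_cycle_edge:
  fixes m :: nat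
  assumes "m \<ge> 3"
  shows "inj_on (\<lambda>a. {a, (a + 1) mod m}) {..<m}"
proof (rule inj_onI)
  fix a b assume ab: "a \<in> {..<m}" "b \<in> {..<m}" "{a, (a + 1) mod m} = {b, (b + 1) mod m}"
  show "a = b"
  proof (rule ccontr)
    assume "a \<noteq> b"
    then have "a = (b + 1) mod m" "b = (a + 1) mod m" using ab(3) by (auto simp: doubleton_eq_iff)
    then show False using ab(1,2) assms by (auto simp: mod_if split: if_splits)
  qed
qed

lemma snd_linear_cycle:
  "snd (linear_cycle r m) = (\<lambda>a. expand_edge r {a, (a + 1) mod m}) ` {..<m}"
  by (auto simp: linear_cycle_def expansion_def cycle_graph_def)

lemma fst_linear_cycle:
  "fst (linear_cycle r m) = Inl ` {..<m} \<union> (\<Union>a<m. Inr ` ({{a, (a + 1) mod m}} \<times> {..<r - 2}))"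
  by (auto simp: linear_cycle_def expansion_def cycle_graph_def)

lemma Union_linear_cycle: "m \<ge> 1 \<Longrightarrow> \<Union> (snd (linear_cycle r m)) = fst (linear_cycle r m)"
  unfolding snd_linear_cycle fst_linear_cycle by (auto simp: expand_edge_def)

text \<open>The new vertices of each cycle edge go to the \<open>r - 2\<close> private vertices of
  \<open>e a\<close> in any order; injectivity holds because private parts of different edges are
  disjoint.\<close>

lemma linear_cycle_map_exists:
  fixes v :: "nat \<Rightarrow> 'a" and e :: "nat \<Rightarrow> 'a set"
  assumes m: "m \<ge> 3" and v: "inj_on v {..<m}"
    and e: "\<And>a. a < m \<Longrightarrow> finite (e a) \<and> card (e a) = r"
    and ve: "\<And>a. a < m \<Longrightarrow> e a \<inter> v ` {..<m} = {v a, v ((a + 1) mod m)}"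
    and disj: "\<And>a b. a < b \<Longrightarrow> b < m \<Longrightarrow> e a \<inter> e b \<subseteq> v ` {..<m}"
  shows "\<exists>\<phi>. inj_on \<phi> (fst (linear_cycle r m)) \<and> (\<forall>a<m. \<phi> ` expand_edge r {a, (a + 1) mod m} = e a)"
proof -
  define s where "s a = (a + 1) mod m" for a
  have s: "s a < m" "s a \<noteq> a" if "a < m" for a using that m by (auto simp: s_def mod_if)
  have "\<exists>\<beta>. bij_betw \<beta> {..<r - 2} (e a - v ` {..<m})" if a: "a < m" for a
  proof -
    have "v a \<noteq> v (s a)" using inj_onD[OF v, of a "s a"] s[OF a] a by auto
    then have "card {v a, v (s a)} = 2" by simp
    then have "card (e a - v ` {..<m}) = r - 2"
      using e[OF a] ve[OF a] card_Diff_subset_Int[of "e a" "v ` {..<m}"] by (simp add: s_def)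
    then show ?thesis using ex_bij_betw_nat_finite[of "e a - v ` {..<m}"] e[OF a] by (auto simp: atLeast0LessThan)
  qed
  then obtain \<beta> where \<beta>: "\<And>a. a < m \<Longrightarrow> bij_betw (\<beta> a) {..<r - 2} (e a - v ` {..<m})" by metis
  \<comment> \<open>New vertices are labelled by their cycle edge as a set, so its index has to be
    recovered; this is where \<open>m \<ge> 3\<close> enters.\<close>
  define idx where "idx = the_inv_into {..<m} (\<lambda>a. {a, s a})"
  have idx: "idx {a, s a} = a" if "a < m" for a
    unfolding idx_def using inj_on_cycle_edge[OF m] that by (intro the_inv_into_f_f) (auto simp: s_def)
  define \<phi> where "\<phi> x = (case x of Inl a \<Rightarrow> v a | Inr (f, t) \<Rightarrow> \<beta> (idx f) t)" for x
  have \<phi>: "\<phi> (Inl a) = v a" "\<phi> (Inr (f, t)) = \<beta> (idx f) t" for a f t by (auto simp: \<phi>_def)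
  have \<beta>in: "\<beta> a t \<in> e a - v ` {..<m}" if "a < m" "t < r - 2" for a t
    using bij_betwE[OF \<beta>[OF that(1)]] that(2) by auto
  have "inj_on \<phi> (fst (linear_cycle r m))"
  proof (rule inj_onI)
    fix x y assume x: "x \<in> fst (linear_cycle r m)" and y: "y \<in> fst (linear_cycle r m)" and eq: "\<phi> x = \<phi> y"
    have cases: "(\<exists>a<m. z = Inl a) \<or> (\<exists>a<m. \<exists>t<r-2. z = Inr ({a, s a}, t))"
      if "z \<in> fst (linear_cycle r m)" for z using that unfolding fst_linear_cycle by (auto simp: s_def)
    from cases[OF x] cases[OF y] show "x = y"
    proof (elim disjE exE conjE)
      fix a b assume "a < m" "x = Inl a" "b < m" "y = Inl b"
      then show "x = y" using eq v by (auto simp: \<phi> inj_on_def)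
    next
      fix a b t assume "a < m" "x = Inl a" "b < m" "t < r - 2" "y = Inr ({b, s b}, t)"
      then show "x = y" using eq \<beta>in[of b t] imageI[of a "{..<m}" v] by (auto simp: \<phi> idx)
    next
      fix a b t assume "b < m" "y = Inl b" "a < m" "t < r - 2" "x = Inr ({a, s a}, t)"
      then show "x = y" using eq \<beta>in[of a t] imageI[of b "{..<m}" v] by (auto simp: \<phi> idx)
    next
      fix a t b u assume *: "a < m" "t < r - 2" "x = Inr ({a, s a}, t)" "b < m" "u < r - 2" "y = Inr ({b, s b}, u)"
      have eq': "\<beta> a t = \<beta> b u" using eq * by (simp add: \<phi> idx)
      have "a = b"
      proof (rule ccontr)
        assume "a \<noteq> b"
        then have "e a \<inter> e b \<subseteq> v ` {..<m}" using disj[of a b] disj[of b a] * by (cases "a < b") auto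
        then show False using \<beta>in[of a t] \<beta>in[of b u] eq' * by auto
      qed
      then have "t = u" using eq' bij_betw_imp_inj_on[OF \<beta>[of a]] * by (auto simp: inj_on_def)
      then show "x = y" using * \<open>a = b\<close> by simp
    qed
  qed
  moreover have "\<phi> ` expand_edge r {a, s a} = e a" if a: "a < m" for a
  proof -
    have "\<phi> ` expand_edge r {a, s a} = {v a, v (s a)} \<union> \<beta> a ` {..<r - 2}"
      unfolding expand_edge_def image_Un image_image using idx[OF a] by (force simp: \<phi> image_iff)
    also have "\<beta> a ` {..<r - 2} = e a - v ` {..<m}" using \<beta>[OF a] by (simp add: bij_betw_def)
    finally show ?thesis using ve[OF a] by (auto simp: s_def)
  qed
  ultimately show ?thesis by (auto simp: s_def)
qed

text \<open>A copy is recorded as its set of edges: for the containers the ground set consists of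
  \<open>r\<close>-sets and the copies are the hyperedges.\<close>

definition cycle_copies :: "nat \<Rightarrow> nat \<Rightarrow> nat \<Rightarrow> nat set set set" where
  "cycle_copies n r m = {((`) \<phi>) ` snd (linear_cycle r m) | \<phi>.
     inj_on \<phi> (fst (linear_cycle r m)) \<and> \<phi> ` fst (linear_cycle r m) \<subseteq> {..<n}}"

text \<open>By \<open>large\<close>, at least half of the guaranteed extensions remain after
  excluding used core vertices. By \<open>inj_image\<close>, an edge given as a set determines its
  function.\<close>

locale positioned_family = regular_family +
  fixes i j k :: nat
  assumes ijk: "i < r" "j < r" "k < r" "i \<noteq> j" "k \<noteq> i" "k \<noteq> j"
    and min_pair: "\<And>a b. a < r \<Longrightarrow> b < r \<Longrightarrow> a \<noteq> b \<Longrightarrow> \<Delta> {i, j} \<le> \<Delta> {a, b}"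
    and large: "2 * \<mu> * (2 * l + 1) \<le> \<Delta> {i, j} / \<Delta> {i, j, k}"
    and inj_image: "inj_on (\<lambda>f. f ` {..<r}) G"
begin

abbreviation "L \<equiv> 2 * l + 1"

text \<open>The core of the cycle is triangulated as a fan with apex \<open>0\<close>; \<open>col a\<close> is the position that the
  \<open>a\<close>-th core vertex takes in the functions containing it.\<close>

definition col :: "nat \<Rightarrow> nat" where
  "col a = (if a = 0 then k else if odd a then i else j)"

text \<open>For \<open>c\<close> among \<open>i\<close>, \<open>j\<close>, \<open>k\<close> this is,
  up to \<open>\<mu>\<close>, the number of values at position \<open>c\<close> that extend a pair
  in the other two positions to a triple.\<close>

definition ext_ratio :: "nat \<Rightarrow> real" where
  "ext_ratio c = \<Delta> ({i, j, k} - {c}) / \<Delta> {i, j, k}"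

text \<open>One triangle of the fan, witnessed by a function of \<open>G'\<close>. Every pair of
  cyclic neighbours lies in such a triangle, so the cycle closes up without a further
  condition.\<close>

definition core_triple :: "nat \<Rightarrow> nat list \<Rightarrow> bool" where
  "core_triple a v \<longleftrightarrow> (\<exists>g\<in>G'. g k = v ! 0 \<and> g (col a) = v ! a \<and> g (col (a + 1)) = v ! (a + 1))"

definition cores :: "nat \<Rightarrow> nat list set" where
  "cores m = {v. length v = m \<and> distinct v \<and> (\<forall>a. 1 \<le> a \<and> a + 1 < m \<longrightarrow> core_triple a v)}"

lemma col_in: "col a \<in> {i, j, k}" "col a < r"
  using ijk by (auto simp: col_def)

lemma ext_ratio_k: "ext_ratio k = \<Delta> {i, j} / \<Delta> {i, j, k}"
proof -
  have "{i, j, k} - {k} = {i, j}" using ijk by auto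
  then show ?thesis by (simp add: ext_ratio_def)
qed

text \<open>All three ratios share a denominator, and by \<open>min_pair\<close> the numerator
  belonging to \<open>k\<close> is the smallest pair degree.\<close>

lemma ext_ratio_ge: "c \<in> {i, j, k} \<Longrightarrow> ext_ratio k \<le> ext_ratio c"
proof -
  assume "c \<in> {i, j, k}"
  then consider "c = k" | "c = i" | "c = j" by auto
  then show ?thesis
  proof cases
    case 2
    then have eq: "{i, j, k} - {c} = {j, k}" using ijk by auto
    show ?thesis unfolding ext_ratio_k unfolding ext_ratio_def eq
      using ijk less_imp_le[OF \<Delta>pos] by (intro divide_right_mono min_pair) auto
  next
    case 3
    then have eq: "{i, j, k} - {c} = {i, k}" using ijk by auto
    show ?thesis unfolding ext_ratio_k unfolding ext_ratio_def eq
      using ijk less_imp_le[OF \<Delta>pos] by (intro divide_right_mono min_pair) auto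
  qed simp
qed

lemma ext_ratio_k_large: "2 * \<mu> * L \<le> ext_ratio k"
  using large by (simp add: ext_ratio_k)

lemma ext_ratio_k_ge_1: "1 \<le> ext_ratio k"
proof -
  have "1 * 1 \<le> (2 * \<mu>) * real L" using \<mu> by (intro mult_mono) auto
  then show ?thesis using ext_ratio_k_large by simp
qed

lemma ext_ratio_pos: "0 < ext_ratio c"
  using \<Delta>pos by (simp add: ext_ratio_def)

section \<open>Lower bound for the number of cores\<close>

lemma finite_cores:
  assumes "m \<ge> 3"
  shows "finite (cores m)"
proof (rule finite_subset)
  show "cores m \<subseteq> {v. set v \<subseteq> {..<n} \<and> length v = m}"
  proof
    fix v assume v: "v \<in> cores m"
    have "v ! a < n" if "a < m" for a
    proof -
      have gn: "g t < n" if "g \<in> G'" "t < r" for g t using that G G'(1) by (auto simp: PiE_def Pi_def)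
      have tri: "core_triple b v" if "1 \<le> b" "b + 1 < m" for b using v that by (auto simp: cores_def)
      have "a = 0 \<or> (1 \<le> a \<and> a + 1 < m) \<or> (a \<ge> 2 \<and> a = m - 1)" using that assms by linarith
      then consider "a = 0" | "1 \<le> a" "a + 1 < m" | "a \<ge> 2" "a = m - 1" by blast
      then show ?thesis
      proof cases
        case 1
        have "core_triple 1 v" using tri[of 1] assms by simp
        then obtain g where "g \<in> G'" "g k = v ! 0" by (auto simp: core_triple_def)
        then show ?thesis using gn[of g k] ijk 1 by simp
      next
        case 2
        then have "core_triple a v" by (rule tri)
        then obtain g where "g \<in> G'" "g (col a) = v ! a" by (auto simp: core_triple_def)
        then show ?thesis using gn[of g "col a"] col_in(2)[of a] by simp
      next
        case 3
        then have "core_triple (a - 1) v" "a - 1 + 1 = a" using tri[of "a - 1"] that by auto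
        then obtain g where "g \<in> G'" "g (col a) = v ! a" unfolding core_triple_def by auto
        then show ?thesis using gn[of g "col a"] col_in(2)[of a] by simp
      qed
    qed
    then show "v \<in> {v. set v \<subseteq> {..<n} \<and> length v = m}" using v by (auto simp: cores_def set_conv_nth)
  qed
qed (auto intro: finite_lists_length_eq)

lemma card_cores_3: "card G' / \<Delta> {i, j, k} \<le> card (cores 3)"
proof -
  define T where "T g = [g k, g i, g j]" for g :: "nat \<Rightarrow> nat"
  have sub: "T ` G' \<subseteq> cores 3"
  proof
    fix v assume "v \<in> T ` G'"
    then obtain g where g: "g \<in> G'" "v = T g" by auto
    have "inj_on g {..<r}" using g G' inj by auto
    then have "distinct v" using ijk g by (auto simp: T_def inj_on_def)
    moreover have "core_triple a v" if "1 \<le> a" "a + 1 < 3" for a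
    proof -
      have "a = 1" using that by simp
      then show ?thesis using g ijk unfolding core_triple_def
        by (intro bexI[of _ g]) (auto simp: T_def col_def numeral_2_eq_2)
    qed
    ultimately show "v \<in> cores 3" using g by (auto simp: cores_def T_def)
  qed
  have "card G' = (\<Sum>v\<in>T ` G'. card {g \<in> G'. T g = v})"
    unfolding card_eq_sum using sum.group[of G' "T ` G'" T "\<lambda>_. 1::nat"] finite_G' by simp
  then have "real (card G') = (\<Sum>v\<in>T ` G'. real (card {g \<in> G'. T g = v}))" by simp
  also have "\<dots> \<le> (\<Sum>v\<in>T ` G'. \<Delta> {i, j, k})"
  proof (intro sum_mono)
    fix v assume "v \<in> T ` G'"
    then obtain g where g: "g \<in> G'" "v = T g" by auto
    then have "{h \<in> G'. T h = v} = matching G' {i, j, k} g" by (auto simp: matching_def T_def)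
    then show "card {h \<in> G'. T h = v} \<le> \<Delta> {i, j, k}"
      using reg[of "{i, j, k}" g] g ijk by (simp add: degree_on_def)
  qed
  also have "\<dots> = card (T ` G') * \<Delta> {i, j, k}" by simp
  also have "\<dots> \<le> card (cores 3) * \<Delta> {i, j, k}"
    using card_mono[OF finite_cores sub] \<Delta>pos[of "{i, j, k}"] by (intro mult_right_mono) auto
  finally show ?thesis using \<Delta>pos[of "{i, j, k}"] by (simp add: field_simps)
qed

lemma col_Suc_pair:
  assumes "a \<ge> 1"
  shows "{k, col a} = {i, j, k} - {col (a + 1)}" "insert (col (a + 1)) {k, col a} = {i, j, k}"
  using assms ijk by (auto simp: col_def)

text \<open>The new triangle shares the pair of the apex and the last vertex with the last triangle
  so far. Regularity supplies \<open>ext_ratio (col m) / \<mu>\<close> candidates, and the at most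
  \<open>m\<close> used vertices are no more than half of that number by
  \<open>large\<close>.\<close>

lemma card_cores_Suc:
  assumes m: "m \<ge> 3" "m < L"
  shows "card (cores m) * (ext_ratio (col m) / (2 * \<mu>)) \<le> card (cores (Suc m))"
proof -
  define E where "E v = {z. v @ [z] \<in> cores (Suc m)}" for v
  have E: "ext_ratio (col m) / (2 * \<mu>) \<le> card (E v)" "finite (E v)" if v: "v \<in> cores m" for v
  proof -
    have inj: "inj (\<lambda>z. v @ [z])" by (auto simp: inj_def)
    have "(\<lambda>z. v @ [z]) ` E v \<subseteq> cores (Suc m)" by (auto simp: E_def)
    then have "finite ((\<lambda>z. v @ [z]) ` E v)" using m by (intro finite_subset[OF _ finite_cores[of "Suc m"]]) auto
    then show fin: "finite (E v)" by (rule finite_imageD[OF _ inj_on_subset[OF inj subset_UNIV]])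
    have len: "length v = m" "distinct v" using v by (auto simp: cores_def)
    have "\<forall>a. 1 \<le> a \<and> a + 1 < m \<longrightarrow> core_triple a v" using v by (simp add: cores_def)
    moreover have "1 \<le> m - 2 \<and> m - 2 + 1 < m" "m - 2 + 1 = m - 1" using m by auto
    ultimately have "core_triple (m - 2) v" by blast
    then obtain g where g: "g \<in> G'" "g k = v ! 0" "g (col (m - 1)) = v ! (m - 1)"
      unfolding core_triple_def \<open>m - 2 + 1 = m - 1\<close> by auto
    define X where "X = extensions {k, col (m - 1)} (col m) g"
    have pair: "{k, col (m - 1)} = {i, j, k} - {col m}" "insert (col m) {k, col (m - 1)} = {i, j, k}"
      using col_Suc_pair[of "m - 1"] m by auto
    have "ext_ratio (col m) \<le> \<mu> * card X"
      unfolding X_def ext_ratio_def using card_extensions_ge[of "{k, col (m - 1)}" "col m" g] pair g ijk col_in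
      by auto
    have "X - set v \<subseteq> E v"
    proof
      fix z assume z: "z \<in> X - set v"
      then obtain h where h: "h \<in> G'" "h k = g k" "h (col (m - 1)) = g (col (m - 1))" "h (col m) = z"
        by (auto simp: X_def extensions_def matching_def)
      have "core_triple a (v @ [z])" if a: "1 \<le> a" "a + 1 < Suc m" for a
      proof (cases "a + 1 < m")
        case True
        then have "core_triple a v" using v a by (auto simp: cores_def)
        then show ?thesis using True m len by (auto simp: core_triple_def nth_append)
      next
        case False
        then have "a = m - 1" "a + 1 = m" using a by auto
        then show ?thesis using h g m len unfolding core_triple_def
          by (intro bexI[of _ h]) (auto simp: nth_append)
      qed
      then show "z \<in> E v" using z len by (auto simp: E_def cores_def)
    qed
    then have "card (X - set v) \<le> card (E v)" by (intro card_mono fin)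
    moreover have "card X - card (set v) \<le> card (X - set v)" by (intro diff_card_le_card_Diff) auto
    moreover have "card (set v) \<le> m" using card_length[of v] len by simp
    ultimately have "real (card X) - m \<le> card (E v)" by linarith
    moreover have "ext_ratio (col m) / \<mu> \<le> card X"
      using \<open>ext_ratio (col m) \<le> \<mu> * card X\<close> \<mu> by (simp add: field_simps)
    moreover have "m \<le> ext_ratio (col m) / (2 * \<mu>)"
    proof -
      have "2 * \<mu> * m \<le> 2 * \<mu> * L" using m \<mu> by (intro mult_left_mono) auto
      also have "\<dots> \<le> ext_ratio (col m)" using ext_ratio_k_large ext_ratio_ge[OF col_in(1)[of m]] by linarith
      finally show ?thesis using \<mu> by (simp add: field_simps)
    qed
    moreover have "ext_ratio (col m) / \<mu> = 2 * (ext_ratio (col m) / (2 * \<mu>))" using \<mu> by simp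
    ultimately show "ext_ratio (col m) / (2 * \<mu>) \<le> card (E v)" by linarith
  qed
  have "card (cores m) * (ext_ratio (col m) / (2 * \<mu>)) = (\<Sum>v\<in>cores m. ext_ratio (col m) / (2 * \<mu>))" by simp
  also have "\<dots> \<le> (\<Sum>v\<in>cores m. real (card (E v)))" by (intro sum_mono E)
  also have "\<dots> = real (\<Sum>v\<in>cores m. card ((\<lambda>z. v @ [z]) ` E v))"
    by (simp add: card_image inj_on_def)
  also have "(\<Sum>v\<in>cores m. card ((\<lambda>z. v @ [z]) ` E v)) = card (\<Union>v\<in>cores m. (\<lambda>z. v @ [z]) ` E v)"
    using finite_cores[OF m(1)] E(2) by (intro card_UN_disjoint[symmetric]) auto
  also have "\<dots> \<le> card (cores (Suc m))"
    using m by (intro card_mono finite_cores) (auto simp: E_def)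
  finally show ?thesis by simp
qed

lemma card_cores_ge:
  assumes "3 + d \<le> L"
  shows "card G' / \<Delta> {i, j, k} * (\<Prod>a\<in>{3..<3 + d}. ext_ratio (col a) / (2 * \<mu>)) \<le> card (cores (3 + d))"
  using assms
proof (induction d)
  case 0
  then show ?case using card_cores_3 by (simp only: add_0_right order_refl atLeastLessThan_empty prod.empty mult_1_right)
next
  case (Suc d)
  define m where "m = 3 + d"
  have m: "3 + Suc d = Suc m" "3 \<le> m" "m < L" using Suc.prems by (auto simp: m_def)
  have "card G' / \<Delta> {i, j, k} * (\<Prod>a\<in>{3..<Suc m}. ext_ratio (col a) / (2 * \<mu>))
      = card G' / \<Delta> {i, j, k} * (\<Prod>a\<in>{3..<m}. ext_ratio (col a) / (2 * \<mu>)) * (ext_ratio (col m) / (2 * \<mu>))"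
    using m(2) by (simp only: prod.atLeastLessThan_Suc mult.assoc)
  also have "\<dots> \<le> card (cores m) * (ext_ratio (col m) / (2 * \<mu>))"
    using Suc ext_ratio_pos[of "col m"] \<mu> by (intro mult_right_mono) (simp_all add: m_def)
  also have "\<dots> \<le> card (cores (Suc m))" by (rule card_cores_Suc[OF m(2,3)])
  finally show ?case unfolding m(1) .
qed

section \<open>Cores through prescribed vertices\<close>

definition nxt :: "nat \<Rightarrow> nat" where
  "nxt a = (a + 1) mod L"

definition pair_at :: "nat \<Rightarrow> nat set" where
  "pair_at a = {col a, col (nxt a)}"

lemma L3: "L \<ge> 3"
  using l by simp

lemma nxt_less: "nxt a < L"
  by (simp add: nxt_def)

lemma nxt_eq: "a < L \<Longrightarrow> nxt a = (if a = 2 * l then 0 else a + 1)"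
  by (auto simp: nxt_def mod_if)

lemma col_nxt: "a < L \<Longrightarrow> col a \<noteq> col (nxt a)"
  using ijk l by (auto simp: nxt_eq col_def)

lemma pair_at_subset: "pair_at a \<subseteq> {..<r}"
  using col_in(2) by (auto simp: pair_at_def)

lemma core_tripleD: "v \<in> cores L \<Longrightarrow> 1 \<le> a \<Longrightarrow> a + 1 < L \<Longrightarrow> core_triple a v"
  by (simp add: cores_def)

lemma core_tripleE:
  assumes "v \<in> cores L" "1 \<le> a" "a + 1 < L"
  obtains g where "g \<in> G'" "g k = v ! 0" "g (col a) = v ! a" "g (col (a + 1)) = v ! (a + 1)"
  using core_tripleD[OF assms] unfolding core_triple_def by blast

text \<open>All values at \<open>x\<close> extend one and the same pair, and this pair is realised
  by some \<open>g0\<close> in \<open>G'\<close>; so a single extension count covers all the cores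
  involved.\<close>

lemma core_vertex_values:
  assumes y: "y < L" "z < L" "x < L" "col y \<noteq> col z" and xc: "{col y, col z} = {i, j, k} - {col x}"
    and tri: "\<And>v. v \<in> cores L \<Longrightarrow> \<exists>g\<in>G'. g (col x) = v ! x \<and> g (col y) = v ! y \<and> g (col z) = v ! z"
  shows "card ((\<lambda>v. v ! x) ` {v \<in> cores L. v ! y = b \<and> v ! z = c}) \<le> \<mu> * ext_ratio (col x)"
proof (cases "{v \<in> cores L. v ! y = b \<and> v ! z = c} = {}")
  case True
  have "0 \<le> \<mu> * ext_ratio (col x)" using \<mu> ext_ratio_pos[of "col x"] by simp
  then show ?thesis unfolding True by simp
next
  case False
  then obtain v0 where v0: "v0 \<in> cores L" "v0 ! y = b" "v0 ! z = c" by blast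
  obtain g0 where g0: "g0 \<in> G'" "g0 (col y) = b" "g0 (col z) = c" using tri[OF v0(1)] v0 by blast
  have ins: "insert (col x) {col y, col z} = {i, j, k}" unfolding xc using col_in(1)[of x] by blast
  have "(\<lambda>v. v ! x) ` {v \<in> cores L. v ! y = b \<and> v ! z = c} \<subseteq> extensions {col y, col z} (col x) g0"
  proof
    fix t assume "t \<in> (\<lambda>v. v ! x) ` {v \<in> cores L. v ! y = b \<and> v ! z = c}"
    then obtain v where v: "v \<in> cores L" "v ! y = b" "v ! z = c" "t = v ! x" by blast
    obtain g where "g \<in> G'" "g (col x) = v ! x" "g (col y) = v ! y" "g (col z) = v ! z"
      using tri[OF v(1)] by blast
    then show "t \<in> extensions {col y, col z} (col x) g0" using v g0
      unfolding extensions_def matching_def by (intro image_eqI[of _ _ g]) auto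
  qed
  then have "card ((\<lambda>v. v ! x) ` {v \<in> cores L. v ! y = b \<and> v ! z = c}) \<le> card (extensions {col y, col z} (col x) g0)"
    by (intro card_mono finite_extensions)
  also have "real \<dots> \<le> \<mu> * (\<Delta> {col y, col z} / \<Delta> (insert (col x) {col y, col z}))"
    using col_in(2) g0 by (intro card_extensions_le) auto
  also have "\<dots> = \<mu> * ext_ratio (col x)" unfolding ins unfolding ext_ratio_def xc ..
  finally show ?thesis by simp
qed

text \<open>A new core vertex \<open>x\<close> is always reached from the pair of the apex and a path neighbour, or,
  if \<open>x\<close> is the apex itself, from an edge of the path.\<close>

lemma new_core_vertex:
  assumes P: "P \<subset> {..<L}" "a0 \<in> P" "nxt a0 \<in> P" "a0 < L"
  obtains x y z where "x < L" "x \<notin> P" "y \<in> P" "z \<in> P"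
    "\<And>b c. card ((\<lambda>v. v ! x) ` {v \<in> cores L. v ! y = b \<and> v ! z = c}) \<le> \<mu> * ext_ratio (col x)"
proof (cases "0 \<in> P")
  case False
  have a0: "a0 \<ge> 1" "nxt a0 \<noteq> 0" using False P by (auto intro: Suc_leI gr0I)
  then have a1: "a0 + 1 < L" "nxt a0 = a0 + 1" using P nxt_eq[of a0] by (auto split: if_splits)
  show ?thesis
  proof (rule that[of 0 a0 "a0 + 1"])
    fix b c
    show "card ((\<lambda>v. v ! 0) ` {v \<in> cores L. v ! a0 = b \<and> v ! (a0 + 1) = c}) \<le> \<mu> * ext_ratio (col 0)"
    proof (rule core_vertex_values)
      show "col a0 \<noteq> col (a0 + 1)" using col_nxt[OF P(4)] a1 by simp
      show "{col a0, col (a0 + 1)} = {i, j, k} - {col 0}" using a0 ijk by (auto simp: col_def)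
      fix v assume "v \<in> cores L"
      from this a0(1) a1(1) show "\<exists>g\<in>G'. g (col 0) = v ! 0 \<and> g (col a0) = v ! a0 \<and> g (col (a0 + 1)) = v ! (a0 + 1)"
        by (rule core_tripleE) (auto simp: col_def)
    qed (use P a1 in auto)
  qed (use False P a1 in auto)
next
  case True
  \<comment> \<open>Otherwise \<open>P\<close> would propagate in both directions along the path of
    the nonzero indices and, together with the apex, be everything.\<close>
  have step: "\<exists>y\<in>P. y \<ge> 1 \<and> (\<exists>x. x < L \<and> x \<ge> 1 \<and> x \<notin> P \<and> (x = y + 1 \<or> y = x + 1))"
  proof (rule ccontr)
    assume neg: "\<not> ?thesis"
    then have nbr: "x \<in> P" if "y \<in> P" "y \<ge> 1" "x < L" "x \<ge> 1" "x = y + 1 \<or> y = x + 1" for x y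
      using that by blast
    obtain y0 where y0: "y0 \<in> P" "y0 \<ge> 1" "y0 < L"
    proof (cases "a0 = 0")
      case True
      then show ?thesis using that[of "nxt a0"] P nxt_less[of a0] nxt_eq[of a0] l by auto
    qed (use that[of a0] P in auto)
    have up: "y0 + d < L \<longrightarrow> y0 + d \<in> P" for d
    proof (induction d)
      case (Suc d)
      show ?case
      proof
        assume "y0 + Suc d < L"
        then have "y0 + d \<in> P" "y0 + d \<ge> 1" using Suc y0 by auto
        then show "y0 + Suc d \<in> P" using nbr[of "y0 + d" "y0 + Suc d"] \<open>y0 + Suc d < L\<close> by simp
      qed
    qed (use y0 in simp)
    have down: "d < y0 \<longrightarrow> y0 - d \<in> P" for d
    proof (induction d)
      case (Suc d)
      show ?case
      proof
        assume d: "Suc d < y0"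
        then have "y0 - d \<in> P" "y0 - d \<ge> 1" "y0 - d = (y0 - Suc d) + 1" using Suc by auto
        then show "y0 - Suc d \<in> P" using nbr[of "y0 - d" "y0 - Suc d"] d y0 by simp
      qed
    qed (use y0 in simp)
    have "{..<L} \<subseteq> P"
    proof
      fix x assume x: "x \<in> {..<L}"
      consider "x = 0" | "x \<ge> y0" | "1 \<le> x" "x < y0" by linarith
      then show "x \<in> P"
      proof cases
        case 2
        then show ?thesis using up[of "x - y0"] x by auto
      next
        case 3
        then show ?thesis using down[of "y0 - x"] by auto
      qed (use True in simp)
    qed
    then show False using P by auto
  qed
  then obtain y x where yx: "y \<in> P" "y \<ge> 1" "x < L" "x \<ge> 1" "x \<notin> P" "x = y + 1 \<or> y = x + 1" by auto
  have yL: "y < L" using yx P by auto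
  show ?thesis
  proof (rule that[of x y 0])
    fix b c
    show "card ((\<lambda>v. v ! x) ` {v \<in> cores L. v ! y = b \<and> v ! 0 = c}) \<le> \<mu> * ext_ratio (col x)"
    proof (rule core_vertex_values)
      show "col y \<noteq> col 0" using yx ijk by (auto simp: col_def)
      show "{col y, col 0} = {i, j, k} - {col x}" using yx ijk by (auto simp: col_def)
      fix v assume v: "v \<in> cores L"
      show "\<exists>g\<in>G'. g (col x) = v ! x \<and> g (col y) = v ! y \<and> g (col 0) = v ! 0"
      proof (cases "x = y + 1")
        case True
        have "y + 1 < L" using True yx by simp
        from v yx(2) this show ?thesis using True by (elim core_tripleE) (auto simp: col_def)
      next
        case False
        then have y: "y = x + 1" using yx by auto
        have "x + 1 < L" using y yL by simp
        from v yx(4) this show ?thesis using y by (elim core_tripleE) (auto simp: col_def)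
      qed
    qed (use yx yL l in auto)
  qed (use yx True in auto)
qed

text \<open>The missing vertices are revealed one at a time, each through a triangle whose other two
  vertices are known, at the cost of a factor \<open>\<mu> * ext_ratio (col x)\<close>. Two
  cyclically consecutive vertices in \<open>P\<close> are needed to get started.\<close>

lemma card_cores_fixed_le:
  assumes "P \<subseteq> {..<L}" "a0 \<in> P" "nxt a0 \<in> P" "a0 < L"
  shows "card {v \<in> cores L. \<forall>x\<in>P. v ! x = w x} \<le> (\<Prod>x\<in>{..<L} - P. \<mu> * ext_ratio (col x))"
  using assms
proof (induction "card ({..<L} - P)" arbitrary: P w)
  case 0
  have "{..<L} - P = {}" using 0(1) by simp
  then have PL: "P = {..<L}" using 0(2) by auto
  have "v = u" if "v \<in> {v \<in> cores L. \<forall>x\<in>P. v ! x = w x}" "u \<in> {v \<in> cores L. \<forall>x\<in>P. v ! x = w x}" for v u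
    using that PL by (intro nth_equalityI) (auto simp: cores_def)
  moreover have "finite {v \<in> cores L. \<forall>x\<in>P. v ! x = w x}" using finite_cores[OF L3] by simp
  ultimately have "card {v \<in> cores L. \<forall>x\<in>P. v ! x = w x} \<le> 1" by (auto simp: card_le_Suc0_iff_eq)
  then show ?case unfolding \<open>{..<L} - P = {}\<close> by (simp only: prod.empty)
next
  case (Suc N)
  have "P \<noteq> {..<L}" using Suc(2) by auto
  then have "P \<subset> {..<L}" using Suc(3) by auto
  then obtain x y z where x: "x < L" "x \<notin> P" and yz: "y \<in> P" "z \<in> P"
    and le: "\<And>b c. card ((\<lambda>v. v ! x) ` {v \<in> cores L. v ! y = b \<and> v ! z = c}) \<le> \<mu> * ext_ratio (col x)"
    using Suc(4,5,6) by (rule new_core_vertex) (rule that)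
  define S where "S = {v \<in> cores L. \<forall>x\<in>P. v ! x = w x}"
  define Z where "Z = (\<lambda>v. v ! x) ` S"
  have finS: "finite S" using finite_cores[OF L3] by (simp add: S_def)
  have "Z \<subseteq> (\<lambda>v. v ! x) ` {v \<in> cores L. v ! y = w y \<and> v ! z = w z}" using yz by (auto simp: Z_def S_def)
  then have "card Z \<le> card ((\<lambda>v. v ! x) ` {v \<in> cores L. v ! y = w y \<and> v ! z = w z})"
    using finite_cores[OF L3] by (intro card_mono) auto
  then have cardZ: "card Z \<le> \<mu> * ext_ratio (col x)" using le[of "w y" "w z"] by linarith
  have eq: "{..<L} - P = insert x ({..<L} - insert x P)" using x by auto
  have "card ({..<L} - P) = Suc (card ({..<L} - insert x P))"
    by (subst eq, subst card_insert_disjoint) auto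
  then have "card ({..<L} - insert x P) = N" using Suc(2) by linarith
  then have IH: "card {v \<in> cores L. \<forall>t\<in>insert x P. v ! t = u t} \<le> (\<Prod>t\<in>{..<L} - insert x P. \<mu> * ext_ratio (col t))" for u
    using Suc(1)[of "insert x P" u] Suc.prems x by auto
  have "card S = (\<Sum>t\<in>Z. card {v \<in> S. v ! x = t})"
    unfolding card_eq_sum Z_def using sum.group[of S "(\<lambda>v. v ! x) ` S" "\<lambda>v. v ! x" "\<lambda>_. 1::nat"] finS by simp
  also have "real \<dots> = (\<Sum>t\<in>Z. real (card {v \<in> S. v ! x = t}))" by simp
  also have "\<dots> \<le> (\<Sum>t\<in>Z. \<Prod>t\<in>{..<L} - insert x P. \<mu> * ext_ratio (col t))"
  proof (intro sum_mono)
    fix t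
    have "{v \<in> S. v ! x = t} = {v \<in> cores L. \<forall>s\<in>insert x P. v ! s = (w(x := t)) s}"
      using x by (auto simp: S_def)
    then show "card {v \<in> S. v ! x = t} \<le> (\<Prod>t\<in>{..<L} - insert x P. \<mu> * ext_ratio (col t))"
      using IH[of "w(x := t)"] by simp
  qed
  also have "\<dots> = card Z * (\<Prod>t\<in>{..<L} - insert x P. \<mu> * ext_ratio (col t))" by simp
  also have "\<dots> \<le> \<mu> * ext_ratio (col x) * (\<Prod>t\<in>{..<L} - insert x P. \<mu> * ext_ratio (col t))"
    using \<mu> less_imp_le[OF ext_ratio_pos] by (intro mult_right_mono cardZ prod_nonneg mult_nonneg_nonneg) auto
  also have "\<dots> = (\<Prod>t\<in>{..<L} - P. \<mu> * ext_ratio (col t))" by (subst eq, subst prod.insert) auto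
  finally show ?case unfolding S_def .
qed

text \<open>Each core pair is completed to an edge of \<open>G'\<close>, whose remaining coordinates are then moved off the
  vertices used before; \<open>G\<close> has minimum degrees large enough for that.\<close>

definition edges_at :: "nat list \<Rightarrow> nat \<Rightarrow> (nat \<Rightarrow> nat) set" where
  "edges_at v a = {g \<in> G'. g (col a) = v ! a \<and> g (col (nxt a)) = v ! nxt a}"

definition used :: "nat list \<Rightarrow> (nat \<Rightarrow> nat) list \<Rightarrow> nat set" where
  "used v es = set v \<union> (\<Union>e\<in>set es. e ` {..<r})"

definition choices :: "nat list \<Rightarrow> nat \<Rightarrow> (nat \<Rightarrow> nat) list \<Rightarrow> (nat \<Rightarrow> nat) set" where
  "choices v a es = avoid (used v es) ({..<r} - pair_at a) ` edges_at v a"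

definition cycles :: "(nat list \<times> (nat \<Rightarrow> nat) list) set" where
  "cycles = Sigma (cores L) (\<lambda>v. seqs (choices v) L)"

text \<open>Bounds the number of edges that \<open>avoid\<close> sends to the same edge.\<close>

definition \<kappa> :: real where
  "\<kappa> = real (((2 * l + 1) * (r + 1) + 1) ^ r)"

lemma \<kappa>_pos: "\<kappa> > 0"
  unfolding \<kappa>_def by (subst of_nat_0_less_iff) simp

text \<open>Each pair of cyclic neighbours lies in a fan triangle: the pair \<open>0, 1\<close> in
  the first, the pair \<open>2 * l, 0\<close> in the last, and a path edge in its own. The witness
  makes the set of completions a class of \<open>G'\<close>, to which regularity applies.\<close>

lemma edges_at:
  assumes v: "v \<in> cores L" and a: "a < L"
  shows "\<Delta> (pair_at a) \<le> \<mu> * card (edges_at v a)" "card (edges_at v a) \<le> \<Delta> (pair_at a)"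
proof -
  have "\<exists>g\<in>G'. g (col a) = v ! a \<and> g (col (nxt a)) = v ! nxt a"
  proof -
    consider "a = 0" | "1 \<le> a" "a + 1 < L" | "a = 2 * l" using a by linarith
    then show ?thesis
    proof cases
      case 1
      have "(1::nat) \<le> 1" "1 + 1 < L" using l by auto
      from v this obtain g where "g \<in> G'" "g k = v ! 0" "g (col 1) = v ! 1" by (rule core_tripleE)
      then show ?thesis using 1 l by (intro bexI[of _ g]) (auto simp: nxt_eq col_def)
    next
      case 2
      from v this obtain g where "g \<in> G'" "g (col a) = v ! a" "g (col (a + 1)) = v ! (a + 1)" by (rule core_tripleE)
      then show ?thesis using 2 a by (intro bexI[of _ g]) (auto simp: nxt_eq)
    next
      case 3
      have "1 \<le> 2 * l - 1" "2 * l - 1 + 1 < L" using l by auto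
      from v this obtain g where "g \<in> G'" "g k = v ! 0" "g (col (2 * l - 1 + 1)) = v ! (2 * l - 1 + 1)"
        by (rule core_tripleE)
      moreover have "2 * l - 1 + 1 = 2 * l" using l by simp
      ultimately show ?thesis using 3 a by (intro bexI[of _ g]) (auto simp: nxt_eq col_def)
    qed
  qed
  then obtain g where g: "g \<in> G'" "g (col a) = v ! a" "g (col (nxt a)) = v ! nxt a" by blast
  then have "edges_at v a = matching G' (pair_at a) g" by (auto simp: edges_at_def matching_def pair_at_def)
  then show "\<Delta> (pair_at a) \<le> \<mu> * card (edges_at v a)" "card (edges_at v a) \<le> \<Delta> (pair_at a)"
    using reg[OF pair_at_subset g(1)] by (auto simp: degree_on_def)
qed

lemma used_small:
  assumes "v \<in> cores L" "length es \<le> L"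
  shows "finite (used v es)" "card (used v es) \<le> (2 * l + 1) * (r + 1)"
proof -
  show "finite (used v es)" by (simp add: used_def)
  have "card (used v es) \<le> card (set v) + card (\<Union>e\<in>set es. e ` {..<r})" unfolding used_def by (rule card_Un_le)
  also have "card (\<Union>e\<in>set es. e ` {..<r}) \<le> (\<Sum>e\<in>set es. card (e ` {..<r}))" by (intro card_UN_le) auto
  also have "\<dots> \<le> (\<Sum>e\<in>set es. r)" by (intro sum_mono) (metis card_image_le card_lessThan finite_lessThan)
  also have "\<dots> = card (set es) * r" by simp
  also have "\<dots> \<le> L * r" using card_length[of es] assms(2) by (intro mult_right_mono) auto
  also have "card (set v) \<le> L" using assms(1) card_length[of v] by (simp add: cores_def)
  finally show "card (used v es) \<le> (2 * l + 1) * (r + 1)" by (simp add: algebra_simps)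
qed

lemma edges_at_subset: "edges_at v a \<subseteq> G"
  using G'(1) by (auto simp: edges_at_def)

lemma choices:
  assumes v: "v \<in> cores L" and a: "a < L" and es: "length es \<le> L"
  shows "finite (choices v a es)" "card (choices v a es) \<le> \<Delta> (pair_at a)"
    "\<Delta> (pair_at a) / (\<mu> * \<kappa>) \<le> card (choices v a es)"
proof -
  have fin: "finite (edges_at v a)" using edges_at_subset finite_G by (rule finite_subset)
  then show "finite (choices v a es)" by (simp add: choices_def)
  have "card (choices v a es) \<le> card (edges_at v a)" unfolding choices_def by (rule card_image_le[OF fin])
  then show "card (choices v a es) \<le> \<Delta> (pair_at a)" using edges_at(2)[OF v a] by linarith
  have "card (edges_at v a) \<le> ((2 * l + 1) * (r + 1) + 1) ^ r * card (choices v a es)"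
    unfolding choices_def using used_small[OF v es] by (intro card_avoid_image edges_at_subset) auto
  then have "real (card (edges_at v a)) \<le> \<kappa> * card (choices v a es)"
    unfolding \<kappa>_def by (metis of_nat_le_iff of_nat_mult)
  then have "\<mu> * card (edges_at v a) \<le> \<mu> * (\<kappa> * card (choices v a es))" using \<mu> by (intro mult_left_mono) auto
  then have "\<Delta> (pair_at a) \<le> (\<mu> * \<kappa>) * card (choices v a es)" using edges_at(1)[OF v a] by simp
  moreover have "\<mu> * \<kappa> > 0" using \<mu> \<kappa>_pos by simp
  ultimately show "\<Delta> (pair_at a) / (\<mu> * \<kappa>) \<le> card (choices v a es)" by (simp add: field_simps)
qed

text \<open>Each edge avoids only the core and the edges before it. Applied to the later of two
  edges, this confines every intersection of two edges to the core.\<close>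

lemma cyclesD:
  assumes "(v, es) \<in> cycles" and a: "a < L"
  shows "v \<in> cores L" "length es = L" "es ! a \<in> G" "(es ! a) (col a) = v ! a" "(es ! a) (col (nxt a)) = v ! nxt a"
    "\<And>t. t < r \<Longrightarrow> t \<notin> pair_at a \<Longrightarrow> (es ! a) t \<notin> set v"
    "\<And>b. b < a \<Longrightarrow> (es ! a) ` ({..<r} - pair_at a) \<inter> (es ! b) ` {..<r} = {}"
proof -
  show v: "v \<in> cores L" and len: "length es = L" using assms by (auto simp: cycles_def seqs_def)
  have "es ! a \<in> choices v a (take a es)" using assms by (auto simp: cycles_def seqs_def)
  then obtain e where e: "e \<in> edges_at v a" "es ! a = avoid (used v (take a es)) ({..<r} - pair_at a) e"
    by (auto simp: choices_def)
  have eG: "e \<in> G" using e edges_at_subset by auto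
  have "length (take a es) \<le> L" using a by simp
  note av = avoid[OF eG used_small[OF v this] Diff_subset[of "{..<r}" "pair_at a"]]
  show "es ! a \<in> G" using av(1) e by simp
  show "(es ! a) (col a) = v ! a" "(es ! a) (col (nxt a)) = v ! nxt a"
    using av(2) e col_in(2) by (auto simp: edges_at_def pair_at_def)
  show "(es ! a) t \<notin> set v" if "t < r" "t \<notin> pair_at a" for t
    using av(3)[of t] that e(2) by (auto simp: used_def)
  fix b assume "b < a"
  then have "es ! b \<in> set (take a es)" using len a by (auto simp: in_set_conv_nth)
  then show "(es ! a) ` ({..<r} - pair_at a) \<inter> (es ! b) ` {..<r} = {}"
    using av(3) e(2) by (fastforce simp: used_def)
qed

lemma finite_seqs_choices: "v \<in> cores L \<Longrightarrow> finite (seqs (choices v) L)"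
  by (rule finite_seqs) (use choices(1) in \<open>auto simp: seqs_def\<close>)

lemma finite_cycles: "finite cycles"
  unfolding cycles_def using finite_cores[OF L3] finite_seqs_choices by (intro finite_SigmaI)

lemma card_cycles_ge:
  "card G' / \<Delta> {i, j, k} * (\<Prod>a\<in>{3..<L}. ext_ratio (col a) / (2 * \<mu>)) * (\<Prod>a<L. \<Delta> (pair_at a) / (\<mu> * \<kappa>)) \<le> card cycles"
proof -
  have b: "(\<Prod>a<L. \<Delta> (pair_at a) / (\<mu> * \<kappa>)) \<le> card (seqs (choices v) L)" if v: "v \<in> cores L" for v
    using choices[OF v] \<mu> \<kappa>_pos less_imp_le[OF \<Delta>pos] by (intro card_seqs_ge) (auto simp: seqs_def)
  have L: "3 + (L - 3) = L" using L3 by simp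
  have "card G' / \<Delta> {i, j, k} * (\<Prod>a\<in>{3..<L}. ext_ratio (col a) / (2 * \<mu>)) * (\<Prod>a<L. \<Delta> (pair_at a) / (\<mu> * \<kappa>))
     \<le> card (cores L) * (\<Prod>a<L. \<Delta> (pair_at a) / (\<mu> * \<kappa>))"
    using card_cores_ge[of "L - 3", unfolded L] \<mu> \<kappa>_pos less_imp_le[OF \<Delta>pos]
    by (intro mult_right_mono prod_nonneg) auto
  also have "\<dots> = (\<Sum>v\<in>cores L. \<Prod>a<L. \<Delta> (pair_at a) / (\<mu> * \<kappa>))" by simp
  also have "\<dots> \<le> (\<Sum>v\<in>cores L. real (card (seqs (choices v) L)))" by (intro sum_mono b)
  also have "\<dots> = card cycles" unfolding cycles_def using finite_cores[OF L3] finite_seqs_choices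
    by (subst card_SigmaI) auto
  finally show ?thesis .
qed

text \<open>Prescribed edges determine the core vertices at both of their ends; the other core
  vertices and the other edges are bounded by their extension counts and pair degrees.\<close>

lemma card_cycles_fixed_le:
  assumes A: "A \<subseteq> {..<L}" "a0 \<in> A"
  shows "card {(v, es) \<in> cycles. \<forall>a\<in>A. es ! a = w a} \<le>
    (\<Prod>x\<in>{..<L} - (A \<union> nxt ` A). \<mu> * ext_ratio (col x)) * (\<Prod>a\<in>{..<L} - A. \<Delta> (pair_at a))"
proof -
  define S where "S = {(v, es) \<in> cycles. \<forall>a\<in>A. es ! a = w a}"
  define P where "P = A \<union> nxt ` A"
  \<comment> \<open>The value forced at \<open>x\<close>: read from the prescribed edge starting at
    \<open>x\<close> if there is one, otherwise from a prescribed edge ending there.\<close>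
  define u where "u x = (if x \<in> A then w x (col x) else w (SOME a. a \<in> A \<and> nxt a = x) (col x))" for x
  have P: "P \<subseteq> {..<L}" "a0 \<in> P" "nxt a0 \<in> P" "a0 < L" using A nxt_less by (auto simp: P_def)
  define C where "C = {v \<in> cores L. \<forall>x\<in>P. v ! x = u x}"
  have "S \<subseteq> Sigma C (\<lambda>v. {es \<in> seqs (choices v) L. \<forall>a\<in>A. a < L \<longrightarrow> es ! a = w a})"
  proof (rule subrelI)
    fix v es assume *: "(v, es) \<in> S"
    then have c: "(v, es) \<in> cycles" and w: "\<And>a. a \<in> A \<Longrightarrow> es ! a = w a" by (auto simp: S_def)
    have "v ! x = u x" if "x \<in> P" for x
    proof (cases "x \<in> A")
      case True
      then show ?thesis using cyclesD(4)[OF c, of x] w[of x] A by (auto simp: u_def)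
    next
      case False
      define a where "a = (SOME a. a \<in> A \<and> nxt a = x)"
      have "\<exists>a. a \<in> A \<and> nxt a = x" using False that by (auto simp: P_def)
      then have a: "a \<in> A" "nxt a = x" using someI_ex[of "\<lambda>a. a \<in> A \<and> nxt a = x"] by (auto simp: a_def)
      have "(es ! a) (col (nxt a)) = v ! nxt a" using a A by (intro cyclesD(5)[OF c]) auto
      moreover have "u x = w a (col x)" using False by (simp add: u_def a_def)
      ultimately show ?thesis using w[OF a(1)] a(2) by simp
    qed
    then show "(v, es) \<in> Sigma C (\<lambda>v. {es \<in> seqs (choices v) L. \<forall>a\<in>A. a < L \<longrightarrow> es ! a = w a})"
      using c w by (auto simp: C_def cycles_def)
  qed
  moreover have fin: "finite C" "\<And>v. v \<in> C \<Longrightarrow> finite {es \<in> seqs (choices v) L. \<forall>a\<in>A. a < L \<longrightarrow> es ! a = w a}"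
    using finite_cores[OF L3] finite_seqs_choices by (auto simp: C_def)
  ultimately have "card S \<le> card (Sigma C (\<lambda>v. {es \<in> seqs (choices v) L. \<forall>a\<in>A. a < L \<longrightarrow> es ! a = w a}))"
    by (intro card_mono finite_SigmaI)
  also have "\<dots> = (\<Sum>v\<in>C. card {es \<in> seqs (choices v) L. \<forall>a\<in>A. a < L \<longrightarrow> es ! a = w a})"
    using fin by (intro card_SigmaI) auto
  finally have "real (card S) \<le> real (\<Sum>v\<in>C. card {es \<in> seqs (choices v) L. \<forall>a\<in>A. a < L \<longrightarrow> es ! a = w a})"
    by (rule of_nat_mono)
  also have "\<dots> = (\<Sum>v\<in>C. real (card {es \<in> seqs (choices v) L. \<forall>a\<in>A. a < L \<longrightarrow> es ! a = w a}))" by simp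
  also have "\<dots> \<le> (\<Sum>v\<in>C. \<Prod>a\<in>{..<L} - A. \<Delta> (pair_at a))"
    using choices(1,2) less_imp_le[OF \<Delta>pos] by (intro sum_mono card_seqs_le) (auto simp: C_def seqs_def)
  also have "\<dots> = card C * (\<Prod>a\<in>{..<L} - A. \<Delta> (pair_at a))" by simp
  also have "\<dots> \<le> (\<Prod>x\<in>{..<L} - P. \<mu> * ext_ratio (col x)) * (\<Prod>a\<in>{..<L} - A. \<Delta> (pair_at a))"
    unfolding C_def using P less_imp_le[OF \<Delta>pos] by (intro mult_right_mono card_cores_fixed_le prod_nonneg) auto
  finally show ?thesis unfolding S_def P_def .
qed

section \<open>Degrees in the system of cycles\<close>

lemma n_pos: "n > 0"
proof -
  obtain f where "f \<in> G'" using G' by auto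
  then have "f \<in> {..<r} \<rightarrow>\<^sub>E {..<n}" using G G' by auto
  moreover have "0 \<in> {..<r}" using r by simp
  ultimately have "f 0 \<in> {..<n}" by (rule PiE_mem)
  then show ?thesis by auto
qed

text \<open>Multiplying \<open>ext_ratio c\<close> by the triple degree restores the degree of the
  pair without \<open>c\<close>. Thus the contribution of a first edge with its two ends is the same
  for every place on the cycle.\<close>

lemma ext_ratio_prod:
  assumes "p \<in> {i, j, k}" "q \<in> {i, j, k}" "p \<noteq> q"
  shows "ext_ratio k * ext_ratio i * ext_ratio j * \<Delta> {i, j, k} = ext_ratio p * ext_ratio q * \<Delta> {p, q}"
proof -
  have X: "ext_ratio c * \<Delta> {i, j, k} = \<Delta> ({i, j, k} - {c})" for c
    using \<Delta>pos[of "{i, j, k}"] by (simp add: ext_ratio_def)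
  have "\<exists>c. {p, q} = {i, j, k} - {c} \<and> ext_ratio k * ext_ratio i * ext_ratio j = ext_ratio p * ext_ratio q * ext_ratio c"
  proof -
    have *: "\<exists>c. {p, q} = {i, j, k} - {c} \<and> ext_ratio k * ext_ratio i * ext_ratio j = ext_ratio p * ext_ratio q * ext_ratio c"
      if "c \<notin> {p, q}" "c \<in> {i, j, k}" for c
      using that assms ijk by (intro exI[of _ c]) (auto simp: mult_ac)
    show ?thesis using *[of i] *[of j] *[of k] assms ijk by blast
  qed
  then obtain c where c: "{p, q} = {i, j, k} - {c}"
    "ext_ratio k * ext_ratio i * ext_ratio j = ext_ratio p * ext_ratio q * ext_ratio c" by blast
  show ?thesis unfolding c(2) mult.assoc[of _ "ext_ratio c"] X c(1) ..
qed

text \<open>Quotient of the upper count of cycles through prescribed edges and the lower count of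
  all cycles. The first edge \<open>a0\<close> with its two ends cancels against the initial triple
  and leaves \<open>card G'\<close>, the number of choices for one edge. Every further end saves at
  least \<open>ext_ratio k\<close>, and every further edge saves a pair degree, hence at least
  \<open>card G' / n^2\<close>.\<close>

lemma card_fixed_le_ratio:
  assumes A: "A \<subseteq> {..<L}" "a0 \<in> A"
  shows "card {(v, es) \<in> cycles. \<forall>a\<in>A. es ! a = w a} * real (card G') * ext_ratio k ^ (card (A \<union> nxt ` A) - 2) *
      (card G' / n\<^sup>2) ^ (card A - 1) \<le> (2 * \<kappa>) ^ L * \<mu> ^ (3 * L) * card cycles"
proof -
  define N where "N = real (card {(v, es) \<in> cycles. \<forall>a\<in>A. es ! a = w a})"
  define e where "e = real (card G')"
  define X where "X = \<Delta> {i, j, k}"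
  define D where "D = ext_ratio k"
  define er where "er x = ext_ratio (col x)" for x
  define De where "De a = \<Delta> (pair_at a)" for a
  define P where "P = A \<union> nxt ` A"
  have pos: "X > 0" "er x > 0" "De x > 0" "e > 0" "D \<ge> 1" for x
    using \<Delta>pos ext_ratio_pos ext_ratio_k_ge_1 G'(2) finite_G' by (auto simp: X_def er_def De_def e_def D_def card_gt_0_iff)
  note ge0 = less_imp_le[OF pos(1)] less_imp_le[OF pos(2)] less_imp_le[OF pos(3)] less_imp_le[OF pos(4)]
  have "a0 < L" using A by auto
  then have "nxt a0 \<noteq> a0" using nxt_eq[of a0] l by auto
  moreover have "nxt a0 \<in> P" "a0 \<in> P" using A(2) unfolding P_def by blast+
  ultimately have a0: "a0 < L" "nxt a0 \<noteq> a0" "nxt a0 \<in> P" "a0 \<in> P" using \<open>a0 < L\<close> by auto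
  have P: "P \<subseteq> {..<L}" using A nxt_less by (auto simp: P_def)
  have finP: "finite P" "finite A" using P A(1) finite_subset by auto
  note n0 = n_pos
  define y where "y = e / n\<^sup>2"
  have y: "0 < y" "y \<le> De a" if "a < L" for a
  proof -
    show "0 < y" using pos(4) n0 by (simp add: y_def)
    have "card (pair_at a) = 2" using col_nxt[OF that] by (simp add: pair_at_def)
    then have "e \<le> real n ^ 2 * De a" using card_le_shadow[OF pair_at_subset[of a]] by (simp add: e_def De_def)
    then show "y \<le> De a" using n0 by (simp add: y_def field_simps)
  qed
  define U where "U = (\<Prod>x\<in>{..<L} - P. \<mu> * er x) * (\<Prod>a\<in>{..<L} - A. De a)"
  have NU: "N \<le> U" unfolding N_def U_def er_def De_def P_def by (rule card_cycles_fixed_le[OF A])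
  have prodP: "(\<Prod>x<L. f x) = (\<Prod>x\<in>{..<L} - B. f x) * (\<Prod>x\<in>B. f x)" if "B \<subseteq> {..<L}" for B and f :: "nat \<Rightarrow> real"
    by (rule prod.subset_diff[OF that]) simp
  have s1: "U * (\<Prod>x\<in>P. er x) * (\<Prod>a\<in>A. De a) \<le> \<mu> ^ L * (\<Prod>x<L. er x) * (\<Prod>a<L. De a)"
  proof -
    have "card ({..<L} - P) \<le> L" using card_mono[of "{..<L}" "{..<L} - P"] by auto
    then have "\<mu> ^ card ({..<L} - P) \<le> \<mu> ^ L" using \<mu> by (intro power_increasing) auto
    then have "(\<Prod>x\<in>{..<L} - P. \<mu> * er x) \<le> \<mu> ^ L * (\<Prod>x\<in>{..<L} - P. er x)"
      using ge0 by (simp add: prod.distrib mult_right_mono prod_nonneg)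
    then have "U * (\<Prod>x\<in>P. er x) * (\<Prod>a\<in>A. De a) \<le> \<mu> ^ L * (\<Prod>x\<in>{..<L} - P. er x) * (\<Prod>a\<in>{..<L} - A. De a) * (\<Prod>x\<in>P. er x) * (\<Prod>a\<in>A. De a)"
      unfolding U_def using ge0 by (intro mult_right_mono prod_nonneg) auto
    also have "\<dots> = \<mu> ^ L * (\<Prod>x<L. er x) * (\<Prod>a<L. De a)"
      unfolding prodP[OF P, of er] prodP[OF A(1), of De] by (simp only: mult_ac)
    finally show ?thesis .
  qed
  have s2: "e / X * (\<Prod>x\<in>{3..<L}. er x) * (\<Prod>a<L. De a) \<le> (2 * \<mu>) ^ L * (\<mu> * \<kappa>) ^ L * card cycles"
  proof -
    have "(\<Prod>x\<in>{3..<L}. er x) = (2 * \<mu>) ^ (L - 3) * (\<Prod>x\<in>{3..<L}. er x / (2 * \<mu>))"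
      using \<mu> by (simp add: prod_dividef)
    moreover have "(\<Prod>a<L. De a) = (\<mu> * \<kappa>) ^ L * (\<Prod>a<L. De a / (\<mu> * \<kappa>))"
      using \<mu> \<kappa>_pos by (simp add: prod_dividef)
    ultimately have "e / X * (\<Prod>x\<in>{3..<L}. er x) * (\<Prod>a<L. De a) =
        (2 * \<mu>) ^ (L - 3) * ((\<mu> * \<kappa>) ^ L * (e / X * (\<Prod>x\<in>{3..<L}. er x / (2 * \<mu>)) * (\<Prod>a<L. De a / (\<mu> * \<kappa>))))"
      by (simp only: mult_ac)
    also have "\<dots> \<le> (2 * \<mu>) ^ (L - 3) * ((\<mu> * \<kappa>) ^ L * card cycles)"
      using card_cycles_ge \<mu> \<kappa>_pos unfolding e_def X_def er_def De_def by (intro mult_left_mono) auto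
    also have "\<dots> \<le> (2 * \<mu>) ^ L * ((\<mu> * \<kappa>) ^ L * card cycles)"
      using \<mu> \<kappa>_pos by (intro mult_right_mono power_increasing) auto
    finally show ?thesis by (simp only: mult.assoc)
  qed
  have s3: "(\<Prod>x<L. er x) = er 0 * er 1 * er 2 * (\<Prod>x\<in>{3..<L}. er x)"
  proof -
    have "{..<L} = {0, 1, 2} \<union> {3..<L}" using L3 by auto
    then have "(\<Prod>x<L. er x) = (\<Prod>x\<in>{0, 1, 2} \<union> {3..<L}. er x)" by simp
    also have "\<dots> = (\<Prod>x\<in>{0, 1, 2}. er x) * (\<Prod>x\<in>{3..<L}. er x)" by (intro prod.union_disjoint) auto
    finally show ?thesis by (simp add: mult_ac)
  qed
  have s4: "er a0 * er (nxt a0) * D ^ (card P - 2) \<le> (\<Prod>x\<in>P. er x)"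
  proof -
    have "(\<Prod>x\<in>P. er x) = (\<Prod>x\<in>P - {a0, nxt a0}. er x) * (\<Prod>x\<in>{a0, nxt a0}. er x)"
      using a0 finP by (intro prod.subset_diff) auto
    moreover have "(\<Prod>x\<in>{a0, nxt a0}. er x) = er a0 * er (nxt a0)" using a0 by auto
    moreover have "(\<Prod>x\<in>P - {a0, nxt a0}. D) \<le> (\<Prod>x\<in>P - {a0, nxt a0}. er x)"
      using pos(5) ext_ratio_ge[OF col_in(1)] by (intro prod_mono) (auto simp: D_def er_def)
    moreover have "card (P - {a0, nxt a0}) = card P - 2" using a0 finP by (simp add: card_Diff_subset)
    ultimately show ?thesis using ge0(2)[of a0] ge0(2)[of "nxt a0"] by (simp add: mult.commute mult_left_mono)
  qed
  have s5: "er 0 * er 1 * er 2 * X = er a0 * er (nxt a0) * De a0"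
  proof -
    have "col 0 = k" "col 1 = i" "col 2 = j" by (auto simp: col_def)
    then show ?thesis unfolding er_def X_def De_def pair_at_def
      using ext_ratio_prod[OF col_in(1) col_in(1) col_nxt[OF a0(1)]] by simp
  qed
  have s6: "De a0 * y ^ (card A - 1) \<le> (\<Prod>a\<in>A. De a)"
  proof -
    have "(\<Prod>a\<in>A - {a0}. y) \<le> (\<Prod>a\<in>A - {a0}. De a)"
      using y A by (intro prod_mono) (auto intro: less_imp_le)
    then show ?thesis using prod.remove[OF finP(2) A(2), of De] ge0(3)[of a0] finP A
      by (simp add: mult_left_mono)
  qed
  define F where "F = er a0 * er (nxt a0) * De a0"
  have F: "F > 0" using pos by (simp add: F_def)
  have "F * (N * e * D ^ (card P - 2) * y ^ (card A - 1)) =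
      e * (N * (er a0 * er (nxt a0) * D ^ (card P - 2)) * (De a0 * y ^ (card A - 1)))" by (simp only: F_def mult_ac)
  also have "\<dots> \<le> e * (U * (\<Prod>x\<in>P. er x) * (\<Prod>a\<in>A. De a))"
  proof -
    have U0: "0 \<le> U" using NU by (intro order.trans[OF _ NU]) (simp add: N_def)
    have P0: "0 \<le> (\<Prod>x\<in>P. er x)" "0 \<le> er a0 * er (nxt a0) * D ^ (card P - 2)"
      using ge0 pos(5) by (auto intro!: prod_nonneg mult_nonneg_nonneg)
    have "0 \<le> De a0 * y ^ (card A - 1)" using ge0 y(1)[OF a0(1)] by simp
    then show ?thesis by (intro mult_left_mono mult_mono s4 s6 NU U0 P0 mult_nonneg_nonneg ge0 zero_le_power less_imp_le[OF y(1)[OF a0(1)]])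
  qed
  also have "\<dots> \<le> e * (\<mu> ^ L * (\<Prod>x<L. er x) * (\<Prod>a<L. De a))" using ge0 by (intro mult_left_mono s1)
  also have "\<dots> = \<mu> ^ L * (er 0 * er 1 * er 2 * X) * (e / X * (\<Prod>x\<in>{3..<L}. er x) * (\<Prod>a<L. De a))"
    unfolding s3 using pos(1) by simp
  also have "\<dots> \<le> \<mu> ^ L * (er 0 * er 1 * er 2 * X) * ((2 * \<mu>) ^ L * (\<mu> * \<kappa>) ^ L * card cycles)"
    using ge0 \<mu> by (intro mult_left_mono s2) auto
  also have "\<dots> = F * ((2 * \<kappa>) ^ L * \<mu> ^ (3 * L) * card cycles)"
  proof -
    have "3 * L = L + L + L" by simp
    then have "\<mu> ^ (3 * L) = \<mu> ^ L * \<mu> ^ L * \<mu> ^ L" by (simp only: power_add)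
    then show ?thesis unfolding s5 F_def[symmetric] by (simp only: power_mult_distrib mult_ac)
  qed
  finally have "N * e * D ^ (card P - 2) * y ^ (card A - 1) \<le> (2 * \<kappa>) ^ L * \<mu> ^ (3 * L) * card cycles"
    by (simp only: mult_le_cancel_left_pos[OF F])
  then show ?thesis unfolding N_def e_def D_def y_def P_def .
qed

definition edge_sets :: "nat list \<times> (nat \<Rightarrow> nat) list \<Rightarrow> nat set set" where
  "edge_sets c = (\<lambda>e. e ` {..<r}) ` set (snd c)"

lemma edge_sets_copy: "c \<in> cycles \<Longrightarrow> edge_sets c \<in> cycle_copies n r L"
proof -
  assume "c \<in> cycles"
  then obtain v es where c: "c = (v, es)" "(v, es) \<in> cycles" by (cases c) auto
  note D = cyclesD[OF c(2)]
  have v: "length v = L" "distinct v" using D(1)[of 0] by (auto simp: cores_def)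
  have setv: "(\<lambda>a. v ! a) ` {..<L} = set v" using v(1) by (auto simp: set_conv_nth)
  have esG: "inj_on (es ! a) {..<r}" "es ! a \<in> {..<r} \<rightarrow>\<^sub>E {..<n}" if "a < L" for a
    using D(3)[OF that] inj G by auto
  have "\<exists>\<phi>. inj_on \<phi> (fst (linear_cycle r L)) \<and> (\<forall>a<L. \<phi> ` expand_edge r {a, (a + 1) mod L} = (es ! a) ` {..<r})"
  proof (rule linear_cycle_map_exists[where v = "\<lambda>a. v ! a"])
    show "L \<ge> 3" by (rule L3)
    show "inj_on (\<lambda>a. v ! a) {..<L}" using v by (auto simp: inj_on_def nth_eq_iff_index_eq)
  next
    fix a assume a: "a < L"
    show "finite ((es ! a) ` {..<r}) \<and> card ((es ! a) ` {..<r}) = r" using esG(1)[OF a] by (simp add: card_image)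
    show "(es ! a) ` {..<r} \<inter> (\<lambda>a. v ! a) ` {..<L} = {v ! a, v ! ((a + 1) mod L)}" unfolding setv
    proof (intro equalityI subsetI)
      fix x assume "x \<in> (es ! a) ` {..<r} \<inter> set v"
      then obtain t where t: "t < r" "x = (es ! a) t" "x \<in> set v" by auto
      then have "t \<in> pair_at a" using D(6)[OF a, of t] by auto
      then show "x \<in> {v ! a, v ! ((a + 1) mod L)}" using t D(4,5)[OF a] by (auto simp: pair_at_def nxt_def)
    next
      fix x assume "x \<in> {v ! a, v ! ((a + 1) mod L)}"
      then have "x = (es ! a) (col a) \<or> x = (es ! a) (col (nxt a))" "x = v ! a \<or> x = v ! nxt a"
        using D(4,5)[OF a] by (auto simp: nxt_def)
      then show "x \<in> (es ! a) ` {..<r} \<inter> set v" using col_in(2) nxt_less[of a] a v(1) by (auto simp: set_conv_nth)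
    qed
  next
    fix a b :: nat assume ab: "a < b" "b < L"
    show "(es ! a) ` {..<r} \<inter> (es ! b) ` {..<r} \<subseteq> (\<lambda>a. v ! a) ` {..<L}" unfolding setv
    proof
      fix x assume x: "x \<in> (es ! a) ` {..<r} \<inter> (es ! b) ` {..<r}"
      then obtain t where t: "t < r" "x = (es ! b) t" by auto
      have "t \<in> pair_at b" using D(7)[OF ab(2,1)] x t by auto
      then have "x = v ! b \<or> x = v ! nxt b" using t D(4,5)[OF ab(2)] by (auto simp: pair_at_def)
      then show "x \<in> set v" using ab nxt_less[of b] v(1) by auto
    qed
  qed
  then obtain \<phi> where \<phi>: "inj_on \<phi> (fst (linear_cycle r L))"
    "\<And>a. a < L \<Longrightarrow> \<phi> ` expand_edge r {a, (a + 1) mod L} = (es ! a) ` {..<r}" by blast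
  have img: "(`) \<phi> ` snd (linear_cycle r L) = edge_sets c"
    unfolding snd_linear_cycle edge_sets_def c(1) using \<phi>(2) D(2)[of 0] by (auto simp: set_conv_nth image_image image_iff)
  have "\<phi> ` fst (linear_cycle r L) = \<Union> ((`) \<phi> ` snd (linear_cycle r L))"
    by (subst Union_linear_cycle[symmetric]) auto
  also have "\<dots> \<subseteq> {..<n}" unfolding img edge_sets_def c(1) using D(2)[of 0] esG(2) by (force simp: set_conv_nth)
  finally show ?thesis unfolding cycle_copies_def using \<phi>(1) img by blast
qed

text \<open>A nonempty set of indices closed under the cyclic successor is everything.\<close>

lemma card_nxt_closure:
  assumes A: "A \<subseteq> {..<L}" "A \<noteq> {}" "A \<noteq> {..<L}"
  shows "card A + 1 \<le> card (A \<union> nxt ` A)"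
proof -
  have finA: "finite A" using A finite_subset by blast
  have "\<not> nxt ` A \<subseteq> A"
  proof
    assume cl: "nxt ` A \<subseteq> A"
    obtain a0 where a0: "a0 \<in> A" using A by auto
    have "(a0 + d) mod L \<in> A" for d
    proof (induction d)
      case 0
      then show ?case using a0 A by auto
    next
      case (Suc d)
      then have "nxt ((a0 + d) mod L) \<in> A" using cl by auto
      then show ?case by (simp add: nxt_def mod_Suc_eq)
    qed
    then have "x \<in> A" if "x < L" for x
    proof -
      have "a0 < L" using a0 A by auto
      have "a0 + (x + L - a0) = x + L" using \<open>a0 < L\<close> by simp
      then have "(a0 + (x + L - a0)) mod L = x" using that by (simp only: mod_add_self2 mod_less)
      then show ?thesis using \<open>\<And>d. (a0 + d) mod L \<in> A\<close>[of "x + L - a0"] by simp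
    qed
    then show False using A by auto
  qed
  then have "A \<subset> A \<union> nxt ` A" by auto
  then have "card A < card (A \<union> nxt ` A)" using finA by (intro psubset_card_mono) auto
  then show ?thesis by simp
qed

text \<open>For the whole cycle, \<open>2 * l - 1\<close> saved vertex factors stand against
  \<open>2 * l\<close> edges after the first. A proper set of edges saves at least one factor per
  further edge, so the whole cycle is the worst case.\<close>

definition \<theta> :: real where
  "\<theta> = (2 * real l - 1) / (2 * real l)"

text \<open>The elements of \<open>S\<close> may occupy any places of the cycle, so the count is a
  union over the assignments \<open>\<alpha>\<close>, of which there are at most
  \<open>L ^ L\<close>.\<close>

lemma card_containing_le:
  assumes S: "2 \<le> card S" "card S \<le> L"
  shows "card {c \<in> cycles. S \<subseteq> edge_sets c} * real (card G') \<le>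
    real L ^ L * ((2 * \<kappa>) ^ L * \<mu> ^ (3 * L)) * (n\<^sup>2 / card G' * ext_ratio k powr (- \<theta>)) ^ (card S - 1) * card cycles"
proof -
  define K where "K = (2 * \<kappa>) ^ L * \<mu> ^ (3 * L)"
  define Y where "Y = n\<^sup>2 / card G' * ext_ratio k powr (- \<theta>)"
  have K: "K \<ge> 0" using \<kappa>_pos \<mu> by (simp add: K_def)
  have finS: "finite S" using S card.infinite by fastforce
  have e: "real (card G') > 0" using finite_G' G' by (simp add: card_gt_0_iff)
  note n0 = n_pos
  define T where "T \<alpha> = {(v, es) \<in> cycles. \<forall>E\<in>S. (es ! \<alpha> E) ` {..<r} = E}" for \<alpha> :: "nat set \<Rightarrow> nat"
  have one: "card (T \<alpha>) * real (card G') \<le> K * Y ^ (card S - 1) * card cycles"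
    if \<alpha>: "\<alpha> \<in> S \<rightarrow>\<^sub>E {..<L}" for \<alpha>
  proof (cases "T \<alpha> = {}")
    case True
    then show ?thesis using K by (simp add: Y_def)
  next
    case False
    then obtain v0 es0 where T0: "(v0, es0) \<in> T \<alpha>" by auto
    define A where "A = \<alpha> ` S"
    have inj\<alpha>: "inj_on \<alpha> S"
    proof (rule inj_onI)
      fix E F assume "E \<in> S" "F \<in> S" "\<alpha> E = \<alpha> F"
      moreover have "(es0 ! \<alpha> E) ` {..<r} = E" "(es0 ! \<alpha> F) ` {..<r} = F"
        using T0 \<open>E \<in> S\<close> \<open>F \<in> S\<close> by (auto simp: T_def)
      ultimately show "E = F" by metis
    qed
    have cardA: "card A = card S" unfolding A_def by (rule card_image[OF inj\<alpha>])
    have AL: "A \<subseteq> {..<L}" using \<alpha> by (auto simp: A_def)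
    obtain a0 where a0: "a0 \<in> A" using cardA S by fastforce
    \<comment> \<open>Two cycles agreeing in an edge as a set agree in its function by
      \<open>inj_image\<close>, so any single member of \<open>T \<alpha>\<close> supplies the
      prescribed functions.\<close>
    have "T \<alpha> \<subseteq> {(v, es) \<in> cycles. \<forall>a\<in>A. es ! a = es0 ! a}"
    proof (rule subrelI)
      fix v es assume T: "(v, es) \<in> T \<alpha>"
      have "es ! a = es0 ! a" if aA: "a \<in> A" for a
      proof -
        obtain E where E: "E \<in> S" "a = \<alpha> E" using aA by (auto simp: A_def)
        then have "(es ! a) ` {..<r} = (es0 ! a) ` {..<r}" using T T0 by (auto simp: T_def)
        moreover have "es ! a \<in> G" "es0 ! a \<in> G" using cyclesD(3)[of _ _ a] T T0 that AL by (auto simp: T_def)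
        ultimately show ?thesis using inj_image by (auto simp: inj_on_def)
      qed
      then show "(v, es) \<in> {(v, es) \<in> cycles. \<forall>a\<in>A. es ! a = es0 ! a}" using T by (auto simp: T_def)
    qed
    then have "card (T \<alpha>) \<le> card {(v, es) \<in> cycles. \<forall>a\<in>A. es ! a = es0 ! a}"
      using finite_cycles by (intro card_mono) (auto intro: finite_subset[of _ cycles])
    then have N: "real (card (T \<alpha>)) * (card G' * ext_ratio k ^ (card (A \<union> nxt ` A) - 2) * (card G' / n\<^sup>2) ^ (card A - 1)) \<le>
        card {(v, es) \<in> cycles. \<forall>a\<in>A. es ! a = es0 ! a} * (card G' * ext_ratio k ^ (card (A \<union> nxt ` A) - 2) * (card G' / n\<^sup>2) ^ (card A - 1))"
      using ext_ratio_pos[of k] by (intro mult_right_mono) auto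
    also have "\<dots> \<le> K * card cycles" unfolding K_def
      using card_fixed_le_ratio[OF AL a0, of "\<lambda>a. es0 ! a"] by (simp only: mult.assoc)
    finally have main: "real (card (T \<alpha>)) * (card G' * ext_ratio k ^ (card (A \<union> nxt ` A) - 2) * (card G' / n\<^sup>2) ^ (card A - 1)) \<le> K * card cycles" .
    have pw: "(ext_ratio k powr \<theta>) ^ (card S - 1) \<le> ext_ratio k ^ (card (A \<union> nxt ` A) - 2)"
    proof -
      have lp: "real l \<ge> 1" using l by simp
      have "\<theta> * real (card S - 1) \<le> real (card (A \<union> nxt ` A) - 2)"
      proof (cases "A = {..<L}")
        case True
        then have "card S = L" using cardA by simp
        moreover have "A \<union> nxt ` A = {..<L}" using True nxt_less by auto
        ultimately show ?thesis using lp by (simp add: \<theta>_def of_nat_diff)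
      next
        case False
        then have "card S + 1 \<le> card (A \<union> nxt ` A)" using card_nxt_closure[OF AL _ False] a0 cardA by auto
        then have "real (card S - 1) \<le> real (card (A \<union> nxt ` A) - 2)" by simp
        moreover have "\<theta> * real (card S - 1) \<le> 1 * real (card S - 1)"
          using lp by (intro mult_right_mono) (auto simp: \<theta>_def field_simps)
        ultimately show ?thesis by linarith
      qed
      then have "ext_ratio k powr (\<theta> * real (card S - 1)) \<le> ext_ratio k powr real (card (A \<union> nxt ` A) - 2)"
        using ext_ratio_k_ge_1 by (intro powr_mono)
      then show ?thesis using ext_ratio_pos[of k] by (simp add: powr_powr[symmetric] powr_realpow)
    qed
    have "(card G' / n\<^sup>2 * ext_ratio k powr \<theta>) ^ (card S - 1) * Y ^ (card S - 1) = 1"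
      unfolding power_mult_distrib[symmetric] Y_def using e n0 ext_ratio_pos[of k]
      by (simp add: powr_minus field_simps)
    then have Y1: "(ext_ratio k powr \<theta>) ^ (card S - 1) * (card G' / n\<^sup>2) ^ (card S - 1) * Y ^ (card S - 1) = 1"
      unfolding power_mult_distrib by (simp only: mult_ac)
    have "real (card (T \<alpha>)) * card G' = real (card (T \<alpha>)) * card G' *
        ((ext_ratio k powr \<theta>) ^ (card S - 1) * (card G' / n\<^sup>2) ^ (card S - 1) * Y ^ (card S - 1))"
      unfolding Y1 by simp
    also have "\<dots> =
        real (card (T \<alpha>)) * (card G' * (ext_ratio k powr \<theta>) ^ (card S - 1) * (card G' / n\<^sup>2) ^ (card S - 1)) * Y ^ (card S - 1)"
      by (simp only: mult_ac)
    also have "\<dots> \<le> real (card (T \<alpha>)) * (card G' * ext_ratio k ^ (card (A \<union> nxt ` A) - 2) * (card G' / n\<^sup>2) ^ (card S - 1)) * Y ^ (card S - 1)"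
      using pw by (intro mult_right_mono mult_left_mono) (auto simp: Y_def)
    also have "\<dots> \<le> K * card cycles * Y ^ (card S - 1)"
      using main unfolding cardA by (intro mult_right_mono) (auto simp: Y_def)
    finally show ?thesis by (simp add: mult_ac)
  qed
  have "{c \<in> cycles. S \<subseteq> edge_sets c} \<subseteq> (\<Union>\<alpha>\<in>S \<rightarrow>\<^sub>E {..<L}. T \<alpha>)"
  proof
    fix c assume c: "c \<in> {c \<in> cycles. S \<subseteq> edge_sets c}"
    obtain v es where ves: "c = (v, es)" by (cases c)
    then have cyc: "(v, es) \<in> cycles" using c by simp
    have "\<exists>a. a < L \<and> (es ! a) ` {..<r} = E" if "E \<in> S" for E
    proof -
      have "E \<in> (\<lambda>e. e ` {..<r}) ` set es" using c that ves by (auto simp: edge_sets_def)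
      then show ?thesis using cyclesD(2)[OF cyc, of 0] by (auto simp: in_set_conv_nth)
    qed
    then obtain \<alpha> where \<alpha>: "\<And>E. E \<in> S \<Longrightarrow> \<alpha> E < L \<and> (es ! \<alpha> E) ` {..<r} = E" by metis
    then have "restrict \<alpha> S \<in> S \<rightarrow>\<^sub>E {..<L}" "c \<in> T (restrict \<alpha> S)" using cyc ves by (auto simp: T_def)
    then show "c \<in> (\<Union>\<alpha>\<in>S \<rightarrow>\<^sub>E {..<L}. T \<alpha>)" by blast
  qed
  moreover have finPi: "finite (S \<rightarrow>\<^sub>E {..<L})" using finS by (intro finite_PiE) auto
  moreover have "finite (T \<alpha>)" for \<alpha> using finite_cycles by (auto simp: T_def intro: finite_subset[of _ cycles])
  ultimately have "card {c \<in> cycles. S \<subseteq> edge_sets c} \<le> card (\<Union>\<alpha>\<in>S \<rightarrow>\<^sub>E {..<L}. T \<alpha>)" by (intro card_mono) auto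
  also have "\<dots> \<le> (\<Sum>\<alpha>\<in>S \<rightarrow>\<^sub>E {..<L}. card (T \<alpha>))" by (intro card_UN_le finPi)
  finally have "real (card {c \<in> cycles. S \<subseteq> edge_sets c}) \<le> real (\<Sum>\<alpha>\<in>S \<rightarrow>\<^sub>E {..<L}. card (T \<alpha>))" by (rule of_nat_mono)
  then have "card {c \<in> cycles. S \<subseteq> edge_sets c} * real (card G') \<le> real (\<Sum>\<alpha>\<in>S \<rightarrow>\<^sub>E {..<L}. card (T \<alpha>)) * card G'"
    by (intro mult_right_mono) auto
  also have "\<dots> = (\<Sum>\<alpha>\<in>S \<rightarrow>\<^sub>E {..<L}. card (T \<alpha>) * real (card G'))" by (simp add: sum_distrib_right)
  also have "\<dots> \<le> (\<Sum>\<alpha>\<in>S \<rightarrow>\<^sub>E {..<L}. K * Y ^ (card S - 1) * card cycles)" by (intro sum_mono one)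
  also have "\<dots> = real L ^ card S * (K * Y ^ (card S - 1) * card cycles)" using finS by (simp add: card_PiE)
  also have "\<dots> \<le> real L ^ L * (K * Y ^ (card S - 1) * card cycles)"
    using S K by (intro mult_right_mono power_increasing) (auto simp: Y_def)
  finally show ?thesis unfolding K_def Y_def by (simp only: mult.assoc)
qed

lemma cycles_nonempty: "card cycles > 0"
proof -
  have "0 < card G' / \<Delta> {i, j, k} * (\<Prod>a\<in>{3..<L}. ext_ratio (col a) / (2 * \<mu>)) * (\<Prod>a<L. \<Delta> (pair_at a) / (\<mu> * \<kappa>))"
  proof -
    have "0 < real (card G')" "0 < \<mu>" using finite_G' G' \<mu> by (auto simp: card_gt_0_iff)
    then show ?thesis
      by (intro mult_pos_pos divide_pos_pos prod_pos \<Delta>pos ext_ratio_pos \<kappa>_pos) simp_all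
  qed
  then show ?thesis using card_cycles_ge by linarith
qed

text \<open>A copy is weighted by the number of elements of \<open>cycles\<close> that produce it.
  As \<open>K \<ge> 1\<close> and \<open>card S \<ge> 2\<close>, the constant may be raised to the
  power \<open>card S - 1\<close>, which brings the degree bound into the form
  \<open>q ^ (card S - 1)\<close>.\<close>

lemma spread_container:
  fixes c q :: real
  assumes C: "finite C" "(\<lambda>f. f ` {..<r}) ` G \<subseteq> C" "card C \<le> c * card G'" and c: "c \<ge> 1"
    and q: "real L ^ L * ((2 * \<kappa>) ^ L * \<mu> ^ (3 * L)) * c * (n\<^sup>2 / card G' * ext_ratio k powr (- \<theta>)) < q"
  shows "spread q L (cycle_copies n r L) C"
proof -
  define w where "w E = real (card {c \<in> cycles. edge_sets c = E})" for E
  define \<S> where "\<S> = edge_sets ` cycles"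
  define K where "K = real L ^ L * ((2 * \<kappa>) ^ L * \<mu> ^ (3 * L)) * c"
  define Y where "Y = n\<^sup>2 / card G' * ext_ratio k powr (- \<theta>)"
  have "1 \<le> K"
  proof -
    have "1 \<le> \<kappa>" unfolding \<kappa>_def by (metis \<kappa>_def \<kappa>_pos of_nat_0_less_iff of_nat_1 of_nat_le_iff Suc_leI One_nat_def)
    then have "1 * (1 * 1) * 1 \<le> K" unfolding K_def using \<mu> c
      by (intro mult_mono one_le_power mult_nonneg_nonneg) auto
    then show ?thesis by simp
  qed
  have sumw: "sum w {E \<in> \<S>. P E} = card {c \<in> cycles. P (edge_sets c)}" for P
  proof -
    have "card {c \<in> cycles. P (edge_sets c)} = (\<Sum>E\<in>{E \<in> \<S>. P E}. card {c' \<in> {c \<in> cycles. P (edge_sets c)}. edge_sets c' = E})"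
      unfolding card_eq_sum \<S>_def using finite_cycles by (intro sum.group[symmetric]) auto
    also have "\<dots> = (\<Sum>E\<in>{E \<in> \<S>. P E}. card {c' \<in> cycles. edge_sets c' = E})"
      by (intro sum.cong refl arg_cong[where f = card]) auto
    finally show ?thesis by (simp add: w_def)
  qed
  have sumwS: "sum w \<S> = card cycles" using sumw[of "\<lambda>_. True"] by simp
  show ?thesis unfolding spread_def
  proof (intro exI[of _ \<S>] exI[of _ w] conjI ballI allI impI)
    show "finite \<S>" using finite_cycles by (simp add: \<S>_def)
    show "\<S> \<subseteq> cycle_copies n r L" using edge_sets_copy by (auto simp: \<S>_def)
    show "0 < sum w \<S>" using cycles_nonempty sumwS by simp
    fix E assume "E \<in> \<S>"
    then obtain v es where E: "(v, es) \<in> cycles" "E = edge_sets (v, es)" by (auto simp: \<S>_def)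
    have "length es = L" using cyclesD(2)[OF E(1), of 0] by simp
    then have "set es \<subseteq> G" using cyclesD(3)[OF E(1)] by (auto simp: in_set_conv_nth)
    then show "E \<subseteq> C" using C(2) E(2) by (auto simp: edge_sets_def)
    have "card E \<le> card (set es)" unfolding E(2) edge_sets_def snd_conv by (intro card_image_le) simp
    also have "\<dots> \<le> L" using card_length[of es] cyclesD(2)[OF E(1), of 0] by simp
    finally show "card E \<le> L" .
    show "0 \<le> w E" by (simp add: w_def)
  next
    fix S assume S: "S \<subseteq> C \<and> 2 \<le> card S \<and> card S \<le> L"
    have Ypos: "Y \<ge> 0" by (simp add: Y_def)
    have "real (card C) * sum w {E \<in> \<S>. S \<subseteq> E} \<le> c * card G' * card {c \<in> cycles. S \<subseteq> edge_sets c}"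
      unfolding sumw using C(3) by (intro mult_right_mono) auto
    also have "\<dots> = c * (card {c \<in> cycles. S \<subseteq> edge_sets c} * real (card G'))" by simp
    also have "\<dots> \<le> c * (real L ^ L * ((2 * \<kappa>) ^ L * \<mu> ^ (3 * L)) * Y ^ (card S - 1) * card cycles)"
      unfolding Y_def using S c by (intro mult_left_mono card_containing_le) auto
    also have "\<dots> = K * Y ^ (card S - 1) * card cycles" by (simp add: K_def)
    also have "\<dots> \<le> K ^ (card S - 1) * Y ^ (card S - 1) * card cycles"
    proof -
      have "K ^ 1 \<le> K ^ (card S - 1)" using S \<open>1 \<le> K\<close> by (intro power_increasing) auto
      then show ?thesis using Ypos by (intro mult_right_mono) auto
    qed
    also have "\<dots> < q ^ (card S - 1) * card cycles"
    proof -
      have "(K * Y) ^ (card S - 1) < q ^ (card S - 1)"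
        using q S \<open>1 \<le> K\<close> Ypos unfolding K_def[symmetric] Y_def[symmetric] by (intro power_strict_mono) auto
      then show ?thesis using cycles_nonempty by (simp add: power_mult_distrib)
    qed
    finally show "real (card C) * sum w {E \<in> \<S>. S \<subseteq> E} < q ^ (card S - 1) * sum w \<S>" unfolding sumwS .
  qed
qed

end

section \<open>Supersaturation and containers for linear cycles\<close>

definition rsets :: "nat \<Rightarrow> nat \<Rightarrow> nat set set" where
  "rsets n r = {e. e \<subseteq> {..<n} \<and> card e = r}"

text \<open>This is \<open>\<theta> / (r - 2)\<close>: the spread bound contains
  \<open>ext_ratio k\<close> to the power \<open>- \<theta>\<close>, and \<open>ext_ratio k\<close>
  is at least about the root of order \<open>r - 2\<close> of \<open>M / n^2\<close>.\<close>

definition scale_exponent :: "nat \<Rightarrow> nat \<Rightarrow> real" where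
  "scale_exponent r l = (2 * real l - 1) / (2 * real l * (real r - 2))"

text \<open>The size, up to \<open>n powr o(1)\<close>, of a fingerprint of a container of size \<open>M\<close>.\<close>

definition fingerprint_scale :: "nat \<Rightarrow> nat \<Rightarrow> nat \<Rightarrow> real \<Rightarrow> real" where
  "fingerprint_scale r l n M = real n ^ 2 * (M / real n ^ 2) powr (- scale_exponent r l)"

lemma finite_rsets: "finite (rsets n r)"
  by (rule finite_subset[of _ "Pow {..<n}"]) (auto simp: rsets_def)

lemma card_rsets_le: "card (rsets n r) \<le> n ^ r"
proof -
  have "card (rsets n r) = n choose r" using n_subsets[of "{..<n}" r] by (simp add: rsets_def)
  then show ?thesis by (cases "r \<le> n") (auto simp: binomial_le_pow binomial_eq_0)
qed

text \<open>One arbitrary ordering is chosen for each edge, so functions and edges correspond one to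
  one.\<close>

lemma tuple_family:
  assumes "E \<subseteq> rsets n r"
  obtains G where "G \<subseteq> {..<r} \<rightarrow>\<^sub>E {..<n}" "\<And>f. f \<in> G \<Longrightarrow> inj_on f {..<r}"
    "inj_on (\<lambda>f. f ` {..<r}) G" "(\<lambda>f. f ` {..<r}) ` G = E"
proof -
  have "\<exists>f. f \<in> {..<r} \<rightarrow>\<^sub>E {..<n} \<and> inj_on f {..<r} \<and> f ` {..<r} = e" if "e \<in> E" for e
  proof -
    have "e \<subseteq> {..<n}" "card e = r" using that assms by (auto simp: rsets_def)
    moreover then have "finite e" using finite_subset by blast
    ultimately obtain f where f: "bij_betw f {..<r} e" using ex_bij_betw_nat_finite[of e] by (auto simp: atLeast0LessThan)
    then show ?thesis using \<open>e \<subseteq> {..<n}\<close>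
      by (intro exI[of _ "restrict f {..<r}"]) (auto simp: bij_betw_def inj_on_def)
  qed
  then obtain g where g: "\<And>e. e \<in> E \<Longrightarrow> g e \<in> {..<r} \<rightarrow>\<^sub>E {..<n} \<and> inj_on (g e) {..<r} \<and> g e ` {..<r} = e"
    by metis
  show ?thesis
  proof
    show "g ` E \<subseteq> {..<r} \<rightarrow>\<^sub>E {..<n}" using g by blast
    show "inj_on f {..<r}" if "f \<in> g ` E" for f using g that by blast
    show "inj_on (\<lambda>f. f ` {..<r}) (g ` E)" using g by (intro inj_onI) auto
    show "(\<lambda>f. f ` {..<r}) ` g ` E = E" using g by (force simp: image_image)
  qed
qed

text \<open>Classes of codegree at most \<open>w\<close> are removed. Each of the \<open>r\<close>
  shadows has at most \<open>n ^ (r - 1)\<close> elements, so half of the family survives. This is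
  the source of the floor of order \<open>n ^ (r - 1)\<close> for container sizes.\<close>

lemma clean_subfamily:
  assumes G: "G \<subseteq> {..<r} \<rightarrow>\<^sub>E {..<n}" and r: "r \<ge> 1" and big: "2 * real (r * (w + 1)) * real n ^ (r - 1) \<le> card G"
  obtains G1 where "G1 \<subseteq> G" "card G \<le> 2 * card G1"
    "\<And>t f. t < r \<Longrightarrow> f \<in> G1 \<Longrightarrow> w < degree_on G1 ({..<r} - {t}) f"
proof -
  have finG: "finite G" using G by (rule finite_subset) (auto intro: finite_PiE)
  define \<I> where "\<I> = (\<lambda>t. {..<r} - {t}) ` {..<r}"
  obtain G1 where G1: "G1 \<subseteq> G" "\<And>I f. I \<in> \<I> \<Longrightarrow> f \<in> G1 \<Longrightarrow> real (w + 1) \<le> degree_on G1 I f"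
    "real (card G) - (\<Sum>I\<in>\<I>. real (w + 1) * card (shadow G I)) \<le> card G1"
  proof (rule min_degree_subfamily[OF finG, of \<I> "\<lambda>_. real (w + 1)"])
    show "finite \<I>" by (simp add: \<I>_def)
  qed (auto intro: that)
  have sh: "card (shadow G I) \<le> n ^ (r - 1)" if I: "I \<in> \<I>" for I
  proof -
    obtain t where t: "t < r" "I = {..<r} - {t}" using I by (auto simp: \<I>_def)
    have "card (shadow G I) \<le> card (I \<rightarrow>\<^sub>E {..<n})"
    proof (intro card_mono finite_PiE)
      show "shadow G I \<subseteq> I \<rightarrow>\<^sub>E {..<n}" using G unfolding shadow_def
      proof (intro image_subsetI)
        fix f assume "f \<in> G"
        then have "f \<in> {..<r} \<rightarrow>\<^sub>E {..<n}" using G by auto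
        then show "restrict f I \<in> I \<rightarrow>\<^sub>E {..<n}" unfolding restrict_PiE_iff t(2) by (auto simp: PiE_iff)
      qed
    qed (auto simp: t)
    also have "\<dots> = n ^ (r - 1)" using t by (simp add: card_PiE)
    finally show ?thesis .
  qed
  have "(\<Sum>I\<in>\<I>. real (w + 1) * card (shadow G I)) \<le> (\<Sum>I\<in>\<I>. real (w + 1) * real n ^ (r - 1))"
  proof (intro sum_mono mult_left_mono)
    fix I assume "I \<in> \<I>"
    then have "real (card (shadow G I)) \<le> real (n ^ (r - 1))" by (intro of_nat_mono sh)
    then show "real (card (shadow G I)) \<le> real n ^ (r - 1)" by simp
  qed auto
  also have "\<dots> = real (card \<I>) * (real (w + 1) * real n ^ (r - 1))" by simp
  also have "\<dots> \<le> real r * (real (w + 1) * real n ^ (r - 1))"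
    using card_image_le[of "{..<r}" "\<lambda>t. {..<r} - {t}"] by (intro mult_right_mono) (auto simp: \<I>_def)
  also have "\<dots> = real (r * (w + 1)) * real n ^ (r - 1)" by (simp only: of_nat_mult mult.assoc)
  finally have "(\<Sum>I\<in>\<I>. real (w + 1) * card (shadow G I)) \<le> card G / 2" using big by linarith
  then have "real (card G) \<le> 2 * card G1" using G1(3) by linarith
  then have "card G \<le> 2 * card G1" by linarith
  moreover have "w < degree_on G1 ({..<r} - {t}) f" if "t < r" "f \<in> G1" for t f
    using G1(2)[of "{..<r} - {t}" f] that by (auto simp: \<I>_def)
  ultimately show ?thesis using G1(1) that by blast
qed

text \<open>The family is first cleaned to get \<open>G\<close>, then regularised to get
  \<open>G'\<close>. With \<open>y = M / n^2\<close>, the chosen pair degree is at least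
  \<open>y\<close> and the extension ratio \<open>D\<close> at least
  \<open>y powr (1 / (r - 2))\<close>, both up to constants and powers of \<open>\<mu>\<close>;
  \<open>spread_container\<close> then applies to \<open>E\<close>, because \<open>G\<close> maps
  into \<open>E\<close> and \<open>G'\<close> is not much smaller.\<close>

lemma supersaturation:
  assumes r: "r \<ge> 3" and l: "l \<ge> 1" and \<delta>: "\<delta> > 0"
  shows "\<forall>\<^sub>F n in sequentially. \<forall>E. E \<subseteq> rsets n r \<and>
      2 * real (r * ((2 * l + 1) * (r + 1) + 1)) * real n ^ (r - 1) \<le> card E \<and> real n powr (2 + \<delta>) \<le> card E \<longrightarrow>
      spread (real n powr \<delta> * fingerprint_scale r l n (card E) / card E) (2 * l + 1) (cycle_copies n r (2 * l + 1)) E"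
proof -
  define L where "L = 2 * l + 1"
  define w where "w = (2 * l + 1) * (r + 1)"
  define \<kappa> where "\<kappa> = real ((w + 1) ^ r)"
  \<comment> \<open>The final estimate loses \<open>\<mu> ^ (3 * L + 5)\<close>:
    \<open>3 * L\<close> from the counting of cycles, one from \<open>c = 2 * \<mu>\<close>, one
    from comparing \<open>card G'\<close> with \<open>M\<close>, three from the lower bound on
    \<open>D\<close>. The factor \<open>real r\<close> serves the fourth power lost in
    \<open>large\<close>, where only \<open>\<delta> / (r - 2)\<close> is available.\<close>
  define \<delta>1 where "\<delta>1 = \<delta> / (real r * (6 * real L + 10))"
  define \<theta> where "\<theta> = (2 * real l - 1) / (2 * real l)"
  define K where "K = real L ^ L * (2 * \<kappa>) ^ L"
  have \<theta>: "0 \<le> \<theta>" "\<theta> \<le> 1" using l by (auto simp: \<theta>_def field_simps)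
  have L3: "real L \<ge> 3" using l by (simp add: L_def)
  have K: "K \<ge> 0" by (simp add: K_def \<kappa>_def)
  have \<delta>1: "\<delta>1 > 0" using \<delta> r L3 by (simp add: \<delta>1_def)
  have \<delta>1a: "\<delta>1 * (3 * real L + 5) < \<delta>"
  proof -
    have "\<delta>1 * (3 * real L + 5) = \<delta> / (2 * real r)" using L3 r by (simp add: \<delta>1_def divide_simps)
    also have "\<dots> < \<delta> / 1" using \<delta> r by (intro divide_strict_left_mono) auto
    finally show ?thesis by simp
  qed
  have \<delta>1b: "4 * \<delta>1 < \<delta> / (real r - 2)"
  proof -
    have "4 * (real r - 2) < real r * (6 * real L + 10)"
    proof -
      have "4 * (real r - 2) < real r * 4" by simp
      also have "\<dots> \<le> real r * (6 * real L + 10)" using L3 by (intro mult_left_mono) auto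
      finally show ?thesis .
    qed
    moreover have "4 * (\<delta> / m) < \<delta> / s" if "4 * s < m" "s > 0" for m s :: real
      using that \<delta> by (simp add: field_simps)
    moreover have "real r - 2 > 0" using r by simp
    ultimately show ?thesis unfolding \<delta>1_def by blast
  qed
  have "\<forall>\<^sub>F n in sequentially. 8 * K * real n powr (\<delta>1 * (3 * real L + 5)) < real n powr \<delta>"
    using \<delta>1a \<delta>1 L3 by real_asymp
  moreover have "\<forall>\<^sub>F n in sequentially. 4 * real L * real n powr (4 * \<delta>1) \<le> real n powr (\<delta> / (real r - 2))"
    using \<delta>1b \<delta>1 L3 by real_asymp
  ultimately show ?thesis using eventually_regular_subfamily[OF \<delta>1, of r] eventually_gt_at_top[of 0]
  proof eventually_elim
    case (elim n)
    show ?case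
    proof (intro allI impI, elim conjE)
      fix E assume E: "E \<subseteq> rsets n r" "2 * real (r * ((2 * l + 1) * (r + 1) + 1)) * real n ^ (r - 1) \<le> card E"
        "real n powr (2 + \<delta>) \<le> card E"
      define \<mu> where "\<mu> = real n powr \<delta>1"
      define M where "M = real (card E)"
      have \<mu>: "\<mu> \<ge> 1" using elim \<delta>1 by (simp add: \<mu>_def ge_one_powr_ge_zero)
      have M: "M > 0" using E(3) elim(4) unfolding M_def by (smt (verit) powr_gt_zero of_nat_0_less_iff)
      obtain G0 where G0: "G0 \<subseteq> {..<r} \<rightarrow>\<^sub>E {..<n}" "\<And>f. f \<in> G0 \<Longrightarrow> inj_on f {..<r}"
        "inj_on (\<lambda>f. f ` {..<r}) G0" "(\<lambda>f. f ` {..<r}) ` G0 = E"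
        using tuple_family[OF E(1)] by blast
      have cE: "card G0 = card E" using card_image[OF G0(3)] G0(4) by simp
      obtain G where G: "G \<subseteq> G0" "card G0 \<le> 2 * card G"
        "\<And>t f. t < r \<Longrightarrow> f \<in> G \<Longrightarrow> w < degree_on G ({..<r} - {t}) f"
      proof (rule clean_subfamily[OF G0(1), of w])
        show "2 * real (r * (w + 1)) * real n ^ (r - 1) \<le> card G0" using E(2) cE by (simp add: w_def)
      qed (use r in \<open>auto intro: that\<close>)
      have MG: "M \<le> 2 * card G" using G(2) cE by (simp add: M_def)
      have "G \<noteq> {}" using MG M by auto
      moreover have GP: "G \<subseteq> {..<r} \<rightarrow>\<^sub>E {..<n}" using G(1) G0(1) by auto
      ultimately obtain G' and \<Delta> :: "nat set \<Rightarrow> real" where G': "G' \<subseteq> G" "G' \<noteq> {}" "real (card G) \<le> \<mu> * card G'"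
        "\<And>I. 0 < \<Delta> I"
        "\<And>I f. I \<subseteq> {..<r} \<Longrightarrow> f \<in> G' \<Longrightarrow> \<Delta> I \<le> \<mu> * degree_on G' I f \<and> degree_on G' I f \<le> \<Delta> I"
        using elim(3) unfolding \<mu>_def[symmetric] by metis
      interpret R: regular_family r n l G G' \<Delta> \<mu>
        using r l \<mu> GP G0(2) G(1) G(3) G' unfolding w_def by unfold_locales auto
      have e: "real (card G') > 0" using R.finite_G' G'(2) by (simp add: card_gt_0_iff)
      have Me: "M \<le> 2 * \<mu> * card G'" using MG G'(3) by linarith
      obtain i j k where ijk: "i < r" "j < r" "k < r" "i \<noteq> j" "k \<noteq> i" "k \<noteq> j"
        "\<And>a b. a < r \<Longrightarrow> b < r \<Longrightarrow> a \<noteq> b \<Longrightarrow> \<Delta> {i, j} \<le> \<Delta> {a, b}"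
        "\<Delta> {i, j} / \<mu> \<le> (\<mu> * (\<Delta> {i, j} / \<Delta> {i, j, k})) ^ (r - 2)"
        using R.choose_positions by metis
      define D where "D = \<Delta> {i, j} / \<Delta> {i, j, k}"
      define y where "y = M / real n ^ 2"
      define x where "x = 1 / (real r - 2)"
      have ypos: "y > 0" using M elim(4) by (simp add: y_def)
      have Dpos: "D > 0" using G'(4) by (simp add: D_def)
      have r2: "real (r - 2) = real r - 2" "real r - 2 \<ge> 1" using r by auto
      have yn: "real n powr \<delta> \<le> y"
      proof -
        have "real n powr (2 + \<delta>) = real n ^ 2 * real n powr \<delta>" using elim(4) by (simp add: powr_add powr_numeral)
        then show ?thesis using E(3) elim(4) by (simp add: y_def M_def field_simps)
      qed
      have "y / (2 * \<mu> ^ 2) \<le> (\<mu> * D) ^ (r - 2)"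
      proof -
        have "card G' \<le> real n ^ 2 * \<Delta> {i, j}" using R.card_le_shadow[of "{i, j}"] ijk by (simp add: power2_eq_square)
        then have "2 * \<mu> * card G' \<le> 2 * \<mu> * (real n ^ 2 * \<Delta> {i, j})" using \<mu> by (intro mult_left_mono) auto
        then have "M \<le> 2 * \<mu> * (real n ^ 2 * \<Delta> {i, j})" using Me by linarith
        then have "y \<le> 2 * \<mu> * \<Delta> {i, j}" using elim(4) by (simp add: y_def field_simps)
        then have "y / (2 * \<mu> ^ 2) \<le> \<Delta> {i, j} / \<mu>" using \<mu> by (simp add: field_simps power2_eq_square)
        also have "\<dots> \<le> (\<mu> * D) ^ (r - 2)" using ijk(8) by (simp add: D_def)
        finally show ?thesis .
      qed
      then have "(y / (2 * \<mu> ^ 2)) powr x \<le> ((\<mu> * D) ^ (r - 2)) powr x"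
        using ypos \<mu> r2 by (intro powr_mono2) (auto simp: x_def)
      also have "\<dots> = \<mu> * D"
        using Dpos \<mu> r2 by (simp add: powr_realpow[symmetric] powr_powr x_def)
      finally have "(y / (2 * \<mu> ^ 2)) powr x \<le> \<mu> * D" .
      moreover have "y powr x / (2 * \<mu> ^ 2) \<le> (y / (2 * \<mu> ^ 2)) powr x"
      proof -
        have "1 \<le> \<mu> ^ 2" using \<mu> by (rule one_le_power)
        then have "(2 * \<mu> ^ 2) powr x \<le> (2 * \<mu> ^ 2) powr 1" using r2 by (intro powr_mono) (auto simp: x_def)
        then have "y powr x / (2 * \<mu> ^ 2) \<le> y powr x / (2 * \<mu> ^ 2) powr x" using \<mu> by (intro divide_left_mono) auto
        then show ?thesis using ypos \<mu> by (simp add: powr_divide)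
      qed
      ultimately have "y powr x / (2 * \<mu> ^ 2) \<le> \<mu> * D" by linarith
      then have Dlow: "y powr x / (2 * \<mu> ^ 3) \<le> D" using \<mu> by (simp add: field_simps power3_eq_cube power2_eq_square)
      have ypx: "4 * real L * \<mu> ^ 4 \<le> y powr x"
      proof -
        have "\<mu> ^ 4 = real n powr (4 * \<delta>1)" using elim(4) by (simp add: \<mu>_def powr_power mult.commute)
        then have "4 * real L * \<mu> ^ 4 \<le> (real n powr \<delta>) powr x" using elim(2) by (simp add: x_def powr_powr)
        also have "\<dots> \<le> y powr x" using yn r2 by (intro powr_mono2) (auto simp: x_def)
        finally show ?thesis .
      qed
      have large: "2 * \<mu> * (2 * l + 1) \<le> D"
      proof -
        have "2 * \<mu> * L * (2 * \<mu> ^ 3) \<le> y powr x" using ypx by (simp add: power3_eq_cube power4_eq_xxxx mult_ac)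
        then have "2 * \<mu> * L \<le> y powr x / (2 * \<mu> ^ 3)" using \<mu> by (subst pos_le_divide_eq) auto
        then show ?thesis using Dlow unfolding L_def by linarith
      qed
      have injG: "inj_on (\<lambda>f. f ` {..<r}) G" using G0(3) G(1) by (rule inj_on_subset)
      interpret P: positioned_family r n l G G' \<Delta> \<mu> i j k
        using ijk large injG unfolding D_def by unfold_locales auto
      have D\<theta>: "D powr (- \<theta>) \<le> 2 * \<mu> ^ 3 * y powr (- scale_exponent r l)"
      proof -
        have "1 \<le> \<mu> ^ 3" using \<mu> by (rule one_le_power)
        have "D powr (- \<theta>) \<le> (y powr x / (2 * \<mu> ^ 3)) powr (- \<theta>)"
          using Dlow ypos \<mu> \<theta> by (intro powr_mono2') auto
        also have "\<dots> = (2 * \<mu> ^ 3) powr \<theta> * y powr (- (x * \<theta>))"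
          using ypos \<mu> by (simp add: powr_divide powr_minus_divide powr_powr)
        also have "\<dots> \<le> (2 * \<mu> ^ 3) powr 1 * y powr (- (x * \<theta>))"
          using \<open>1 \<le> \<mu> ^ 3\<close> \<theta> by (intro mult_right_mono powr_mono) auto
        also have "x * \<theta> = scale_exponent r l" by (simp add: x_def \<theta>_def scale_exponent_def)
        finally show ?thesis using \<mu> by simp
      qed
      show "spread (real n powr \<delta> * fingerprint_scale r l n (card E) / card E) (2 * l + 1) (cycle_copies n r (2 * l + 1)) E"
      proof (rule P.spread_container[where c = "2 * \<mu>"])
        show "finite E" using E(1) finite_rsets by (rule finite_subset)
        show "(\<lambda>f. f ` {..<r}) ` G \<subseteq> E" using G(1) G0(4) by auto
        show "real (card E) \<le> 2 * \<mu> * real (card G')" using Me by (simp add: M_def)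
        show "1 \<le> 2 * \<mu>" using \<mu> by simp
        have k: "P.\<kappa> = \<kappa>" by (simp add: P.\<kappa>_def \<kappa>_def w_def)
        have t: "P.\<theta> = \<theta>" by (simp add: P.\<theta>_def \<theta>_def)
        have er: "P.ext_ratio k = D" by (simp add: P.ext_ratio_k D_def)
        have "real n ^ 2 / card G' \<le> 2 * \<mu> * (real n ^ 2 / M)"
        proof -
          have "real n ^ 2 * M \<le> real n ^ 2 * (2 * \<mu> * card G')" using Me by (intro mult_left_mono) auto
          then show ?thesis using e M by (simp add: field_simps)
        qed
        then have "real n ^ 2 / card G' * D powr (- \<theta>) \<le> 2 * \<mu> * (real n ^ 2 / M) * (2 * \<mu> ^ 3 * y powr (- scale_exponent r l))"
          using D\<theta> M \<mu> by (intro mult_mono) auto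
        then have "K * \<mu> ^ (3 * L) * (2 * \<mu>) * (real n ^ 2 / card G' * D powr (- \<theta>)) \<le>
            K * \<mu> ^ (3 * L) * (2 * \<mu>) * (2 * \<mu> * (real n ^ 2 / M) * (2 * \<mu> ^ 3 * y powr (- scale_exponent r l)))"
          using K \<mu> by (intro mult_left_mono) auto
        also have "\<dots> = 8 * K * (\<mu> ^ (3 * L) * \<mu> ^ 5) * (fingerprint_scale r l n M / M)"
          by (simp add: fingerprint_scale_def y_def eval_nat_numeral mult_ac)
        also have "\<mu> ^ (3 * L) * \<mu> ^ 5 = real n powr (\<delta>1 * (3 * real L + 5))"
          using elim(4) by (simp add: \<mu>_def powr_power powr_add[symmetric] algebra_simps)
        also have "8 * K * real n powr (\<delta>1 * (3 * real L + 5)) * (fingerprint_scale r l n M / M) < real n powr \<delta> * (fingerprint_scale r l n M / M)"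
        proof -
          have "0 < fingerprint_scale r l n M / M" using M elim(4) ypos by (simp add: fingerprint_scale_def y_def[symmetric])
          then show ?thesis using elim(1) by (intro mult_strict_right_mono)
        qed
        finally show "real (2 * l + 1) ^ (2 * l + 1) * ((2 * P.\<kappa>) ^ (2 * l + 1) * \<mu> ^ (3 * (2 * l + 1))) * (2 * \<mu>) *
            (real (n\<^sup>2) / real (card G') * P.ext_ratio k powr - P.\<theta>) < real n powr \<delta> * fingerprint_scale r l n (card E) / card E"
          unfolding k t er of_nat_power unfolding K_def L_def M_def by (simp only: mult.assoc times_divide_eq_right)
      qed
    qed
  qed
qed

section \<open>Iterating the container step\<close>

lemma card_small_subsets_le:
  assumes "finite V"
  shows "card {F. F \<subseteq> V \<and> card F \<le> m} \<le> (card V + 1) ^ m"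
proof -
  have "card {F. F \<subseteq> V \<and> card F \<le> m} = (\<Sum>i\<le>m. card {F. F \<subseteq> V \<and> card F = i})"
  proof -
    have "{F. F \<subseteq> V \<and> card F \<le> m} = (\<Union>i\<in>{..m}. {F. F \<subseteq> V \<and> card F = i})" by auto
    moreover have "card (\<Union>i\<in>{..m}. {F. F \<subseteq> V \<and> card F = i}) = (\<Sum>i\<in>{..m}. card {F. F \<subseteq> V \<and> card F = i})"
      using assms by (intro card_UN_disjoint) (auto intro: finite_subset[of _ "Pow V"])
    ultimately show ?thesis by simp
  qed
  also have "\<dots> = (\<Sum>i\<le>m. card V choose i)" using n_subsets[OF assms] by simp
  also have "\<dots> \<le> (\<Sum>i\<le>m. (m choose i) * card V ^ i)"
  proof (intro sum_mono)
    fix i assume "i \<in> {..m}"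
    then have "1 \<le> m choose i" by (simp add: Suc_leI)
    moreover have "card V choose i \<le> card V ^ i"
      by (cases "i \<le> card V") (auto simp: binomial_le_pow binomial_eq_0)
    ultimately show "card V choose i \<le> (m choose i) * card V ^ i"
      using mult_mono[of 1 "m choose i" "card V choose i" "card V ^ i"] by simp
  qed
  also have "\<dots> = (card V + 1) ^ m" using binomial_ring[of "card V" 1 m] by simp
  finally show ?thesis .
qed

text \<open>A container still larger than \<open>M\<close> is processed with
  \<open>q = T * x / card C\<close>. A resulting \<open>C'\<close> that exceeds \<open>M\<close> is
  spread at \<open>T / card C'\<close> but not at \<open>q\<close>, which forces
  \<open>card C' < card C / x\<close>. As \<open>q * card C\<close> is the same for all
  \<open>C\<close>, each round multiplies the number of containers by at most one fixed
  factor.\<close>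

lemma iterated_containers:
  fixes V :: "'a set" and T x M :: real
  assumes V: "finite V" and k: "k \<ge> 1" and T: "T > 0" and x: "x > 1"
    and small: "T * x * (real k * 2 ^ (k + 3)) \<le> M"
    and super: "\<And>C. C \<subseteq> V \<Longrightarrow> M < card C \<Longrightarrow> spread (T / card C) k H C"
  shows "\<exists>\<C>. finite \<C> \<and> card \<C> \<le> ((real (card V) + 1) powr (real k * 2 ^ (k + 3) * (T * x))) ^ j \<and>
    (\<forall>C\<in>\<C>. C \<subseteq> V \<and> (card C \<le> M \<or> card C \<le> card V / x ^ j)) \<and>
    (\<forall>I\<subseteq>V. (\<forall>E\<in>H. \<not> E \<subseteq> I) \<longrightarrow> (\<exists>C\<in>\<C>. I \<subseteq> C))"
proof (induction j)
  case 0
  show ?case by (intro exI[of _ "{V}"]) auto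
next
  case (Suc j)
  define f where "f = real k * 2 ^ (k + 3) * (T * x)"
  define B where "B = (real (card V) + 1) powr f"
  have kp: "real k * 2 ^ (k + 3) > 0" using k by simp
  have f: "f \<ge> 0" using T x by (simp add: f_def)
  obtain \<C> where \<C>: "finite \<C>" "card \<C> \<le> B ^ j"
    "\<And>C. C \<in> \<C> \<Longrightarrow> C \<subseteq> V \<and> (card C \<le> M \<or> card C \<le> card V / x ^ j)"
    "\<And>I. I \<subseteq> V \<Longrightarrow> (\<forall>E\<in>H. \<not> E \<subseteq> I) \<Longrightarrow> (\<exists>C\<in>\<C>. I \<subseteq> C)"
    using Suc.IH unfolding f_def[symmetric] B_def[symmetric] by metis
  have step: "\<exists>\<D>. finite \<D> \<and> card \<D> \<le> B \<and> (\<forall>C'\<in>\<D>. C' \<subseteq> V \<and> (card C' \<le> M \<or> card C' \<le> card V / x ^ Suc j)) \<and>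
      (\<forall>I\<subseteq>C. (\<forall>E\<in>H. \<not> E \<subseteq> I) \<longrightarrow> (\<exists>C'\<in>\<D>. I \<subseteq> C'))" if C: "C \<in> \<C>" for C
  proof (cases "card C \<le> M")
    case True
    have "1 \<le> B" unfolding B_def using f by (intro ge_one_powr_ge_zero) auto
    then show ?thesis using True \<C>(3)[OF C] by (intro exI[of _ "{C}"]) auto
  next
    case False
    have CV: "C \<subseteq> V" and cC: "card C \<le> card V / x ^ j" using \<C>(3)[OF C] False by auto
    have finC: "finite C" using CV V by (rule finite_subset)
    have M0: "M > 0" using small T x kp by (smt (verit) mult_pos_pos)
    then have cpos: "real (card C) > 0" using False by linarith
    define q where "q = T * x / card C"
    have qpos: "q > 0" using T x cpos by (simp add: q_def)
    have "real k * q \<le> 1 / 2 ^ (k + 3)"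
    proof -
      have "T * x * (real k * 2 ^ (k + 3)) \<le> card C" using small False by linarith
      then show ?thesis using cpos by (simp add: q_def field_simps)
    qed
    from container_step[OF finC k qpos this, of H] obtain \<psi> where \<psi>: "\<forall>I\<subseteq>C. (\<forall>E\<in>H. \<not> E \<subseteq> I) \<longrightarrow>
        (\<exists>F\<subseteq>I. real (card F) \<le> real k * 2 ^ (k + 3) * q * real (card C) \<and> I \<subseteq> \<psi> F \<and> \<psi> F \<subseteq> C \<and> \<not> spread q k H (\<psi> F))"
      by (elim exE) (rule that)
    have fq: "real k * 2 ^ (k + 3) * q * real (card C) = f" using cpos by (simp add: q_def f_def)
    define m where "m = nat \<lfloor>f\<rfloor>"
    define \<F> where "\<F> = {F. F \<subseteq> C \<and> card F \<le> m}"
    define \<D> where "\<D> = {\<psi> F | F. F \<in> \<F> \<and> \<psi> F \<subseteq> C \<and> \<not> spread q k H (\<psi> F)}"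
    have fin\<F>: "finite \<F>" using finC by (auto simp: \<F>_def intro: finite_subset[of _ "Pow C"])
    have \<D>\<F>: "\<D> \<subseteq> \<psi> ` \<F>" by (auto simp: \<D>_def)
    have "card \<D> \<le> card \<F>" using \<D>\<F> fin\<F> by (meson card_image_le card_mono finite_imageI le_trans)
    also have "\<dots> \<le> (card C + 1) ^ m" unfolding \<F>_def by (rule card_small_subsets_le[OF finC])
    finally have "real (card \<D>) \<le> real ((card C + 1) ^ m)" by (rule of_nat_mono)
    also have "\<dots> = (real (card C) + 1) ^ m" by (simp add: add.commute)
    also have "\<dots> \<le> (real (card V) + 1) ^ m" using card_mono[OF V CV] by (intro power_mono) auto
    also have "\<dots> = (real (card V) + 1) powr real m" by (simp add: powr_realpow)
    also have "\<dots> \<le> B" unfolding B_def using f by (intro powr_mono) (auto simp: m_def)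
    finally have "card \<D> \<le> B" .
    moreover have "C' \<subseteq> V \<and> (card C' \<le> M \<or> card C' \<le> card V / x ^ Suc j)" if "C' \<in> \<D>" for C'
    proof -
      have C': "C' \<subseteq> C" "\<not> spread q k H C'" using that by (auto simp: \<D>_def)
      have "card C' \<le> card V / x ^ Suc j" if big: "\<not> card C' \<le> M"
      proof -
        have c'pos: "real (card C') > 0" using big M0 by linarith
        have "spread (T / card C') k H C'" using C' CV big by (intro super) auto
        then have "\<not> T / card C' \<le> q" using C'(2) spread_mono[of "T / card C'" k H C' q] T c'pos by auto
        then have "T * x / card C < T / card C'" by (simp add: q_def)
        then have "T * (x * card C') < T * card C" using cpos c'pos by (simp add: field_simps)
        then have "x * card C' < card C" using T by simp
        then have "card C' < card C / x" using x by (simp add: field_simps)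
        also have "\<dots> \<le> card V / x ^ j / x" using cC x by (intro divide_right_mono) auto
        finally show ?thesis by (simp add: mult.commute)
      qed
      then show ?thesis using C' CV by auto
    qed
    moreover have "\<exists>C'\<in>\<D>. I \<subseteq> C'" if I: "I \<subseteq> C" "\<forall>E\<in>H. \<not> E \<subseteq> I" for I
    proof -
      from \<psi>[rule_format, OF I(1)] I(2) obtain F where F: "F \<subseteq> I" "real (card F) \<le> f"
        "I \<subseteq> \<psi> F" "\<psi> F \<subseteq> C" "\<not> spread q k H (\<psi> F)" unfolding fq by blast
      have "card F \<le> m" using F(2) by (simp add: m_def le_nat_floor)
      then have "\<psi> F \<in> \<D>" using F I by (auto simp: \<D>_def \<F>_def)
      then show ?thesis using F by blast
    qed
    moreover have "finite \<D>" using \<D>\<F> fin\<F> finite_surj by blast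
    ultimately show ?thesis by (intro exI[of _ \<D>]) blast
  qed
  then obtain \<D> where \<D>: "\<And>C. C \<in> \<C> \<Longrightarrow> finite (\<D> C) \<and> real (card (\<D> C)) \<le> B \<and>
      (\<forall>C'\<in>\<D> C. C' \<subseteq> V \<and> (card C' \<le> M \<or> card C' \<le> card V / x ^ Suc j)) \<and>
      (\<forall>I\<subseteq>C. (\<forall>E\<in>H. \<not> E \<subseteq> I) \<longrightarrow> (\<exists>C'\<in>\<D> C. I \<subseteq> C'))" by metis
  have "card (\<Union>C\<in>\<C>. \<D> C) \<le> (\<Sum>C\<in>\<C>. card (\<D> C))" using \<C>(1) by (rule card_UN_le)
  then have "real (card (\<Union>C\<in>\<C>. \<D> C)) \<le> real (\<Sum>C\<in>\<C>. card (\<D> C))" by (rule of_nat_mono)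
  also have "\<dots> = (\<Sum>C\<in>\<C>. real (card (\<D> C)))" by simp
  also have "\<dots> \<le> (\<Sum>C\<in>\<C>. B)" using \<D> by (intro sum_mono) blast
  also have "\<dots> = card \<C> * B" by simp
  also have "\<dots> \<le> B ^ j * B" using \<C>(2) by (intro mult_right_mono) (auto simp: B_def)
  finally have "real (card (\<Union>C\<in>\<C>. \<D> C)) \<le> B ^ Suc j" by (simp add: mult.commute)
  moreover have "finite (\<Union>C\<in>\<C>. \<D> C)" using \<C>(1) \<D> by blast
  moreover have "\<exists>C\<in>(\<Union>C\<in>\<C>. \<D> C). I \<subseteq> C" if I: "I \<subseteq> V" "\<forall>E\<in>H. \<not> E \<subseteq> I" for I
  proof -
    obtain C where "C \<in> \<C>" "I \<subseteq> C" using \<C>(4)[OF I] by blast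
    then show ?thesis using \<D>[of C] I by blast
  qed
  ultimately show ?case unfolding f_def[symmetric] B_def[symmetric] using \<D> by (intro exI[of _ "\<Union>C\<in>\<C>. \<D> C"]) blast
qed

lemma scale_exponent_pos: "r \<ge> 3 \<Longrightarrow> l \<ge> 1 \<Longrightarrow> scale_exponent r l > 0"
  by (auto simp: scale_exponent_def)

lemma fingerprint_scale_antimono:
  assumes "r \<ge> 3" "l \<ge> 1" "0 < M" "M \<le> M'" "n > 0"
  shows "fingerprint_scale r l n M' \<le> fingerprint_scale r l n M"
  unfolding fingerprint_scale_def using assms scale_exponent_pos[OF assms(1,2)]
  by (intro mult_left_mono powr_mono2') (auto simp: divide_right_mono)

lemma fingerprint_scale_le:
  assumes "r \<ge> 3" "l \<ge> 1" "real n ^ 2 \<le> M" "n > 0"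
  shows "fingerprint_scale r l n M \<le> real n ^ 2"
proof -
  have "1 \<le> M / real n ^ 2" using assms by simp
  then have "(M / real n ^ 2) powr (- scale_exponent r l) \<le> (M / real n ^ 2) powr 0"
    using scale_exponent_pos[OF assms(1,2)] by (intro powr_mono) auto
  also have "(M / real n ^ 2) powr 0 = 1" using \<open>1 \<le> M / real n ^ 2\<close> assms(4) by (intro powr_zero_eq_one[THEN trans]) auto
  finally have "real n ^ 2 * (M / real n ^ 2) powr (- scale_exponent r l) \<le> real n ^ 2 * 1"
    by (intro mult_left_mono) auto
  then show ?thesis by (simp add: fingerprint_scale_def)
qed

text \<open>Shrinking by \<open>n powr \<epsilon>\<close> per round takes a bounded number
  \<open>j\<close> of rounds, since there are at most \<open>n ^ r\<close> sets to begin with. The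
  fingerprint carries two factors \<open>n powr \<epsilon>\<close>, one from supersaturation and one
  from the shrinking; the remaining \<open>n powr (\<delta> / 2)\<close> absorbs \<open>j\<close>,
  the constants and the logarithm.\<close>

lemma containers:
  assumes r: "r \<ge> 3" and l: "l \<ge> 1" and \<delta>: "\<delta> > 0"
  shows "\<forall>\<^sub>F n in sequentially. \<forall>M :: real.
      2 * real (r * ((2 * l + 1) * (r + 1) + 1)) * real n ^ (r - 1) \<le> M \<and> real n powr (2 + \<delta>) \<le> M \<longrightarrow>
      (\<exists>\<C>. finite \<C> \<and> card \<C> \<le> exp (real n powr \<delta> * fingerprint_scale r l n M) \<and> (\<forall>C\<in>\<C>. C \<subseteq> rsets n r \<and> card C \<le> M) \<and>
        (\<forall>I\<subseteq>rsets n r. (\<forall>E\<in>cycle_copies n r (2 * l + 1). \<not> E \<subseteq> I) \<longrightarrow> (\<exists>C\<in>\<C>. I \<subseteq> C)))"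
proof -
  define \<epsilon> where "\<epsilon> = \<delta> / 4"
  have \<epsilon>: "\<epsilon> > 0" using \<delta> by (simp add: \<epsilon>_def)
  define k where "k = 2 * l + 1"
  define c where "c = real k * 2 ^ (k + 3)"
  have c: "c > 0" by (simp add: c_def k_def)
  define j where "j = nat \<lceil>real r / \<epsilon>\<rceil>"
  have j: "real r \<le> \<epsilon> * real j"
  proof -
    have "real r / \<epsilon> \<le> real j" unfolding j_def by linarith
    then show ?thesis using \<epsilon> by (simp add: field_simps)
  qed
  have "\<forall>\<^sub>F n in sequentially. c * (real n powr (2 + 2 * \<epsilon>)) \<le> real n powr (2 + \<delta>)"
    using \<epsilon> c by (simp add: \<epsilon>_def) real_asymp
  moreover have "\<forall>\<^sub>F n in sequentially. (real j * c * (real r + 1)) * real n powr (2 * \<epsilon>) * ln (real n) \<le> real n powr \<delta>"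
    using \<epsilon> c by (simp add: \<epsilon>_def) real_asymp
  ultimately show ?thesis using supersaturation[OF r l \<epsilon>] eventually_gt_at_top[of 1]
  proof eventually_elim
    case (elim n)
    show ?case
    proof (intro allI impI, elim conjE)
      fix M assume M: "2 * real (r * ((2 * l + 1) * (r + 1) + 1)) * real n ^ (r - 1) \<le> M" "real n powr (2 + \<delta>) \<le> M"
      have n: "real n > 1" using elim(4) by simp
      have M2: "real n ^ 2 \<le> M"
      proof -
        have "real n powr 2 \<le> real n powr (2 + \<delta>)" using n \<delta> by (intro powr_mono) auto
        then show ?thesis using M(2) n by (simp add: powr_numeral)
      qed
      have Mpos: "M > 0" using M2 n by (smt (verit) zero_less_power)
      have Spos: "fingerprint_scale r l n M > 0" using n Mpos by (simp add: fingerprint_scale_def)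
      define x where "x = real n powr \<epsilon>"
      have x: "x > 1" using n \<epsilon> by (simp add: x_def)
      define T where "T = x * fingerprint_scale r l n M"
      have T: "T > 0" using x Spos by (simp add: T_def)
      have xx: "x * x = real n powr (2 * \<epsilon>)" by (simp add: x_def powr_add[symmetric])
      have Tx: "T * x = real n powr (2 * \<epsilon>) * fingerprint_scale r l n M" unfolding T_def xx[symmetric] by simp
      have small: "T * x * (real k * 2 ^ (k + 3)) \<le> M"
      proof -
        have "T * x * c \<le> real n powr (2 * \<epsilon>) * real n ^ 2 * c"
          unfolding Tx using fingerprint_scale_le[OF r l M2] n c by (intro mult_right_mono mult_left_mono) auto
        also have "\<dots> = c * real n powr (2 + 2 * \<epsilon>)" using n by (simp add: powr_add powr_numeral)
        also have "\<dots> \<le> M" using elim(1) M(2) by linarith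
        finally show ?thesis by (simp add: c_def)
      qed
      \<comment> \<open>The fingerprint scale decreases with the container size, so its value at
        \<open>M\<close> serves all larger containers.\<close>
      have super: "spread (T / card C) k (cycle_copies n r k) C" if C: "C \<subseteq> rsets n r" "M < card C" for C
      proof -
        have "real n powr (2 + \<epsilon>) \<le> real n powr (2 + \<delta>)" using n \<epsilon> by (intro powr_mono) (auto simp: \<epsilon>_def)
        then have "spread (real n powr \<epsilon> * fingerprint_scale r l n (card C) / card C) k (cycle_copies n r k) C"
          unfolding k_def using elim(3) C M by auto
        then show ?thesis
        proof (rule spread_mono)
          have "fingerprint_scale r l n (card C) \<le> fingerprint_scale r l n M" using C Mpos n by (intro fingerprint_scale_antimono r l) auto
          then show "real n powr \<epsilon> * fingerprint_scale r l n (card C) / card C \<le> T / card C"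
            unfolding T_def x_def by (intro divide_right_mono mult_left_mono) auto
          show "0 \<le> real n powr \<epsilon> * fingerprint_scale r l n (card C) / card C" by (simp add: fingerprint_scale_def)
        qed
      qed
      have "k \<ge> 1" by (simp add: k_def)
      have "\<exists>\<C>. finite \<C> \<and> card \<C> \<le> ((real (card (rsets n r)) + 1) powr (real k * 2 ^ (k + 3) * (T * x))) ^ j \<and>
          (\<forall>C\<in>\<C>. C \<subseteq> rsets n r \<and> (card C \<le> M \<or> card C \<le> card (rsets n r) / x ^ j)) \<and>
          (\<forall>I\<subseteq>rsets n r. (\<forall>E\<in>cycle_copies n r k. \<not> E \<subseteq> I) \<longrightarrow> (\<exists>C\<in>\<C>. I \<subseteq> C))"
        by (rule iterated_containers[OF finite_rsets \<open>k \<ge> 1\<close> T x small]) (rule super)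
      then obtain \<C> where \<C>: "finite \<C>"
        "card \<C> \<le> ((real (card (rsets n r)) + 1) powr (real k * 2 ^ (k + 3) * (T * x))) ^ j"
        "\<forall>C\<in>\<C>. C \<subseteq> rsets n r \<and> (card C \<le> M \<or> card C \<le> card (rsets n r) / x ^ j)"
        "\<forall>I\<subseteq>rsets n r. (\<forall>E\<in>cycle_copies n r k. \<not> E \<subseteq> I) \<longrightarrow> (\<exists>C\<in>\<C>. I \<subseteq> C)"
        by (elim exE conjE) (rule that)
      have cr: "real (card (rsets n r)) \<le> real n ^ r"
      proof -
        have "real (card (rsets n r)) \<le> real (n ^ r)" by (intro of_nat_mono card_rsets_le)
        then show ?thesis by simp
      qed
      have "card C \<le> M" if "C \<in> \<C>" for C
      proof -
        have "real n ^ r \<le> x ^ j"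
        proof -
          have "x ^ j = real n powr (\<epsilon> * real j)" using n by (simp add: x_def powr_power mult.commute)
          moreover have "real n ^ r = real n powr real r" using n by (simp add: powr_realpow)
          ultimately show ?thesis using j n by (simp add: powr_mono)
        qed
        then have "real (card (rsets n r)) \<le> x ^ j" using cr by linarith
        then have "card (rsets n r) / x ^ j \<le> 1" using x by (subst divide_le_eq_1_pos) auto
        moreover have "1 ^ 2 \<le> real n ^ 2" using n by (intro power_mono) auto
        ultimately have "card (rsets n r) / x ^ j \<le> M" using M2 by simp
        moreover have "card C \<le> M \<or> card C \<le> card (rsets n r) / x ^ j" using \<C>(3) that by blast
        ultimately show ?thesis by linarith
      qed
      moreover have "real (card \<C>) \<le> exp (real n powr \<delta> * fingerprint_scale r l n M)"
      proof -
        define f where "f = c * (T * x)"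
        have f: "f \<ge> 0" using c T x by (simp add: f_def)
        have "real (card \<C>) \<le> ((real (card (rsets n r)) + 1) powr f) ^ j" using \<C>(2) by (simp add: f_def c_def)
        also have "\<dots> \<le> ((real n ^ r + 1) powr f) ^ j" using cr f by (intro power_mono powr_mono2) auto
        also have "\<dots> = exp (real j * f * ln (real n ^ r + 1))"
          using n by (simp add: powr_def exp_of_nat_mult[symmetric] add_pos_pos less_imp_neq[symmetric] mult.assoc)
        also have "real j * f * ln (real n ^ r + 1) = real j * (c * real n powr (2 * \<epsilon>)) * ln (real n ^ r + 1) * fingerprint_scale r l n M"
          by (simp add: f_def Tx)
        also have "exp \<dots> \<le> exp (real n powr \<delta> * fingerprint_scale r l n M)"
        proof -
          have "2 \<le> real n" using elim(4) by simp
          then have "real n ^ r * 2 \<le> real n ^ r * real n" by (intro mult_left_mono) auto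
          moreover have "1 \<le> real n ^ r" using n by simp
          moreover have "real n ^ (r + 1) = real n ^ r * real n" by simp
          ultimately have "real n ^ r + 1 \<le> real n ^ (r + 1)" by linarith
          moreover have "0 < real n ^ r + 1" using n by (intro add_pos_pos) auto
          ultimately have "ln (real n ^ r + 1) \<le> ln (real n ^ (r + 1))" by (intro ln_mono)
          also have "\<dots> = (real r + 1) * ln (real n)" using n by (subst ln_realpow) auto
          finally have "real j * (c * real n powr (2 * \<epsilon>)) * ln (real n ^ r + 1) \<le>
              real j * (c * real n powr (2 * \<epsilon>)) * ((real r + 1) * ln (real n))"
            using c by (intro mult_left_mono) auto
          also have "\<dots> = (real j * c * (real r + 1)) * real n powr (2 * \<epsilon>) * ln (real n)" by (simp only: mult_ac)
          also have "\<dots> \<le> real n powr \<delta>" by (rule elim(2))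
          finally have "real j * (c * real n powr (2 * \<epsilon>)) * ln (real n ^ r + 1) \<le> real n powr \<delta>" .
          then have "real j * (c * real n powr (2 * \<epsilon>)) * ln (real n ^ r + 1) * fingerprint_scale r l n M \<le> real n powr \<delta> * fingerprint_scale r l n M"
            using Spos by (intro mult_right_mono) auto
          then show ?thesis by (simp only: exp_le_cancel_iff)
        qed
        finally show ?thesis .
      qed
      ultimately show "\<exists>\<C>. finite \<C> \<and> card \<C> \<le> exp (real n powr \<delta> * fingerprint_scale r l n M) \<and> (\<forall>C\<in>\<C>. C \<subseteq> rsets n r \<and> card C \<le> M) \<and>
        (\<forall>I\<subseteq>rsets n r. (\<forall>E\<in>cycle_copies n r (2 * l + 1). \<not> E \<subseteq> I) \<longrightarrow> (\<exists>C\<in>\<C>. I \<subseteq> C))"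
        using \<C> unfolding k_def by (intro exI[of _ \<C>]) blast
    qed
  qed
qed

section \<open>Upper bounds\<close>

lemma prob_superset:
  assumes p: "0 \<le> p" "p \<le> 1" and I: "I \<subseteq> rsets n r"
  shows "measure_pmf.prob (random_rgraph r n p) {G. I \<subseteq> snd G} = p ^ card I"
proof -
  let ?K = "rsets n r"
  have "random_rgraph r n p = map_pmf (\<lambda>f. ({..<n}, {e \<in> ?K. f e})) (Pi_pmf ?K False (\<lambda>_. bernoulli_pmf p))"
    by (simp add: random_rgraph_def rsets_def Let_def)
  then have "measure_pmf.prob (random_rgraph r n p) {G. I \<subseteq> snd G} =
      measure_pmf.prob (Pi_pmf ?K False (\<lambda>_. bernoulli_pmf p)) ((\<lambda>f. ({..<n}, {e \<in> ?K. f e})) -` {G. I \<subseteq> snd G})"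
    by simp
  also have "(\<lambda>f. ({..<n}, {e \<in> ?K. f e})) -` {G. I \<subseteq> snd G} = Pi ?K (\<lambda>e. if e \<in> I then {True} else UNIV)"
    using I by (auto simp: Pi_def)
  also have "measure_pmf.prob (Pi_pmf ?K False (\<lambda>_. bernoulli_pmf p)) \<dots> =
      (\<Prod>e\<in>?K. measure_pmf.prob (bernoulli_pmf p) (if e \<in> I then {True} else UNIV))"
    by (rule measure_Pi_pmf_Pi[OF finite_rsets])
  also have "\<dots> = (\<Prod>e\<in>?K. if e \<in> I then p else 1)"
    using p by (intro prod.cong refl) (auto simp: measure_pmf_single)
  also have "\<dots> = (\<Prod>e\<in>I. p)"
    using I finite_rsets by (intro prod.mono_neutral_cong_right) auto
  finally show ?thesis by simp
qed

lemma set_pmf_random_rgraph: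
  "G \<in> set_pmf (random_rgraph r n p) \<Longrightarrow> fst G = {..<n} \<and> snd G \<subseteq> rsets n r"
  by (auto simp: random_rgraph_def rsets_def Let_def)

lemma finite_extremal_cards:
  assumes "finite (snd G)"
  shows "finite {card (snd F) | F. subhypergraph F G \<and> \<not> contains_copy F H}"
proof (rule finite_subset)
  show "{card (snd F) | F. subhypergraph F G \<and> \<not> contains_copy F H} \<subseteq> {..card (snd G)}"
    using assms by (auto simp: subhypergraph_def intro!: card_mono)
qed simp

lemma ex_ge:
  assumes "finite (snd G)" "subhypergraph F G" "\<not> contains_copy F H"
  shows "card (snd F) \<le> ex G H"
  unfolding ex_def using assms by (intro Max_ge finite_extremal_cards CollectI exI[of _ F] conjI refl)

text \<open>A maximum copy-free subgraph is cut down to exactly \<open>m\<close> edges, so that the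
  union bound meets sets of a single size. The hypergraph without vertices and edges shows that the
  maximum in \<open>ex\<close> is attained.\<close>

lemma copy_free_of_ex_ge:
  assumes G: "fst G = {..<n}" "snd G \<subseteq> rsets n r" and L: "L \<ge> 1" and m: "m \<le> ex G (linear_cycle r L)"
  obtains I where "I \<subseteq> snd G" "card I = m" "\<forall>E\<in>cycle_copies n r L. \<not> E \<subseteq> I"
proof -
  have finG: "finite (snd G)" using G(2) finite_rsets by (rule finite_subset)
  let ?S = "{card (snd F) | F. subhypergraph F G \<and> \<not> contains_copy F (linear_cycle r L)}"
  have "Inl 0 \<in> fst (linear_cycle r L)" using L by (auto simp: fst_linear_cycle)
  then have "\<not> contains_copy ({}, {}) (linear_cycle r L)" by (auto simp: contains_copy_def)
  moreover have "subhypergraph ({}, {}) G" by (simp add: subhypergraph_def)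
  ultimately have "?S \<noteq> {}" by blast
  then have "ex G (linear_cycle r L) \<in> ?S" unfolding ex_def by (intro Max_in finite_extremal_cards finG)
  then obtain F where F: "subhypergraph F G" "\<not> contains_copy F (linear_cycle r L)"
    "card (snd F) = ex G (linear_cycle r L)" by auto
  then obtain I where I: "I \<subseteq> snd F" "card I = m" using m by (metis obtain_subset_with_card_n)
  show ?thesis
  proof (rule that)
    show "I \<subseteq> snd G" using I F by (auto simp: subhypergraph_def)
    show "card I = m" by fact
    show "\<forall>E\<in>cycle_copies n r L. \<not> E \<subseteq> I"
    proof (intro ballI notI)
      fix E assume "E \<in> cycle_copies n r L" "E \<subseteq> I"
      then obtain \<phi> where \<phi>: "inj_on \<phi> (fst (linear_cycle r L))" "((`) \<phi>) ` snd (linear_cycle r L) \<subseteq> snd F"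
        using I by (auto simp: cycle_copies_def)
      have "\<phi> ` fst (linear_cycle r L) = \<Union> ((`) \<phi> ` snd (linear_cycle r L))"
        by (subst Union_linear_cycle[symmetric, OF L]) auto
      also have "\<dots> \<subseteq> \<Union> (snd F)" using \<phi>(2) by blast
      also have "\<dots> \<subseteq> fst F" using F(1) by (simp add: subhypergraph_def)
      finally have "contains_copy F (linear_cycle r L)" using \<phi> unfolding contains_copy_def by blast
      then show False using F(2) by simp
    qed
  qed
qed

text \<open>One term of the exponential series at \<open>m\<close>, together with
  \<open>exp 1 \<le> 3\<close>.\<close>

lemma power_self_le_fact: "real m ^ m \<le> 3 ^ m * fact m"
proof -
  have "real m ^ m / fact m \<le> exp (real m)"
  proof -
    have "(\<Sum>i\<in>{m}. real m ^ i / fact i) \<le> (\<Sum>i. real m ^ i / fact i)"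
      using summable_exp[of "real m"] by (intro sum_le_suminf) (auto simp: field_simps)
    then show ?thesis by (simp add: exp_def scaleR_conv_of_real field_simps)
  qed
  also have "\<dots> = exp 1 ^ m" by (simp add: exp_of_nat_mult[symmetric])
  also have "\<dots> \<le> 3 ^ m" using exp_le by (intro power_mono) auto
  finally show ?thesis by (simp add: field_simps)
qed

text \<open>The constant \<open>6\<close> combines the \<open>3\<close> of
  \<open>power_self_le_fact\<close> with the \<open>2\<close> that produces the base
  \<open>1 / 2\<close>.\<close>

lemma binomial_power_le:
  assumes "0 \<le> p" "6 * real N * p \<le> real m" "m \<ge> 1"
  shows "real (N choose m) * p ^ m \<le> (1 / 2) ^ m"
proof -
  have m: "real m > 0" using assms by simp
  have "real (N choose m) * real m ^ m \<le> real (N choose m) * (3 ^ m * fact m)"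
    by (intro mult_left_mono power_self_le_fact) auto
  also have "\<dots> = 3 ^ m * (real (N choose m) * fact m)" by simp
  also have "\<dots> \<le> 3 ^ m * real N ^ m"
  proof -
    have "real ((N choose m) * fact m) \<le> real (N ^ m)" by (intro of_nat_mono binomial_fact_pow)
    then show ?thesis by (intro mult_left_mono) auto
  qed
  finally have "real (N choose m) * real m ^ m * p ^ m \<le> 3 ^ m * real N ^ m * p ^ m"
    using assms by (intro mult_right_mono) auto
  also have "\<dots> = (3 * real N * p) ^ m" by (simp add: power_mult_distrib)
  also have "\<dots> \<le> (real m / 2) ^ m" using assms by (intro power_mono) auto
  also have "\<dots> = (1 / 2) ^ m * real m ^ m" by (simp add: power_divide)
  finally have "(real (N choose m) * p ^ m) * real m ^ m \<le> (1 / 2) ^ m * real m ^ m" by (simp add: mult_ac)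
  then show ?thesis using m by simp
qed

lemma prob_ex_ge:
  assumes p: "0 \<le> p" "p \<le> 1" and L: "L \<ge> 1" and m: "m \<ge> 1" "6 * M * p \<le> real m"
    and \<C>: "finite \<C>" "\<And>C. C \<in> \<C> \<Longrightarrow> C \<subseteq> rsets n r \<and> real (card C) \<le> M"
      "\<And>I. I \<subseteq> rsets n r \<Longrightarrow> \<forall>E\<in>cycle_copies n r L. \<not> E \<subseteq> I \<Longrightarrow> \<exists>C\<in>\<C>. I \<subseteq> C"
  shows "measure_pmf.prob (random_rgraph r n p) {G. m \<le> ex G (linear_cycle r L)} \<le> card \<C> * (1 / 2) ^ m"
proof -
  let ?P = "random_rgraph r n p"
  define \<I> where "\<I> C = {I. I \<subseteq> C \<and> card I = m}" for C :: "nat set set"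
  have finC: "finite C" if "C \<in> \<C>" for C using \<C>(2)[OF that] finite_rsets finite_subset by blast
  have fin\<I>: "finite (\<I> C)" if "C \<in> \<C>" for C
    using finC[OF that] by (auto simp: \<I>_def intro: finite_subset[of _ "Pow C"])
  have "measure_pmf.prob ?P {G. m \<le> ex G (linear_cycle r L)} =
      measure_pmf.prob ?P ({G. m \<le> ex G (linear_cycle r L)} \<inter> set_pmf ?P)"
    by (rule measure_Int_set_pmf[symmetric])
  also have "\<dots> \<le> measure_pmf.prob ?P (\<Union>C\<in>\<C>. \<Union>I\<in>\<I> C. {G. I \<subseteq> snd G})"
  proof (intro measure_pmf.finite_measure_mono subsetI)
    fix G assume "G \<in> {G. m \<le> ex G (linear_cycle r L)} \<inter> set_pmf ?P"
    then have G: "m \<le> ex G (linear_cycle r L)" "fst G = {..<n}" "snd G \<subseteq> rsets n r"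
      using set_pmf_random_rgraph by blast+
    obtain I where I: "I \<subseteq> snd G" "card I = m" "\<forall>E\<in>cycle_copies n r L. \<not> E \<subseteq> I"
      using copy_free_of_ex_ge[OF G(2,3) L G(1)] by blast
    then obtain C where "C \<in> \<C>" "I \<subseteq> C" using \<C>(3)[of I] G(3) by blast
    then show "G \<in> (\<Union>C\<in>\<C>. \<Union>I\<in>\<I> C. {G. I \<subseteq> snd G})" using I by (auto simp: \<I>_def)
  qed auto
  also have "\<dots> \<le> (\<Sum>C\<in>\<C>. measure_pmf.prob ?P (\<Union>I\<in>\<I> C. {G. I \<subseteq> snd G}))"
    using \<C>(1) by (intro measure_pmf.finite_measure_subadditive_finite) auto
  also have "\<dots> \<le> (\<Sum>C\<in>\<C>. \<Sum>I\<in>\<I> C. measure_pmf.prob ?P {G. I \<subseteq> snd G})"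
    using fin\<I> by (intro sum_mono measure_pmf.finite_measure_subadditive_finite) auto
  also have "\<dots> = (\<Sum>C\<in>\<C>. \<Sum>I\<in>\<I> C. p ^ m)"
    using \<C>(2) by (intro sum.cong refl, subst prob_superset[OF p]) (auto simp: \<I>_def)
  also have "\<dots> = (\<Sum>C\<in>\<C>. real (card C choose m) * p ^ m)"
    using n_subsets[OF finC] by (intro sum.cong refl) (simp add: \<I>_def)
  also have "\<dots> \<le> (\<Sum>C\<in>\<C>. (1 / 2) ^ m)"
  proof (intro sum_mono binomial_power_le p m)
    fix C assume "C \<in> \<C>"
    then have "6 * real (card C) * p \<le> 6 * M * p" using \<C>(2) p by (intro mult_right_mono mult_left_mono) auto
    then show "6 * real (card C) * p \<le> real m" using m by linarith
  qed
  finally show ?thesis by simp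
qed

text \<open>Containers of size \<open>M = \<mu> / (6 * p)\<close> number at most
  \<open>exp (\<mu> / 4)\<close>, and each contributes at most \<open>exp (- \<mu> / 2)\<close> to
  the first moment. The threshold \<open>\<mu>\<close> stays free, to be chosen separately in the
  two ranges of \<open>p\<close>.\<close>

lemma ex_tail:
  assumes r: "r \<ge> 3" and l: "l \<ge> 1" and \<delta>: "\<delta> > 0"
  shows "\<forall>\<^sub>F n in sequentially. \<forall>p \<mu>. 0 < p \<and> p \<le> 1 \<and> real n \<le> \<mu> \<and>
      2 * real (r * ((2 * l + 1) * (r + 1) + 1)) * real n ^ (r - 1) \<le> \<mu> / (6 * p) \<and>
      real n powr (2 + \<delta>) \<le> \<mu> / (6 * p) \<and> real n powr \<delta> * fingerprint_scale r l n (\<mu> / (6 * p)) \<le> \<mu> / 4 \<longrightarrow>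
      measure_pmf.prob (random_rgraph r n p) {G. \<mu> < real (ex G (linear_cycle r (2 * l + 1)))} \<le> exp (- real n / 4)"
  using containers[OF r l \<delta>] eventually_gt_at_top[of 0]
proof eventually_elim
  case (elim n)
  show ?case
  proof (intro allI impI, elim conjE)
    fix p \<mu> :: real
    assume p: "0 < p" "p \<le> 1" and \<mu>: "real n \<le> \<mu>"
      and M: "2 * real (r * ((2 * l + 1) * (r + 1) + 1)) * real n ^ (r - 1) \<le> \<mu> / (6 * p)"
        "real n powr (2 + \<delta>) \<le> \<mu> / (6 * p)" and T: "real n powr \<delta> * fingerprint_scale r l n (\<mu> / (6 * p)) \<le> \<mu> / 4"
    from elim(1)[rule_format, OF conjI[OF M]] obtain \<C> where \<C>: "finite \<C>"
      "card \<C> \<le> exp (real n powr \<delta> * fingerprint_scale r l n (\<mu> / (6 * p)))"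
      "\<forall>C\<in>\<C>. C \<subseteq> rsets n r \<and> card C \<le> \<mu> / (6 * p)"
      "\<forall>I\<subseteq>rsets n r. (\<forall>E\<in>cycle_copies n r (2 * l + 1). \<not> E \<subseteq> I) \<longrightarrow> (\<exists>C\<in>\<C>. I \<subseteq> C)"
      by (elim exE conjE) (rule that)
    define m where "m = nat \<lceil>\<mu>\<rceil>"
    have \<mu>0: "\<mu> > 0" using \<mu> elim(2) by (smt (verit) of_nat_0_less_iff)
    have m: "\<mu> \<le> real m" "m \<ge> 1" using \<mu>0 by (auto simp: m_def Suc_le_eq)
    have "measure_pmf.prob (random_rgraph r n p) {G. \<mu> < real (ex G (linear_cycle r (2 * l + 1)))} \<le>
        measure_pmf.prob (random_rgraph r n p) {G. m \<le> ex G (linear_cycle r (2 * l + 1))}"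
      by (intro measure_pmf.finite_measure_mono) (auto simp: m_def nat_le_iff ceiling_le_iff)
    also have "\<dots> \<le> card \<C> * (1 / 2) ^ m"
    proof (rule prob_ex_ge)
      show "6 * (\<mu> / (6 * p)) * p \<le> real m" using m p by simp
    qed (use p m \<C> in auto)
    also have "\<dots> \<le> exp (\<mu> / 4) * exp (- \<mu> / 2)"
    proof (intro mult_mono)
      show "real (card \<C>) \<le> exp (\<mu> / 4)" using \<C>(2) T by (smt (verit) exp_le_cancel_iff)
      have "(1 / 2 :: real) \<le> exp (- 1 / 2)"
        using exp_ge_add_one_self[of "- 1 / 2 :: real"] by simp
      then have "(1 / 2 :: real) ^ m \<le> exp (- 1 / 2) ^ m" by (intro power_mono) auto
      also have "\<dots> = exp (- real m / 2)" by (simp add: exp_of_nat_mult[symmetric])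
      also have "\<dots> \<le> exp (- \<mu> / 2)" using m by simp
      finally show "(1 / 2) ^ m \<le> exp (- \<mu> / 2)" .
    qed auto
    also have "\<dots> = exp (- \<mu> / 4)" by (simp add: exp_add[symmetric])
    also have "\<dots> \<le> exp (- real n / 4)" using \<mu> by simp
    finally show "measure_pmf.prob (random_rgraph r n p) {G. \<mu> < real (ex G (linear_cycle r (2 * l + 1)))} \<le> exp (- real n / 4)" .
  qed
qed

section \<open>Arithmetic of the exponents\<close>

definition density_exponent :: "nat \<Rightarrow> nat \<Rightarrow> real" where
  "density_exponent r l = (2 * real l - 1) / (2 * real l * (real r - 1) - 1)"

lemma exponent_denominators:
  assumes "r \<ge> 3" "l \<ge> 1"
  shows "2 * real l * (real r - 1) - 1 > 2 * real l - 1" "2 * real l - 1 > 0" "2 * real l * (real r - 2) > 0"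
proof -
  have "2 * real l * 1 < 2 * real l * (real r - 1)" using assms by (intro mult_strict_left_mono) auto
  then show "2 * real l * (real r - 1) - 1 > 2 * real l - 1" by simp
qed (use assms in auto)

lemma density_exponent_bounds:
  assumes "r \<ge> 3" "l \<ge> 1"
  shows "0 < density_exponent r l" "density_exponent r l < 1"
proof -
  note d = exponent_denominators[OF assms]
  have "2 * real l * (real r - 1) - 1 > 0" using d by linarith
  then show "0 < density_exponent r l" "density_exponent r l < 1"
    unfolding density_exponent_def using d by (simp_all only: divide_pos_pos divide_less_eq_1_pos)
qed

lemma upper_exponent_eq:
  assumes "r \<ge> 3" "l \<ge> 1"
  shows "upper_exponent r l = - (real r - 3) * (2 * real l * (real r - 1) - 1) / (2 * real l * (real r - 2))"
  using exponent_denominators[OF assms] assms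
  by (simp add: upper_exponent_def field_simps)

lemma density_minus_one:
  assumes "r \<ge> 3" "l \<ge> 1"
  shows "density_exponent r l - 1 = - (2 * real l * (real r - 2)) / (2 * real l * (real r - 1) - 1)"
proof -
  have "2 * real l * (real r - 1) - 1 > 0" using exponent_denominators[OF assms] by linarith
  then have "density_exponent r l - 1 =
      ((2 * real l - 1) - (2 * real l * (real r - 1) - 1)) / (2 * real l * (real r - 1) - 1)"
    by (simp only: density_exponent_def diff_divide_distrib divide_self_if) simp
  then show ?thesis by (simp add: algebra_simps)
qed

text \<open>Write \<open>a\<close> for the density exponent and let the container size be
  \<open>n^2 * p powr (a - 1)\<close>. In order: at the upper threshold this size meets the floor
  \<open>n ^ (r - 1)\<close>; its fingerprint size is \<open>n^2 * p powr a\<close>, which is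
  \<open>p\<close> times the container size; at the lower threshold this bound equals
  \<open>n powr (1 + 1 / (2 * l))\<close>; at the upper threshold \<open>p * n ^ (r - 1)\<close> is
  the fingerprint size of a container at the floor.\<close>

lemma exponent_identities:
  assumes "r \<ge> 3" "l \<ge> 1"
  shows "upper_exponent r l * (density_exponent r l - 1) = real r - 3"
    "(density_exponent r l - 1) * (- scale_exponent r l) = density_exponent r l"
    "density_exponent r l * lower_exponent r l = - ((2 * real l - 1) / (2 * real l))"
    "upper_exponent r l + (real r - 1) = 2 - scale_exponent r l * (real r - 3)"
proof -
  define A where "A = 2 * real l * (real r - 1) - 1"
  define B where "B = 2 * real l * (real r - 2)"
  have A: "A > 0" and B: "B > 0" using exponent_denominators[OF assms] unfolding A_def B_def by linarith+
  note d = density_minus_one[OF assms, folded A_def B_def] and u = upper_exponent_eq[OF assms, folded A_def B_def]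
  show "upper_exponent r l * (density_exponent r l - 1) = real r - 3"
    unfolding d u using A B by simp
  show "(density_exponent r l - 1) * (- scale_exponent r l) = density_exponent r l"
    unfolding d unfolding scale_exponent_def density_exponent_def A_def[symmetric] B_def[symmetric] using A B by simp
  have "lower_exponent r l = - A / (2 * real l)" using assms by (simp add: lower_exponent_def A_def field_simps)
  then show "density_exponent r l * lower_exponent r l = - ((2 * real l - 1) / (2 * real l))"
    unfolding density_exponent_def A_def[symmetric] using A by simp
  have AB: "A = B + (2 * real l - 1)" by (simp add: A_def B_def algebra_simps)
  show "upper_exponent r l + (real r - 1) = 2 - scale_exponent r l * (real r - 3)"
    unfolding u unfolding scale_exponent_def B_def[symmetric] AB using B by (simp add: field_simps)
qed

text \<open>The container size stays at the floor \<open>C0 * n ^ (r - 1)\<close> for every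
  \<open>p\<close>, and \<open>\<mu>\<close> is \<open>6 * p\<close> times that.\<close>

lemma upper_bound_dense:
  fixes r l :: nat and \<epsilon> :: real
  defines "C0 \<equiv> 2 * real (r * ((2 * l + 1) * (r + 1) + 1))"
  assumes r: "r \<ge> 3" and l: "l \<ge> 1" and \<epsilon>: "0 < \<epsilon>" "\<epsilon> \<le> 1"
  shows "\<forall>\<^sub>F n in sequentially. \<forall>p. 0 \<le> p \<and> p \<le> 1 \<and> real n powr (upper_exponent r l + \<epsilon>) \<le> p \<longrightarrow>
    measure_pmf.prob (random_rgraph r n p)
      {G. 6 * C0 * p * real n ^ (r - 1) < real (ex G (linear_cycle r (2 * l + 1)))} \<le> exp (- real n / 4)"
proof -
  have C0: "C0 \<ge> 1"
  proof -
    have "1 \<le> r * ((2 * l + 1) * (r + 1) + 1)" using r by simp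
    then have "1 \<le> real (r * ((2 * l + 1) * (r + 1) + 1))" by linarith
    then show ?thesis unfolding C0_def by linarith
  qed
  have "\<epsilon> / 2 > 0" using \<epsilon> by simp
  note tail = ex_tail[OF r l this, folded C0_def]
  have "\<forall>\<^sub>F n in sequentially. real n powr (- \<epsilon> / 2) \<le> 1 / 4" using \<epsilon> by real_asymp
  with tail show ?thesis using eventually_gt_at_top[of 1]
  proof eventually_elim
    case (elim n)
    have n: "real n > 1" using elim(3) by simp
    then have n2: "real n ^ 2 = real n powr 2" by (simp add: powr_numeral)
    show ?case
    proof (intro allI impI, elim conjE)
      fix p assume p: "0 \<le> p" "p \<le> 1" "real n powr (upper_exponent r l + \<epsilon>) \<le> p"
      have p0: "p > 0" using p(3) n by (smt (verit) powr_gt_zero)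
      \<comment> \<open>For \<open>r = 3\<close> the threshold exponent is \<open>0\<close>, and
        \<open>n powr \<epsilon> \<le> p \<le> 1\<close> is impossible. For \<open>r \<ge> 4\<close>
        the floor \<open>n ^ (r - 1)\<close> exceeds
        \<open>n powr (2 + \<epsilon> / 2)\<close>.\<close>
      have r4: "r \<ge> 4"
      proof (rule ccontr)
        assume "\<not> r \<ge> 4"
        then have "r = 3" using r by simp
        then have "upper_exponent r l = 0" using upper_exponent_eq[OF r l] by simp
        then have "real n powr \<epsilon> \<le> 1" using p by simp
        moreover have "real n powr 0 < real n powr \<epsilon>" using n \<epsilon> by (intro powr_less_mono) auto
        ultimately show False using n by simp
      qed
      define \<mu> where "\<mu> = 6 * C0 * p * real n ^ (r - 1)"
      have M: "\<mu> / (6 * p) = C0 * real n ^ (r - 1)" using p0 by (simp add: \<mu>_def)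
      have s: "scale_exponent r l > 0" using r l by (rule scale_exponent_pos)
      have nr: "real n ^ (r - 1) = real n powr (real r - 1)"
        using n r by (subst powr_realpow[symmetric]) auto
      have pn: "real n powr (2 - scale_exponent r l * (real r - 3) + \<epsilon>) \<le> p * real n ^ (r - 1)"
      proof -
        have "real n powr (upper_exponent r l + \<epsilon>) * real n powr (real r - 1) \<le> p * real n powr (real r - 1)"
          using p(3) by (intro mult_right_mono) auto
        moreover have "(upper_exponent r l + \<epsilon>) + (real r - 1) = 2 - scale_exponent r l * (real r - 3) + \<epsilon>"
          using exponent_identities(4)[OF r l] by linarith
        ultimately show ?thesis unfolding nr by (simp add: powr_add[symmetric])
      qed
      have \<mu>p: "p * real n ^ (r - 1) \<le> \<mu>"
      proof -
        have "1 * (p * real n ^ (r - 1)) \<le> (6 * C0) * (p * real n ^ (r - 1))" using C0 p by (intro mult_right_mono) auto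
        then show ?thesis by (simp add: \<mu>_def mult.assoc)
      qed
      have "scale_exponent r l * (real r - 3) \<le> 1"
      proof -
        have d: "2 * real l * (real r - 2) > 0" using r l by simp
        have "(2 * real l - 1) * (real r - 3) \<le> (2 * real l) * (real r - 2)" using r l by (intro mult_mono) auto
        then show ?thesis unfolding scale_exponent_def times_divide_eq_left using d by (simp add: divide_le_eq_1_pos)
      qed
      then have "real n powr 1 \<le> real n powr (2 - scale_exponent r l * (real r - 3) + \<epsilon>)"
        using n \<epsilon> by (intro powr_mono) auto
      then have c1: "real n \<le> \<mu>" using pn \<mu>p n by simp
      have "real n powr (2 + \<epsilon> / 2) \<le> real n powr (real r - 1)" using n r4 \<epsilon> by (intro powr_mono) auto
      also have "\<dots> \<le> C0 * real n ^ (r - 1)" unfolding nr using C0 by (simp add: mult_le_cancel_right1)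
      finally have c3: "real n powr (2 + \<epsilon> / 2) \<le> \<mu> / (6 * p)" unfolding M .
      have c4: "real n powr (\<epsilon> / 2) * fingerprint_scale r l n (\<mu> / (6 * p)) \<le> \<mu> / 4"
      proof -
        have "real n powr (real r - 3) \<le> \<mu> / (6 * p) / real n ^ 2"
        proof -
          have "real n ^ (r - 1) = real n powr (real r - 3) * real n ^ 2"
            by (simp only: nr n2 powr_add[symmetric]) (simp add: algebra_simps)
          then have "\<mu> / (6 * p) / real n ^ 2 = C0 * real n powr (real r - 3)" unfolding M using n by simp
          then show ?thesis using C0 by (simp add: mult_le_cancel_right1)
        qed
        then have "(\<mu> / (6 * p) / real n ^ 2) powr (- scale_exponent r l) \<le> (real n powr (real r - 3)) powr (- scale_exponent r l)"
          using s n by (intro powr_mono2') auto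
        then have "fingerprint_scale r l n (\<mu> / (6 * p)) \<le> real n ^ 2 * (real n powr (real r - 3)) powr (- scale_exponent r l)"
          unfolding fingerprint_scale_def by (intro mult_left_mono) auto
        also have "\<dots> = real n powr (2 - scale_exponent r l * (real r - 3))"
        proof -
          have "2 + (real r - 3) * (- scale_exponent r l) = 2 - scale_exponent r l * (real r - 3)"
            by (simp add: mult.commute)
          then show ?thesis by (simp only: n2 powr_powr powr_add[symmetric])
        qed
        finally have "real n powr (\<epsilon> / 2) * fingerprint_scale r l n (\<mu> / (6 * p)) \<le>
            real n powr (\<epsilon> / 2) * real n powr (2 - scale_exponent r l * (real r - 3))" by (intro mult_left_mono) auto
        also have "\<dots> = real n powr (- \<epsilon> / 2) * real n powr (2 - scale_exponent r l * (real r - 3) + \<epsilon>)"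
          by (simp add: powr_add[symmetric])
        also have "\<dots> \<le> 1 / 4 * real n powr (2 - scale_exponent r l * (real r - 3) + \<epsilon>)"
          using elim(2) by (intro mult_right_mono) auto
        also have "\<dots> \<le> 1 / 4 * \<mu>" using pn \<mu>p by simp
        finally show ?thesis by simp
      qed
      have "measure_pmf.prob (random_rgraph r n p) {G. \<mu> < real (ex G (linear_cycle r (2 * l + 1)))} \<le> exp (- real n / 4)"
        using elim(1) p0 p(2) c1 M c3 c4 by auto
      then show "measure_pmf.prob (random_rgraph r n p)
          {G. 6 * C0 * p * real n ^ (r - 1) < real (ex G (linear_cycle r (2 * l + 1)))} \<le> exp (- real n / 4)"
        unfolding \<mu>_def .
    qed
  qed
qed

text \<open>Here \<open>\<mu>\<close> is the balanced value \<open>n^2 * p powr a\<close>, enlarged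
  by \<open>n powr (2 * \<epsilon>)\<close>. The enlargement keeps \<open>M\<close> above the floor
  although \<open>p\<close> may exceed the exact threshold by \<open>n powr \<epsilon>\<close>, and
  it absorbs the constants and the factor \<open>n powr (\<epsilon> / 2)\<close> of
  \<open>ex_tail\<close>.\<close>

lemma upper_bound_sparse:
  fixes r l :: nat and \<epsilon> :: real
  assumes r: "r \<ge> 3" and l: "l \<ge> 1" and \<epsilon>: "0 < \<epsilon>"
  shows "\<forall>\<^sub>F n in sequentially. \<forall>p. 0 \<le> p \<and> p \<le> 1 \<and> real n powr (lower_exponent r l + \<epsilon>) \<le> p \<and>
      p \<le> real n powr (upper_exponent r l + \<epsilon>) \<longrightarrow>
    measure_pmf.prob (random_rgraph r n p)
      {G. p powr density_exponent r l * real n powr (2 + 2 * \<epsilon>) < real (ex G (linear_cycle r (2 * l + 1)))} \<le> exp (- real n / 4)"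
proof -
  define C0 where "C0 = 2 * real (r * ((2 * l + 1) * (r + 1) + 1))"
  define a where "a = density_exponent r l"
  have a: "0 < a" "a < 1" using density_exponent_bounds[OF r l] by (auto simp: a_def)
  have "\<epsilon> / 2 > 0" using \<epsilon> by simp
  note tail = ex_tail[OF r l this, folded C0_def]
  have "\<forall>\<^sub>F n in sequentially. real n powr (- (3 / 2 * \<epsilon>)) \<le> 1 / 4" using \<epsilon> by real_asymp
  moreover have "\<forall>\<^sub>F n in sequentially. 6 * C0 \<le> real n powr \<epsilon>" using \<epsilon> by real_asymp
  moreover have "\<forall>\<^sub>F n in sequentially. 6 \<le> real n powr (\<epsilon> / 2)" using \<epsilon> by real_asymp
  ultimately show ?thesis using tail eventually_gt_at_top[of 1]
  proof eventually_elim
    case (elim n)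
    have n: "real n > 1" using elim(5) by simp
    then have n2: "real n ^ 2 = real n powr 2" by (simp add: powr_numeral)
    show ?case
    proof (intro allI impI, elim conjE)
      fix p assume p: "0 \<le> p" "p \<le> 1" "real n powr (lower_exponent r l + \<epsilon>) \<le> p" "p \<le> real n powr (upper_exponent r l + \<epsilon>)"
      have p0: "p > 0" using p(3) n by (smt (verit) powr_gt_zero)
      define \<mu> where "\<mu> = p powr a * real n powr (2 + 2 * \<epsilon>)"
      define M where "M = \<mu> / (6 * p)"
      define y where "y = p powr (a - 1) * real n powr (2 * \<epsilon>) / 6"
      have My: "M = real n ^ 2 * y"
      proof -
        have "p powr a = p powr (a - 1) * p" using p0 by (simp add: powr_diff)
        moreover have "real n powr (2 + 2 * \<epsilon>) = real n ^ 2 * real n powr (2 * \<epsilon>)"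
          using n by (simp add: powr_add powr_numeral)
        ultimately show ?thesis using p0 by (simp add: M_def \<mu>_def y_def)
      qed
      have ylow: "real n powr (real r - 3 + \<epsilon>) \<le> 6 * y"
      proof -
        have "(real n powr (upper_exponent r l + \<epsilon>)) powr (a - 1) \<le> p powr (a - 1)"
          using p(4) p0 a by (intro powr_mono2') auto
        then have "real n powr ((upper_exponent r l + \<epsilon>) * (a - 1)) * real n powr (2 * \<epsilon>) \<le> p powr (a - 1) * real n powr (2 * \<epsilon>)"
          by (intro mult_right_mono) (auto simp: powr_powr)
        moreover have "real r - 3 + \<epsilon> \<le> (upper_exponent r l + \<epsilon>) * (a - 1) + 2 * \<epsilon>"
        proof -
          have "0 \<le> a * \<epsilon>" using a \<epsilon> by simp
          then show ?thesis using exponent_identities(1)[OF r l] by (simp add: a_def algebra_simps)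
        qed
        then have "real n powr (real r - 3 + \<epsilon>) \<le> real n powr ((upper_exponent r l + \<epsilon>) * (a - 1) + 2 * \<epsilon>)"
          using n by (intro powr_mono) auto
        ultimately show ?thesis by (simp add: y_def powr_add)
      qed
      have Mlow: "real n powr (real r - 1 + \<epsilon>) \<le> 6 * M"
      proof -
        have "real n ^ 2 * real n powr (real r - 3 + \<epsilon>) \<le> real n ^ 2 * (6 * y)" using ylow by (intro mult_left_mono) auto
        moreover have "real n ^ 2 * real n powr (real r - 3 + \<epsilon>) = real n powr (real r - 1 + \<epsilon>)"
          by (simp only: n2 powr_add[symmetric]) (simp add: algebra_simps)
        ultimately show ?thesis by (simp add: My)
      qed
      have c2: "C0 * real n ^ (r - 1) \<le> M"
      proof -
        have "6 * C0 * real n ^ (r - 1) \<le> real n powr \<epsilon> * real n ^ (r - 1)" using elim(2) by (intro mult_right_mono) auto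
        also have "\<dots> = real n powr (real r - 1 + \<epsilon>)"
          using n r by (subst powr_realpow[symmetric]) (auto simp: powr_add[symmetric] algebra_simps)
        finally show ?thesis using Mlow by linarith
      qed
      have c3: "real n powr (2 + \<epsilon> / 2) \<le> M"
      proof -
        have "6 * real n powr (2 + \<epsilon> / 2) \<le> real n powr (\<epsilon> / 2) * real n powr (2 + \<epsilon> / 2)"
          using elim(3) by (intro mult_right_mono) auto
        also have "\<dots> = real n powr (2 + \<epsilon>)" by (simp add: powr_add[symmetric] add.commute)
        also have "\<dots> \<le> real n powr (real r - 1 + \<epsilon>)" using n r by (intro powr_mono) auto
        finally show ?thesis using Mlow by linarith
      qed
      have c1: "real n \<le> \<mu>"
      proof -
        have "real n powr 1 \<le> real n powr ((lower_exponent r l + \<epsilon>) * a + (2 + 2 * \<epsilon>))"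
        proof (intro powr_mono)
          have "- 1 \<le> a * lower_exponent r l" unfolding a_def exponent_identities(3)[OF r l] using l by (simp add: field_simps)
          moreover have "0 \<le> a * \<epsilon>" using a \<epsilon> by simp
          ultimately show "1 \<le> (lower_exponent r l + \<epsilon>) * a + (2 + 2 * \<epsilon>)" using \<epsilon> by (simp add: algebra_simps)
        qed (use n in simp)
        also have "\<dots> = (real n powr (lower_exponent r l + \<epsilon>)) powr a * real n powr (2 + 2 * \<epsilon>)"
          by (subst powr_add) (simp only: powr_powr)
        also have "\<dots> \<le> \<mu>" unfolding \<mu>_def using p(3) a by (intro mult_right_mono powr_mono2) auto
        finally show ?thesis using n by simp
      qed
      have c4: "real n powr (\<epsilon> / 2) * fingerprint_scale r l n M \<le> \<mu> / 4"
      proof -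
        have s: "scale_exponent r l > 0" using r l by (rule scale_exponent_pos)
        have "M / real n ^ 2 = y" using My n by simp
        moreover have "p powr (a - 1) \<le> y"
        proof -
          have "real n powr (\<epsilon> / 2) \<le> real n powr (2 * \<epsilon>)" using n \<epsilon> by (intro powr_mono) auto
          then have "6 \<le> real n powr (2 * \<epsilon>)" using elim(3) by linarith
          then have "p powr (a - 1) * 6 \<le> p powr (a - 1) * real n powr (2 * \<epsilon>)" by (intro mult_left_mono) auto
          then show ?thesis by (simp add: y_def)
        qed
        ultimately have "(M / real n ^ 2) powr (- scale_exponent r l) \<le> (p powr (a - 1)) powr (- scale_exponent r l)"
          using s p0 by (intro powr_mono2') auto
        also have "\<dots> = p powr a" unfolding powr_powr using exponent_identities(2)[OF r l] by (simp add: a_def)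
        finally have "fingerprint_scale r l n M \<le> real n ^ 2 * p powr a" unfolding fingerprint_scale_def by (intro mult_left_mono) auto
        then have "real n powr (\<epsilon> / 2) * fingerprint_scale r l n M \<le> real n powr (\<epsilon> / 2) * (real n ^ 2 * p powr a)" by (intro mult_left_mono) auto
        also have "\<dots> = real n powr (- (3 / 2 * \<epsilon>)) * \<mu>"
        proof -
          have "real n powr (- (3 / 2 * \<epsilon>)) * real n powr (2 + 2 * \<epsilon>) = real n powr (\<epsilon> / 2) * real n ^ 2"
            by (simp only: n2 powr_add[symmetric]) (simp add: algebra_simps)
          then show ?thesis by (simp add: \<mu>_def mult_ac)
        qed
        also have "\<dots> \<le> 1 / 4 * \<mu>" using elim(1) by (intro mult_right_mono) (auto simp: \<mu>_def)
        finally show ?thesis by simp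
      qed
      have "measure_pmf.prob (random_rgraph r n p) {G. \<mu> < real (ex G (linear_cycle r (2 * l + 1)))} \<le> exp (- real n / 4)"
        using elim(4) p0 p(2) c1 c2 c3 c4 unfolding M_def by blast
      then show "measure_pmf.prob (random_rgraph r n p)
          {G. p powr density_exponent r l * real n powr (2 + 2 * \<epsilon>) < real (ex G (linear_cycle r (2 * l + 1)))} \<le> exp (- real n / 4)"
        unfolding \<mu>_def a_def .
    qed
  qed
qed

section \<open>Lower bounds for triangles\<close>

lemma finite_set_pmf_random_rgraph: "finite (set_pmf (random_rgraph r n p))"
proof (rule finite_subset)
  show "set_pmf (random_rgraph r n p) \<subseteq> {{..<n}} \<times> Pow (rsets n r)"
    using set_pmf_random_rgraph by fastforce
  show "finite ({{..<n}} \<times> Pow (rsets n r))" using finite_rsets by simp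
qed

lemma integrable_random_rgraph [simp]:
  fixes f :: "nat hypergraph \<Rightarrow> real"
  shows "integrable (measure_pmf (random_rgraph r n p)) f"
  by (rule integrable_measure_pmf_finite[OF finite_set_pmf_random_rgraph])

lemma expectation_of_bool_superset:
  assumes "0 \<le> p" "p \<le> 1" "I \<subseteq> rsets n r"
  shows "measure_pmf.expectation (random_rgraph r n p) (\<lambda>G. of_bool (I \<subseteq> snd G)) = p ^ card I"
proof -
  have "(\<lambda>G :: nat hypergraph. of_bool (I \<subseteq> snd G) :: real) = indicator {G. I \<subseteq> snd G}" by (auto simp: indicator_def fun_eq_iff)
  then show ?thesis using prob_superset[OF assms] by simp
qed

lemma prob_ge_le:
  fixes X :: "nat hypergraph \<Rightarrow> real"
  assumes "\<And>G. 0 \<le> X G" "0 < c"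
  shows "measure_pmf.prob (random_rgraph r n p) {G. c \<le> X G} \<le> measure_pmf.expectation (random_rgraph r n p) X / c"
  using integral_Markov_inequality_measure[of "measure_pmf (random_rgraph r n p)" X "{}" c] assms by simp

text \<open>Chebyshev's inequality; for a sum of independent indicators the variance is at most the
  mean.\<close>

lemma prob_few_edges:
  assumes p: "0 < p" "p \<le> 1" and F: "F \<subseteq> rsets n r" "F \<noteq> {}"
  shows "measure_pmf.prob (random_rgraph r n p) {G. real (card (F \<inter> snd G)) < p * card F / 2} \<le> 4 / (p * card F)"
proof -
  let ?M = "random_rgraph r n p"
  let ?E = "measure_pmf.expectation ?M"
  have finF: "finite F" using F(1) finite_rsets by (rule finite_subset)
  define N where "N = real (card F)"
  have N: "N > 0" using finF F by (simp add: N_def card_gt_0_iff)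
  define X where "X G = real (card (F \<inter> snd G))" for G :: "nat hypergraph"
  have X: "X G = (\<Sum>e\<in>F. of_bool ({e} \<subseteq> snd G))" for G
    using finF by (simp add: X_def Int_def)
  have X2: "X G ^ 2 = (\<Sum>e\<in>F. \<Sum>e'\<in>F. of_bool ({e, e'} \<subseteq> snd G))" for G
    unfolding X power2_eq_square sum_product by (intro sum.cong refl) auto
  have EX: "?E X = N * p"
  proof -
    have "?E X = (\<Sum>e\<in>F. ?E (\<lambda>G. of_bool ({e} \<subseteq> snd G)))"
      unfolding X by (rule Bochner_Integration.integral_sum) simp
    also have "\<dots> = (\<Sum>e\<in>F. p)"
      using F p by (intro sum.cong refl, subst expectation_of_bool_superset) auto
    finally show ?thesis by (simp add: N_def)
  qed
  have EX2: "?E (\<lambda>G. X G ^ 2) \<le> N * p + (N * p)\<^sup>2"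
  proof -
    have "?E (\<lambda>G. X G ^ 2) = (\<Sum>e\<in>F. \<Sum>e'\<in>F. ?E (\<lambda>G. of_bool ({e, e'} \<subseteq> snd G)))"
      unfolding X2 by (subst Bochner_Integration.integral_sum, simp, intro sum.cong refl Bochner_Integration.integral_sum, simp)
    also have "\<dots> = (\<Sum>e\<in>F. \<Sum>e'\<in>F. p ^ card {e, e'})"
      using F p by (intro sum.cong refl expectation_of_bool_superset) auto
    also have "\<dots> \<le> (\<Sum>e\<in>F. \<Sum>e'\<in>F. (if e = e' then p else 0) + p\<^sup>2)"
      using p by (intro sum_mono) (auto simp: card_insert_if power2_eq_square)
    also have "\<dots> = N * p + (N * p)\<^sup>2"
      using finF by (simp add: sum.distrib sum.delta N_def power2_eq_square algebra_simps)
    finally show ?thesis .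
  qed
  have var: "?E (\<lambda>G. (X G - N * p)\<^sup>2) \<le> N * p"
  proof -
    have "?E (\<lambda>G. (X G - N * p)\<^sup>2) = ?E (\<lambda>G. X G ^ 2 - 2 * (N * p) * X G + (N * p)\<^sup>2)"
      by (simp add: power2_diff algebra_simps)
    also have "\<dots> = ?E (\<lambda>G. X G ^ 2) - 2 * (N * p) * ?E X + (N * p)\<^sup>2"
      by (subst Bochner_Integration.integral_add, simp, simp, subst Bochner_Integration.integral_diff) auto
    also have "\<dots> \<le> N * p" unfolding EX using EX2 by (simp add: power2_eq_square algebra_simps)
    finally show ?thesis .
  qed
  have "measure_pmf.prob ?M {G. X G < p * N / 2} \<le> measure_pmf.prob ?M {G. (N * p / 2)\<^sup>2 \<le> (X G - N * p)\<^sup>2}"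
  proof (intro measure_pmf.finite_measure_mono subsetI CollectI)
    fix G assume "G \<in> {G. X G < p * N / 2}"
    then have "N * p / 2 \<le> N * p - X G" by (simp add: mult.commute)
    then have "(N * p / 2)\<^sup>2 \<le> (N * p - X G)\<^sup>2" using N p by (intro power_mono) auto
    then show "(N * p / 2)\<^sup>2 \<le> (X G - N * p)\<^sup>2" by (simp add: power2_commute)
  qed auto
  also have "\<dots> \<le> ?E (\<lambda>G. (X G - N * p)\<^sup>2) / (N * p / 2)\<^sup>2"
    using N p by (intro prob_ge_le) auto
  also have "\<dots> \<le> N * p / (N * p / 2)\<^sup>2" using var by (intro divide_right_mono) auto
  also have "\<dots> = 4 / (p * N)" using N p by (simp add: power2_eq_square field_simps)
  finally show ?thesis unfolding X_def N_def .
qed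

text \<open>The three edges of a linear triangle have no vertex in common.\<close>

lemma star_copy_free:
  assumes "\<And>e. e \<in> snd F \<Longrightarrow> v \<in> e"
  shows "\<not> contains_copy F (linear_cycle r 3)"
proof
  assume "contains_copy F (linear_cycle r 3)"
  then obtain \<phi> where \<phi>: "inj_on \<phi> (fst (linear_cycle r 3))" "\<forall>e\<in>snd (linear_cycle r 3). \<phi> ` e \<in> snd F"
    by (auto simp: contains_copy_def)
  define e where "e a = expand_edge r {a, (a + 1) mod 3}" for a :: nat
  have e: "e a \<in> snd (linear_cycle r 3)" if "a < 3" for a using that by (auto simp: snd_linear_cycle e_def)
  have sub: "e a \<subseteq> fst (linear_cycle r 3)" if "a < 3" for a
    using e[OF that] Union_linear_cycle[of 3 r] by auto
  have "v \<in> \<phi> ` e a" if "a < 3" for a using \<phi>(2) e[OF that] assms by blast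
  then have "v \<in> \<phi> ` e 0" "v \<in> \<phi> ` e 1" "v \<in> \<phi> ` e 2" by auto
  then obtain x y z where xyz: "x \<in> e 0" "y \<in> e 1" "z \<in> e 2" "\<phi> x = v" "\<phi> y = v" "\<phi> z = v" by auto
  then have "x = y" "x = z" using inj_onD[OF \<phi>(1)] sub[of 0] sub[of 1] sub[of 2] by fastforce+
  then have "x \<in> e 0 \<inter> e 1 \<inter> e 2" using xyz by auto
  moreover have "e 0 \<inter> e 1 \<inter> e 2 = {}" by (auto simp: e_def expand_edge_def doubleton_eq_iff)
  ultimately show False by auto
qed

lemma star_lower_bound:
  assumes r: "r \<ge> 3" and p: "0 < p" "p \<le> 1" and n: "n \<ge> 2 * r"
  defines "c \<equiv> (1 / (2 * real r)) ^ (r - 1)"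
  shows "measure_pmf.prob (random_rgraph r n p) {G. real (ex G (linear_cycle r 3)) < c / 2 * p * real n ^ (r - 1)}
    \<le> 4 / (c * p * real n ^ (r - 1))"
proof -
  let ?M = "random_rgraph r n p"
  define F where "F = {e \<in> rsets n r. 0 \<in> e}"
  have F: "F \<subseteq> rsets n r" by (auto simp: F_def)
  have finF: "finite F" using F finite_rsets by (rule finite_subset)
  have cardF: "card F = (n - 1) choose (r - 1)"
  proof -
    have "bij_betw (insert 0) {e. e \<subseteq> {1..<n} \<and> card e = r - 1} F"
    proof (rule bij_betwI[where g = "\<lambda>e. e - {0}"])
      show "insert 0 \<in> {e. e \<subseteq> {1..<n} \<and> card e = r - 1} \<rightarrow> F"
      proof
        fix e assume e: "e \<in> {e. e \<subseteq> {1..<n} \<and> card e = r - 1}"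
        then have "finite e" "0 \<notin> e" using finite_subset by fastforce+
        then show "insert 0 e \<in> F" using e r n by (auto simp: F_def rsets_def)
      qed
      show "(\<lambda>e. e - {0}) \<in> F \<rightarrow> {e. e \<subseteq> {1..<n} \<and> card e = r - 1}"
        by (auto simp: F_def rsets_def subset_iff)
    qed (auto simp: F_def)
    then have "card F = card {e. e \<subseteq> {1..<n} \<and> card e = r - 1}" by (simp add: bij_betw_same_card)
    also have "\<dots> = (n - 1) choose (r - 1)" using n_subsets[of "{1..<n}" "r - 1"] by simp
    finally show ?thesis .
  qed
  have cF: "c * real n ^ (r - 1) \<le> card F"
  proof -
    have "(real n / 2) / real r \<le> real (n - 1) / real (r - 1)"
      using r n by (intro frac_le) (auto simp: of_nat_diff)
    then have "real n / (2 * real r) \<le> real (n - 1) / real (r - 1)" by simp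
    then have "(real n / (2 * real r)) ^ (r - 1) \<le> (real (n - 1) / real (r - 1)) ^ (r - 1)" by (intro power_mono) auto
    also have "\<dots> \<le> real (card F)" unfolding cardF using r n by (intro binomial_ge_n_over_k_pow_k) auto
    finally show ?thesis by (simp add: c_def power_divide)
  qed
  have cpos: "c * real n ^ (r - 1) > 0" using r n by (simp add: c_def)
  then have Fne: "F \<noteq> {}" using cF by auto
  have "measure_pmf.prob ?M {G. real (ex G (linear_cycle r 3)) < c / 2 * p * real n ^ (r - 1)} =
      measure_pmf.prob ?M ({G. real (ex G (linear_cycle r 3)) < c / 2 * p * real n ^ (r - 1)} \<inter> set_pmf ?M)"
    by (rule measure_Int_set_pmf[symmetric])
  also have "\<dots> \<le> measure_pmf.prob ?M {G. real (card (F \<inter> snd G)) < p * card F / 2}"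
  proof (intro measure_pmf.finite_measure_mono subsetI CollectI)
    fix G assume "G \<in> {G. real (ex G (linear_cycle r 3)) < c / 2 * p * real n ^ (r - 1)} \<inter> set_pmf ?M"
    then have G: "real (ex G (linear_cycle r 3)) < c / 2 * p * real n ^ (r - 1)" "fst G = {..<n}" "snd G \<subseteq> rsets n r"
      using set_pmf_random_rgraph by blast+
    have "card (snd ({..<n}, F \<inter> snd G)) \<le> ex G (linear_cycle r 3)"
    proof (rule ex_ge)
      show "finite (snd G)" using G(3) finite_rsets by (rule finite_subset)
      show "subhypergraph ({..<n}, F \<inter> snd G) G" using G by (auto simp: subhypergraph_def rsets_def)
      show "\<not> contains_copy ({..<n}, F \<inter> snd G) (linear_cycle r 3)"
        by (rule star_copy_free[of _ 0]) (auto simp: F_def)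
    qed
    then have "real (card (F \<inter> snd G)) < c / 2 * p * real n ^ (r - 1)" using G(1) by simp
    also have "\<dots> = p * (c * real n ^ (r - 1)) / 2" by simp
    also have "\<dots> \<le> p * card F / 2" using cF p by (intro divide_right_mono mult_left_mono) auto
    finally show "real (card (F \<inter> snd G)) < p * card F / 2" .
  qed auto
  also have "\<dots> \<le> 4 / (p * card F)" by (rule prob_few_edges[OF p F Fne])
  also have "\<dots> \<le> 4 / (p * (c * real n ^ (r - 1)))"
    using cF p by (intro frac_le mult_left_mono mult_pos_pos[OF p(1) cpos]) auto
  finally show ?thesis by (simp add: mult_ac)
qed

section \<open>Large sets without weighted means\<close>

lemma digits_less:
  fixes x :: "nat \<Rightarrow> nat"
  assumes "\<And>i. i < h \<Longrightarrow> x i < B"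
  shows "(\<Sum>i<h. x i * B ^ i) < B ^ h"
  using assms
proof (induction h)
  case (Suc h)
  have "(\<Sum>i<h. x i * B ^ i) < B ^ h" using Suc by auto
  moreover have "x h * B ^ h + B ^ h \<le> B * B ^ h"
    using Suc.prems[of h] mult_le_mono1[of "x h + 1" B "B ^ h"] by (simp add: algebra_simps)
  ultimately show ?case by simp
qed simp

lemma digits_unique:
  fixes x y :: "nat \<Rightarrow> nat"
  assumes "\<And>i. i < h \<Longrightarrow> x i < B \<and> y i < B" "(\<Sum>i<h. x i * B ^ i) = (\<Sum>i<h. y i * B ^ i)" "i < h"
  shows "x i = y i"
  using assms
proof (induction h arbitrary: x y i)
  case (Suc h)
  have split: "(\<Sum>i<Suc h. z i * B ^ i) = z 0 + B * (\<Sum>i<h. z (Suc i) * B ^ i)" for z :: "nat \<Rightarrow> nat"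
    by (simp only: sum.lessThan_Suc_shift sum_distrib_left) (simp add: mult_ac)
  have eq: "x 0 + B * (\<Sum>i<h. x (Suc i) * B ^ i) = y 0 + B * (\<Sum>i<h. y (Suc i) * B ^ i)"
    using Suc.prems(2) unfolding split .
  have B: "x 0 < B" "y 0 < B" using Suc.prems(1)[of 0] by auto
  have "x 0 = (x 0 + B * (\<Sum>i<h. x (Suc i) * B ^ i)) mod B" using B by simp
  also have "\<dots> = y 0" unfolding eq using B by simp
  finally have 0: "x 0 = y 0" .
  then have "(\<Sum>i<h. x (Suc i) * B ^ i) = (\<Sum>i<h. y (Suc i) * B ^ i)" using eq B by simp
  then have "x (Suc j) = y (Suc j)" if "j < h" for j
    using Suc.prems(1) that by (intro Suc.IH[of "\<lambda>i. x (Suc i)" "\<lambda>i. y (Suc i)"]) auto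
  then show ?case using 0 Suc.prems(3) by (cases i) auto
qed simp

text \<open>The weights will be differences of positions within an edge, which is why their sum
  stays below \<open>r\<close>.\<close>

definition convex_free :: "nat \<Rightarrow> nat set \<Rightarrow> bool" where
  "convex_free r A \<longleftrightarrow> (\<forall>a\<in>A. \<forall>b\<in>A. \<forall>c\<in>A. \<forall>\<alpha> \<beta>. 0 < \<alpha> \<and> 0 < \<beta> \<and> \<alpha> + \<beta> < r \<and>
     \<alpha> * a + \<beta> * b = (\<alpha> + \<beta>) * c \<longrightarrow> a = c \<and> b = c)"

text \<open>Behrend's construction: integers whose digits form a vector on a fixed sphere; the digits are so
  small that the equation holds digit by digit, and the sphere is strictly convex.\<close>

lemma behrend_digits:
  assumes d: "d \<ge> 1" and r: "r \<ge> 1"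
  shows "\<exists>A\<subseteq>{..<(r * d) ^ h}. d ^ h \<le> (h * d\<^sup>2 + 1) * card A \<and> convex_free r A"
proof -
  define X where "X = ({..<h} \<rightarrow>\<^sub>E {..<d})"
  \<comment> \<open>Base \<open>r * d\<close> leaves room for the digits of
    \<open>\<alpha> * x + \<beta> * y\<close> with \<open>\<alpha> + \<beta> < r\<close>, so no
    carries occur.\<close>
  define B where "B = r * d"
  define N where "N x = (\<Sum>i<h. (x i)\<^sup>2)" for x :: "nat \<Rightarrow> nat"
  define enc where "enc x = (\<Sum>i<h. x i * B ^ i)" for x :: "nat \<Rightarrow> nat"
  have finX: "finite X" by (auto simp: X_def intro: finite_PiE)
  have Xd: "x i < d" if "x \<in> X" "i < h" for x i using that by (auto simp: X_def)
  have dB: "d \<le> B" using r by (simp add: B_def)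
  have "N x \<le> h * d\<^sup>2" if "x \<in> X" for x
  proof -
    have "N x \<le> (\<Sum>i<h. d\<^sup>2)" unfolding N_def
      using Xd[OF that] by (intro sum_mono power_mono) (auto intro: less_imp_le)
    then show ?thesis by simp
  qed
  then have NX: "N ` X \<subseteq> {..h * d\<^sup>2}" by auto
  \<comment> \<open>Pigeonhole over the possible squared norms, at most \<open>h * d^2 + 1\<close>
    in number.\<close>
  have "\<exists>R\<in>N ` X. card X \<le> (h * d\<^sup>2 + 1) * card {x \<in> X. N x = R}"
  proof (rule ccontr)
    assume neg: "\<not> ?thesis"
    have "X \<noteq> {}" using d by (auto simp: X_def PiE_eq_empty_iff lessThan_empty_iff)
    have "(h * d\<^sup>2 + 1) * card X = (\<Sum>R\<in>N ` X. (h * d\<^sup>2 + 1) * card {x \<in> X. N x = R})"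
      unfolding card_eq_sum[of X] sum_distrib_left[symmetric]
      using sum.group[of X "N ` X" N "\<lambda>_. 1::nat"] finX by simp
    also have "\<dots> < (\<Sum>R\<in>N ` X. card X)"
      using neg finX \<open>X \<noteq> {}\<close> by (intro sum_strict_mono) (auto simp: not_le)
    also have "\<dots> = card (N ` X) * card X" by simp
    also have "\<dots> \<le> (h * d\<^sup>2 + 1) * card X" using card_mono[OF _ NX] by (intro mult_le_mono1) simp
    finally show False by simp
  qed
  then obtain R where R: "card X \<le> (h * d\<^sup>2 + 1) * card {x \<in> X. N x = R}" by auto
  define Y where "Y = {x \<in> X. N x = R}"
  have inj: "inj_on enc X"
  proof (rule inj_onI)
    fix x y assume xy: "x \<in> X" "y \<in> X" "enc x = enc y"
    show "x = y"
    proof (rule PiE_ext)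
      show "x \<in> {..<h} \<rightarrow>\<^sub>E {..<d}" "y \<in> {..<h} \<rightarrow>\<^sub>E {..<d}" using xy by (auto simp: X_def)
      fix i assume "i \<in> {..<h}"
      then show "x i = y i" using xy Xd dB unfolding enc_def
        by (intro digits_unique[of h x B y]) (auto intro: less_le_trans)
    qed
  qed
  show ?thesis
  proof (intro exI[of _ "enc ` Y"] conjI)
    show "enc ` Y \<subseteq> {..<(r * d) ^ h}"
    proof
      fix a assume "a \<in> enc ` Y"
      then obtain x where "x \<in> X" "a = enc x" by (auto simp: Y_def)
      then show "a \<in> {..<(r * d) ^ h}" unfolding enc_def B_def[symmetric]
        using Xd dB by (auto intro!: digits_less intro: less_le_trans)
    qed
    have "card (enc ` Y) = card Y" using inj by (intro card_image) (auto simp: Y_def inj_on_def)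
    moreover have "card X = d ^ h" by (simp add: X_def card_PiE)
    ultimately show "d ^ h \<le> (h * d\<^sup>2 + 1) * card (enc ` Y)" using R by (simp add: Y_def)
    show "convex_free r (enc ` Y)" unfolding convex_free_def
    proof (intro ballI allI impI)
      fix a b c \<alpha> \<beta> assume "a \<in> enc ` Y" "b \<in> enc ` Y" "c \<in> enc ` Y"
        and *: "0 < \<alpha> \<and> 0 < \<beta> \<and> \<alpha> + \<beta> < r \<and> \<alpha> * a + \<beta> * b = (\<alpha> + \<beta>) * c"
      then obtain x y z where xyz: "x \<in> Y" "y \<in> Y" "z \<in> Y" "a = enc x" "b = enc y" "c = enc z" by auto
      have XX: "x \<in> X" "y \<in> X" "z \<in> X" and NN: "N x = R" "N y = R" "N z = R" using xyz by (auto simp: Y_def)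
      have dig: "\<alpha> * x i + \<beta> * y i = (\<alpha> + \<beta>) * z i" if i: "i < h" for i
      proof (rule digits_unique[of h "\<lambda>i. \<alpha> * x i + \<beta> * y i" B "\<lambda>i. (\<alpha> + \<beta>) * z i" i])
        fix i assume i: "i < h"
        have "\<alpha> * x i + \<beta> * y i \<le> \<alpha> * d + \<beta> * d"
          using Xd[OF XX(1) i] Xd[OF XX(2) i] by (intro add_mono mult_le_mono2) auto
        also have "\<dots> = (\<alpha> + \<beta>) * d" by (simp add: algebra_simps)
        finally have 1: "\<alpha> * x i + \<beta> * y i \<le> (\<alpha> + \<beta>) * d" .
        have 2: "(\<alpha> + \<beta>) * z i \<le> (\<alpha> + \<beta>) * d" using Xd[OF XX(3) i] by (intro mult_le_mono2) auto
        have "(\<alpha> + \<beta>) * d < B" using * d by (simp add: B_def)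
        then show "\<alpha> * x i + \<beta> * y i < B \<and> (\<alpha> + \<beta>) * z i < B" using 1 2 by linarith
      next
        have "(\<Sum>i<h. (\<alpha> * x i + \<beta> * y i) * B ^ i) = \<alpha> * enc x + \<beta> * enc y"
          by (simp add: enc_def sum_distrib_left sum.distrib[symmetric] algebra_simps)
        also have "\<dots> = (\<alpha> + \<beta>) * enc z" using * xyz by simp
        also have "\<dots> = (\<Sum>i<h. (\<alpha> + \<beta>) * z i * B ^ i)" by (simp add: enc_def sum_distrib_left mult.assoc)
        finally show "(\<Sum>i<h. (\<alpha> * x i + \<beta> * y i) * B ^ i) = (\<Sum>i<h. (\<alpha> + \<beta>) * z i * B ^ i)" .
      qed (rule i)
      have "(\<Sum>i<h. real \<alpha> * real \<beta> * (real (x i) - real (y i))\<^sup>2) = 0"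
      proof -
        \<comment> \<open>Strict convexity of the square in exact form: \<open>(\<alpha> + \<beta>)
          * (\<alpha> * x^2 + \<beta> * y^2) - (\<alpha> * x + \<beta> * y)^2 = \<alpha> * \<beta> *
          (x - y)^2\<close>. Summed over the digits, the left side vanishes because all three norms
          equal \<open>R\<close>.\<close>
        have eq: "real \<alpha> * real \<beta> * (real (x i) - real (y i))\<^sup>2 =
            real (\<alpha> + \<beta>) * (real \<alpha> * real ((x i)\<^sup>2) + real \<beta> * real ((y i)\<^sup>2)) - (real (\<alpha> + \<beta>))\<^sup>2 * real ((z i)\<^sup>2)"
          if "i < h" for i
        proof -
          have "real \<alpha> * real (x i) + real \<beta> * real (y i) = real (\<alpha> + \<beta>) * real (z i)"
            using dig[OF that] by (metis of_nat_add of_nat_mult)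
          then have "(real (\<alpha> + \<beta>))\<^sup>2 * real ((z i)\<^sup>2) = (real \<alpha> * real (x i) + real \<beta> * real (y i))\<^sup>2"
            by (simp add: power_mult_distrib)
          then show ?thesis by (simp add: power2_eq_square algebra_simps)
        qed
        have "(\<Sum>i<h. real \<alpha> * real \<beta> * (real (x i) - real (y i))\<^sup>2) =
            (\<Sum>i<h. real (\<alpha> + \<beta>) * (real \<alpha> * real ((x i)\<^sup>2) + real \<beta> * real ((y i)\<^sup>2)) - (real (\<alpha> + \<beta>))\<^sup>2 * real ((z i)\<^sup>2))"
          by (intro sum.cong refl eq) auto
        also have "\<dots> =
            real (\<alpha> + \<beta>) * (real \<alpha> * real (N x) + real \<beta> * real (N y)) - (real (\<alpha> + \<beta>))\<^sup>2 * real (N z)"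
          by (simp only: sum_subtractf sum.distrib sum_distrib_left[symmetric] N_def of_nat_sum)
        also have "\<dots> = 0" unfolding NN by (simp add: power2_eq_square algebra_simps)
        finally show ?thesis .
      qed
      then have "\<forall>i\<in>{..<h}. real \<alpha> * real \<beta> * (real (x i) - real (y i))\<^sup>2 = 0"
        by (subst (asm) sum_nonneg_eq_0_iff) auto
      then have xy: "x i = y i" if "i < h" for i using that * by auto
      have "z i = x i" if "i < h" for i
      proof -
        have "(\<alpha> + \<beta>) * x i = (\<alpha> + \<beta>) * z i" using dig[OF that] xy[OF that] by (simp add: algebra_simps)
        then show ?thesis using * by auto
      qed
      then show "a = c \<and> b = c" using xyz xy by (simp add: enc_def)
    qed
  qed
qed

lemma nat_floor_ge_half:
  fixes z :: real
  assumes "1 \<le> z"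
  shows "z / 2 \<le> real (nat \<lfloor>z\<rfloor>)"
proof -
  have "1 \<le> \<lfloor>z\<rfloor>" using assms by simp
  then show ?thesis by linarith
qed

text \<open>Only \<open>s powr (1 - \<delta>)\<close> elements are wanted, so a fixed dimension
  \<open>h\<close> with \<open>2 / h \<le> \<delta>\<close> suffices: with \<open>d\<close> about
  \<open>s powr (1 / h) / r\<close>, the sphere has at least of order \<open>d ^ (h - 2)\<close>
  points. If \<open>s\<close> is too small for \<open>d \<ge> 1\<close>, it is bounded by
  \<open>r ^ h\<close> and \<open>{0}\<close> serves.\<close>

lemma behrend:
  fixes \<delta> :: real
  assumes \<delta>: "0 < \<delta>" "\<delta> \<le> 1" and r: "r \<ge> 1"
  shows "\<exists>c>0. \<forall>s\<ge>1. \<exists>A\<subseteq>{..<s}. c * real s powr (1 - \<delta>) \<le> card A \<and> convex_free r A"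
proof -
  define h where "h = nat \<lceil>2 / \<delta>\<rceil> + 1"
  have h: "2 / \<delta> \<le> real h" unfolding h_def by linarith
  have "2 \<le> 2 / \<delta>" using \<delta> by (simp add: field_simps)
  then have h3: "h \<ge> 3" unfolding h_def by linarith
  define c1 where "c1 = 1 / ((real h + 1) * (2 * real r) ^ (h - 2))"
  define c2 where "c2 = 1 / real r ^ h"
  have c: "c1 > 0" "c2 > 0" using r by (auto simp: c1_def c2_def)
  have "\<exists>A\<subseteq>{..<s}. min c1 c2 * real s powr (1 - \<delta>) \<le> card A \<and> convex_free r A" if s: "s \<ge> 1" for s
  proof -
    define z where "z = real s powr (1 / h)"
    have zh: "z ^ h = real s" using s h3 by (simp add: z_def powr_power)
    have z0: "z > 0" using s by (simp add: z_def)
    define d where "d = nat \<lfloor>z / r\<rfloor>"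
    show ?thesis
    proof (cases "1 \<le> z / r")
      case True
      have d1: "z / r / 2 \<le> real d" unfolding d_def using True by (rule nat_floor_ge_half)
      then have d: "d \<ge> 1" using True unfolding d_def by simp
      have "real d \<le> z / r" unfolding d_def using z0 by simp
      then have "real (r * d) \<le> z" using r by (simp add: field_simps)
      then have "real (r * d) ^ h \<le> z ^ h" by (intro power_mono) auto
      then have rd: "(r * d) ^ h \<le> s" unfolding zh by (metis of_nat_le_iff of_nat_power)
      obtain A where A: "A \<subseteq> {..<(r * d) ^ h}" "d ^ h \<le> (h * d\<^sup>2 + 1) * card A" "convex_free r A"
        using behrend_digits[OF d r] by blast
      have "c1 * real s powr (1 - \<delta>) \<le> card A"
      proof -
        have "(real h + 1) * (real d)\<^sup>2 * card A \<ge> real ((h * d\<^sup>2 + 1) * card A)"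
        proof -
          have "(1::real) \<le> (real d)\<^sup>2" using d by simp
          then have "real (card A) * 1 \<le> real (card A) * (real d)\<^sup>2" by (intro mult_left_mono) auto
          then show ?thesis by (simp add: algebra_simps)
        qed
        moreover have "real (d ^ h) \<le> real ((h * d\<^sup>2 + 1) * card A)" using A(2) by (rule of_nat_mono)
        ultimately have "real d ^ h \<le> (real h + 1) * (real d)\<^sup>2 * card A" by simp
        moreover have "real d ^ h = real d ^ (h - 2) * (real d)\<^sup>2"
        proof -
          have "real d ^ (h - 2 + 2) = real d ^ (h - 2) * (real d)\<^sup>2" by (rule power_add)
          moreover have "h - 2 + 2 = h" using h3 by simp
          ultimately show ?thesis by metis
        qed
        ultimately have "real d ^ (h - 2) * (real d)\<^sup>2 \<le> ((real h + 1) * card A) * (real d)\<^sup>2" by (simp add: mult_ac)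
        then have dh: "real d ^ (h - 2) \<le> (real h + 1) * card A" using d by (subst (asm) mult_le_cancel_right_pos) auto
        have "(z / r / 2) ^ (h - 2) \<le> real d ^ (h - 2)" using d1 z0 by (intro power_mono) auto
        then have "z ^ (h - 2) / (2 * real r) ^ (h - 2) \<le> (real h + 1) * card A"
          using dh by (simp add: power_divide power_mult_distrib mult.commute)
        then have "z ^ (h - 2) / (2 * real r) ^ (h - 2) / (real h + 1) \<le> (real h + 1) * card A / (real h + 1)"
          by (intro divide_right_mono) auto
        then have "c1 * z ^ (h - 2) \<le> card A" by (simp add: c1_def mult.commute)
        moreover have "real s powr (1 - \<delta>) \<le> z ^ (h - 2)"
        proof -
          have "z ^ (h - 2) = real s powr (1 / h * real (h - 2))" using s by (simp add: z_def powr_power mult.commute)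
          also have "1 / h * real (h - 2) = 1 - 2 / h" using h3 by (simp add: of_nat_diff field_simps)
          finally have "z ^ (h - 2) = real s powr (1 - 2 / h)" .
          moreover have "2 / real h \<le> \<delta>" using h \<delta> h3 by (simp add: field_simps)
          ultimately show ?thesis using s by (simp add: powr_mono)
        qed
        then have "c1 * real s powr (1 - \<delta>) \<le> c1 * z ^ (h - 2)" using c by (intro mult_left_mono) auto
        ultimately show ?thesis by linarith
      qed
      then have "min c1 c2 * real s powr (1 - \<delta>) \<le> card A"
        by (smt (verit) mult_right_mono powr_ge_zero min.cobounded1)
      then show ?thesis using A rd by (intro exI[of _ A]) auto
    next
      case False
      then have "z < r" using r by (simp add: field_simps)
      then have "z ^ h \<le> real r ^ h" using z0 by (intro power_mono) auto
      then have "real s \<le> real r ^ h" by (simp add: zh)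
      moreover have "real s powr (1 - \<delta>) \<le> real s powr 1" using s \<delta> by (intro powr_mono) auto
      moreover have "real s powr 1 = real s" by simp
      ultimately have "real s powr (1 - \<delta>) \<le> real r ^ h" by linarith
      then have "c2 * real s powr (1 - \<delta>) \<le> 1" using r s by (simp add: c2_def field_simps)
      then have "min c1 c2 * real s powr (1 - \<delta>) \<le> 1"
        by (smt (verit) mult_right_mono powr_ge_zero min.cobounded2)
      moreover have "convex_free r {0}" by (simp add: convex_free_def)
      ultimately show ?thesis using s by (intro exI[of _ "{0}"]) auto
    qed
  qed
  then show ?thesis using c by (intro exI[of _ "min c1 c2"]) auto
qed

text \<open>An edge of the base hypergraph is a progression \<open>y, y + a, y + 2 a, \<dots>\<close> with difference in a
  convex-free set \<open>A\<close>, its \<open>i\<close>-th point lying in the \<open>i\<close>-th part; every point is blown up to \<open>x\<close> vertices.\<close>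

locale blow_up =
  fixes r s x n :: nat and A :: "nat set"
  assumes r: "r \<ge> 3" and A: "A \<subseteq> {..<s}" "convex_free r A" and n: "r * (r * s) * x \<le> n" and x: "x \<ge> 1"
begin

text \<open>Mixed radix numbering by part, level below \<open>r * s\<close> and copy below
  \<open>x\<close>; the hypothesis \<open>n\<close> of the locale says that all these numbers fit
  below \<open>n\<close>.\<close>

definition vertex :: "nat \<Rightarrow> nat \<Rightarrow> nat \<Rightarrow> nat" where
  "vertex i y u = (i * (r * s) + y) * x + u"

definition edge :: "nat \<Rightarrow> nat \<Rightarrow> (nat \<Rightarrow> nat) \<Rightarrow> nat set" where
  "edge y a u = (\<lambda>i. vertex i (y + i * a) (u i)) ` {..<r}"

abbreviation "U \<equiv> {..<r} \<rightarrow>\<^sub>E {..<x}"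

definition edges :: "nat set set" where
  "edges = (\<lambda>(y, a, u). edge y a u) ` ({..<s} \<times> A \<times> U)"

section \<open>Intersections and triangles in the blow-up\<close>

lemma vertex_inj:
  assumes "vertex i y u = vertex i' y' u'" "y < r * s" "y' < r * s" "u < x" "u' < x"
  shows "i = i' \<and> y = y' \<and> u = u'"
proof -
  have "vertex i y u mod x = u" "vertex i' y' u' mod x = u'" using assms(4,5) by (simp_all add: vertex_def)
  moreover have "vertex i y u div x = i * (r * s) + y" "vertex i' y' u' div x = i' * (r * s) + y'"
    using assms(4,5) by (simp_all add: vertex_def)
  ultimately have u: "u = u'" and e: "i * (r * s) + y = i' * (r * s) + y'" using assms(1) by auto
  have dm: "(q * m + t) mod m = t" "(q * m + t) div m = q" if "t < m" for q m t :: nat using that by simp_all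
  have "(i * (r * s) + y) mod (r * s) = y" "(i' * (r * s) + y') mod (r * s) = y'" by (intro dm assms)+
  moreover have "(i * (r * s) + y) div (r * s) = i" "(i' * (r * s) + y') div (r * s) = i'"
    by (intro dm assms)+
  ultimately show ?thesis using u e by metis
qed

lemma level_less:
  assumes "y < s" "a \<in> A" "i < r"
  shows "y + i * a < r * s"
proof -
  have "i * a \<le> (r - 1) * s" using assms A by (intro mult_le_mono) auto
  moreover have "r * s = s + (r - 1) * s" using r by (cases r) auto
  ultimately show ?thesis using assms by linarith
qed

lemma edge_Int:
  assumes "y < s" "a \<in> A" "u \<in> U" "y' < s" "a' \<in> A" "u' \<in> U" "v \<in> edge y a u" "v \<in> edge y' a' u'"
  obtains i where "i < r" "v = vertex i (y + i * a) (u i)" "y + i * a = y' + i * a'" "u i = u' i"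
proof -
  obtain i i' where i: "i < r" "v = vertex i (y + i * a) (u i)" "i' < r" "v = vertex i' (y' + i' * a') (u' i')"
    using assms(7,8) by (auto simp: edge_def)
  have "u i < x" "u' i' < x" using PiE_mem[OF assms(3), of i] PiE_mem[OF assms(6), of i'] i by simp_all
  moreover have "vertex i (y + i * a) (u i) = vertex i' (y' + i' * a') (u' i')" using i by simp
  ultimately have "i = i' \<and> y + i * a = y' + i' * a' \<and> u i = u' i'"
    using level_less assms i by (intro vertex_inj) auto
  then show ?thesis using i that by auto
qed

lemma edge_inj:
  assumes "y < s" "a \<in> A" "u \<in> U" "y' < s" "a' \<in> A" "u' \<in> U" "edge y a u = edge y' a' u'"
  shows "y = y' \<and> a = a' \<and> u = u'"
proof -
  have *: "y + i * a = y' + i * a' \<and> u i = u' i" if "i < r" for i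
  proof -
    have "vertex i (y + i * a) (u i) \<in> edge y a u" using that by (auto simp: edge_def)
    moreover from this have "vertex i (y + i * a) (u i) \<in> edge y' a' u'" using assms(7) by simp
    ultimately obtain j where j: "j < r" "vertex i (y + i * a) (u i) = vertex j (y + j * a) (u j)"
      "y + j * a = y' + j * a'" "u j = u' j"
      using edge_Int[OF assms(1-6)] by metis
    have "u i < x" "u j < x" using PiE_mem[OF assms(3), of i] PiE_mem[OF assms(3), of j] that j(1) by simp_all
    then have "i = j" using vertex_inj[OF j(2) level_less[OF assms(1,2) that] level_less[OF assms(1,2) j(1)]] by simp
    then show ?thesis using j by simp
  qed
  from *[of 0] *[of 1] r have "y = y'" "a = a'" by auto
  moreover have "u = u'" using assms(3,6) * by (intro PiE_ext[of u "{..<r}" "\<lambda>_. {..<x}" u']) auto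
  ultimately show ?thesis by simp
qed

lemma edges_rsets: "edges \<subseteq> rsets n r"
proof
  fix e assume "e \<in> edges"
  then obtain y a u where e: "e = edge y a u" "y < s" "a \<in> A" "u \<in> U" by (auto simp: edges_def)
  have ux: "u i < x" if "i < r" for i using PiE_mem[OF e(4), of i] that by simp
  have "vertex i (y + i * a) (u i) < n" if i: "i < r" for i
  proof -
    have "i * (r * s) + (y + i * a) < i * (r * s) + r * s" using level_less e i by simp
    also have "\<dots> = (i + 1) * (r * s)" by simp
    also have "\<dots> \<le> r * (r * s)" using i by (intro mult_le_mono1) simp
    finally have "i * (r * s) + (y + i * a) + 1 \<le> r * (r * s)" by simp
    then have "(i * (r * s) + (y + i * a) + 1) * x \<le> r * (r * s) * x" by (intro mult_le_mono1)
    then have "vertex i (y + i * a) (u i) < r * (r * s) * x" using ux[OF i] by (simp add: vertex_def algebra_simps)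
    then show ?thesis using n by simp
  qed
  moreover have "card (edge y a u) = r"
  proof -
    have "inj_on (\<lambda>i. vertex i (y + i * a) (u i)) {..<r}"
    proof (rule inj_onI)
      fix i j assume ij: "i \<in> {..<r}" "j \<in> {..<r}" "vertex i (y + i * a) (u i) = vertex j (y + j * a) (u j)"
      then show "i = j" using vertex_inj[OF ij(3)] level_less e ux by auto
    qed
    then show ?thesis by (simp add: edge_def card_image)
  qed
  ultimately show "e \<in> rsets n r" using e by (auto simp: rsets_def edge_def)
qed

lemma finite_A: "finite A"
  using A(1) finite_subset by blast

lemma card_edges: "card edges = s * card A * x ^ r"
proof -
  have "inj_on (\<lambda>(y, a, u). edge y a u) ({..<s} \<times> A \<times> U)"
    using edge_inj by (auto intro!: inj_onI)
  then have "card edges = card ({..<s} \<times> A \<times> U)" unfolding edges_def by (rule card_image)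
  then show ?thesis by (simp add: card_cartesian_product card_PiE)
qed

text \<open>The three edges share \<open>y\<close> and \<open>a\<close>, that is, they lie in one
  block; \<open>triangle_in_block\<close> is the justification. As \<open>j \<noteq> k\<close>, the
  third edge agrees with the others at two positions, which is worth a factor \<open>x^2\<close> in
  the count.\<close>

definition triangles :: "(nat set \<times> nat set \<times> nat set) set" where
  "triangles = {(edge y a u1, edge y a u2, edge y a u3) | y a u1 u2 u3.
     y < s \<and> a \<in> A \<and> u1 \<in> U \<and> u2 \<in> U \<and> u3 \<in> U \<and>
     edge y a u1 \<noteq> edge y a u2 \<and> edge y a u2 \<noteq> edge y a u3 \<and> edge y a u1 \<noteq> edge y a u3 \<and>
     (\<exists>i<r. \<exists>j<r. \<exists>k<r. j \<noteq> k \<and> u1 i = u2 i \<and> u2 j = u3 j \<and> u3 k = u1 k)}"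

text \<open>The meeting points lie in three different parts \<open>i\<close>, \<open>j\<close>,
  \<open>k\<close>. Adding the level equations gives a vanishing combination of \<open>a1\<close>,
  \<open>a2\<close>, \<open>a3\<close> whose coefficients are differences of positions with sum
  zero. For each of the six orders one of the \<open>a\<close> is a weighted mean of the other two,
  so convex-freeness makes them equal, and then the starting points agree as well.\<close>

lemma triangle_in_block:
  assumes 1: "y1 < s" "a1 \<in> A" "u1 \<in> U" and 2: "y2 < s" "a2 \<in> A" "u2 \<in> U" and 3: "y3 < s" "a3 \<in> A" "u3 \<in> U"
    and v: "v12 \<in> edge y1 a1 u1" "v12 \<in> edge y2 a2 u2" "v23 \<in> edge y2 a2 u2" "v23 \<in> edge y3 a3 u3"
      "v31 \<in> edge y3 a3 u3" "v31 \<in> edge y1 a1 u1"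
    and d: "v12 \<noteq> v23" "v23 \<noteq> v31" "v31 \<noteq> v12"
    and ne: "edge y1 a1 u1 \<noteq> edge y2 a2 u2" "edge y2 a2 u2 \<noteq> edge y3 a3 u3" "edge y1 a1 u1 \<noteq> edge y3 a3 u3"
  shows "(edge y1 a1 u1, edge y2 a2 u2, edge y3 a3 u3) \<in> triangles"
proof -
  obtain i where i: "i < r" "v12 = vertex i (y1 + i * a1) (u1 i)" "y1 + i * a1 = y2 + i * a2" "u1 i = u2 i"
    using edge_Int[OF 1 2 v(1,2)] .
  obtain j where j: "j < r" "v23 = vertex j (y2 + j * a2) (u2 j)" "y2 + j * a2 = y3 + j * a3" "u2 j = u3 j"
    using edge_Int[OF 2 3 v(3,4)] .
  obtain k where k: "k < r" "v31 = vertex k (y3 + k * a3) (u3 k)" "y3 + k * a3 = y1 + k * a1" "u3 k = u1 k"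
    using edge_Int[OF 3 1 v(5,6)] .
  have ij: "i \<noteq> j" using d(1) i j by auto
  have jk: "j \<noteq> k" using d(2) j k by auto
  have ki: "k \<noteq> i" using d(3) i k by auto
  have conv: "b = c \<and> b' = c" if "b \<in> A" "b' \<in> A" "c \<in> A" "(\<alpha>::nat) > 0" "\<beta> > 0" "\<alpha> + \<beta> < r"
    "int \<alpha> * int b + int \<beta> * int b' = (int \<alpha> + int \<beta>) * int c" for b b' c \<alpha> \<beta>
  proof -
    have "int (\<alpha> * b + \<beta> * b') = int ((\<alpha> + \<beta>) * c)" using that(7) by simp
    then have "\<alpha> * b + \<beta> * b' = (\<alpha> + \<beta>) * c" by (simp only: of_nat_eq_iff)
    then show ?thesis using A(2) that unfolding convex_free_def by blast
  qed
  have eq: "(int i - int k) * int a1 + (int j - int i) * int a2 + (int k - int j) * int a3 = 0"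
  proof -
    have "int y1 + int i * int a1 = int y2 + int i * int a2" "int y2 + int j * int a2 = int y3 + int j * int a3"
      "int y3 + int k * int a3 = int y1 + int k * int a1"
      using i(3) j(3) k(3) by (metis of_nat_add of_nat_mult)+
    then show ?thesis by (simp add: algebra_simps)
  qed
  have a: "a1 = a2 \<and> a2 = a3"
  proof -
    consider "k < j \<and> j < i" | "j < i \<and> i < k" | "i < k \<and> k < j" | "i < j \<and> j < k" | "j < k \<and> k < i" | "k < i \<and> i < j"
      using ij jk ki by linarith
    then show ?thesis
    proof cases
      case 1
      then show ?thesis using conv[of a2 a3 a1 "i - j" "j - k"] eq 1 i(1) \<open>a1 \<in> A\<close> \<open>a2 \<in> A\<close> \<open>a3 \<in> A\<close>
        by (auto simp: of_nat_diff algebra_simps)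
    next
      case 2
      then show ?thesis using conv[of a1 a2 a3 "k - i" "i - j"] eq k(1) \<open>a1 \<in> A\<close> \<open>a2 \<in> A\<close> \<open>a3 \<in> A\<close>
        by (auto simp: of_nat_diff algebra_simps)
    next
      case 3
      then show ?thesis using conv[of a1 a3 a2 "k - i" "j - k"] eq j(1) \<open>a1 \<in> A\<close> \<open>a2 \<in> A\<close> \<open>a3 \<in> A\<close>
        by (auto simp: of_nat_diff algebra_simps)
    next
      case 4
      then show ?thesis using conv[of a2 a3 a1 "j - i" "k - j"] eq k(1) \<open>a1 \<in> A\<close> \<open>a2 \<in> A\<close> \<open>a3 \<in> A\<close>
        by (auto simp: of_nat_diff algebra_simps)
    next
      case 5
      then show ?thesis using conv[of a1 a3 a2 "i - k" "k - j"] eq i(1) \<open>a1 \<in> A\<close> \<open>a2 \<in> A\<close> \<open>a3 \<in> A\<close>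
        by (auto simp: of_nat_diff algebra_simps)
    next
      case 6
      then show ?thesis using conv[of a1 a2 a3 "i - k" "j - i"] eq j(1) \<open>a1 \<in> A\<close> \<open>a2 \<in> A\<close> \<open>a3 \<in> A\<close>
        by (auto simp: of_nat_diff algebra_simps)
    qed
  qed
  then have y: "y1 = y2" "y2 = y3" using i j by auto
  have "\<exists>i<r. \<exists>j<r. \<exists>k<r. j \<noteq> k \<and> u1 i = u2 i \<and> u2 j = u3 j \<and> u3 k = u1 k"
    using i(1,4) j(1,4) k(1,4) jk by blast
  then show ?thesis unfolding triangles_def using 1 2 3 ne a y by blast
qed

text \<open>\<open>u1\<close> is free, \<open>u2\<close> is tied at \<open>i\<close>, and
  \<open>u3\<close> is tied at \<open>j\<close> and \<open>k\<close>; this leaves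
  \<open>r + (r - 1) + (r - 2)\<close> free values. The positions cost at most
  \<open>r ^ 3\<close>.\<close>

lemma card_triangles: "card triangles \<le> s * card A * (r ^ 3 * x ^ (3 * r - 3))" "finite triangles"
proof -
  define T where "T = (\<lambda>(i, j, k). {(u1, u2, u3). u1 \<in> U \<and> u2 \<in> U \<and> u3 \<in> U \<and> u1 i = u2 i \<and> u2 j = u3 j \<and> u3 k = u1 k})"
  define I where "I = {(i, j, k). i < r \<and> j < r \<and> k < r \<and> j \<noteq> k}"
  have finU: "finite U" by (intro finite_PiE) auto
  have I: "I \<subseteq> {..<r} \<times> {..<r} \<times> {..<r}" by (auto simp: I_def)
  then have finI: "finite I" by (rule finite_subset) auto
  have "card I \<le> card ({..<r} \<times> {..<r} \<times> {..<r})" using I by (intro card_mono) auto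
  then have cI: "card I \<le> r ^ 3" by (simp add: card_cartesian_product power3_eq_cube)
  have T: "card (T t) \<le> x ^ (3 * r - 3)" if t: "t \<in> I" for t
  proof -
    obtain i j k where ijk: "t = (i, j, k)" "i < r" "j < r" "k < r" "j \<noteq> k" using t by (auto simp: I_def)
    define g where "g = (\<lambda>(u1, u2, u3). (u1 :: nat \<Rightarrow> nat, restrict u2 ({..<r} - {i}) :: nat \<Rightarrow> nat, restrict u3 ({..<r} - {j, k}) :: nat \<Rightarrow> nat))"
    define Z where "Z = U \<times> (({..<r} - {i}) \<rightarrow>\<^sub>E {..<x}) \<times> (({..<r} - {j, k}) \<rightarrow>\<^sub>E {..<x})"
    have ext: "u = v" if "u \<in> U" "v \<in> U" "restrict u ({..<r} - B) = restrict v ({..<r} - B)" "\<forall>b\<in>B. u b = v b" for u v B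
    proof (rule PiE_ext[OF that(1,2)])
      fix t assume "t \<in> {..<r}"
      then show "u t = v t" using that(3,4) unfolding restrict_eq_iff by (cases "t \<in> B") auto
    qed
    have "inj_on g (T t)"
    proof (rule inj_onI)
      fix p q assume p: "p \<in> T t" and q: "q \<in> T t" and eq: "g p = g q"
      obtain u1 u2 u3 where pu: "p = (u1, u2, u3)" by (cases p) auto
      obtain w1 w2 w3 where qw: "q = (w1, w2, w3)" by (cases q) auto
      have P: "u1 \<in> U" "u2 \<in> U" "u3 \<in> U" "u1 i = u2 i" "u2 j = u3 j" "u3 k = u1 k" using p by (auto simp: T_def ijk(1) pu)
      have Q: "w1 \<in> U" "w2 \<in> U" "w3 \<in> U" "w1 i = w2 i" "w2 j = w3 j" "w3 k = w1 k" using q by (auto simp: T_def ijk(1) qw)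
      have 1: "u1 = w1" and e2: "restrict u2 ({..<r} - {i}) = restrict w2 ({..<r} - {i})"
        and e3: "restrict u3 ({..<r} - {j, k}) = restrict w3 ({..<r} - {j, k})" using eq by (auto simp: g_def pu qw)
      have 2: "u2 = w2" using P Q 1 by (intro ext[OF _ _ e2]) auto
      have 3: "u3 = w3" using P Q 1 2 by (intro ext[OF _ _ e3]) auto
      show "p = q" using 1 2 3 pu qw by simp
    qed
    moreover have "g ` T t \<subseteq> Z"
    proof (rule image_subsetI)
      fix q assume q: "q \<in> T t"
      obtain w1 w2 w3 where qw: "q = (w1, w2, w3)" by (cases q) auto
      have W: "w1 \<in> U" "w2 \<in> U" "w3 \<in> U" using q by (auto simp: T_def ijk(1) qw)
      have "restrict w ({..<r} - B) \<in> ({..<r} - B) \<rightarrow>\<^sub>E {..<x}" if "w \<in> U" for w B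
        unfolding restrict_PiE_iff using PiE_mem[OF that] by blast
      then show "g q \<in> Z" using W unfolding Z_def g_def qw by simp
    qed
    moreover have "finite Z" unfolding Z_def using finU by (intro finite_cartesian_product finite_PiE) auto
    ultimately have "card (T t) \<le> card Z" by (rule card_inj_on_le)
    also have "\<dots> = x ^ r * (x ^ (r - 1) * x ^ (r - 2))"
      unfolding Z_def using ijk by (simp add: card_cartesian_product card_PiE card_Diff_subset numeral_2_eq_2)
    also have "\<dots> = x ^ (3 * r - 3)"
    proof -
      have "3 * r - 3 = r + ((r - 1) + (r - 2))" using r by simp
      then show ?thesis by (simp only: power_add)
    qed
    finally show ?thesis .
  qed
  have finT: "finite (T t)" for t
  proof (cases t)
    case (fields i j k)
    have "T t \<subseteq> U \<times> U \<times> U" by (auto simp: T_def fields)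
    then show ?thesis by (rule finite_subset) (use finU in auto)
  qed
  define f where "f = (\<lambda>(y, a, u1, u2, u3). (edge y a u1, edge y a u2, edge y a u3))"
  define D where "D = {..<s} \<times> A \<times> (\<Union>t\<in>I. T t)"
  have sub: "triangles \<subseteq> f ` D"
  proof
    fix q assume "q \<in> triangles"
    then obtain y a u1 u2 u3 i j k where q: "q = (edge y a u1, edge y a u2, edge y a u3)" "y < s" "a \<in> A"
      "u1 \<in> U" "u2 \<in> U" "u3 \<in> U" "i < r" "j < r" "k < r" "j \<noteq> k" "u1 i = u2 i" "u2 j = u3 j" "u3 k = u1 k"
      unfolding triangles_def mem_Collect_eq by (elim exE conjE) (rule that)
    have "(i, j, k) \<in> I" "(u1, u2, u3) \<in> T (i, j, k)" using q by (auto simp: I_def T_def)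
    then have "(y, a, u1, u2, u3) \<in> D" using q by (auto simp: D_def)
    then show "q \<in> f ` D" using q(1) by (intro image_eqI[of _ _ "(y, a, u1, u2, u3)"]) (simp_all add: f_def)
  qed
  have finD: "finite D" unfolding D_def using finI finT finite_A by auto
  then show "finite triangles" using sub finite_surj by blast
  have "card triangles \<le> card (f ` D)" using finD sub by (intro card_mono) auto
  also have "\<dots> \<le> card D" by (rule card_image_le[OF finD])
  also have "\<dots> = s * (card A * card (\<Union>t\<in>I. T t))" by (simp add: D_def card_cartesian_product)
  also have "card (\<Union>t\<in>I. T t) \<le> (\<Sum>t\<in>I. card (T t))" by (rule card_UN_le[OF finI])
  also have "\<dots> \<le> (\<Sum>t\<in>I. x ^ (3 * r - 3))" by (intro sum_mono T)
  also have "\<dots> = card I * x ^ (3 * r - 3)" by simp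
  also have "\<dots> \<le> r ^ 3 * x ^ (3 * r - 3)" using cI by (rule mult_le_mono1)
  finally show "card triangles \<le> s * card A * (r ^ 3 * x ^ (3 * r - 3))" by (simp add: mult.assoc)
qed

text \<open>Without genuine blow-up a block is a single edge. This settles the case in which the
  desired number of copies is at most \<open>1\<close> and gets rounded up.\<close>

lemma triangles_empty: "x = 1 \<Longrightarrow> triangles = {}"
proof (rule ccontr)
  assume "x = 1" "triangles \<noteq> {}"
  then obtain y a u1 u2 where *: "u1 \<in> U" "u2 \<in> U" "edge y a u1 \<noteq> edge y a u2"
    unfolding triangles_def by blast
  have "u1 = u2"
  proof (rule PiE_ext[OF *(1,2)])
    fix i assume i: "i \<in> {..<r}"
    show "u1 i = u2 i" using PiE_mem[OF *(1) i] PiE_mem[OF *(2) i] \<open>x = 1\<close> by simp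
  qed
  then show False using * by simp
qed

lemma copy_free:
  assumes F: "F \<subseteq> edges" and free: "\<And>e1 e2 e3. (e1, e2, e3) \<in> triangles \<Longrightarrow> \<not> (e1 \<in> F \<and> e2 \<in> F \<and> e3 \<in> F)"
  shows "\<not> contains_copy (V, F) (linear_cycle r 3)"
proof
  assume "contains_copy (V, F) (linear_cycle r 3)"
  then obtain \<phi> where \<phi>: "inj_on \<phi> (fst (linear_cycle r 3))" "\<forall>e\<in>snd (linear_cycle r 3). \<phi> ` e \<in> F"
    by (auto simp: contains_copy_def)
  define e where "e a = expand_edge r {a, (a + 1) mod 3}" for a :: nat
  have e: "e a \<in> snd (linear_cycle r 3)" if "a < 3" for a using that by (auto simp: snd_linear_cycle e_def)
  have sub: "e a \<subseteq> fst (linear_cycle r 3)" if "a < 3" for a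
    using e[OF that] Union_linear_cycle[of 3 r] by auto
  have ne: "\<phi> ` e a \<noteq> \<phi> ` e b" if "a < 3" "b < 3" "e a \<noteq> e b" for a b
    using inj_on_image_eq_iff[OF \<phi>(1) sub[OF that(1)] sub[OF that(2)]] that(3) by simp
  have mem: "Inl 1 \<in> e 0" "Inl 1 \<in> e 1" "Inl 2 \<in> e 1" "Inl 2 \<in> e 2" "Inl 0 \<in> e 2" "Inl 0 \<in> e 0"
    by (auto simp: e_def expand_edge_def)
  have "Inl 2 \<notin> e 0" "Inl 0 \<notin> e 1" by (auto simp: e_def expand_edge_def)
  then have de: "e 0 \<noteq> e 1" "e 1 \<noteq> e 2" "e 0 \<noteq> e 2" using mem by auto
  have in3: "Inl 0 \<in> fst (linear_cycle r 3)" "Inl 1 \<in> fst (linear_cycle r 3)" "Inl 2 \<in> fst (linear_cycle r 3)"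
    by (auto simp: fst_linear_cycle)
  have dv: "\<phi> (Inl 1) \<noteq> \<phi> (Inl 2)" "\<phi> (Inl 2) \<noteq> \<phi> (Inl 0)" "\<phi> (Inl 0) \<noteq> \<phi> (Inl 1)"
    using inj_onD[OF \<phi>(1)] in3 by fastforce+
  have inF: "\<phi> ` e 0 \<in> F" "\<phi> ` e 1 \<in> F" "\<phi> ` e 2 \<in> F" using \<phi>(2) e by auto
  have ed: "\<exists>y a u. f = edge y a u \<and> y < s \<and> a \<in> A \<and> u \<in> U" if "f \<in> F" for f
  proof -
    have "f \<in> (\<lambda>(y, a, u). edge y a u) ` ({..<s} \<times> A \<times> U)" using that F unfolding edges_def by blast
    then show ?thesis by (elim imageE) (auto split: prod.splits)
  qed
  from ed[OF inF(1)] obtain y1 a1 u1 where E1: "\<phi> ` e 0 = edge y1 a1 u1" "y1 < s" "a1 \<in> A" "u1 \<in> U"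
    by (elim exE conjE) (rule that)
  from ed[OF inF(2)] obtain y2 a2 u2 where E2: "\<phi> ` e 1 = edge y2 a2 u2" "y2 < s" "a2 \<in> A" "u2 \<in> U"
    by (elim exE conjE) (rule that)
  from ed[OF inF(3)] obtain y3 a3 u3 where E3: "\<phi> ` e 2 = edge y3 a3 u3" "y3 < s" "a3 \<in> A" "u3 \<in> U"
    by (elim exE conjE) (rule that)
  note E = E1 E2 E3
  have "(edge y1 a1 u1, edge y2 a2 u2, edge y3 a3 u3) \<in> triangles"
  proof (rule triangle_in_block[OF E(2-4) E(6-8) E(10-12)])
    show "\<phi> (Inl 1) \<in> edge y1 a1 u1" "\<phi> (Inl 1) \<in> edge y2 a2 u2" "\<phi> (Inl 2) \<in> edge y2 a2 u2"
      "\<phi> (Inl 2) \<in> edge y3 a3 u3" "\<phi> (Inl 0) \<in> edge y3 a3 u3" "\<phi> (Inl 0) \<in> edge y1 a1 u1"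
      unfolding E(1,5,9)[symmetric] using mem by auto
    show "edge y1 a1 u1 \<noteq> edge y2 a2 u2" "edge y2 a2 u2 \<noteq> edge y3 a3 u3" "edge y1 a1 u1 \<noteq> edge y3 a3 u3"
      unfolding E(1,5,9)[symmetric] using ne de by auto
  qed (rule dv)+
  then show False using free inF unfolding E(1,5,9) by blast
qed

text \<open>Deletion method: from each surviving triangle its first edge is removed.\<close>

lemma ex_ge_edges_minus_triangles:
  assumes G: "fst G = {..<n}" "snd G \<subseteq> rsets n r"
  shows "real (card (edges \<inter> snd G)) - card {t \<in> triangles. {fst t, fst (snd t), snd (snd t)} \<subseteq> snd G}
    \<le> ex G (linear_cycle r 3)"
proof -
  define S where "S = {t \<in> triangles. {fst t, fst (snd t), snd (snd t)} \<subseteq> snd G}"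
  have finS: "finite S" using card_triangles(2) by (simp add: S_def)
  have finG: "finite (snd G)" using G(2) finite_rsets by (rule finite_subset)
  define F where "F = edges \<inter> snd G - fst ` S"
  have "card (edges \<inter> snd G) - card (fst ` S) \<le> card F" unfolding F_def using finS by (intro diff_card_le_card_Diff) auto
  moreover have "card (fst ` S) \<le> card S" using finS by (rule card_image_le)
  ultimately have 1: "real (card (edges \<inter> snd G)) - card S \<le> card F" by linarith
  have "card (snd ({..<n}, F)) \<le> ex G (linear_cycle r 3)"
  proof (rule ex_ge[OF finG])
    show "subhypergraph ({..<n}, F) G" using G by (auto simp: subhypergraph_def F_def rsets_def)
    show "\<not> contains_copy ({..<n}, F) (linear_cycle r 3)"
    proof (rule copy_free)
      show "F \<subseteq> edges" by (auto simp: F_def)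
      fix e1 e2 e3 assume t: "(e1, e2, e3) \<in> triangles"
      show "\<not> (e1 \<in> F \<and> e2 \<in> F \<and> e3 \<in> F)"
      proof
        assume "e1 \<in> F \<and> e2 \<in> F \<and> e3 \<in> F"
        then have "(e1, e2, e3) \<in> S" "e1 \<notin> fst ` S" using t by (auto simp: S_def F_def)
        then show False by force
      qed
    qed
  qed
  then show ?thesis using 1 unfolding S_def by simp
qed

lemma triangles_edges:
  assumes "t \<in> triangles"
  shows "{fst t, fst (snd t), snd (snd t)} \<subseteq> rsets n r" "card {fst t, fst (snd t), snd (snd t)} = 3"
proof -
  obtain y a u1 u2 u3 where t: "t = (edge y a u1, edge y a u2, edge y a u3)" "y < s" "a \<in> A" "u1 \<in> U" "u2 \<in> U" "u3 \<in> U"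
    "edge y a u1 \<noteq> edge y a u2" "edge y a u2 \<noteq> edge y a u3" "edge y a u1 \<noteq> edge y a u3"
    using assms unfolding triangles_def mem_Collect_eq by (elim exE conjE) (rule that)
  show "card {fst t, fst (snd t), snd (snd t)} = 3" using t by simp
  have ee: "edge y a u \<in> edges" if "u \<in> U" for u
    unfolding edges_def using t(2,3) that by (intro image_eqI[of _ _ "(y, a, u)"]) simp_all
  show "{fst t, fst (snd t), snd (snd t)} \<subseteq> rsets n r"
    unfolding t(1) using subsetD[OF edges_rsets ee] t(4-6) by simp
qed

text \<open>Chebyshev for the edges, Markov for the triangles. The expected number of triangles
  divided by \<open>p * card edges / 4\<close> is at most
  \<open>4 * r ^ 3 * p^2 * x ^ (2 * r - 3)\<close>, and this decides how large \<open>x\<close> may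
  be.\<close>

lemma prob_ex_small:
  assumes p: "0 < p" "p \<le> 1" and s: "s \<ge> 1" and A0: "A \<noteq> {}"
  shows "measure_pmf.prob (random_rgraph r n p) {G. real (ex G (linear_cycle r 3)) < p * card edges / 4}
    \<le> 4 / (p * card edges) + (if x = 1 then 0 else 4 * real r ^ 3 * (p\<^sup>2 * real x ^ (2 * r - 3)))"
proof -
  let ?M = "random_rgraph r n p"
  define Y where "Y G = real (card {t \<in> triangles. {fst t, fst (snd t), snd (snd t)} \<subseteq> snd G})" for G :: "nat hypergraph"
  define N where "N = real (card edges)"
  have N: "N = real s * card A * real x ^ r" by (simp add: N_def card_edges)
  have cA: "card A > 0" using A0 finite_A by (simp add: card_gt_0_iff)
  have N0: "N > 0" unfolding N using s cA x by simp
  have EY: "measure_pmf.expectation ?M Y \<le> card triangles * p ^ 3"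
  proof -
    have YS: "Y G = (\<Sum>t\<in>triangles. of_bool ({fst t, fst (snd t), snd (snd t)} \<subseteq> snd G))" for G
      unfolding Y_def using card_triangles(2) by (simp add: Int_def)
    have "measure_pmf.expectation ?M Y =
        (\<Sum>t\<in>triangles. measure_pmf.expectation ?M (\<lambda>G. of_bool ({fst t, fst (snd t), snd (snd t)} \<subseteq> snd G)))"
      unfolding YS by (rule Bochner_Integration.integral_sum) simp
    also have "\<dots> = (\<Sum>t\<in>triangles. p ^ 3)"
      using p triangles_edges by (intro sum.cong refl, subst expectation_of_bool_superset) auto
    finally show ?thesis by simp
  qed
  have Yb: "measure_pmf.prob ?M {G. p * N / 4 \<le> Y G} \<le> (if x = 1 then 0 else 4 * real r ^ 3 * (p\<^sup>2 * real x ^ (2 * r - 3)))"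
  proof (cases "x = 1")
    case True
    then have "Y G = 0" for G using triangles_empty by (simp add: Y_def)
    then have emp: "{G. p * N / 4 \<le> Y G} = {}" using p N0 by (auto simp: not_le mult_pos_pos)
    show ?thesis unfolding emp using True by simp
  next
    case False
    have "measure_pmf.prob ?M {G. p * N / 4 \<le> Y G} \<le> measure_pmf.expectation ?M Y / (p * N / 4)"
      using p N0 by (intro prob_ge_le) (auto simp: Y_def)
    also have "\<dots> \<le> (card triangles * p ^ 3) / (p * N / 4)" using EY p N0 by (intro divide_right_mono) auto
    also have "\<dots> \<le> (real (s * card A * (r ^ 3 * x ^ (3 * r - 3))) * p ^ 3) / (p * N / 4)"
      using card_triangles(1) p N0 by (intro divide_right_mono mult_right_mono of_nat_mono) auto
    also have "\<dots> = 4 * real r ^ 3 * (p\<^sup>2 * real x ^ (2 * r - 3))"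
    proof -
      have "3 * r - 3 = r + (2 * r - 3)" using r by simp
      then have "real x ^ (3 * r - 3) = real x ^ r * real x ^ (2 * r - 3)" by (simp only: power_add)
      moreover have "p ^ 3 = p * p\<^sup>2" by (simp add: power3_eq_cube power2_eq_square)
      ultimately show ?thesis unfolding N using s cA x p by (simp add: field_simps)
    qed
    finally show ?thesis using False by simp
  qed
  have "measure_pmf.prob ?M {G. real (ex G (linear_cycle r 3)) < p * N / 4} =
      measure_pmf.prob ?M ({G. real (ex G (linear_cycle r 3)) < p * N / 4} \<inter> set_pmf ?M)"
    by (rule measure_Int_set_pmf[symmetric])
  also have "\<dots> \<le> measure_pmf.prob ?M ({G. real (card (edges \<inter> snd G)) < p * N / 2} \<union> {G. p * N / 4 \<le> Y G})"
  proof (intro measure_pmf.finite_measure_mono subsetI)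
    fix G assume "G \<in> {G. real (ex G (linear_cycle r 3)) < p * N / 4} \<inter> set_pmf ?M"
    then have G: "real (ex G (linear_cycle r 3)) < p * N / 4" "fst G = {..<n}" "snd G \<subseteq> rsets n r"
      using set_pmf_random_rgraph by blast+
    show "G \<in> {G. real (card (edges \<inter> snd G)) < p * N / 2} \<union> {G. p * N / 4 \<le> Y G}"
      using ex_ge_edges_minus_triangles[OF G(2,3)] G(1) unfolding Y_def[symmetric] by auto
  qed auto
  also have "\<dots> \<le> measure_pmf.prob ?M {G. real (card (edges \<inter> snd G)) < p * N / 2} + measure_pmf.prob ?M {G. p * N / 4 \<le> Y G}"
    by (intro measure_Un_le) auto
  also have "\<dots> \<le> 4 / (p * N) + (if x = 1 then 0 else 4 * real r ^ 3 * (p\<^sup>2 * real x ^ (2 * r - 3)))"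
  proof (intro add_mono Yb)
    have "edges \<noteq> {}" using N0 by (auto simp: N_def)
    then show "measure_pmf.prob ?M {G. real (card (edges \<inter> snd G)) < p * N / 2} \<le> 4 / (p * N)"
      unfolding N_def by (intro prob_few_edges p edges_rsets)
  qed
  finally show ?thesis unfolding N_def .
qed

end

text \<open>The blow-up is as large as the triangles permit, \<open>x ^ (2 * r - 3)\<close> being
  about \<open>p powr (- 2)\<close>, and \<open>s\<close> is about \<open>n / (r^2 * x)\<close>. The
  number of edges is then about \<open>p * n^2 * x ^ (r - 2)\<close>, that is
  \<open>n^2 * p powr (1 / (2 * r - 3))\<close>, up to constants and small powers of
  \<open>n\<close>. The lower end of the range is where \<open>x\<close> would reach
  \<open>n\<close>.\<close>

lemma lower_bound_sparse:
  fixes \<epsilon> :: real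
  assumes r: "r \<ge> 3" and \<epsilon>: "0 < \<epsilon>" "\<epsilon> \<le> 1 / 2"
  shows "\<forall>\<^sub>F n in sequentially. \<forall>p. 0 \<le> p \<and> p \<le> 1 \<and> real n powr (lower_exponent r 1 + \<epsilon>) \<le> p \<longrightarrow>
    measure_pmf.prob (random_rgraph r n p)
      {G. real (ex G (linear_cycle r 3)) < p powr (1 / (2 * real r - 3)) * real n powr (2 - 3 * \<epsilon>)} \<le> \<epsilon>"
proof -
  obtain c where c: "c > 0" "\<And>s. s \<ge> 1 \<Longrightarrow> \<exists>A\<subseteq>{..<s}. c * real s powr (1 - \<epsilon>) \<le> card A \<and> convex_free r A"
    using behrend[of \<epsilon> r] \<epsilon> r by auto
  define \<rho> where "\<rho> = 2 * real r - 3"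
  have \<rho>: "\<rho> \<ge> 3" using r by (simp add: \<rho>_def)
  \<comment> \<open>\<open>4 * r ^ 4\<close> is the square of \<open>2 * r^2\<close>, with
    \<open>r^2\<close> from the definition of \<open>t\<close> and \<open>2\<close> from rounding
    \<open>t\<close> down.\<close>
  define c4 where "c4 = c / (4 * real r ^ 4)"
  have c4: "c4 > 0" using c r by (simp add: c4_def)
  have "\<forall>\<^sub>F n in sequentially. 2 * real r ^ 2 \<le> real n powr (3 * \<epsilon> / \<rho>)" using \<epsilon> \<rho> by real_asymp
  moreover have "\<forall>\<^sub>F n in sequentially. 4 / c4 \<le> real n powr \<epsilon>" using \<epsilon> by real_asymp
  moreover have "\<forall>\<^sub>F n in sequentially. 4 / c4 * real n powr (- 1 / 2) \<le> \<epsilon> / 2" using \<epsilon> by real_asymp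
  moreover have "\<forall>\<^sub>F n in sequentially. (4 * real r ^ 3 * 2 ^ (2 * r - 3)) * real n powr (- \<epsilon>) \<le> \<epsilon> / 2"
    using \<epsilon> by real_asymp
  ultimately show ?thesis using eventually_gt_at_top[of 1]
  proof eventually_elim
    case (elim n)
    have n: "real n > 1" using elim(5) by simp
    show ?case
    proof (intro allI impI, elim conjE)
      fix p assume p: "0 \<le> p" "p \<le> 1" "real n powr (lower_exponent r 1 + \<epsilon>) \<le> p"
      have p0: "p > 0" using p(3) n by (smt (verit) powr_gt_zero)
      have low: "lower_exponent r 1 = - \<rho> / 2" by (simp add: lower_exponent_def \<rho>_def)
      \<comment> \<open>The target for \<open>x ^ (2 * r - 3)\<close>; the factor
        \<open>n powr (- \<epsilon>)\<close> makes triangles rare compared with edges.\<close>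
      define w where "w = p powr (- 2) * real n powr (- \<epsilon>)"
      have w: "w > 0" using p0 n by (simp add: w_def)
      define z where "z = w powr (1 / \<rho>)"
      have z: "z > 0" using w by (simp add: z_def)
      define x where "x = nat \<lceil>z\<rceil>"
      have zx: "z \<le> real x" "real x \<le> z + 1" using z unfolding x_def by linarith+
      have x1: "x \<ge> 1" using z by (simp add: x_def Suc_le_eq)
      have znu: "z \<le> real n powr (1 - 3 * \<epsilon> / \<rho>)"
      proof -
        have "p powr (- 2) \<le> (real n powr (lower_exponent r 1 + \<epsilon>)) powr (- 2)"
          using p(3) n by (intro powr_mono2') auto
        also have "\<dots> = real n powr (\<rho> - 2 * \<epsilon>)" unfolding powr_powr low by (simp add: algebra_simps)
        finally have "w \<le> real n powr (\<rho> - 2 * \<epsilon>) * real n powr (- \<epsilon>)" unfolding w_def by (intro mult_right_mono) auto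
        also have "\<dots> = real n powr (\<rho> - 3 * \<epsilon>)" by (simp add: powr_add[symmetric])
        finally have "z \<le> (real n powr (\<rho> - 3 * \<epsilon>)) powr (1 / \<rho>)"
          unfolding z_def using w \<rho> by (intro powr_mono2) auto
        also have "\<dots> = real n powr (1 - 3 * \<epsilon> / \<rho>)" unfolding powr_powr using \<rho> by (simp add: diff_divide_distrib)
        finally show ?thesis .
      qed
      have xu: "real x \<le> 2 * real n powr (1 - 3 * \<epsilon> / \<rho>)"
      proof -
        have "real n powr 0 \<le> real n powr (1 - 3 * \<epsilon> / \<rho>)" using n \<epsilon> \<rho> by (intro powr_mono) auto
        then have "1 \<le> real n powr (1 - 3 * \<epsilon> / \<rho>)" using n by simp
        then show ?thesis using zx(2) znu by linarith
      qed
      define t where "t = real n / (real r ^ 2 * real x)"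
      have t1: "1 \<le> t"
      proof -
        have "real r ^ 2 * real x \<le> real r ^ 2 * (2 * real n powr (1 - 3 * \<epsilon> / \<rho>))" using xu by (intro mult_left_mono) auto
        also have "\<dots> = 2 * real r ^ 2 * real n powr (1 - 3 * \<epsilon> / \<rho>)" by simp
        also have "\<dots> \<le> real n powr (3 * \<epsilon> / \<rho>) * real n powr (1 - 3 * \<epsilon> / \<rho>)" using elim(1) by (intro mult_right_mono) auto
        also have "\<dots> = real n" using n by (simp add: powr_add[symmetric])
        finally have "real r ^ 2 * real x \<le> real n" .
        moreover have "0 < real r ^ 2 * real x" using r x1 by simp
        ultimately show ?thesis unfolding t_def by (simp add: le_divide_eq_1_pos)
      qed
      define s where "s = nat \<lfloor>t\<rfloor>"
      have st: "t / 2 \<le> real s" "real s \<le> t" unfolding s_def using t1 nat_floor_ge_half[OF t1] by auto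
      have s1: "s \<ge> 1" using t1 unfolding s_def by linarith
      have rx: "real r ^ 2 * real x > 0" using r x1 by simp
      have nb: "r * (r * s) * x \<le> n"
      proof -
        have "real s * (real r ^ 2 * real x) \<le> t * (real r ^ 2 * real x)" using st rx by (intro mult_right_mono) auto
        also have "\<dots> = real n" unfolding t_def using less_imp_neq[OF rx] by (intro nonzero_eq_divide_eq[THEN iffD1]) auto
        finally have "real (r * (r * s) * x) \<le> real n" by (simp add: power2_eq_square mult_ac)
        then show ?thesis by (simp only: of_nat_le_iff)
      qed
      obtain A where A: "A \<subseteq> {..<s}" "c * real s powr (1 - \<epsilon>) \<le> card A" "convex_free r A" using c(2)[OF s1] by blast
      interpret B: blow_up r s x n A using r A nb x1 by unfold_locales auto
      have "0 < c * real s powr (1 - \<epsilon>)" using c s1 by simp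
      then have A0: "A \<noteq> {}" using A(2) by auto
      have sn: "real s \<le> real n"
      proof -
        have "1 * 1 \<le> real r ^ 2 * real x" using r x1 by (intro mult_mono one_le_power) auto
        then have "t \<le> real n / 1" unfolding t_def using n by (intro divide_left_mono) auto
        then show ?thesis using st by simp
      qed
      have N: "c4 * real n powr (2 - \<epsilon>) * real x ^ (r - 2) \<le> card B.edges"
      proof -
        have "real n powr (- \<epsilon>) \<le> real s powr (- \<epsilon>)" using sn s1 \<epsilon> by (intro powr_mono2') auto
        moreover have "real s powr (1 - \<epsilon>) = real s * real s powr (- \<epsilon>)" using s1 by (simp add: powr_diff powr_minus divide_inverse)
        ultimately have "c * (real s * real n powr (- \<epsilon>)) \<le> card A"
          using A(2) c(1) by (smt (verit) mult_left_mono of_nat_0_le_iff)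
        then have "real s * (c * (real s * real n powr (- \<epsilon>))) * real x ^ r \<le> real s * card A * real x ^ r"
          by (intro mult_right_mono mult_left_mono) auto
        also have "\<dots> = card B.edges" by (simp add: B.card_edges)
        finally have 1: "c * real n powr (- \<epsilon>) * real s ^ 2 * real x ^ r \<le> card B.edges"
          by (simp add: power2_eq_square mult_ac)
        have "(t / 2) ^ 2 \<le> real s ^ 2" using st t1 by (intro power_mono) auto
        then have "c * real n powr (- \<epsilon>) * (t / 2) ^ 2 * real x ^ r \<le> c * real n powr (- \<epsilon>) * real s ^ 2 * real x ^ r"
          using c by (intro mult_right_mono mult_left_mono) auto
        moreover have "c * real n powr (- \<epsilon>) * (t / 2) ^ 2 * real x ^ r = c4 * real n powr (2 - \<epsilon>) * real x ^ (r - 2)"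
        proof -
          have "r = (r - 2) + 2" using r by simp
          then have "real x ^ r = real x ^ (r - 2) * real x ^ 2" by (metis power_add)
          moreover have "real n powr (2 - \<epsilon>) = real n powr (- \<epsilon>) * real n ^ 2"
            using n by (simp add: powr_diff powr_minus powr_numeral field_simps)
          ultimately show ?thesis using r x1 by (simp add: t_def c4_def power_divide power_mult_distrib field_simps)
        qed
        ultimately show ?thesis using 1 by linarith
      qed
      have zr: "p powr (- (2 * (real r - 2) / \<rho>)) * real n powr (- \<epsilon>) \<le> real x ^ (r - 2)"
      proof -
        have "z ^ (r - 2) \<le> real x ^ (r - 2)" using zx z by (intro power_mono) auto
        moreover have "z ^ (r - 2) = w powr ((real r - 2) / \<rho>)"
          using w r by (simp add: z_def powr_power of_nat_diff)
        moreover have "w powr ((real r - 2) / \<rho>) = p powr (- (2 * (real r - 2) / \<rho>)) * real n powr (- \<epsilon> * ((real r - 2) / \<rho>))"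
          using p0 n by (simp add: w_def powr_mult powr_powr diff_divide_distrib)
        moreover have "real n powr (- \<epsilon>) \<le> real n powr (- \<epsilon> * ((real r - 2) / \<rho>))"
        proof (intro powr_mono)
          have "(real r - 2) / \<rho> \<le> 1" using \<rho> r by (simp add: \<rho>_def divide_le_eq_1_pos)
          then have "\<epsilon> * ((real r - 2) / \<rho>) \<le> \<epsilon> * 1" using \<epsilon> by (intro mult_left_mono) auto
          then show "- \<epsilon> \<le> - \<epsilon> * ((real r - 2) / \<rho>)" by simp
        qed (use n in simp)
        ultimately show ?thesis by (smt (verit) mult_left_mono powr_ge_zero)
      qed
      have pN: "c4 * real n powr (2 - 2 * \<epsilon>) * p powr (1 / \<rho>) \<le> p * card B.edges"
      proof -
        have "p * (c4 * real n powr (2 - \<epsilon>) * (p powr (- (2 * (real r - 2) / \<rho>)) * real n powr (- \<epsilon>))) \<le>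
            p * (c4 * real n powr (2 - \<epsilon>) * real x ^ (r - 2))"
          using zr p c4 by (intro mult_left_mono) auto
        also have "\<dots> \<le> p * card B.edges" using N p by (intro mult_left_mono) auto
        finally have "p * (c4 * real n powr (2 - \<epsilon>) * (p powr (- (2 * (real r - 2) / \<rho>)) * real n powr (- \<epsilon>))) \<le> p * card B.edges" .
        moreover have "p * p powr (- (2 * (real r - 2) / \<rho>)) = p powr (1 / \<rho>)"
        proof -
          have "1 + (- (2 * (real r - 2) / \<rho>)) = 1 / \<rho>" using \<rho> by (simp add: \<rho>_def field_simps)
          moreover have "p * p powr (- (2 * (real r - 2) / \<rho>)) = p powr (1 + (- (2 * (real r - 2) / \<rho>)))"
            using p0 by (subst powr_add) simp
          ultimately show ?thesis by simp
        qed
        moreover have "real n powr (2 - \<epsilon>) * real n powr (- \<epsilon>) = real n powr (2 - 2 * \<epsilon>)"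
          by (simp add: powr_add[symmetric])
        moreover have "p * (c4 * a * (b * d)) = c4 * (a * d) * (p * b)" for a b d by (simp only: mult_ac)
        ultimately show ?thesis by simp
      qed
      have big: "p powr (1 / \<rho>) * real n powr (2 - 3 * \<epsilon>) \<le> p * card B.edges / 4"
      proof -
        have "real n powr (2 - 2 * \<epsilon>) = real n powr \<epsilon> * real n powr (2 - 3 * \<epsilon>)" by (simp add: powr_add[symmetric])
        moreover have "4 \<le> c4 * real n powr \<epsilon>" using elim(2) c4 by (simp add: field_simps)
        then have "4 * (real n powr (2 - 3 * \<epsilon>) * p powr (1 / \<rho>)) \<le> (c4 * real n powr \<epsilon>) * (real n powr (2 - 3 * \<epsilon>) * p powr (1 / \<rho>))"
          by (intro mult_right_mono) auto
        ultimately show ?thesis using pN by (simp add: mult_ac)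
      qed
      have t1': "4 / (p * card B.edges) \<le> \<epsilon> / 2"
      proof -
        have "real n powr (- 1 / 2) \<le> p powr (1 / \<rho>)"
        proof -
          have "real n powr (- 1 / 2) \<le> (real n powr (lower_exponent r 1 + \<epsilon>)) powr (1 / \<rho>)"
            unfolding powr_powr low using n \<epsilon> \<rho> by (intro powr_mono) (auto simp: field_simps)
          also have "\<dots> \<le> p powr (1 / \<rho>)" using p(3) \<rho> by (intro powr_mono2) auto
          finally show ?thesis .
        qed
        moreover have "real n powr 1 \<le> real n powr (2 - 2 * \<epsilon>)" using n \<epsilon> by (intro powr_mono) auto
        ultimately have "real n powr 1 * real n powr (- 1 / 2) \<le> real n powr (2 - 2 * \<epsilon>) * p powr (1 / \<rho>)"
          by (intro mult_mono) auto
        moreover have "real n powr 1 * real n powr (- 1 / 2) = real n powr (1 / 2)" unfolding powr_add[symmetric] by simp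
        ultimately have "real n powr (1 / 2) \<le> real n powr (2 - 2 * \<epsilon>) * p powr (1 / \<rho>)" by linarith
        then have "c4 * real n powr (1 / 2) \<le> c4 * (real n powr (2 - 2 * \<epsilon>) * p powr (1 / \<rho>))"
          using c4 by (intro mult_left_mono) auto
        then have "c4 * real n powr (1 / 2) \<le> p * card B.edges" using pN by (simp add: mult.assoc)
        moreover have "0 < c4 * real n powr (1 / 2)" using c4 n by simp
        ultimately have "4 / (p * card B.edges) \<le> 4 / (c4 * real n powr (1 / 2))"
          by (intro frac_le) auto
        also have "\<dots> = 4 / c4 * real n powr (- 1 / 2)" using n by (simp add: powr_minus field_simps)
        finally show ?thesis using elim(3) by linarith
      qed
      \<comment> \<open>If \<open>x > 1\<close> then \<open>z > 1\<close>, so rounding up at most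
        doubles \<open>z\<close>; if \<open>x = 1\<close> there are no triangles.\<close>
      have t2: "(if x = 1 then 0 else 4 * real r ^ 3 * (p\<^sup>2 * real x ^ (2 * r - 3))) \<le> \<epsilon> / 2"
      proof (cases "x = 1")
        case False
        then have "z > 1" using z unfolding x_def by linarith
        then have "real x ^ (2 * r - 3) \<le> (2 * z) ^ (2 * r - 3)" using zx by (intro power_mono) auto
        also have "\<dots> = 2 ^ (2 * r - 3) * w"
        proof -
          have "z ^ (2 * r - 3) = w powr (1 / \<rho> * real (2 * r - 3))" using w by (simp add: z_def powr_power mult.commute)
          also have "real (2 * r - 3) = \<rho>" using r by (simp add: \<rho>_def of_nat_diff)
          finally show ?thesis using w \<rho> by (simp add: power_mult_distrib)
        qed
        finally have "4 * real r ^ 3 * (p\<^sup>2 * real x ^ (2 * r - 3)) \<le> 4 * real r ^ 3 * (p\<^sup>2 * (2 ^ (2 * r - 3) * w))"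
          by (intro mult_left_mono) auto
        also have "\<dots> = (4 * real r ^ 3 * 2 ^ (2 * r - 3)) * (p\<^sup>2 * w)" by simp
        also have "p\<^sup>2 * w = real n powr (- \<epsilon>)"
          using p0 by (simp add: w_def powr_minus powr_numeral)
        finally show ?thesis using False elim(4) by simp
      qed (use \<epsilon> in simp)
      have "measure_pmf.prob (random_rgraph r n p)
          {G. real (ex G (linear_cycle r 3)) < p powr (1 / (2 * real r - 3)) * real n powr (2 - 3 * \<epsilon>)} \<le>
        measure_pmf.prob (random_rgraph r n p) {G. real (ex G (linear_cycle r 3)) < p * card B.edges / 4}"
        using big unfolding \<rho>_def by (intro measure_pmf.finite_measure_mono) auto
      also have "\<dots> \<le> \<epsilon>" using B.prob_ex_small[OF p0 p(2) s1 A0] t1' t2 by linarith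
      finally show "measure_pmf.prob (random_rgraph r n p)
          {G. real (ex G (linear_cycle r 3)) < p powr (1 / (2 * real r - 3)) * real n powr (2 - 3 * \<epsilon>)} \<le> \<epsilon>" .
    qed
  qed
qed

text \<open>Ensures that \<open>p * n ^ (r - 1)\<close> is at least \<open>n\<close> in the dense
  range, so that the Chebyshev bound for the star tends to zero.\<close>

lemma upper_exponent_ge:
  assumes "r \<ge> 3" "l \<ge> 1"
  shows "1 \<le> upper_exponent r l + (real r - 1)"
proof -
  have d: "2 * real l * (real r - 2) > 0" using exponent_denominators[OF assms] by simp
  have "(2 * real l - 1) * (real r - 3) \<le> (2 * real l) * (real r - 2)" using assms by (intro mult_mono) auto
  then have "scale_exponent r l * (real r - 3) \<le> 1"
    unfolding scale_exponent_def times_divide_eq_left using d by (simp only: divide_le_eq_1_pos)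
  then show ?thesis unfolding exponent_identities(4)[OF assms] by simp
qed

lemma lower_bound_dense:
  fixes \<epsilon> :: real
  assumes r: "r \<ge> 3" and \<epsilon>: "0 < \<epsilon>"
  shows "\<forall>\<^sub>F n in sequentially. \<forall>p. 0 \<le> p \<and> p \<le> 1 \<and> real n powr (upper_exponent r 1 + \<epsilon>) \<le> p \<longrightarrow>
    measure_pmf.prob (random_rgraph r n p)
      {G. real (ex G (linear_cycle r 3)) < (1 / (2 * real r)) ^ (r - 1) / 2 * p * real n ^ (r - 1)} \<le> \<epsilon>"
proof -
  define c where "c = (1 / (2 * real r)) ^ (r - 1)"
  have c: "c > 0" using r by (simp add: c_def)
  have "\<forall>\<^sub>F n in sequentially. 4 / c * (1 / real n) \<le> \<epsilon>" using \<epsilon> by real_asymp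
  then show ?thesis using eventually_gt_at_top[of 1] eventually_ge_at_top[of "2 * r"]
  proof eventually_elim
    case (elim n)
    have n: "real n > 1" using elim(2) by simp
    show ?case
    proof (intro allI impI, elim conjE)
      fix p assume p: "0 \<le> p" "p \<le> 1" "real n powr (upper_exponent r 1 + \<epsilon>) \<le> p"
      have p0: "p > 0" using p(3) n by (smt (verit) powr_gt_zero)
      have nr: "real n ^ (r - 1) = real n powr (real r - 1)" using n r by (subst powr_realpow[symmetric]) auto
      have "real n powr 1 \<le> real n powr ((upper_exponent r 1 + \<epsilon>) + (real r - 1))"
        using upper_exponent_ge[OF r, of 1] n \<epsilon> by (intro powr_mono) auto
      also have "\<dots> = real n powr (upper_exponent r 1 + \<epsilon>) * real n ^ (r - 1)" unfolding nr by (rule powr_add)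
      also have "\<dots> \<le> p * real n ^ (r - 1)" using p(3) by (intro mult_right_mono) auto
      finally have pn: "real n \<le> p * real n ^ (r - 1)" using n by simp
      have "measure_pmf.prob (random_rgraph r n p) {G. real (ex G (linear_cycle r 3)) < c / 2 * p * real n ^ (r - 1)}
          \<le> 4 / (c * p * real n ^ (r - 1))"
        unfolding c_def by (rule star_lower_bound[OF r p0 p(2) elim(3)])
      also have "\<dots> \<le> 4 / (c * real n)" using pn c n by (intro frac_le) (auto simp: mult.assoc)
      also have "\<dots> \<le> \<epsilon>" using elim(1) by simp
      finally show "measure_pmf.prob (random_rgraph r n p)
          {G. real (ex G (linear_cycle r 3)) < (1 / (2 * real r)) ^ (r - 1) / 2 * p * real n ^ (r - 1)} \<le> \<epsilon>"
        unfolding c_def .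
    qed
  qed
qed

section \<open>Error terms tending to zero\<close>

text \<open>\<open>K n\<close> is the largest index whose threshold \<open>N k\<close> has been
  passed by \<open>n\<close>; the constraint \<open>k \<le> n\<close> keeps the maximum finite.
  Every fixed index is passed eventually, so \<open>K n\<close> tends to infinity.\<close>

lemma diagonal_sequence:
  fixes Q :: "real \<Rightarrow> nat \<Rightarrow> bool"
  assumes e0: "e0 > 0" and Q: "\<And>\<epsilon>. 0 < \<epsilon> \<Longrightarrow> \<epsilon> \<le> e0 \<Longrightarrow> \<forall>\<^sub>F n in sequentially. Q \<epsilon> n"
  obtains e where "e \<longlonglongrightarrow> 0" "\<forall>\<^sub>F n in sequentially. Q (e n) n"
proof -
  have "\<exists>N. \<forall>n\<ge>N. Q (e0 / (real k + 1)) n" for k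
    using Q[of "e0 / (real k + 1)"] e0 by (auto simp: eventually_sequentially divide_le_eq mult_le_cancel_left1)
  then obtain N where N: "\<And>k n. n \<ge> N k \<Longrightarrow> Q (e0 / (real k + 1)) n" by metis
  define S where "S n = {k. k \<le> n \<and> N k \<le> n}" for n
  define K where "K n = Max (insert 0 (S n))" for n
  have finS: "finite (S n)" for n by (simp add: S_def)
  have Kge: "k \<le> K n" if "n \<ge> max k (N k)" for k n
    unfolding K_def using finS that by (intro Max_ge) (auto simp: S_def)
  have lim: "(\<lambda>n. e0 / (real (K n) + 1)) \<longlonglongrightarrow> 0"
  proof (rule tendstoI)
    fix \<epsilon> :: real assume \<epsilon>: "\<epsilon> > 0"
    obtain k :: nat where k: "e0 / \<epsilon> < real k" using reals_Archimedean2 by blast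
    have "\<forall>\<^sub>F n in sequentially. n \<ge> max k (N k)" by (rule eventually_ge_at_top)
    then show "\<forall>\<^sub>F n in sequentially. dist (e0 / (real (K n) + 1)) 0 < \<epsilon>"
    proof eventually_elim
      case (elim n)
      have "e0 / \<epsilon> < real (K n) + 1" using k Kge[OF elim] by linarith
      then show ?case using e0 \<epsilon> by (simp add: field_simps)
    qed
  qed
  have "\<forall>\<^sub>F n in sequentially. n \<ge> N 0" by (rule eventually_ge_at_top)
  then have "\<forall>\<^sub>F n in sequentially. Q (e0 / (real (K n) + 1)) n"
  proof eventually_elim
    case (elim n)
    have "0 \<in> S n" using elim by (simp add: S_def)
    have "K n \<in> insert 0 (S n)" unfolding K_def using finS by (intro Max_in) auto
    then have "K n \<in> S n" using \<open>0 \<in> S n\<close> by auto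
    then show ?case by (intro N) (simp add: S_def)
  qed
  then show ?thesis using lim by (rule that[rotated])
qed

lemma aasI:
  assumes "\<forall>\<^sub>F n in sequentially. measure_pmf.prob (M n) {x. \<not> P n x} \<le> \<delta> n" "\<delta> \<longlonglongrightarrow> 0"
  shows "aas M P"
proof -
  have eq: "measure_pmf.prob (M n) {x. P n x} = 1 - measure_pmf.prob (M n) {x. \<not> P n x}" for n
    using measure_pmf.prob_compl[of "{x. \<not> P n x}" "M n"] by (simp add: Compl_eq_Diff_UNIV[symmetric] Collect_neg_eq[symmetric])
  have "(\<lambda>n. measure_pmf.prob (M n) {x. P n x}) \<longlonglongrightarrow> 1"
  proof (rule tendsto_sandwich)
    show "\<forall>\<^sub>F n in sequentially. 1 - \<delta> n \<le> measure_pmf.prob (M n) {x. P n x}"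
      using assms(1) by eventually_elim (simp add: eq)
    show "\<forall>\<^sub>F n in sequentially. measure_pmf.prob (M n) {x. P n x} \<le> 1" by simp
    show "(\<lambda>n. 1 - \<delta> n) \<longlonglongrightarrow> 1" using tendsto_diff[OF tendsto_const assms(2), of 1] by simp
  qed simp
  then show ?thesis by (simp add: aas_def)
qed

text \<open>The premises \<open>a\<close> and \<open>b\<close> are conditions on \<open>p\<close>
  and not on the random graph, so each failure event is either empty or covered by the corresponding
  bound.\<close>

lemma prob_two_implications:
  assumes "a \<Longrightarrow> measure_pmf.prob M {x. \<not> A x} \<le> \<epsilon>" "b \<Longrightarrow> measure_pmf.prob M {x. \<not> B x} \<le> \<epsilon>" "\<epsilon> \<ge> 0"
  shows "measure_pmf.prob M {x. \<not> ((a \<longrightarrow> A x) \<and> (b \<longrightarrow> B x))} \<le> 2 * \<epsilon>"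
proof -
  have "measure_pmf.prob M {x. a \<and> \<not> A x} \<le> \<epsilon>" using assms by (cases a) auto
  moreover have "measure_pmf.prob M {x. b \<and> \<not> B x} \<le> \<epsilon>" using assms by (cases b) auto
  moreover have "measure_pmf.prob M {x. \<not> ((a \<longrightarrow> A x) \<and> (b \<longrightarrow> B x))} \<le>
      measure_pmf.prob M ({x. a \<and> \<not> A x} \<union> {x. b \<and> \<not> B x})"
    by (intro measure_pmf.finite_measure_mono) auto
  moreover have "measure_pmf.prob M ({x. a \<and> \<not> A x} \<union> {x. b \<and> \<not> B x}) \<le>
      measure_pmf.prob M {x. a \<and> \<not> A x} + measure_pmf.prob M {x. b \<and> \<not> B x}"
    by (intro measure_Un_le) auto
  ultimately show ?thesis by linarith
qed

theorem theorem1p8: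
  fixes r l :: nat
  assumes "r \<ge> 3" and "l \<ge> 1"
  shows "\<exists>(c::real) (\<epsilon>1 :: nat \<Rightarrow> real) (\<epsilon>2 :: nat \<Rightarrow> real) (\<epsilon>3 :: nat \<Rightarrow> real).
    c > 0 \<and> \<epsilon>1 \<longlonglongrightarrow> 0 \<and> \<epsilon>2 \<longlonglongrightarrow> 0 \<and> \<epsilon>3 \<longlonglongrightarrow> 0 \<and>
    (\<forall>p :: nat \<Rightarrow> real. (\<forall>n. 0 \<le> p n \<and> p n \<le> 1) \<longrightarrow>
      aas (\<lambda>n. random_rgraph r n (p n)) (\<lambda>n G.
        (p n \<ge> real n powr (upper_exponent r l + \<epsilon>1 n) \<longrightarrow>
           real (ex G (linear_cycle r (2 * l + 1))) \<le> c * p n * real n ^ (r - 1)) \<and>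
        (real n powr (lower_exponent r l + \<epsilon>2 n) \<le> p n \<and>
         p n \<le> real n powr (upper_exponent r l + \<epsilon>1 n) \<longrightarrow>
           real (ex G (linear_cycle r (2 * l + 1)))
             \<le> p n powr ((2 * real l - 1) / (2 * real l * (real r - 1) - 1))
                * real n powr (2 + \<epsilon>3 n)))) \<and>
    (l = 1 \<longrightarrow> (\<exists>c'::real. c' > 0 \<and>
      (\<forall>p :: nat \<Rightarrow> real. (\<forall>n. 0 \<le> p n \<and> p n \<le> 1) \<longrightarrow>
        aas (\<lambda>n. random_rgraph r n (p n)) (\<lambda>n G.
          (p n \<ge> real n powr (upper_exponent r l + \<epsilon>1 n) \<longrightarrow>
             real (ex G (linear_cycle r 3)) \<ge> c' * p n * real n ^ (r - 1)) \<and>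
          (real n powr (lower_exponent r l + \<epsilon>2 n) \<le> p n \<and>
           p n \<le> real n powr (upper_exponent r l + \<epsilon>1 n) \<longrightarrow>
             real (ex G (linear_cycle r 3))
               \<ge> p n powr (1 / (2 * real r - 3)) * real n powr (2 - \<epsilon>3 n))))))"
proof -
  define c where "c = 6 * (2 * real (r * ((2 * l + 1) * (r + 1) + 1)))"
  define c' where "c' = (1 / (2 * real r)) ^ (r - 1) / 2"
  \<comment> \<open>Positivity of \<open>\<epsilon>\<close> is included so that the diagonal
    sequence is eventually positive. The coefficient \<open>3\<close> is the larger of the losses
    \<open>2 * \<epsilon>\<close> in the upper and \<open>3 * \<epsilon>\<close> in the lower
    bound.\<close>
  define Q where "Q \<epsilon> n \<longleftrightarrow> \<epsilon> > 0 \<and> (\<forall>p. 0 \<le> p \<and> p \<le> 1 \<longrightarrow>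
    (real n powr (upper_exponent r l + \<epsilon>) \<le> p \<longrightarrow> measure_pmf.prob (random_rgraph r n p)
      {G. \<not> real (ex G (linear_cycle r (2 * l + 1))) \<le> c * p * real n ^ (r - 1)} \<le> \<epsilon>) \<and>
    (real n powr (lower_exponent r l + \<epsilon>) \<le> p \<and> p \<le> real n powr (upper_exponent r l + \<epsilon>) \<longrightarrow>
      measure_pmf.prob (random_rgraph r n p)
      {G. \<not> real (ex G (linear_cycle r (2 * l + 1))) \<le>
         p powr ((2 * real l - 1) / (2 * real l * (real r - 1) - 1)) * real n powr (2 + 3 * \<epsilon>)} \<le> \<epsilon>) \<and>
    (l = 1 \<longrightarrow>
      (real n powr (upper_exponent r l + \<epsilon>) \<le> p \<longrightarrow> measure_pmf.prob (random_rgraph r n p)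
        {G. \<not> real (ex G (linear_cycle r 3)) \<ge> c' * p * real n ^ (r - 1)} \<le> \<epsilon>) \<and>
      (real n powr (lower_exponent r l + \<epsilon>) \<le> p \<and> p \<le> real n powr (upper_exponent r l + \<epsilon>) \<longrightarrow>
        measure_pmf.prob (random_rgraph r n p)
        {G. \<not> real (ex G (linear_cycle r 3)) \<ge> p powr (1 / (2 * real r - 3)) * real n powr (2 - 3 * \<epsilon>)} \<le> \<epsilon>)))"
    for \<epsilon> n
  have "\<forall>\<^sub>F n in sequentially. Q \<epsilon> n" if \<epsilon>: "0 < \<epsilon>" "\<epsilon> \<le> 1 / 2" for \<epsilon>
  proof -
    have \<epsilon>1: "\<epsilon> \<le> 1" using \<epsilon> by simp
    have "\<forall>\<^sub>F n in sequentially. exp (- real n / 4) \<le> \<epsilon>" using \<epsilon> by real_asymp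
    then show ?thesis
      using upper_bound_dense[OF assms \<epsilon>(1) \<epsilon>1] upper_bound_sparse[OF assms \<epsilon>(1)]
        lower_bound_dense[OF assms(1) \<epsilon>(1)] lower_bound_sparse[OF assms(1) \<epsilon>] eventually_gt_at_top[of 0]
    proof eventually_elim
      case (elim n)
      show ?case unfolding Q_def
      proof (intro conjI allI impI \<epsilon>; (elim conjE)?)
        fix p :: real assume p: "0 \<le> p" "p \<le> 1"
        {
          assume "real n powr (upper_exponent r l + \<epsilon>) \<le> p"
          then have "measure_pmf.prob (random_rgraph r n p)
              {G. c * p * real n ^ (r - 1) < real (ex G (linear_cycle r (2 * l + 1)))} \<le> exp (- real n / 4)"
            unfolding c_def using elim(2) p by blast
          then show "measure_pmf.prob (random_rgraph r n p)
              {G. \<not> real (ex G (linear_cycle r (2 * l + 1))) \<le> c * p * real n ^ (r - 1)} \<le> \<epsilon>"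
            using elim(1) by (simp only: not_le)
        }
        {
          assume "real n powr (lower_exponent r l + \<epsilon>) \<le> p" "p \<le> real n powr (upper_exponent r l + \<epsilon>)"
          then have 1: "measure_pmf.prob (random_rgraph r n p)
              {G. p powr density_exponent r l * real n powr (2 + 2 * \<epsilon>) < real (ex G (linear_cycle r (2 * l + 1)))} \<le> exp (- real n / 4)"
            using elim(3) p by blast
          have "real n powr (2 + 2 * \<epsilon>) \<le> real n powr (2 + 3 * \<epsilon>)" using elim(6) \<epsilon> by (intro powr_mono) auto
          then have "p powr density_exponent r l * real n powr (2 + 2 * \<epsilon>) \<le> p powr density_exponent r l * real n powr (2 + 3 * \<epsilon>)"
            by (intro mult_left_mono) auto
          then have "measure_pmf.prob (random_rgraph r n p)
              {G. \<not> real (ex G (linear_cycle r (2 * l + 1))) \<le> p powr density_exponent r l * real n powr (2 + 3 * \<epsilon>)} \<le>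
            measure_pmf.prob (random_rgraph r n p)
              {G. p powr density_exponent r l * real n powr (2 + 2 * \<epsilon>) < real (ex G (linear_cycle r (2 * l + 1)))}"
            by (intro measure_pmf.finite_measure_mono) auto
          then show "measure_pmf.prob (random_rgraph r n p)
              {G. \<not> real (ex G (linear_cycle r (2 * l + 1))) \<le>
                 p powr ((2 * real l - 1) / (2 * real l * (real r - 1) - 1)) * real n powr (2 + 3 * \<epsilon>)} \<le> \<epsilon>"
            using 1 elim(1) unfolding density_exponent_def by linarith
        }
        {
          assume "l = 1" "real n powr (upper_exponent r l + \<epsilon>) \<le> p"
          then show "measure_pmf.prob (random_rgraph r n p)
              {G. \<not> real (ex G (linear_cycle r 3)) \<ge> c' * p * real n ^ (r - 1)} \<le> \<epsilon>"
            unfolding c'_def not_le using elim(4) p by blast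
        }
        {
          assume "l = 1" "real n powr (lower_exponent r l + \<epsilon>) \<le> p"
          then show "measure_pmf.prob (random_rgraph r n p)
              {G. \<not> real (ex G (linear_cycle r 3)) \<ge> p powr (1 / (2 * real r - 3)) * real n powr (2 - 3 * \<epsilon>)} \<le> \<epsilon>"
            unfolding not_le using elim(5) p by blast
        }
      qed
    qed
  qed
  then obtain e where e: "e \<longlonglongrightarrow> 0" "\<forall>\<^sub>F n in sequentially. Q (e n) n"
    using diagonal_sequence[of "1 / 2" Q] by auto
  \<comment> \<open>\<open>2 * e n\<close> bounds the failure probability over both ranges together;
    \<open>3 * e n\<close> becomes the third error term.\<close>
  have lim2: "(\<lambda>n. 2 * e n) \<longlonglongrightarrow> 0" and lim3: "(\<lambda>n. 3 * e n) \<longlonglongrightarrow> 0"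
    using tendsto_mult_left[OF e(1), of 2] tendsto_mult_left[OF e(1), of 3] by auto
  have "0 < r * ((2 * l + 1) * (r + 1) + 1)" using assms by (intro mult_pos_pos) auto
  then have "0 < real (r * ((2 * l + 1) * (r + 1) + 1))" by (simp only: of_nat_0_less_iff)
  then have c: "c > 0" unfolding c_def by linarith
  have c': "c' > 0" using assms by (simp add: c'_def)
  show ?thesis
  proof (rule exI[of _ c], rule exI[of _ e], rule exI[of _ e], rule exI[of _ "\<lambda>n. 3 * e n"], intro conjI impI)
    show "\<forall>p :: nat \<Rightarrow> real. (\<forall>n. 0 \<le> p n \<and> p n \<le> 1) \<longrightarrow>
      aas (\<lambda>n. random_rgraph r n (p n)) (\<lambda>n G.
        (p n \<ge> real n powr (upper_exponent r l + e n) \<longrightarrow>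
           real (ex G (linear_cycle r (2 * l + 1))) \<le> c * p n * real n ^ (r - 1)) \<and>
        (real n powr (lower_exponent r l + e n) \<le> p n \<and>
         p n \<le> real n powr (upper_exponent r l + e n) \<longrightarrow>
           real (ex G (linear_cycle r (2 * l + 1)))
             \<le> p n powr ((2 * real l - 1) / (2 * real l * (real r - 1) - 1))
                * real n powr (2 + 3 * e n)))"
    proof (intro allI impI)
      fix p :: "nat \<Rightarrow> real" assume p: "\<forall>n. 0 \<le> p n \<and> p n \<le> 1"
      show "aas (\<lambda>n. random_rgraph r n (p n)) (\<lambda>n G.
        (p n \<ge> real n powr (upper_exponent r l + e n) \<longrightarrow>
           real (ex G (linear_cycle r (2 * l + 1))) \<le> c * p n * real n ^ (r - 1)) \<and>
        (real n powr (lower_exponent r l + e n) \<le> p n \<and>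
         p n \<le> real n powr (upper_exponent r l + e n) \<longrightarrow>
           real (ex G (linear_cycle r (2 * l + 1)))
             \<le> p n powr ((2 * real l - 1) / (2 * real l * (real r - 1) - 1))
                * real n powr (2 + 3 * e n)))"
        using e(2) by (intro aasI[OF _ lim2], eventually_elim) (rule prob_two_implications; use p in \<open>auto simp: Q_def\<close>)
    qed
  next
    assume l: "l = 1"
    show "\<exists>c'::real. c' > 0 \<and>
      (\<forall>p :: nat \<Rightarrow> real. (\<forall>n. 0 \<le> p n \<and> p n \<le> 1) \<longrightarrow>
        aas (\<lambda>n. random_rgraph r n (p n)) (\<lambda>n G.
          (p n \<ge> real n powr (upper_exponent r l + e n) \<longrightarrow>
             real (ex G (linear_cycle r 3)) \<ge> c' * p n * real n ^ (r - 1)) \<and>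
          (real n powr (lower_exponent r l + e n) \<le> p n \<and>
           p n \<le> real n powr (upper_exponent r l + e n) \<longrightarrow>
             real (ex G (linear_cycle r 3))
               \<ge> p n powr (1 / (2 * real r - 3)) * real n powr (2 - 3 * e n))))"
    proof (intro exI[of _ c'] conjI c' allI impI)
      fix p :: "nat \<Rightarrow> real" assume p: "\<forall>n. 0 \<le> p n \<and> p n \<le> 1"
      show "aas (\<lambda>n. random_rgraph r n (p n)) (\<lambda>n G.
          (p n \<ge> real n powr (upper_exponent r l + e n) \<longrightarrow>
             real (ex G (linear_cycle r 3)) \<ge> c' * p n * real n ^ (r - 1)) \<and>
          (real n powr (lower_exponent r l + e n) \<le> p n \<and>
           p n \<le> real n powr (upper_exponent r l + e n) \<longrightarrow>
             real (ex G (linear_cycle r 3))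
               \<ge> p n powr (1 / (2 * real r - 3)) * real n powr (2 - 3 * e n)))"
        using e(2) by (intro aasI[OF _ lim2], eventually_elim) (rule prob_two_implications; use p l in \<open>auto simp: Q_def\<close>)
    qed
  qed (use c e lim3 in auto)
qed

end
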